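(* Let $A\in C^*(\mathcal{D})$. Then $$\lim_{z\to\partial\mathbb{D}}\langle Ak_z,k_z\rangle=0$$ if and only if $A$ is a compact operator on $L^2_a(\mathbb{D})$.
   Context: Fix an integer $n\ge 1$. $D$ is the open unit disc in $\mathbb{C}$ and $\mathbb{D}=\{z=(z_1,\dots,z_n)\in\mathbb{C}^n:|z_i|<1,\ i=1,\dots,n\}$ is the polydisk, with topological boundary $\partial\mathbb{D}$ in $\mathbb{C}^n$. $dv=dA_1\cdots dA_n$ is normalized Lebesgue measure on $\mathbb{D}$ (each $dA_i$ is normalized area measure on $D$). The Bergman space $L^2_a(\mathbb{D})$ is the closed subspace of analytic functions in $L^2(\mathbb{D},dv)$. Its normalized reproducing kernels are $k_z(w)=\prod_{i=1}^n\frac{1-|z_i|^2}{(1-w_i\overline{z_i})^2}$, $z,w\in\mathbb{D}$. For vectors $f,g$, $f\otimes g$ is the operator $h\mapsto\langle h,g\rangle f$. For $u,v\in D$ let $\varphi_u(v)=(u-v)/(1-v\overline{u})$ and $\beta(u,v)=\frac12\log\frac{1+|\varphi_u(v)|}{1-|\varphi_u(v)|}$. On $\mathbb{D}$ use the metric $d(z,w)=\sum_{i=1}^n\beta(z_i,w_i)$ and write $D(z,a)=\{w\in\mathbb{D}:d(z,w)<a\}$. A set $\Gamma\subset\mathbb{D}$ is separated if there is $a>0$ with $D(u,a)\cap D(v,a)=\emptyset$ for all $u\ne v$ in $\Gamma$. $\mathcal{D}_0$ is the collection of operators $\sum_{z\in\Gamma}c_zk_z\otimes k_{\gamma(z)}$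 on $L^2_a(\mathbb{D})$, where $\Gamma$ is any separated set in $\mathbb{D}$, $\{c_z:z\in\Gamma\}$ is any bounded set of complex coefficients, and $\gamma:\Gamma\to\mathbb{D}$ is any map for which there is $0\le C<\infty$ with $d(z,\gamma(z))\le C$ for every $z\in\Gamma$ (sums over $\Gamma$ are understood in the strong operator topology). $\mathcal{D}$ is the operator-norm closure of the linear span of $\mathcal{D}_0$, and $C^*(\mathcal{D})$ is the $C^*$-algebra generated by $\mathcal{D}$. *)

theory Defs
  imports "HOL-Analysis.Analysis"
begin

definition polydisk :: "(complex ^ 'n::finite) set"
  where "polydisk = {z. \<forall>i. norm (z $ i) < 1}"

text \<open>The volume of the polydisk, by which \<open>uniform_measure\<close> divides, is \<open>pi ^ n\<close>, so this is
  the product of the normalized area measures.\<close>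

definition dv :: "(complex ^ 'n::finite) measure"
  where "dv = uniform_measure lborel polydisk"

text \<open>The filter describing \<open>z \<rightarrow> frontier polydisk\<close> from inside the polydisk: the limit
  is taken as the Euclidean distance to the whole topological boundary tends to 0.\<close>

definition to_boundary :: "(complex ^ 'n::finite) filter"
  where "to_boundary =
    inf (filtercomap (\<lambda>z. infdist z (frontier polydisk)) (nhds 0)) (principal polydisk)"

lemma eventually_to_boundary:
  "eventually P (to_boundary :: (complex ^ 'n::finite) filter) \<longleftrightarrow>
    (\<exists>\<delta>>0. \<forall>z\<in>polydisk. infdist z (frontier polydisk) < \<delta> \<longrightarrow> P z)"
proof -
  have "eventually P (to_boundary :: (complex ^ 'n) filter) \<longleftrightarrow>
    (\<exists>Q. (\<exists>\<delta>>0. \<forall>r. dist r (0::real) < \<delta> \<longrightarrow> Q r) \<and>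
       (\<forall>z. Q (infdist z (frontier polydisk)) \<longrightarrow> z \<in> polydisk \<longrightarrow> P z))"
    by (simp add: to_boundary_def eventually_inf_principal eventually_filtercomap
        eventually_nhds_metric)
  also have "\<dots> \<longleftrightarrow> (\<exists>\<delta>>0. \<forall>z\<in>polydisk. infdist z (frontier polydisk) < \<delta> \<longrightarrow> P z)"
    (is "?L \<longleftrightarrow> ?R")
  proof
    assume ?L
    then obtain Q \<delta> where Q: "\<delta> > 0" "\<And>r. dist r (0::real) < \<delta> \<Longrightarrow> Q r"
      "\<And>z. Q (infdist z (frontier polydisk)) \<Longrightarrow> z \<in> polydisk \<Longrightarrow> P z"
      by blast
    show ?R
      by (rule exI[of _ \<delta>]) (use Q(1) in \<open>auto intro!: Q(2,3) simp: dist_real_def abs_of_nonneg infdist_nonneg\<close>)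
  next
    assume ?R
    then obtain \<delta> where d: "\<delta> > 0"
      "\<And>z. z \<in> polydisk \<Longrightarrow> infdist z (frontier polydisk) < \<delta> \<Longrightarrow> P z"
      by blast
    show ?L
      by (rule exI[of _ "\<lambda>r. dist r 0 < \<delta>"]) (use d in \<open>auto simp: dist_real_def\<close>)
  qed
  finally show ?thesis .
qed

definition mobius :: "complex \<Rightarrow> complex \<Rightarrow> complex"
  where "mobius u v = (u - v) / (1 - v * cnj u)"

definition beta_dist :: "complex \<Rightarrow> complex \<Rightarrow> real"
  where "beta_dist u v = 1 / 2 * ln ((1 + norm (mobius u v)) / (1 - norm (mobius u v)))"

definition polydisk_dist :: "complex ^ 'n::finite \<Rightarrow> complex ^ 'n \<Rightarrow> real"
  where "polydisk_dist z w = (\<Sum>i\<in>UNIV. beta_dist (z $ i) (w $ i))"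

definition polydisk_ball :: "complex ^ 'n::finite \<Rightarrow> real \<Rightarrow> (complex ^ 'n) set"
  where "polydisk_ball z a = {w \<in> polydisk. polydisk_dist z w < a}"

definition separated_set :: "(complex ^ 'n::finite) set \<Rightarrow> bool"
  where "separated_set \<Gamma> \<longleftrightarrow> \<Gamma> \<subseteq> polydisk \<and>
    (\<exists>a>0. \<forall>u\<in>\<Gamma>. \<forall>v\<in>\<Gamma>. u \<noteq> v \<longrightarrow> polydisk_ball u a \<inter> polydisk_ball v a = {})"

lemma open_polydisk: "open (polydisk :: (complex ^ 'n::finite) set)"
proof -
  have "open (\<Inter>i\<in>UNIV. {z :: complex ^ 'n. norm (z $ i) < 1})"
    by (intro open_INT finite ballI open_Collect_less continuous_intros)
  also have "(\<Inter>i\<in>UNIV. {z :: complex ^ 'n. norm (z $ i) < 1}) = polydisk"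
    by (auto simp: polydisk_def)
  finally show ?thesis .
qed

lemma zero_in_polydisk: "0 \<in> polydisk"
  by (simp add: polydisk_def)

lemma bounded_polydisk: "bounded (polydisk :: (complex ^ 'n::finite) set)"
proof -
  have "norm z \<le> real CARD('n)" if "z \<in> polydisk" for z :: "complex ^ 'n"
  proof -
    have "norm z \<le> (\<Sum>i\<in>UNIV. norm (z $ i))"
      unfolding norm_vec_def by (rule L2_set_le_sum) simp
    also have "\<dots> \<le> (\<Sum>i\<in>(UNIV::'n set). 1)"
      by (rule sum_mono) (use that in \<open>auto simp: polydisk_def less_imp_le\<close>)
    finally show ?thesis by simp
  qed
  then show ?thesis by (auto simp: bounded_iff)
qed

lemma emeasure_lborel_open_pos:
  fixes S :: "'a::euclidean_space set"
  assumes "open S" "S \<noteq> {}"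
  shows "emeasure lborel S \<noteq> 0"
proof
  assume "emeasure lborel S = 0"
  then have "S \<in> null_sets lborel" using assms by auto
  then have "S \<in> null_sets lebesgue" by (rule null_sets_completionI)
  then have "negligible S" by (simp add: negligible_iff_null_sets)
  with open_not_negligible[OF assms] show False by blast
qed

lemma emeasure_polydisk:
  "emeasure lborel (polydisk :: (complex ^ 'n::finite) set) \<noteq> 0"
  "emeasure lborel (polydisk :: (complex ^ 'n::finite) set) \<noteq> \<infinity>"
  using emeasure_lborel_open_pos[OF open_polydisk] zero_in_polydisk
    emeasure_bounded_finite[OF bounded_polydisk]
  by (blast, metis less_irrefl infinity_ennreal_def)

lemma sets_dv [simp, measurable_cong]: "sets dv = sets borel"
  by (simp add: dv_def)

lemma space_dv [simp]: "space dv = UNIV"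
  by (simp add: dv_def)

lemma finite_measure_dv: "finite_measure dv"
proof
  show "emeasure dv (space dv) \<noteq> \<infinity>"
    unfolding dv_def space_uniform_measure
    using emeasure_polydisk borel_open[OF open_polydisk]
    by (subst emeasure_uniform_measure) (auto simp: ennreal_divide_eq_top_iff)
qed

lemma AE_dv: "(AE z in dv. P z) \<longleftrightarrow> (AE z in lborel. z \<in> polydisk \<longrightarrow> P z)"
  unfolding dv_def
  by (rule AE_uniform_measure) (use emeasure_polydisk in \<open>auto simp: less_top\<close>)

text \<open>Analytic functions of several variables: continuous and holomorphic in each variable
  separately.\<close>

definition polydisk_analytic :: "(complex ^ 'n::finite \<Rightarrow> complex) \<Rightarrow> bool"
  where "polydisk_analytic f \<longleftrightarrow> continuous_on polydisk f \<and>
    (\<forall>z\<in>polydisk. \<forall>i. (\<lambda>w. f (\<chi> j. if j = i then w else z $ j)) holomorphic_on ball 0 1)"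

text \<open>A class of \<open>L\<^sup>2(dv)\<close> containing an analytic function contains exactly one.  It is
  represented by that function, extended by 0 off the polydisk so that equality of elements is
  equality of functions on the polydisk.\<close>

definition bergman_functions :: "(complex ^ 'n::finite \<Rightarrow> complex) set"
  where "bergman_functions = {f. polydisk_analytic f \<and>
    integrable dv (\<lambda>w. (norm (f w))\<^sup>2) \<and> (\<forall>w. w \<notin> polydisk \<longrightarrow> f w = 0)}"

lemma polydisk_analytic_add:
  "polydisk_analytic f \<Longrightarrow> polydisk_analytic g \<Longrightarrow> polydisk_analytic (\<lambda>w. f w + g w)"
  by (auto simp: polydisk_analytic_def intro!: continuous_intros holomorphic_intros)

lemma polydisk_analytic_cmult:
  "polydisk_analytic f \<Longrightarrow> polydisk_analytic (\<lambda>w. c * f w)"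
  by (auto simp: polydisk_analytic_def intro!: continuous_intros holomorphic_intros)

lemma bergman_functions_measurable:
  assumes "f \<in> bergman_functions"
  shows "f \<in> borel_measurable borel"
proof -
  have "(\<lambda>w. if w \<in> polydisk then f w else 0) \<in> borel_measurable borel"
    by (rule borel_measurable_continuous_on_if)
      (use assms borel_open[OF open_polydisk] in \<open>auto simp: bergman_functions_def polydisk_analytic_def\<close>)
  also have "(\<lambda>w. if w \<in> polydisk then f w else 0) = f"
    using assms by (auto simp: bergman_functions_def)
  finally show ?thesis .
qed

lemma bergman_functions_integrable_mult:
  assumes f: "f \<in> bergman_functions" and g: "g \<in> bergman_functions"
  shows "integrable dv (\<lambda>w. f w * cnj (g w))"
proof (rule Bochner_Integration.integrable_bound)
  show "integrable dv (\<lambda>w. (norm (f w))\<^sup>2 + (norm (g w))\<^sup>2)"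
    using f g by (simp add: bergman_functions_def)
  have "(\<lambda>w. f w * cnj (g w)) \<in> borel_measurable borel"
    using bergman_functions_measurable[OF f]
      measurable_compose[OF bergman_functions_measurable[OF g]
        borel_measurable_continuous_onI[OF continuous_on_cnj[OF continuous_on_id]]]
    by (rule borel_measurable_times)
  then show "(\<lambda>w. f w * cnj (g w)) \<in> borel_measurable dv"
    by (simp cong: measurable_cong_sets)
  have "a * b \<le> a\<^sup>2 + b\<^sup>2" if "a \<ge> 0" "b \<ge> 0" for a b :: real
    using that sum_squares_bound[of a b] mult_nonneg_nonneg[OF that]
    unfolding power2_eq_square by linarith
  then show "AE w in dv. norm (f w * cnj (g w)) \<le> norm ((norm (f w))\<^sup>2 + (norm (g w))\<^sup>2)"
    by (auto simp: norm_mult)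
qed

lemma bergman_functions_add:
  assumes f: "f \<in> bergman_functions" and g: "g \<in> bergman_functions"
  shows "(\<lambda>w. f w + g w) \<in> bergman_functions"
proof -
  have "integrable dv (\<lambda>w. (norm (f w + g w))\<^sup>2)"
  proof (rule Bochner_Integration.integrable_bound)
    show "integrable dv (\<lambda>w. 2 * (norm (f w))\<^sup>2 + 2 * (norm (g w))\<^sup>2)"
      using f g by (simp add: bergman_functions_def)
    have "(\<lambda>w. (norm (f w + g w))\<^sup>2) \<in> borel_measurable borel"
      using bergman_functions_measurable[OF f] bergman_functions_measurable[OF g] by measurable
    then show "(\<lambda>w. (norm (f w + g w))\<^sup>2) \<in> borel_measurable dv"
      by (simp cong: measurable_cong_sets)
    have "(norm (a + b))\<^sup>2 \<le> 2 * (norm a)\<^sup>2 + 2 * (norm b)\<^sup>2" for a b :: complex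
    proof -
      have "(norm (a + b))\<^sup>2 \<le> (norm a + norm b)\<^sup>2"
        by (intro power_mono norm_triangle_ineq) simp
      also have "\<dots> \<le> 2 * (norm a)\<^sup>2 + 2 * (norm b)\<^sup>2"
        using sum_squares_bound[of "norm a" "norm b"] by (simp add: power2_sum)
      finally show ?thesis .
    qed
    then show "AE w in dv. norm ((norm (f w + g w))\<^sup>2)
        \<le> norm (2 * (norm (f w))\<^sup>2 + 2 * (norm (g w))\<^sup>2)"
      by simp
  qed
  then show ?thesis
    using f g by (auto simp: bergman_functions_def polydisk_analytic_add)
qed

lemma bergman_functions_cmult:
  "f \<in> bergman_functions \<Longrightarrow> (\<lambda>w. c * f w) \<in> bergman_functions"
  by (auto simp: bergman_functions_def polydisk_analytic_cmult norm_mult power_mult_distrib)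

lemma bergman_functions_zero: "(\<lambda>w. 0) \<in> bergman_functions"
  by (auto simp: bergman_functions_def polydisk_analytic_def)

lemma bergman_functions_norm_zero_iff:
  assumes f: "f \<in> bergman_functions"
  shows "(\<integral>w. (norm (f w))\<^sup>2 \<partial>dv) = 0 \<longleftrightarrow> f = (\<lambda>w. 0)"
proof
  assume "(\<integral>w. (norm (f w))\<^sup>2 \<partial>dv) = 0"
  then have "AE w in dv. f w = 0"
    using f by (subst (asm) integral_nonneg_eq_0_iff_AE) (auto simp: bergman_functions_def)
  then have AE: "AE w in lborel. w \<in> polydisk \<longrightarrow> f w = 0"
    by (simp add: AE_dv)
  let ?S = "polydisk \<inter> f -` (- {0})"
  have "open ?S"
    using f open_polydisk
    by (intro continuous_open_preimage) (auto simp: bergman_functions_def polydisk_analytic_def)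
  moreover have "emeasure lborel ?S = 0"
  proof -
    have "{w \<in> space lborel. \<not> (w \<in> polydisk \<longrightarrow> f w = 0)} = ?S" by auto
    moreover have "?S \<in> sets lborel" using \<open>open ?S\<close> by simp
    ultimately show ?thesis
      using AE AE_iff_measurable[of ?S lborel "\<lambda>w. w \<in> polydisk \<longrightarrow> f w = 0"] by auto
  qed
  ultimately have "?S = {}"
    using emeasure_lborel_open_pos by blast
  then show "f = (\<lambda>w. 0)"
    using f by (auto simp: bergman_functions_def fun_eq_iff)
qed simp

typedef ('n::finite) bergman = "bergman_functions :: (complex ^ 'n \<Rightarrow> complex) set"
  morphisms bergman_fun Bergman
  using bergman_functions_zero by blast

setup_lifting type_definition_bergman

definition bergman_inner :: "'n::finite bergman \<Rightarrow> 'n bergman \<Rightarrow> complex"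
  where "bergman_inner f g = (\<integral>w. bergman_fun f w * cnj (bergman_fun g w) \<partial>dv)"

lemma bergman_inner_commute: "bergman_inner g f = cnj (bergman_inner f g)"
proof -
  have "bergman_inner g f = (\<integral>w. cnj (bergman_fun f w * cnj (bergman_fun g w)) \<partial>dv)"
    by (simp add: bergman_inner_def mult.commute)
  also have "\<dots> = cnj (bergman_inner f g)" unfolding bergman_inner_def by (rule Bochner_Integration.integral_cnj)
  finally show ?thesis .
qed

lift_definition bergman_scale :: "complex \<Rightarrow> 'n::finite bergman \<Rightarrow> 'n bergman"
  is "\<lambda>c f w. c * f w"
  by (rule bergman_functions_cmult)

text \<open>The Hilbert space norm comes from the complex inner product; the real inner product that
  the type class asks for is its real part.\<close>

instantiation bergman :: (finite) real_inner
begin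

lift_definition zero_bergman :: "'a bergman" is "\<lambda>w. 0"
  by (rule bergman_functions_zero)

lift_definition plus_bergman :: "'a bergman \<Rightarrow> 'a bergman \<Rightarrow> 'a bergman"
  is "\<lambda>f g w. f w + g w"
  by (rule bergman_functions_add)

lift_definition uminus_bergman :: "'a bergman \<Rightarrow> 'a bergman"
  is "\<lambda>f w. - f w"
  using bergman_functions_cmult[of _ "-1"] by simp

definition minus_bergman :: "'a bergman \<Rightarrow> 'a bergman \<Rightarrow> 'a bergman"
  where "minus_bergman f g = f + - g"

definition scaleR_bergman :: "real \<Rightarrow> 'a bergman \<Rightarrow> 'a bergman"
  where "scaleR_bergman r f = bergman_scale (complex_of_real r) f"

definition inner_bergman :: "'a bergman \<Rightarrow> 'a bergman \<Rightarrow> real"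
  where "inner_bergman f g = Re (bergman_inner f g)"

definition norm_bergman :: "'a bergman \<Rightarrow> real"
  where "norm_bergman f = sqrt (Re (bergman_inner f f))"

definition sgn_bergman :: "'a bergman \<Rightarrow> 'a bergman"
  where "sgn_bergman f = inverse (norm f) *\<^sub>R f"

definition dist_bergman :: "'a bergman \<Rightarrow> 'a bergman \<Rightarrow> real"
  where "dist_bergman f g = norm (f - g)"

definition uniformity_bergman :: "('a bergman \<times> 'a bergman) filter"
  where "uniformity_bergman = (INF e\<in>{0<..}. principal {(f, g). dist f g < e})"

definition open_bergman :: "'a bergman set \<Rightarrow> bool"
  where "open_bergman U \<longleftrightarrow> (\<forall>f\<in>U. \<forall>\<^sub>F (f', g) in uniformity. f' = f \<longrightarrow> g \<in> U)"

instance
proof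
  fix f g h :: "'a bergman" and r s :: real
  show "f + g + h = f + (g + h)" "f + g = g + f" "0 + f = f" "- f + f = 0"
    by (transfer; simp add: algebra_simps)+
  show "f - g = f + - g" by (simp add: minus_bergman_def)
  show "r *\<^sub>R (f + g) = r *\<^sub>R f + r *\<^sub>R g" "(r + s) *\<^sub>R f = r *\<^sub>R f + s *\<^sub>R f"
    "r *\<^sub>R s *\<^sub>R f = (r * s) *\<^sub>R f" "1 *\<^sub>R f = f"
    unfolding scaleR_bergman_def by (transfer; simp add: algebra_simps)+
  show "sgn f = inverse (norm f) *\<^sub>R f" by (simp add: sgn_bergman_def)
  show "dist f g = norm (f - g)" by (simp add: dist_bergman_def)
  show "uniformity = (INF e\<in>{0<..}. principal {(f::'a bergman, g). dist f g < e})"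
    by (simp add: uniformity_bergman_def)
  show "open U \<longleftrightarrow> (\<forall>f\<in>U. \<forall>\<^sub>F (f', g) in uniformity. f' = f \<longrightarrow> g \<in> U)"
    for U :: "'a bergman set"
    by (simp add: open_bergman_def)
  note int = bergman_functions_integrable_mult[OF bergman_fun bergman_fun]
  have self: "bergman_inner f f = complex_of_real (\<integral>w. (norm (bergman_fun f w))\<^sup>2 \<partial>dv)"
    unfolding bergman_inner_def integral_complex_of_real[symmetric]
    by (simp only: complex_norm_square)
  show "inner f g = inner g f"
    by (simp add: inner_bergman_def bergman_inner_commute[of f g])
  show "inner (f + g) h = inner f h + inner g h"
    by (simp add: inner_bergman_def bergman_inner_def plus_bergman.rep_eq int distrib_right)
  show "inner (r *\<^sub>R f) g = r * inner f g"
    by (simp add: inner_bergman_def bergman_inner_def scaleR_bergman_def bergman_scale.rep_eq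
        mult.assoc)
  show "0 \<le> inner f f" by (simp add: inner_bergman_def self)
  show "inner f f = 0 \<longleftrightarrow> f = 0"
    using bergman_functions_norm_zero_iff[OF bergman_fun[of f]]
    by (simp add: inner_bergman_def self bergman_fun_inject[symmetric] zero_bergman.rep_eq)
  show "norm f = sqrt (inner f f)" by (simp add: norm_bergman_def inner_bergman_def)
qed

end

lemma bergman_inner_add_left:
  "bergman_inner (f + g) h = bergman_inner f h + bergman_inner g h"
  by (simp add: bergman_inner_def plus_bergman.rep_eq distrib_right
      bergman_functions_integrable_mult[OF bergman_fun bergman_fun])

lemma bergman_inner_scale_left:
  "bergman_inner (bergman_scale c f) g = c * bergman_inner f g"
  by (simp add: bergman_inner_def bergman_scale.rep_eq mult.assoc)

lemma bergman_scale_scaleR: "bergman_scale (complex_of_real r) f = r *\<^sub>R f"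
  by (simp add: scaleR_bergman_def)

lemma vector_space_bergman_scale: "vector_space bergman_scale"
  by unfold_locales (transfer; simp add: algebra_simps)+

lemma norm_bergman_scale: "norm (bergman_scale c f) = norm c * norm f"
proof -
  have "bergman_inner (bergman_scale c f) (bergman_scale c f) = c * cnj c * bergman_inner f f"
    by (simp add: bergman_inner_scale_left bergman_inner_commute[of f "bergman_scale c f"])
      (simp add: bergman_inner_commute[of f f, symmetric])
  also have "c * cnj c = complex_of_real ((norm c)\<^sup>2)"
    by (simp only: complex_norm_square)
  finally have "Re (bergman_inner (bergman_scale c f) (bergman_scale c f))
      = (norm c)\<^sup>2 * Re (bergman_inner f f)"
    by simp
  then show ?thesis by (simp add: norm_bergman_def real_sqrt_mult)
qed

lemma bounded_linear_bergman_scale: "bounded_linear (bergman_scale c)"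
proof (rule bounded_linear_intro[of _ "norm c"])
  show "bergman_scale c (f + g) = bergman_scale c f + bergman_scale c g" for f g :: "'a bergman"
    by (transfer; simp add: algebra_simps)
  show "bergman_scale c (r *\<^sub>R f) = r *\<^sub>R bergman_scale c f" for r and f :: "'a bergman"
    unfolding scaleR_bergman_def by (transfer; simp add: algebra_simps)
  show "norm (bergman_scale c f) \<le> norm f * norm c" for f :: "'a bergman"
    by (simp add: norm_bergman_scale mult.commute)
qed

lemma norm_bergman_inner_le: "norm (bergman_inner f g) \<le> norm f * norm g"
proof (cases "bergman_inner f g = 0")
  case False
  define c where "c = cnj (sgn (bergman_inner f g))"
  have c: "norm c = 1" using False by (simp add: c_def norm_sgn)
  have "c * bergman_inner f g = norm (bergman_inner f g)"
    using False complex_norm_square[of "bergman_inner f g"] unfolding c_def sgn_eq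
    by (simp add: field_simps power2_eq_square)
  then have "norm (bergman_inner f g) = inner (bergman_scale c f) g"
    by (simp add: inner_bergman_def bergman_inner_scale_left)
  also have "\<dots> \<le> norm (bergman_scale c f) * norm g" by (rule norm_cauchy_schwarz)
  finally show ?thesis by (simp add: norm_bergman_scale c)
qed simp

text \<open>Bounded operators are taken from the library type of bounded real-linear maps, which carries
  the operator norm; complex linearity is imposed by \<open>clinear_op\<close>.\<close>

type_synonym 'n bergman_op = "'n bergman \<Rightarrow>\<^sub>L 'n bergman"

definition clinear_op :: "'n::finite bergman_op \<Rightarrow> bool"
  where "clinear_op A \<longleftrightarrow> (\<forall>c f. A (bergman_scale c f) = bergman_scale c (A f))"

definition op_scale :: "complex \<Rightarrow> 'n::finite bergman_op \<Rightarrow> 'n bergman_op"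
  where "op_scale c A = Blinfun (\<lambda>f. bergman_scale c (A f))"

lemma op_scale_apply: "op_scale c A f = bergman_scale c (A f)"
  unfolding op_scale_def
  by (simp add: bounded_linear_Blinfun_apply
      bounded_linear_compose[OF bounded_linear_bergman_scale blinfun.bounded_linear_right])

lemma vector_space_op_scale: "vector_space op_scale"
  by unfold_locales
    (rule blinfun_eqI, simp add: op_scale_apply blinfun.add_left
      vector_space.vector_space_assms[OF vector_space_bergman_scale])+

definition is_adjoint_op :: "'n::finite bergman_op \<Rightarrow> 'n bergman_op \<Rightarrow> bool"
  where "is_adjoint_op A B \<longleftrightarrow> (\<forall>f g. bergman_inner (A f) g = bergman_inner f (B g))"

definition compact_op :: "'n::finite bergman_op \<Rightarrow> bool"
  where "compact_op A \<longleftrightarrow> compact (closure (blinfun_apply A ` cball 0 1))"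

definition rank_one :: "'n::finite bergman \<Rightarrow> 'n bergman \<Rightarrow> 'n bergman_op"
  where "rank_one f g = Blinfun (\<lambda>h. bergman_scale (bergman_inner h g) f)"

lemma rank_one_apply: "rank_one f g h = bergman_scale (bergman_inner h g) f"
proof -
  have "bounded_linear (\<lambda>h. bergman_scale (bergman_inner h g) f)"
  proof (rule bounded_linear_intro[of _ "norm g * norm f"])
    show "bergman_scale (bergman_inner (h + k) g) f =
        bergman_scale (bergman_inner h g) f + bergman_scale (bergman_inner k g) f" for h k
      unfolding bergman_inner_add_left by (transfer; simp add: algebra_simps)
    show "bergman_scale (bergman_inner (r *\<^sub>R h) g) f =
        r *\<^sub>R bergman_scale (bergman_inner h g) f" for r h
      unfolding scaleR_bergman_def bergman_inner_scale_left
      by (transfer; simp add: algebra_simps)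
    show "norm (bergman_scale (bergman_inner h g) f) \<le> norm h * (norm g * norm f)" for h
      using mult_right_mono[OF norm_bergman_inner_le[of h g] norm_ge_zero[of f]]
      by (simp add: norm_bergman_scale mult.assoc)
  qed
  then show ?thesis by (simp add: rank_one_def bounded_linear_Blinfun_apply)
qed

text \<open>C*-subalgebras of the algebra of all bounded complex-linear operators; they need not contain
  the identity.\<close>

definition cstar_subalgebra :: "'n::finite bergman_op set \<Rightarrow> bool"
  where "cstar_subalgebra X \<longleftrightarrow>
    (\<forall>A\<in>X. clinear_op A) \<and> module.subspace op_scale X \<and>
    (\<forall>A\<in>X. \<forall>B\<in>X. A o\<^sub>L B \<in> X) \<and>
    (\<forall>A\<in>X. \<forall>B. is_adjoint_op A B \<longrightarrow> B \<in> X) \<and> closed X"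

definition cstar_generated :: "'n::finite bergman_op set \<Rightarrow> 'n bergman_op set"
  where "cstar_generated S = \<Inter> {X. S \<subseteq> X \<and> cstar_subalgebra X}"

definition normalized_kernel_fun :: "complex ^ 'n::finite \<Rightarrow> complex ^ 'n \<Rightarrow> complex"
  where "normalized_kernel_fun z w =
    (\<Prod>i\<in>UNIV. complex_of_real (1 - (norm (z $ i))\<^sup>2) / (1 - w $ i * cnj (z $ i))\<^sup>2)"

definition normalized_kernel :: "complex ^ 'n::finite \<Rightarrow> 'n bergman"
  where "normalized_kernel z =
    Bergman (\<lambda>w. if w \<in> polydisk then normalized_kernel_fun z w else 0)"

text \<open>The kernel function does lie in the Bergman space, so the abstraction above is meaningful.\<close>

lemma bergman_fun_normalized_kernel:
  fixes z :: "complex ^ 'n::finite"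
  assumes z: "z \<in> polydisk"
  shows "bergman_fun (normalized_kernel z) =
    (\<lambda>w. if w \<in> polydisk then normalized_kernel_fun z w else 0)"
proof -
  let ?k = "\<lambda>w. if w \<in> polydisk then normalized_kernel_fun z w else 0"
  have lower: "norm (1 - a * cnj (z $ i)) \<ge> 1 - norm (z $ i)" if "norm a < 1" for a i
  proof -
    have "norm (a * cnj (z $ i)) \<le> norm (z $ i)"
      using that mult_right_mono[of "norm a" 1 "norm (z $ i)"] by (simp add: norm_mult)
    then show ?thesis using norm_triangle_ineq2[of 1 "a * cnj (z $ i)"] by simp
  qed
  have zi: "1 - norm (z $ i) > 0" for i using z by (simp add: polydisk_def)
  have nz: "1 - a * cnj (z $ i) \<noteq> 0" if "norm a < 1" for a i
    using lower[OF that, of i] zi[of i] by auto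
  have cont: "continuous_on polydisk (normalized_kernel_fun z)"
    unfolding normalized_kernel_fun_def
    by (intro continuous_intros) (use nz in \<open>auto simp: polydisk_def\<close>)
  have upd: "(\<chi> j. if j = i then a else w $ j) \<in> polydisk"
    if "w \<in> polydisk" "norm a < 1" for w :: "complex ^ 'n" and i a
    using that by (auto simp: polydisk_def)
  have hol: "(\<lambda>a. ?k (\<chi> j. if j = i then a else w $ j)) holomorphic_on ball 0 1"
    if w: "w \<in> polydisk" for w i
  proof (rule holomorphic_transform)
    show "(\<lambda>a. normalized_kernel_fun z (\<chi> j. if j = i then a else w $ j)) holomorphic_on ball 0 1"
      unfolding normalized_kernel_fun_def
    proof (intro holomorphic_intros)
      fix j a
      assume a: "a \<in> ball (0::complex) 1"
      show "(1 - (\<chi> j. if j = i then a else w $ j) $ j * cnj (z $ j))\<^sup>2 \<noteq> 0"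
        using nz upd[OF w, of a i] a by (simp add: polydisk_def)
    next
      fix j
      show "(\<lambda>a. (\<chi> j. if j = i then a else w $ j) $ j) holomorphic_on ball 0 1"
        by (cases "j = i") (auto intro: holomorphic_intros)
    qed
  qed (use upd[OF w] in auto)
  have an: "polydisk_analytic ?k"
    unfolding polydisk_analytic_def using hol cont by (auto cong: continuous_on_cong)
  define B where "B = (\<Prod>i\<in>UNIV. norm (complex_of_real (1 - (norm (z $ i))\<^sup>2)) / (1 - norm (z $ i))\<^sup>2)"
  have B: "norm (?k w) \<le> B" for w
  proof (cases "w \<in> polydisk")
    case True
    have "norm (normalized_kernel_fun z w) \<le> B"
      unfolding normalized_kernel_fun_def B_def prod_norm[symmetric]
    proof (intro prod_mono conjI norm_ge_zero)
      fix i
      have "norm (w $ i) < 1" using True by (simp add: polydisk_def)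
      then have "(1 - norm (z $ i))\<^sup>2 \<le> (norm (1 - w $ i * cnj (z $ i)))\<^sup>2"
        using lower[of "w $ i" i] zi[of i] by (intro power_mono) auto
      then show "norm (complex_of_real (1 - (norm (z $ i))\<^sup>2) / (1 - w $ i * cnj (z $ i))\<^sup>2)
          \<le> norm (complex_of_real (1 - (norm (z $ i))\<^sup>2)) / (1 - norm (z $ i))\<^sup>2"
        unfolding norm_divide norm_power using zi[of i]
        by (intro divide_left_mono mult_pos_pos) (auto simp: zero_less_power intro!: zero_less_power less_le_trans[of 0 "(1 - norm (z $ i))\<^sup>2"])
    qed
    then show ?thesis using True by simp
  next
    case False
    then show ?thesis by (simp add: B_def prod_nonneg)
  qed
  have "?k \<in> borel_measurable borel"
    by (rule borel_measurable_continuous_on_if) (use cont borel_open[OF open_polydisk] in auto)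
  then have "(\<lambda>w. (norm (?k w))\<^sup>2) \<in> borel_measurable borel" by measurable
  moreover have "norm ((norm (?k w))\<^sup>2) \<le> B\<^sup>2" for w
    using power_mono[OF B[of w], of 2] by simp
  ultimately have "integrable dv (\<lambda>w. (norm (?k w))\<^sup>2)"
    by (intro finite_measure.integrable_const_bound[OF finite_measure_dv, where B = "B\<^sup>2"] AE_I2)
      (simp_all cong: measurable_cong_sets)
  with an have "?k \<in> bergman_functions" by (simp add: bergman_functions_def)
  then show ?thesis by (simp add: normalized_kernel_def Bergman_inverse)
qed

text \<open>The collection \<open>D\<^sub>0\<close>.  Convergence of the sum over \<open>\<Gamma>\<close> in the strong operator topology
  is norm convergence, along the finite subsets of \<open>\<Gamma>\<close>, of the sums applied to each vector.\<close>

definition localized_ops0 :: "'n::finite bergman_op set"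
  where "localized_ops0 = {T. \<exists>\<Gamma> c \<gamma>.
    separated_set \<Gamma> \<and> bounded (c ` \<Gamma>) \<and> \<gamma> ` \<Gamma> \<subseteq> polydisk \<and>
    (\<exists>C\<ge>0. \<forall>z\<in>\<Gamma>. polydisk_dist z (\<gamma> z) \<le> C) \<and>
    (\<forall>h. ((\<lambda>z. blinfun_apply
              (op_scale (c z) (rank_one (normalized_kernel z) (normalized_kernel (\<gamma> z)))) h)
          has_sum blinfun_apply T h) \<Gamma>)}"

definition localized_ops :: "'n::finite bergman_op set"
  where "localized_ops = closure (module.span op_scale localized_ops0)"

text \<open>The intersection defining \<open>C*(D)\<close> is over a nonempty family: all complex-linear bounded
  operators form a C*-subalgebra containing \<open>D\<close>.\<close>

lemma clinear_op_add: "clinear_op A \<Longrightarrow> clinear_op B \<Longrightarrow> clinear_op (A + B)"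
  by (simp add: clinear_op_def blinfun.add_left
      vector_space.vector_space_assms(1)[OF vector_space_bergman_scale])

lemma clinear_op_scale: "clinear_op A \<Longrightarrow> clinear_op (op_scale c A)"
  by (simp add: clinear_op_def op_scale_apply mult.commute
      vector_space.vector_space_assms(3)[OF vector_space_bergman_scale])

lemma clinear_op_zero: "clinear_op 0"
  by (simp add: clinear_op_def linear_simps[OF bounded_linear_bergman_scale])

lemma subspace_clinear_op: "module.subspace op_scale {A. clinear_op A}"
  by (rule module.subspaceI[OF vector_space_op_scale[folded module_iff_vector_space]])
    (auto intro: clinear_op_add clinear_op_scale clinear_op_zero)

lemma closed_clinear_op: "closed {A :: 'n::finite bergman_op. clinear_op A}"
proof -
  have "closed {A :: 'n::finite bergman_op. A (bergman_scale c f) = bergman_scale c (A f)}" for c and f :: "'n::finite bergman"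
    by (rule closed_Collect_eq)
      (rule linear_continuous_on blinfun.bounded_linear_left
        bounded_linear_compose[OF bounded_linear_bergman_scale])+
  then have "closed (\<Inter>c. \<Inter>f. {A :: 'n::finite bergman_op. A (bergman_scale c f) = bergman_scale c (A f)})"
    by (intro closed_INT ballI)
  then show ?thesis by (simp add: clinear_op_def Collect_all_eq)
qed

lemma clinear_op_adjoint:
  assumes "is_adjoint_op A B"
  shows "clinear_op B"
  unfolding clinear_op_def
proof (intro allI)
  fix c and g :: "'a bergman"
  let ?d = "B (bergman_scale c g) - bergman_scale c (B g)"
  have right: "bergman_inner f (bergman_scale c g) = cnj c * bergman_inner f g" for f g :: "'a bergman"
    by (simp add: bergman_inner_commute[of f "bergman_scale c g"] bergman_inner_scale_left
        bergman_inner_commute[of g f])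
  have "bergman_inner f (B (bergman_scale c g)) = bergman_inner f (bergman_scale c (B g))" for f
    using assms by (simp add: is_adjoint_op_def right flip: assms[unfolded is_adjoint_op_def, rule_format])
  then have "inner ?d ?d = 0"
    by (simp only: inner_diff_right) (simp add: inner_bergman_def)
  then show "B (bergman_scale c g) = bergman_scale c (B g)" by simp
qed

lemma cstar_subalgebra_clinear_op: "cstar_subalgebra {A :: 'n::finite bergman_op. clinear_op A}"
  using subspace_clinear_op closed_clinear_op clinear_op_adjoint
  by (auto simp: cstar_subalgebra_def clinear_op_def)

lemma localized_ops_clinear: "localized_ops \<subseteq> {A :: 'n::finite bergman_op. clinear_op A}"
proof -
  have "clinear_op T" if T: "T \<in> localized_ops0" for T :: "'n::finite bergman_op"
    unfolding clinear_op_def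
  proof (intro allI)
    fix a and h :: "'n bergman"
    obtain \<Gamma> c \<gamma> where "\<forall>h. ((\<lambda>z. blinfun_apply
        (op_scale (c z) (rank_one (normalized_kernel z) (normalized_kernel (\<gamma> z)))) h)
        has_sum T h) \<Gamma>"
      using T unfolding localized_ops0_def by blast
    then have sum: "((\<lambda>z. blinfun_apply
        (op_scale (c z) (rank_one (normalized_kernel z) (normalized_kernel (\<gamma> z)))) h)
        has_sum T h) \<Gamma>" for h by blast
    have "((\<lambda>z. bergman_scale a (blinfun_apply
        (op_scale (c z) (rank_one (normalized_kernel z) (normalized_kernel (\<gamma> z)))) h))
        has_sum bergman_scale a (T h)) \<Gamma>"
      using has_sum_bounded_linear[OF bounded_linear_bergman_scale sum] by (simp add: o_def)
    moreover have "bergman_scale a (blinfun_apply (op_scale b (rank_one f g)) h) =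
        blinfun_apply (op_scale b (rank_one f g)) (bergman_scale a h)" for b f g
      by (simp add: op_scale_apply rank_one_apply bergman_inner_scale_left ac_simps
          vector_space.vector_space_assms(3)[OF vector_space_bergman_scale])
    ultimately show "T (bergman_scale a h) = bergman_scale a (T h)"
      using sum[of "bergman_scale a h"] has_sum_unique by fastforce
  qed
  then have "module.span op_scale localized_ops0 \<subseteq> {A :: 'n bergman_op. clinear_op A}"
    by (intro module.span_minimal[OF vector_space_op_scale[folded module_iff_vector_space]]
        subspace_clinear_op) auto
  then show ?thesis
    unfolding localized_ops_def by (rule closure_minimal[OF _ closed_clinear_op])
qed

end

theory Submission
  imports Defs "HOL-Complex_Analysis.Great_Picard"
begin

text \<open>
  Call a symbol \<open>\<phi>\<close> slow if it varies little over hyperbolic balls of large radius.  By a Schur test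
  against the Bergman kernel, \<open>\<phi> h\<close> is then close in norm to \<open>T\<^sub>\<phi> h\<close>, where \<open>T\<^sub>\<phi>\<close> is the Toeplitz operator.
  The operators \<open>A\<close> whose commutators with \<open>T\<^sub>\<phi>\<close> become small as \<open>\<phi>\<close> becomes slow form a C*-algebra,
  and it contains the generators because they move mass only over bounded hyperbolic distances.

  The hyperbolic plane has finite asymptotic dimension: there are square partitions of unity
  \<open>\<Sum> \<phi>\<^sub>j\<^sup>2 = 1\<close> by functions of bounded support, as slow as desired, of which at most \<open>4\<close> (hence
  \<open>4 ^ n\<close> on the polydisk) meet at any point.  All sums \<open>\<Sum> \<plusminus>\<phi>\<^sub>j\<close> are slow up to a factor depending on \<open>n\<close> only, and
  averaging over the signs gives \<open>A \<approx> \<Sum> T\<^sub>j A T\<^sub>j\<close> as forms, with \<open>T\<^sub>j\<close> the Toeplitz operator of \<open>\<phi>\<^sub>j\<close>.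

  If \<open>\<langle>A k\<^sub>z, k\<^sub>z\<rangle>\<close> vanishes at the boundary, then so does \<open>\<langle>A k\<^sub>u, k\<^sub>w\<rangle>\<close> for \<open>u, w\<close> within a bounded distance of
  \<open>z\<close>, by analyticity in \<open>w\<close> and antianalyticity in \<open>u\<close>; hence the terms \<open>T\<^sub>j A T\<^sub>j\<close> located near the boundary
  are small, and \<open>\<parallel>A h\<parallel> \<le> \<epsilon> \<parallel>h\<parallel> + \<parallel>A\<parallel> \<parallel>1\<^sub>K h\<parallel>\<close> for a compact set \<open>K\<close>.  This makes \<open>A\<close> map bounded sequences that
  converge pointwise to norm convergent ones.  Conversely, \<open>k\<^sub>z\<close> tends weakly to \<open>0\<close> at the boundary.
\<close>

section \<open>Integration on the disc\<close>

text \<open>Two demands pull against each other. Symbols have to vary slowly for the commutators to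
  be small, so the cells grow as the accuracy increases; the errors must nevertheless not
  accumulate. Hence the number of cells meeting at a point has to be independent of the scale, and
  the error is estimated once for each signed sum of all cells, never cell by cell. Dividing the
  cells by \<open>4 ^ n\<close> makes all signed sums admissible symbols; the resulting factor
  \<open>1 / (4 ^ n)^2\<close> occurs on both sides of the final estimate and cancels. No Hilbert
  space L^2(dv) and no orthogonal projection are built. A Toeplitz operator comes from its
  sesquilinear form by the Riesz theorem, and the component of \<phi> h orthogonal to the Bergman
  space is the function \<open>toeplitz_defect\<close>. Its squared norm is a double integral of
  \<phi> z - \<phi> w against the kernel, which is where slowness enters. The passage from diagonal
  to off-diagonal elements must be uniform in the base point; it therefore uses normal families with
  a common bound in place of the identity theorem for one fixed function.\<close>

definition plane_complex :: "real ^ 2 \<Rightarrow> complex"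
  where "plane_complex x = Complex (x $ 1) (x $ 2)"

definition complex_plane :: "complex \<Rightarrow> real ^ 2"
  where "complex_plane z = (\<chi> i. if i = 1 then Re z else Im z)"

lemma plane_complex_inverse [simp]:
  "plane_complex (complex_plane z) = z" "complex_plane (plane_complex x) = x"
  by (simp_all add: plane_complex_def complex_plane_def vec_eq_iff forall_2)

lemma bounded_linear_plane_complex: "bounded_linear plane_complex"
  unfolding linear_conv_bounded_linear[symmetric]
  by (auto simp: linear_iff plane_complex_def complex_eq_iff)

lemma bounded_linear_complex_plane: "bounded_linear complex_plane"
  unfolding linear_conv_bounded_linear[symmetric]
  by (auto simp: linear_iff complex_plane_def vec_eq_iff)

lemma measurable_plane_complex [measurable]:
  "plane_complex \<in> borel_measurable borel" "complex_plane \<in> borel_measurable borel"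
  by (intro borel_measurable_continuous_onI linear_continuous_on
      bounded_linear_plane_complex bounded_linear_complex_plane)+

text \<open>Transports Lebesgue measure from \<open>real ^ 2\<close>, where the change of variables
  theorem with determinants of matrices lives, to the complex numbers. Both measures give every box
  the product of its side lengths.\<close>

lemma lborel_complex_eq: "(lborel :: complex measure) = distr lborel borel plane_complex"
proof (rule lborel_eqI)
  fix l u :: complex
  assume le: "\<And>b. b \<in> Basis \<Longrightarrow> l \<bullet> b \<le> u \<bullet> b"
  have *: "Re l \<le> Re u" "Im l \<le> Im u"
    using le[of 1] le[of \<i>] by (auto simp: Basis_complex_def)
  have "plane_complex -` box l u = box (complex_plane l) (complex_plane u)"
    by (auto simp: mem_box_cart in_box_complex_iff plane_complex_def complex_plane_def forall_2)
  then have "emeasure (distr lborel borel plane_complex) (box l u) =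
      emeasure lborel (box (complex_plane l) (complex_plane u))"
    by (subst emeasure_distr) auto
  also have "\<dots> = (\<Prod>b\<in>Basis. (complex_plane u - complex_plane l) \<bullet> b)"
    using * by (intro emeasure_lborel_box)
      (auto simp: Basis_vec_def inner_axis complex_plane_def forall_2 UNIV_2)
  also have "(\<Prod>b\<in>Basis. (complex_plane u - complex_plane l) \<bullet> b) = (\<Prod>b\<in>Basis. (u - l) \<bullet> b)"
  proof -
    have B: "(Basis :: (real ^ 2) set) = {axis 1 1, axis 2 (1::real)}" "axis 1 1 \<noteq> (axis 2 1 :: real ^ 2)"
      by (auto simp: Basis_vec_def UNIV_2 axis_eq_axis)
    have "(\<Prod>b\<in>Basis. (complex_plane u - complex_plane l) \<bullet> b) =
        (complex_plane u - complex_plane l) $ 1 * (complex_plane u - complex_plane l) $ 2"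
      unfolding B(1) using B(2) by (simp add: inner_axis)
    then show ?thesis by (simp add: complex_plane_def Basis_complex_def)
  qed
  finally show "emeasure (distr lborel borel plane_complex) (box l u) = (\<Prod>b\<in>Basis. (u - l) \<bullet> b)" .
qed simp

lemma det_complex_mult:
  "det (matrix (\<lambda>x. complex_plane (c * plane_complex x))) = (norm c)\<^sup>2"
  by (simp add: det_2 matrix_def complex_plane_def plane_complex_def axis_def cmod_power2)
    (simp add: power2_eq_square)

text \<open>Conjugation by \<open>plane_complex\<close> turns multiplication by the complex
  derivative into a real matrix with determinant |g' z|^2 (\<open>det_complex_mult\<close>). The
  bounded image has finite measure, so the real area formula can be read as a nonnegative
  integral.\<close>

lemma emeasure_holomorphic_image:
  fixes g :: "complex \<Rightarrow> complex"
  assumes B: "B \<in> sets borel" and gB: "g ` B \<in> sets borel" "bounded (g ` B)"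
    and der: "\<And>z. z \<in> B \<Longrightarrow> (g has_field_derivative g' z) (at z)"
    and inj: "inj_on g B" and g': "g' \<in> borel_measurable borel"
  shows "emeasure lborel (g ` B) = (\<integral>\<^sup>+z. ennreal ((norm (g' z))\<^sup>2) * indicator B z \<partial>lborel)"
proof -
  define G where "G = complex_plane \<circ> g \<circ> plane_complex"
  define S where "S = plane_complex -` B"
  have S: "S \<in> sets borel" unfolding S_def using measurable_sets[OF measurable_plane_complex(1) B] by simp
  \<comment> \<open>Rewriting the image as a preimage under the measurable map
    \<open>plane_complex\<close> reduces its measurability to that of the image of B under
    g.\<close>
  have im: "G ` S = plane_complex -` (g ` B)"
    unfolding G_def S_def
    by (auto simp: image_iff) (metis plane_complex_inverse vimage_eq)
  have meas: "plane_complex -` (g ` B) \<in> sets borel"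
    using measurable_sets[OF measurable_plane_complex(1) gB(1)] by simp
  have bdd: "bounded (plane_complex -` (g ` B))"
  proof -
    have "plane_complex -` (g ` B) = complex_plane ` (g ` B)"
      by (auto simp: image_iff) (metis plane_complex_inverse)+
    then show ?thesis using bounded_linear_image[OF gB(2) bounded_linear_complex_plane] by simp
  qed
  have lm: "G ` S \<in> lmeasurable"
    unfolding im using bdd meas by (simp add: bounded_set_imp_lmeasurable)
  have "(G has_derivative (\<lambda>x. complex_plane (g' (plane_complex p) * plane_complex x))) (at p within S)"
    if "p \<in> S" for p
  proof -
    have "(g has_derivative (*) (g' (plane_complex p))) (at (plane_complex p))"
      using der[of "plane_complex p"] that by (simp add: S_def has_field_derivative_def)
    then have "((\<lambda>x. complex_plane (g (plane_complex x))) has_derivative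
        (\<lambda>x. complex_plane (g' (plane_complex p) * plane_complex x))) (at p)"
      by (intro bounded_linear.has_derivative[OF bounded_linear_complex_plane]
          has_derivative_compose[of plane_complex, where g = g]
          bounded_linear_imp_has_derivative bounded_linear_plane_complex) 
    then show ?thesis unfolding G_def o_def by (rule has_derivative_at_withinI)
  qed
  moreover have "inj_on G S"
    using inj unfolding inj_on_def G_def S_def by (metis comp_apply plane_complex_inverse vimage_eq)
  ultimately have "((\<lambda>x. \<bar>det (matrix (\<lambda>y. complex_plane (g' (plane_complex x) * plane_complex y)))\<bar>)
      has_integral measure lebesgue (G ` S)) S"
    using has_measure_differentiable_image[of S G
        "\<lambda>p x. complex_plane (g' (plane_complex p) * plane_complex x)" "measure lebesgue (G ` S)"]
      S lm by auto
  then have int: "((\<lambda>x. (norm (g' (plane_complex x)))\<^sup>2) has_integral measure lebesgue (G ` S)) S"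
    by (simp add: det_complex_mult)
  have "(\<integral>\<^sup>+z. ennreal ((norm (g' z))\<^sup>2) * indicator B z \<partial>lborel) =
      (\<integral>\<^sup>+x. ennreal ((norm (g' (plane_complex x)))\<^sup>2) * indicator B (plane_complex x) \<partial>lborel)"
    by (subst lborel_complex_eq, subst nn_integral_distr) (use g' B in auto)
  also have "\<dots> = (\<integral>\<^sup>+x. ennreal ((norm (g' (plane_complex x)))\<^sup>2) * indicator S x \<partial>lborel)"
    by (simp add: S_def indicator_def)
  also have "\<dots> = ennreal (measure lebesgue (G ` S))"
    by (rule nn_integral_has_integral_lebesgue'[OF _ int]) simp
  also have "\<dots> = emeasure lebesgue (G ` S)"
    using lm by (simp add: emeasure_eq_measure2)
  also have "\<dots> = emeasure lborel (plane_complex -` (g ` B))"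
    unfolding im using meas by simp
  also have "\<dots> = emeasure lborel (g ` B)"
    by (subst lborel_complex_eq, subst emeasure_distr) (use gB in auto)
  finally show ?thesis by simp
qed

section \<open>Normalized area on the disc\<close>

definition disc_measure :: "complex measure"
  where "disc_measure = uniform_measure lborel (ball 0 1)"

lemma sets_disc_measure [simp, measurable_cong]: "sets disc_measure = sets borel"
  by (simp add: disc_measure_def)

lemma space_disc_measure [simp]: "space disc_measure = UNIV"
  by (simp add: disc_measure_def)

lemma emeasure_unit_disc: "emeasure lborel (ball (0::complex) 1) = ennreal pi"
  by (simp add: emeasure_ball unit_ball_vol_def) (simp add: Gamma_numeral)

lemma nn_integral_disc_measure:
  "f \<in> borel_measurable borel \<Longrightarrow>
    (\<integral>\<^sup>+z. f z \<partial>disc_measure) = (\<integral>\<^sup>+z. f z * indicator (ball 0 1) z \<partial>lborel) / ennreal pi"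
  unfolding disc_measure_def by (subst nn_integral_uniform_measure) (auto simp: emeasure_unit_disc)

lemma AE_disc_measure: "AE z in disc_measure. norm z < 1"
  unfolding disc_measure_def by (subst AE_uniform_measure) (simp_all add: emeasure_unit_disc)

lemma emeasure_disc_measure:
  "B \<in> sets borel \<Longrightarrow> emeasure disc_measure B = emeasure lborel (B \<inter> ball 0 1) / ennreal pi"
  unfolding disc_measure_def
  by (subst emeasure_uniform_measure) (simp_all add: emeasure_unit_disc Int_commute)

lemma finite_measure_disc_measure: "finite_measure disc_measure"
  by (rule finite_measureI)
    (simp add: emeasure_disc_measure emeasure_unit_disc divide_ennreal)

text \<open>Stated as an equality of measures, so that nonnegative integrals, integrability and
  Bochner integrals all change variables through the rules for \<open>distr\<close> and
  \<open>density\<close>. The preimage of B in the disc is mapped by g bijectively onto the part of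
  B in the disc, and the area formula applies.\<close>

lemma disc_change_of_variables:
  assumes g [measurable]: "g \<in> borel_measurable borel" "g' \<in> borel_measurable borel"
    and der: "\<And>z. norm z < 1 \<Longrightarrow> (g has_field_derivative g' z) (at z)"
    and inj: "inj_on g (ball 0 1)" and im: "g ` ball 0 1 = ball 0 1"
  shows "distr (density disc_measure (\<lambda>z. ennreal ((norm (g' z))\<^sup>2))) borel g = disc_measure"
proof (rule measure_eqI)
  fix B assume "B \<in> sets (distr (density disc_measure (\<lambda>z. ennreal ((norm (g' z))\<^sup>2))) borel g)"
  then have B [measurable]: "B \<in> sets borel" by simp
  define B0 where "B0 = g -` B \<inter> ball 0 1"
  have [measurable]: "g -` B \<in> sets borel" using measurable_sets[OF g(1) B] by simp
  have B0: "B0 \<in> sets borel" by (simp add: B0_def)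
  have gB0: "g ` B0 = B \<inter> ball 0 1"
  proof -
    have "g ` B0 = B \<inter> g ` ball 0 1" unfolding B0_def by blast
    then show ?thesis unfolding im .
  qed
  have "emeasure (distr (density disc_measure (\<lambda>z. ennreal ((norm (g' z))\<^sup>2))) borel g) B =
      (\<integral>\<^sup>+z. ennreal ((norm (g' z))\<^sup>2) * indicator (g -` B) z \<partial>disc_measure)"
    by (subst emeasure_distr) (auto simp: emeasure_density)
  also have "\<dots> = (\<integral>\<^sup>+z. ennreal ((norm (g' z))\<^sup>2) * indicator B0 z \<partial>lborel) / ennreal pi"
    by (subst nn_integral_disc_measure) (auto simp: B0_def indicator_inter_arith mult.assoc)
  also have "(\<integral>\<^sup>+z. ennreal ((norm (g' z))\<^sup>2) * indicator B0 z \<partial>lborel) = emeasure lborel (g ` B0)"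
    by (rule emeasure_holomorphic_image[symmetric])
      (use B0 gB0 der inj_on_subset[OF inj] bounded_subset[OF bounded_ball] in \<open>auto simp: B0_def\<close>)
  also have "emeasure lborel (g ` B0) / ennreal pi = emeasure disc_measure B"
    unfolding gB0 by (simp add: emeasure_disc_measure)
  finally show "emeasure (distr (density disc_measure (\<lambda>z. ennreal ((norm (g' z))\<^sup>2))) borel g) B
      = emeasure disc_measure B" .
qed simp

section \<open>Moebius automorphisms of the disc\<close>

lemma norm_diff_sq_mobius:
  "(norm (1 - v * cnj u))\<^sup>2 - (norm (u - v))\<^sup>2 = (1 - (norm u)\<^sup>2) * (1 - (norm v)\<^sup>2)"
  unfolding cmod_power2 by (simp add: algebra_simps power2_eq_square)

lemma one_minus_mult_cnj_nz: "norm u < 1 \<Longrightarrow> norm v < 1 \<Longrightarrow> 1 - v * cnj u \<noteq> 0"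
proof -
  assume *: "norm u < 1" "norm v < 1"
  have "norm (v * cnj u) < 1"
    using mult_strict_mono'[OF *(2,1)] by (simp add: norm_mult)
  then show ?thesis by auto
qed

lemma norm_less_one_sq_pos: "norm (u::complex) < 1 \<Longrightarrow> 1 - (norm u)\<^sup>2 > 0"
  by (simp add: abs_square_less_1)

lemma one_minus_norm_mobius_sq:
  assumes "norm u < 1" "norm v < 1"
  shows "1 - (norm (mobius u v))\<^sup>2 =
    (1 - (norm u)\<^sup>2) * (1 - (norm v)\<^sup>2) / (norm (1 - v * cnj u))\<^sup>2"
proof -
  have "norm (1 - v * cnj u) \<noteq> 0" using one_minus_mult_cnj_nz[OF assms] by simp
  then show ?thesis
    unfolding norm_diff_sq_mobius[symmetric] mobius_def norm_divide
    by (simp add: power_divide diff_divide_distrib)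
qed

lemma norm_mobius_less_one:
  assumes "norm u < 1" "norm v < 1"
  shows "norm (mobius u v) < 1"
proof -
  have "1 - (norm (mobius u v))\<^sup>2 > 0"
    unfolding one_minus_norm_mobius_sq[OF assms]
    using assms norm_less_one_sq_pos one_minus_mult_cnj_nz[OF assms] by simp
  then show ?thesis by (simp add: abs_square_less_1)
qed

lemma norm_mobius_commute: "norm (mobius u v) = norm (mobius v u)"
proof -
  have "norm (1 - v * cnj u) = norm (cnj (1 - v * cnj u))" by (simp only: complex_mod_cnj)
  then show ?thesis by (simp add: mobius_def norm_divide norm_minus_commute mult.commute)
qed

lemma of_real_norm_sq: "(complex_of_real (norm u))\<^sup>2 = u * cnj u"
  by (simp add: complex_norm_square flip: of_real_power)

lemma one_minus_mobius_cnj: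
  assumes "norm u < 1" "norm v < 1"
  shows "1 - mobius u v * cnj u = of_real (1 - (norm u)\<^sup>2) / (1 - v * cnj u)"
  using one_minus_mult_cnj_nz[OF assms]
  by (simp add: mobius_def of_real_norm_sq) (simp add: field_simps)

text \<open>With the sign convention u - v the automorphism exchanging 0 and u is an involution. The
  same map thus moves u to the centre and back, and its bijectivity on the disc follows at
  once.\<close>

lemma mobius_mobius [simp]:
  assumes "norm u < 1" "norm v < 1"
  shows "mobius u (mobius u v) = v"
proof -
  have nz: "1 - v * cnj u \<noteq> 0" by (rule one_minus_mult_cnj_nz[OF assms])
  have nz': "complex_of_real (1 - (norm u)\<^sup>2) \<noteq> 0"
    using norm_less_one_sq_pos[OF assms(1)] by (simp only: of_real_eq_0_iff)
  have "u - mobius u v = v * of_real (1 - (norm u)\<^sup>2) / (1 - v * cnj u)"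
    using nz by (simp add: mobius_def of_real_norm_sq) (simp add: field_simps)
  then have "mobius u (mobius u v) = (v * of_real (1 - (norm u)\<^sup>2) / (1 - v * cnj u)) /
      (of_real (1 - (norm u)\<^sup>2) / (1 - v * cnj u))"
    by (subst mobius_def) (simp add: one_minus_mobius_cnj[OF assms])
  then show ?thesis using nz nz' by simp
qed

lemma mobius_zero [simp]: "mobius u 0 = u"
  by (simp add: mobius_def)

lemma mobius_image_disc: "norm u < 1 \<Longrightarrow> mobius u ` ball 0 1 = ball 0 1"
  by (auto simp: image_iff norm_mobius_less_one) (metis mem_ball_0 mobius_mobius norm_mobius_less_one)

lemma inj_on_mobius: "norm u < 1 \<Longrightarrow> inj_on (mobius u) (ball 0 1)"
  by (rule inj_on_inverseI[where g = "mobius u"]) simp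

lemma measurable_mobius [measurable]:
  "f \<in> borel_measurable M \<Longrightarrow> g \<in> borel_measurable M \<Longrightarrow> (\<lambda>x. mobius (f x) (g x)) \<in> borel_measurable M"
  unfolding mobius_def
  by (intro borel_measurable_divide borel_measurable_diff borel_measurable_times borel_measurable_const
      measurable_compose[of f, OF _ borel_measurable_continuous_onI[OF continuous_on_cnj[OF continuous_on_id]]])

lemma has_field_derivative_mobius:
  assumes "norm u < 1" "norm v < 1"
  shows "(mobius u has_field_derivative - of_real (1 - (norm u)\<^sup>2) / (1 - v * cnj u)\<^sup>2) (at v)"
proof -
  have nz: "1 - v * cnj u \<noteq> 0" by (rule one_minus_mult_cnj_nz[OF assms])
  have "((\<lambda>v. u - v) has_field_derivative 0 - 1) (at v)"
    by (intro DERIV_diff DERIV_const DERIV_ident)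
  moreover have "((\<lambda>v. 1 - v * cnj u) has_field_derivative 0 - 1 * cnj u) (at v)"
    by (intro DERIV_diff DERIV_const DERIV_cmult_right DERIV_ident)
  ultimately have "((\<lambda>v. (u - v) / (1 - v * cnj u)) has_field_derivative
      ((0 - 1) * (1 - v * cnj u) - (u - v) * (0 - 1 * cnj u)) / ((1 - v * cnj u) * (1 - v * cnj u))) (at v)"
    by (rule DERIV_divide) (rule nz)
  moreover have "(0 - 1) * (1 - v * cnj u) - (u - v) * (0 - 1 * cnj u) = - of_real (1 - (norm u)\<^sup>2)"
    by (simp add: of_real_norm_sq algebra_simps)
  ultimately show ?thesis
    unfolding mobius_def[abs_def] power2_eq_square[of "1 - v * cnj u"] by (simp only:)
qed

lemma holomorphic_on_mobius: "norm u < 1 \<Longrightarrow> mobius u holomorphic_on ball 0 1"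
  by (rule holomorphic_onI) (auto simp: field_differentiable_def
      intro!: exI has_field_derivative_at_within[OF has_field_derivative_mobius])

text \<open>The squared modulus of the derivative of \<open>mobius u\<close>, hence its real
  Jacobian. It is also the squared modulus of the normalized kernel of the disc at u.\<close>

definition mobius_jac :: "complex \<Rightarrow> complex \<Rightarrow> real"
  where "mobius_jac u v = (1 - (norm u)\<^sup>2)\<^sup>2 / (norm (1 - v * cnj u)) ^ 4"

lemma mobius_jac_nonneg: "mobius_jac u v \<ge> 0"
  by (simp add: mobius_jac_def)

lemma measurable_mobius_jac [measurable]: "mobius_jac u \<in> borel_measurable borel"
  unfolding mobius_jac_def by measurable

text \<open>The chain rule applied to \<open>mobius u\<close> composed with itself.\<close>

lemma mobius_jac_mobius:
  assumes "norm u < 1" "norm v < 1"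
  shows "mobius_jac u v * mobius_jac u (mobius u v) = 1"
proof -
  have nz: "norm (1 - v * cnj u) \<noteq> 0" "1 - (norm u)\<^sup>2 \<noteq> 0"
    using one_minus_mult_cnj_nz[OF assms] norm_less_one_sq_pos[OF assms(1)] by auto
  have "norm (1 - mobius u v * cnj u) = (1 - (norm u)\<^sup>2) / norm (1 - v * cnj u)"
    unfolding one_minus_mobius_cnj[OF assms] norm_divide
    using norm_less_one_sq_pos[OF assms(1)] by (simp del: of_real_diff)
  moreover have "x\<^sup>2 / y ^ 4 * (x\<^sup>2 / (x / y) ^ 4) = 1" if "y \<noteq> 0" "x \<noteq> 0" for x y :: real
    using that by (simp add: field_simps)
  ultimately show ?thesis
    using nz by (simp only: mobius_jac_def)
qed

lemma disc_mobius_distr: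
  assumes "norm u < 1"
  shows "distr (density disc_measure (\<lambda>v. ennreal (mobius_jac u v))) borel (mobius u) = disc_measure"
proof -
  have "norm (- complex_of_real (1 - (norm u)\<^sup>2) / (1 - v * cnj u)\<^sup>2) ^ 2 = mobius_jac u v" for v
    unfolding mobius_jac_def norm_divide norm_power norm_minus_cancel norm_of_real power_divide
      power2_abs power_mult[symmetric] by simp
  moreover have "distr (density disc_measure
      (\<lambda>v. ennreal ((norm (- complex_of_real (1 - (norm u)\<^sup>2) / (1 - v * cnj u)\<^sup>2))\<^sup>2))) borel (mobius u) =
      disc_measure"
  proof (rule disc_change_of_variables)
    show "(\<lambda>v. - complex_of_real (1 - (norm u)\<^sup>2) / (1 - v * cnj u)\<^sup>2) \<in> borel_measurable borel"
      by measurable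
  qed (measurable, fact has_field_derivative_mobius[OF assms], fact inj_on_mobius[OF assms],
      fact mobius_image_disc[OF assms])
  ultimately show ?thesis by (simp only:)
qed

lemma nn_integral_disc_mobius:
  assumes "norm u < 1" and [measurable]: "f \<in> borel_measurable borel"
  shows "(\<integral>\<^sup>+w. f w \<partial>disc_measure) = (\<integral>\<^sup>+v. ennreal (mobius_jac u v) * f (mobius u v) \<partial>disc_measure)"
proof -
  have "(\<integral>\<^sup>+w. f w \<partial>disc_measure) =
      (\<integral>\<^sup>+w. f w \<partial>distr (density disc_measure (\<lambda>v. ennreal (mobius_jac u v))) borel (mobius u))"
    by (simp only: disc_mobius_distr[OF assms(1)])
  then show ?thesis by (simp add: nn_integral_distr nn_integral_density)
qed

lemma integrable_disc_mobius:
  fixes f :: "complex \<Rightarrow> 'b::{banach,second_countable_topology}"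
  assumes "norm u < 1" and [measurable]: "f \<in> borel_measurable borel"
  shows "integrable disc_measure f \<longleftrightarrow> integrable disc_measure (\<lambda>v. mobius_jac u v *\<^sub>R f (mobius u v))"
proof -
  have "integrable disc_measure f \<longleftrightarrow>
      integrable (distr (density disc_measure (\<lambda>v. ennreal (mobius_jac u v))) borel (mobius u)) f"
    by (simp only: disc_mobius_distr[OF assms(1)])
  then show ?thesis by (simp add: integrable_distr_eq integrable_density mobius_jac_nonneg)
qed

lemma integral_disc_mobius:
  fixes f :: "complex \<Rightarrow> 'b::{banach,second_countable_topology}"
  assumes "norm u < 1" and [measurable]: "f \<in> borel_measurable borel"
  shows "(\<integral>w. f w \<partial>disc_measure) = (\<integral>v. mobius_jac u v *\<^sub>R f (mobius u v) \<partial>disc_measure)"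
proof -
  have "(\<integral>w. f w \<partial>disc_measure) =
      (\<integral>w. f w \<partial>distr (density disc_measure (\<lambda>v. ennreal (mobius_jac u v))) borel (mobius u))"
    by (simp only: disc_mobius_distr[OF assms(1)])
  then show ?thesis by (simp add: integral_distr integral_density mobius_jac_nonneg)
qed

section \<open>Rotations and mean value properties\<close>

lemma disc_rotation_distr:
  assumes "norm c = 1"
  shows "distr disc_measure borel ((*) c) = disc_measure"
proof -
  have "c \<noteq> 0" using assms by auto
  have "distr (density disc_measure (\<lambda>v. ennreal ((norm c)\<^sup>2))) borel ((*) c) = disc_measure"
  proof (rule disc_change_of_variables)
    show "((*) c has_field_derivative c) (at z)" for z
      by (rule derivative_eq_intros refl | simp)+
    show "(*) c ` ball 0 1 = ball 0 1"
    proof (intro equalityI subsetI)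
      fix z assume "z \<in> ball (0::complex) 1"
      then have "z = c * (z / c)" "z / c \<in> ball 0 1"
        using \<open>c \<noteq> 0\<close> assms by (auto simp: norm_divide)
      then show "z \<in> (*) c ` ball 0 1" by blast
    qed (use assms in \<open>auto simp: norm_mult\<close>)
  qed (use \<open>c \<noteq> 0\<close> in \<open>auto simp: inj_on_def\<close>)
  then show ?thesis using assms by (simp add: density_1)
qed

lemma integral_disc_rotation:
  fixes f :: "complex \<Rightarrow> 'b::{banach,second_countable_topology}"
  assumes "norm c = 1" and [measurable]: "f \<in> borel_measurable borel"
  shows "(\<integral>v. f (c * v) \<partial>disc_measure) = (\<integral>v. f v \<partial>disc_measure)"
proof -
  have "(\<integral>v. f v \<partial>disc_measure) = (\<integral>v. f v \<partial>distr disc_measure borel ((*) c))"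
    by (simp only: disc_rotation_distr[OF assms(1)])
  then show ?thesis by (simp add: integral_distr)
qed

lemma integrable_disc_rotation:
  fixes f :: "complex \<Rightarrow> 'b::{banach,second_countable_topology}"
  assumes "norm c = 1" and [measurable]: "f \<in> borel_measurable borel"
  shows "integrable disc_measure (\<lambda>v. f (c * v)) \<longleftrightarrow> integrable disc_measure f"
proof -
  have "integrable disc_measure f \<longleftrightarrow> integrable (distr disc_measure borel ((*) c)) f"
    by (simp only: disc_rotation_distr[OF assms(1)])
  then show ?thesis by (simp add: integrable_distr_eq)
qed

text \<open>Cauchy's formula at the centre of the unit circle, applied to f (z * v) as a function of
  z. Dilating by v instead of shrinking the circle covers v = 0 as well.\<close>

lemma circle_mean_value:
  assumes f: "f holomorphic_on ball 0 1" and v: "norm v < 1"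
  shows "set_integrable lborel {0..1} (\<lambda>t. f (cis (2 * pi * t) * v))"
    and "(LINT t:{0..1}|lborel. f (cis (2 * pi * t) * v)) = f 0"
proof -
  have hol: "(\<lambda>z. f (z * v)) holomorphic_on cball 0 1"
  proof -
    have "(\<lambda>z. z * v) ` cball 0 1 \<subseteq> ball 0 1"
    proof safe
      fix z :: complex assume "z \<in> cball 0 1"
      then have "norm z * norm v \<le> 1 * norm v" by (intro mult_right_mono) auto
      then show "z * v \<in> ball 0 1" using v by (simp add: norm_mult)
    qed
    then show ?thesis
      using holomorphic_on_compose_gen[of "\<lambda>z. z * v" "cball 0 1" f "ball 0 1"] f
        holomorphic_on_mult[OF holomorphic_on_ident holomorphic_on_const]
      by (auto simp: o_def)
  qed
  have "((\<lambda>u. f (u * v) / (u - 0)) has_contour_integral 2 * of_real pi * \<i> * f (0 * v)) (circlepath 0 1)"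
    by (rule Cauchy_integral_circlepath_simple[OF hol]) simp
  then have "((\<lambda>t. f (circlepath 0 1 t * v) / circlepath 0 1 t *
      vector_derivative (circlepath 0 1) (at t within {0..1})) has_integral 2 * of_real pi * \<i> * f 0) {0..1}"
    by (simp add: has_contour_integral_def)
  then have "((\<lambda>t. (2 * of_real pi * \<i>) * f (cis (2 * pi * t) * v)) has_integral 2 * of_real pi * \<i> * f 0) {0..1}"
  proof (rule has_integral_eq[rotated])
    fix t :: real assume t: "t \<in> {0..1}"
    have "circlepath 0 1 t = cis (2 * pi * t)"
      by (simp add: circlepath cis_conv_exp mult_ac)
    moreover have "vector_derivative (circlepath 0 1) (at t within {0..1}) = 2 * of_real pi * \<i> * cis (2 * pi * t)"
      using t vector_derivative_circlepath01[of t 0 1] by (simp add: cis_conv_exp mult_ac)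
    ultimately show "f (circlepath 0 1 t * v) / circlepath 0 1 t *
      vector_derivative (circlepath 0 1) (at t within {0..1}) = (2 * of_real pi * \<i>) * f (cis (2 * pi * t) * v)"
      by simp
  qed
  from has_integral_mult_right[OF this, of "inverse (2 * of_real pi * \<i>)"]
  have int: "((\<lambda>t. f (cis (2 * pi * t) * v)) has_integral f 0) {0..1}"
    by (simp add: field_simps)
  have "continuous_on {0..1} (\<lambda>t::real. f (cis (2 * pi * t) * v))"
  proof (rule continuous_on_compose2[OF holomorphic_on_imp_continuous_on[OF f]])
    show "continuous_on {0..1} (\<lambda>t::real. cis (2 * pi * t) * v)"
      unfolding cis_conv_exp by (intro continuous_intros)
    show "(\<lambda>t::real. cis (2 * pi * t) * v) ` {0..1} \<subseteq> ball 0 1" using v by (auto simp: norm_mult)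
  qed
  then show si: "set_integrable lborel {0..1} (\<lambda>t. f (cis (2 * pi * t) * v))"
    by (rule borel_integrable_atLeastAtMost')
  show "(LINT t:{0..1}|lborel. f (cis (2 * pi * t) * v)) = f 0"
    using set_borel_integral_eq_integral(2)[OF si] int by (simp add: integral_unique)
qed

text \<open>A radial weight makes the integral invariant under rotations of f. Averaging over all
  rotations and exchanging the integrals leaves the circle averages of f, which equal f 0.\<close>

lemma radial_mean_value:
  fixes f :: "complex \<Rightarrow> complex" and F :: "real \<Rightarrow> real"
  assumes f: "f holomorphic_on ball 0 1" and [measurable]: "f \<in> borel_measurable borel"
    and [measurable]: "F \<in> borel_measurable borel"
    and int: "integrable disc_measure (\<lambda>v. F (norm v) *\<^sub>R f v)"
  shows "(\<integral>v. F (norm v) *\<^sub>R f v \<partial>disc_measure) = (\<integral>v. F (norm v) *\<^sub>R f 0 \<partial>disc_measure)"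
proof -
  have [measurable]: "cis \<in> borel_measurable borel"
    unfolding cis_conv_exp by measurable
  interpret disc: finite_measure disc_measure by (rule finite_measure_disc_measure)
  interpret pair: pair_sigma_finite lborel disc_measure by standard
  define g where "g t v = indicator {0..1::real} t *\<^sub>R (F (norm v) *\<^sub>R f (cis (2 * pi * t) * v))" for t v
  have rot: "integrable disc_measure (\<lambda>v. F (norm v) *\<^sub>R f (cis a * v))"
    "(\<integral>v. F (norm v) *\<^sub>R f (cis a * v) \<partial>disc_measure) = (\<integral>v. F (norm v) *\<^sub>R f v \<partial>disc_measure)"
    "(\<integral>v. norm (F (norm v) *\<^sub>R f (cis a * v)) \<partial>disc_measure) = (\<integral>v. norm (F (norm v) *\<^sub>R f v) \<partial>disc_measure)" for a
    using integrable_disc_rotation[of "cis a" "\<lambda>v. F (norm v) *\<^sub>R f v"] int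
      integral_disc_rotation[of "cis a" "\<lambda>v. F (norm v) *\<^sub>R f v"]
      integral_disc_rotation[of "cis a" "\<lambda>v. norm (F (norm v) *\<^sub>R f v)"]
    by (simp_all add: norm_mult)
  \<comment> \<open>Rotation invariance makes the integral of the norm over v the same for all t in
    the unit interval, so the iterated norm integral is finite.\<close>
  have "integrable (lborel \<Otimes>\<^sub>M disc_measure) (\<lambda>(t, v). g t v)"
  proof (rule pair.Fubini_integrable)
    show "(\<lambda>(t, v). g t v) \<in> borel_measurable (lborel \<Otimes>\<^sub>M disc_measure)"
      unfolding g_def by measurable
    have "(\<integral>v. norm (g t v) \<partial>disc_measure) = indicator {0..1} t *\<^sub>R (\<integral>v. norm (F (norm v) *\<^sub>R f v) \<partial>disc_measure)" for t
      unfolding g_def using rot(3)[of "2 * pi * t"] by (simp add: indicator_def)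
    then show "integrable lborel (\<lambda>x. \<integral>y. norm (case (x, y) of (t, v) \<Rightarrow> g t v) \<partial>disc_measure)"
      by (simp add: integrable_mult_left_iff)
    show "AE x in lborel. integrable disc_measure (\<lambda>y. case (x, y) of (t, v) \<Rightarrow> g t v)"
      unfolding g_def using rot(1) by (simp add: integrable_scaleR_right del: scaleR_scaleR)
  qed
  then have "(\<integral>v. (\<integral>t. g t v \<partial>lborel) \<partial>disc_measure) = (\<integral>t. (\<integral>v. g t v \<partial>disc_measure) \<partial>lborel)"
    by (rule pair.Fubini_integral)
  also have "\<dots> = (\<integral>t. indicator {0..1::real} t *\<^sub>R (\<integral>v. F (norm v) *\<^sub>R f v \<partial>disc_measure) \<partial>lborel)"
    unfolding g_def integral_scaleR_right rot(2) ..
  also have "\<dots> = (\<integral>v. F (norm v) *\<^sub>R f v \<partial>disc_measure)" by simp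
  finally have "(\<integral>v. F (norm v) *\<^sub>R f v \<partial>disc_measure) = (\<integral>v. (\<integral>t. g t v \<partial>lborel) \<partial>disc_measure)" ..
  also have "\<dots> = (\<integral>v. F (norm v) *\<^sub>R f 0 \<partial>disc_measure)"
  proof (rule integral_cong_AE)
    show "(\<lambda>v. \<integral>t. g t v \<partial>lborel) \<in> borel_measurable disc_measure"
      unfolding g_def by measurable
    show "AE v in disc_measure. (\<integral>t. g t v \<partial>lborel) = F (norm v) *\<^sub>R f 0"
      using AE_disc_measure
    proof eventually_elim
      case (elim v)
      have "(\<integral>t. g t v \<partial>lborel) = (\<integral>t. F (norm v) *\<^sub>R (indicator {0..1::real} t *\<^sub>R f (cis (2 * pi * t) * v)) \<partial>lborel)"
        unfolding g_def by (simp only: scaleR_left_commute)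
      also have "\<dots> = F (norm v) *\<^sub>R (LINT t:{0..1}|lborel. f (cis (2 * pi * t) * v))"
        unfolding set_lebesgue_integral_def integral_scaleR_right ..
      finally show ?case using circle_mean_value(2)[OF f elim] by simp
    qed
  qed measurable
  finally show ?thesis .
qed

lemma measure_disc_UNIV [simp]: "measure disc_measure UNIV = 1"
  and integral_disc_const: "(\<integral>v. c \<partial>disc_measure) = (c :: 'a :: {banach, second_countable_topology})"
  and integrable_disc_const: "integrable disc_measure (\<lambda>v. c)"
proof -
  have "emeasure disc_measure UNIV = 1"
    by (simp add: emeasure_disc_measure emeasure_unit_disc divide_ennreal)
  then show m: "measure disc_measure UNIV = 1" by (simp add: measure_def)
  then show "(\<integral>v. c \<partial>disc_measure) = c" by simp
  show "integrable disc_measure (\<lambda>v. c)"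
    by (rule finite_measure.integrable_const[OF finite_measure_disc_measure])
qed

text \<open>The radial mean value property transported by \<open>mobius u\<close>, whose Jacobians
  cancel by \<open>mobius_jac_mobius\<close>. With F = 1 it becomes the reproducing formula; with F
  an indicator it yields submean inequalities on pseudohyperbolic discs.\<close>

lemma radial_mobius_mean_value:
  fixes g :: "complex \<Rightarrow> complex" and F :: "real \<Rightarrow> real"
  assumes u: "norm u < 1" and g: "g holomorphic_on ball 0 1" and [measurable]: "g \<in> borel_measurable borel"
    and [measurable]: "F \<in> borel_measurable borel"
    and int: "integrable disc_measure (\<lambda>w. (F (norm (mobius u w)) * mobius_jac u w) *\<^sub>R g w)"
  shows "(\<integral>w. (F (norm (mobius u w)) * mobius_jac u w) *\<^sub>R g w \<partial>disc_measure) =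
    (\<integral>v. F (norm v) \<partial>disc_measure) *\<^sub>R g u"
proof -
  have eq: "AE v in disc_measure. mobius_jac u v *\<^sub>R
      ((F (norm (mobius u (mobius u v))) * mobius_jac u (mobius u v)) *\<^sub>R g (mobius u v)) =
      F (norm v) *\<^sub>R g (mobius u v)"
    using AE_disc_measure
  proof eventually_elim
    case (elim v)
    then show ?case
      using mobius_jac_mobius[OF u elim] u by (simp add: mult_ac)
  qed
  have "integrable disc_measure (\<lambda>v. F (norm v) *\<^sub>R g (mobius u v))"
    using int by (subst (asm) integrable_disc_mobius[OF u]) (auto intro: integrable_cong_AE_imp[OF _ _ eq])
  moreover have "(\<lambda>v. g (mobius u v)) holomorphic_on ball 0 1"
    using holomorphic_on_compose_gen[OF holomorphic_on_mobius[OF u] g] u mobius_image_disc[OF u]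
    by (simp add: o_def)
  ultimately have "(\<integral>v. F (norm v) *\<^sub>R g (mobius u v) \<partial>disc_measure) = (\<integral>v. F (norm v) *\<^sub>R g (mobius u 0) \<partial>disc_measure)"
    by (intro radial_mean_value[where f = "\<lambda>v. g (mobius u v)"]) measurable
  also have "\<dots> = (\<integral>v. F (norm v) \<partial>disc_measure) *\<^sub>R g u"
    unfolding scaleR_conv_of_real mobius_zero by simp
  also have "(\<integral>v. F (norm v) *\<^sub>R g (mobius u v) \<partial>disc_measure) =
      (\<integral>w. (F (norm (mobius u w)) * mobius_jac u w) *\<^sub>R g w \<partial>disc_measure)"
  proof -
    have "(\<integral>w. (F (norm (mobius u w)) * mobius_jac u w) *\<^sub>R g w \<partial>disc_measure) =
      (\<integral>v. mobius_jac u v *\<^sub>R ((F (norm (mobius u (mobius u v))) * mobius_jac u (mobius u v)) *\<^sub>R g (mobius u v)) \<partial>disc_measure)"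
      by (rule integral_disc_mobius[OF u]) measurable
    also have "\<dots> = (\<integral>v. F (norm v) *\<^sub>R g (mobius u v) \<partial>disc_measure)"
      by (rule integral_cong_AE[OF _ _ eq]) measurable
    finally show ?thesis ..
  qed
  finally show ?thesis .
qed

lemma measurable_cnj [measurable]: "cnj \<in> borel_measurable borel"
  by (rule borel_measurable_continuous_onI[OF continuous_on_cnj[OF continuous_on_id]])

text \<open>Half of the factor |1 - w cnj z|^(-4) of the Jacobian is absorbed into a holomorphic
  function: for the auxiliary function \<open>g\<close> the product of the Jacobian and g is f times
  the conjugate kernel, and g z = f z. The mean value property with F = 1 then gives the value at
  z.\<close>

lemma disc_reproducing:
  fixes f :: "complex \<Rightarrow> complex"
  assumes z: "norm z < 1" and f: "f holomorphic_on ball 0 1" and [measurable]: "f \<in> borel_measurable borel"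
    and int: "integrable disc_measure (\<lambda>w. f w * (1 / (1 - z * cnj w)\<^sup>2))"
  shows "(\<integral>w. f w * (1 / (1 - z * cnj w)\<^sup>2) \<partial>disc_measure) = f z"
proof -
  define g where "g w = f w * (1 - w * cnj z)\<^sup>2 / of_real ((1 - (norm z)\<^sup>2)\<^sup>2)" for w
  have nz: "complex_of_real (1 - (norm z)\<^sup>2) \<noteq> 0"
    using norm_less_one_sq_pos[OF z] by (simp only: of_real_eq_0_iff)
  have eq: "AE w in disc_measure. f w * (1 / (1 - z * cnj w)\<^sup>2) =
      ((\<lambda>_. 1) (norm (mobius z w)) * mobius_jac z w) *\<^sub>R g w"
    using AE_disc_measure
  proof eventually_elim
    case (elim w)
    define b where "b = 1 - w * cnj z"
    have b: "b \<noteq> 0" unfolding b_def by (rule one_minus_mult_cnj_nz[OF z elim])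
    have "1 - z * cnj w = cnj b" by (simp add: b_def)
    moreover have "complex_of_real ((norm b) ^ 4) = (b * cnj b)\<^sup>2"
    proof -
      have "complex_of_real ((norm b) ^ 4) = ((complex_of_real (norm b))\<^sup>2)\<^sup>2"
        by (simp flip: power_mult)
      then show ?thesis by (simp only: of_real_norm_sq)
    qed
    moreover have "of_real ((1 - (norm z)\<^sup>2)\<^sup>2) / x * (y / of_real ((1 - (norm z)\<^sup>2)\<^sup>2)) = y / x" for x y :: complex
      using nz by simp
    ultimately show ?case
      using b unfolding g_def scaleR_conv_of_real mobius_jac_def b_def[symmetric]
      by (simp del: of_real_power of_real_diff add: of_real_divide) (simp add: field_simps power2_eq_square)
  qed
  have [measurable]: "g \<in> borel_measurable borel" unfolding g_def by measurable
  have "(\<integral>w. f w * (1 / (1 - z * cnj w)\<^sup>2) \<partial>disc_measure) =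
      (\<integral>w. ((\<lambda>_. 1) (norm (mobius z w)) * mobius_jac z w) *\<^sub>R g w \<partial>disc_measure)"
    by (rule integral_cong_AE[OF _ _ eq]) measurable
  also have "\<dots> = (\<integral>v. (\<lambda>_. 1) (norm v) \<partial>disc_measure) *\<^sub>R g z"
  proof (rule radial_mobius_mean_value[OF z])
    show "g holomorphic_on ball 0 1"
      unfolding g_def by (intro holomorphic_intros f) (use nz in \<open>simp del: of_real_diff\<close>)
    show "integrable disc_measure (\<lambda>w. ((\<lambda>_. 1) (norm (mobius z w)) * mobius_jac z w) *\<^sub>R g w)"
      by (rule integrable_cong_AE_imp[OF int]) (use eq in \<open>auto elim: eventually_mono\<close>)
  qed measurable
  also have "\<dots> = g z" by simp
  also have "\<dots> = f z"
  proof -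
    have "1 - z * cnj z = of_real (1 - (norm z)\<^sup>2)" by (simp add: of_real_norm_sq)
    then show ?thesis using nz unfolding g_def by (simp del: of_real_diff)
  qed
  finally show ?thesis .
qed

section \<open>The Schur estimate for the kernel of the disc\<close>

lemma emeasure_disc_ball:
  assumes "0 \<le> r" "r \<le> 1"
  shows "emeasure disc_measure (ball 0 r) = ennreal (r\<^sup>2)"
proof -
  have "ball 0 r \<inter> ball 0 1 = ball (0::complex) r" using assms by auto
  moreover have "emeasure lborel (ball (0::complex) r) = ennreal (pi * r\<^sup>2)"
    using assms by (simp add: emeasure_ball unit_ball_vol_def) (simp add: Gamma_numeral)
  ultimately show ?thesis
    by (simp add: emeasure_disc_measure divide_ennreal)
qed

text \<open>The Schur weight. With the exponent 3/4 the substitution by \<open>mobius z\<close>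
  leaves exactly the power |1 - v cnj z|^(-1/2), which is comparable with the real part of a
  holomorphic square root, so that a mean value property evaluates the integral.\<close>

definition disc_weight :: "complex \<Rightarrow> real"
  where "disc_weight v = (1 - (norm v)\<^sup>2) powr (- (3 / 4))"

lemma disc_weight_nonneg: "disc_weight v \<ge> 0"
  by (simp add: disc_weight_def)

lemma disc_weight_pos: "norm v < 1 \<Longrightarrow> disc_weight v > 0"
  using norm_less_one_sq_pos[of v] by (simp add: disc_weight_def)

lemma measurable_disc_weight [measurable]: "disc_weight \<in> borel_measurable borel"
  unfolding disc_weight_def by measurable

lemma emeasure_disc_annulus:
  assumes "0 \<le> t" "t \<le> 1"
  shows "emeasure disc_measure {v. norm v < 1 \<and> 1 - (norm v)\<^sup>2 \<le> t} = ennreal t"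
proof -
  have "{v. norm v < 1 \<and> 1 - (norm v)\<^sup>2 \<le> t} = ball (0::complex) 1 - ball 0 (sqrt (1 - t))"
  proof -
    have "1 - (norm v)\<^sup>2 \<le> t \<longleftrightarrow> sqrt (1 - t) \<le> norm v" for v :: complex
    proof
      assume "1 - (norm v)\<^sup>2 \<le> t"
      then show "sqrt (1 - t) \<le> norm v" by (intro real_le_lsqrt) simp_all
    next
      assume "sqrt (1 - t) \<le> norm v"
      from sqrt_le_D[OF this] show "1 - (norm v)\<^sup>2 \<le> t" by linarith
    qed
    then have "{v. norm v < 1 \<and> 1 - (norm v)\<^sup>2 \<le> t} = {v::complex. norm v < 1 \<and> sqrt (1 - t) \<le> norm v}"
      by (simp only:)
    also have "\<dots> = ball 0 1 - ball 0 (sqrt (1 - t))" by (auto simp: not_less)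
    finally show ?thesis .
  qed
  moreover have "emeasure disc_measure (ball 0 1 - ball 0 (sqrt (1 - t))) = ennreal (1 - (1 - t))"
  proof -
    have "emeasure disc_measure (ball 0 1 - ball 0 (sqrt (1 - t))) =
        emeasure disc_measure (ball 0 1) - emeasure disc_measure (ball 0 (sqrt (1 - t)))"
      using assms by (intro emeasure_Diff) (simp_all add: emeasure_disc_ball subset_ball)
    moreover have "emeasure disc_measure (ball 0 1) = ennreal 1"
      using emeasure_disc_ball[of 1] by simp
    moreover have "emeasure disc_measure (ball 0 (sqrt (1 - t))) = ennreal (1 - t)"
      using emeasure_disc_ball[of "sqrt (1 - t)"] assms by simp
    ultimately show ?thesis using assms by (simp only: ennreal_minus)
  qed
  ultimately show ?thesis by (simp only:) simp
qed

text \<open>Decomposition into layers where 1 - |v|^2 is at most 16^(-k). Outside the next layer the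
  weight is at most 8^(k+1), since 16^(3/4) = 8, and the layer has measure 16^(-k); the resulting
  sum is geometric with ratio 1/2.\<close>

lemma nn_integral_disc_weight_finite: "(\<integral>\<^sup>+v. ennreal (disc_weight v) \<partial>disc_measure) < \<infinity>"
proof -
  define S where "S k = {v::complex. norm v < 1 \<and> 1 - (norm v)\<^sup>2 \<le> (1 / 16) ^ k}" for k :: nat
  have [measurable]: "S k \<in> sets borel" for k unfolding S_def by measurable
  have "(\<integral>\<^sup>+v. ennreal (disc_weight v) \<partial>disc_measure) \<le>
      (\<integral>\<^sup>+v. (\<Sum>k. ennreal (8 ^ Suc k) * indicator (S k) v) \<partial>disc_measure)"
  proof (rule nn_integral_mono_AE)
    show "AE v in disc_measure. ennreal (disc_weight v) \<le> (\<Sum>k. ennreal (8 ^ Suc k) * indicator (S k) v)"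
      using AE_disc_measure
    proof eventually_elim
      case (elim v)
      define s where "s = 1 - (norm v)\<^sup>2"
      have s: "0 < s" "s \<le> 1" using norm_less_one_sq_pos[OF elim] by (auto simp: s_def)
      obtain n where "(1 / 16) ^ n < s" using real_arch_pow_inv[of s "1/16"] s by auto
      \<comment> \<open>The least exponent is positive because s \<le> 1, so its predecessor k
        satisfies 16^(-k-1) < s \<le> 16^(-k).\<close>
      define k where "k = (LEAST n. (1 / 16) ^ n < s) - 1"
      have L: "(1 / 16) ^ (LEAST n. (1 / 16) ^ n < s) < s" by (rule LeastI) fact
      then have pos: "(LEAST n. (1 / 16) ^ n < s) > 0" using s by (cases "LEAST n. (1 / 16) ^ n < s") auto
      have k1: "(1 / 16) ^ Suc k < s" using L pos by (simp add: k_def)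
      have k2: "s \<le> (1 / 16) ^ k"
        using not_less_Least[of k "\<lambda>n. (1 / 16) ^ n < s"] pos by (simp add: k_def)
      have "disc_weight v = s powr (- (3 / 4))" by (simp add: disc_weight_def s_def)
      also have "\<dots> \<le> ((1 / 16) ^ Suc k) powr (- (3 / 4))"
        using k1 by (intro powr_mono2') auto
      also have "\<dots> = 8 ^ Suc k"
      proof -
        have 16: "(16::real) powr (3 / 4) = 8"
        proof -
          have "(16::real) powr (3 / 4) = (2 powr 4) powr (3 / 4)" by simp
          also have "\<dots> = 2 powr 3" unfolding powr_powr by simp
          finally show ?thesis by simp
        qed
        have "((1 / 16) ^ Suc k) powr (- (3 / 4)) = ((16::real) ^ Suc k) powr (3 / 4)"
          by (simp add: powr_minus_divide power_one_over powr_divide del: power_Suc)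
        also have "\<dots> = (16 powr (3 / 4)) ^ Suc k"
          by (simp only: powr_realpow[symmetric] powr_powr mult.commute zero_less_numeral
              powr_gt_zero)
        finally show ?thesis unfolding 16 .
      qed
      finally have "ennreal (disc_weight v) \<le> ennreal (8 ^ Suc k) * indicator (S k) v"
        using k2 elim by (simp add: S_def s_def ennreal_leI)
      also have "\<dots> \<le> (\<Sum>k. ennreal (8 ^ Suc k) * indicator (S k) v)"
      proof -
        have "g k \<le> suminf g" for g :: "nat \<Rightarrow> ennreal"
          using sum_le_suminf[of g "{k}"] by simp
        then show ?thesis .
      qed
      finally show ?case .
    qed
  qed
  also have "\<dots> = (\<Sum>k. \<integral>\<^sup>+v. ennreal (8 ^ Suc k) * indicator (S k) v \<partial>disc_measure)"
    by (rule nn_integral_suminf) measurable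
  also have "\<dots> = (\<Sum>k. ennreal (8 * (1 / 2) ^ k))"
  proof (rule suminf_cong)
    fix k :: nat
    have "(1 / 16 :: real) ^ k \<le> 1" by (simp add: power_le_one)
    then have "(\<integral>\<^sup>+v. ennreal (8 ^ Suc k) * indicator (S k) v \<partial>disc_measure) = ennreal (8 ^ Suc k) * ennreal ((1 / 16) ^ k)"
      using emeasure_disc_annulus[of "(1 / 16) ^ k"]
      by (subst nn_integral_cmult_indicator) (simp_all add: S_def)
    also have "\<dots> = ennreal (8 ^ Suc k * (1 / 16) ^ k)"
      by (simp add: ennreal_mult)
    also have "8 ^ Suc k * (1 / 16) ^ k = 8 * (1 / 2 :: real) ^ k"
      by (simp add: power_mult_distrib[symmetric])
    finally show "(\<integral>\<^sup>+v. ennreal (8 ^ Suc k) * indicator (S k) v \<partial>disc_measure) = ennreal (8 * (1 / 2) ^ k)" .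
  qed
  also have "\<dots> = ennreal (\<Sum>k. 8 * (1 / 2) ^ k)"
    by (rule suminf_ennreal2) (auto intro: summable_mult summable_geometric)
  also have "\<dots> < \<infinity>" by simp
  finally show ?thesis .
qed

lemma integrable_disc_weight: "integrable disc_measure disc_weight"
  using nn_integral_disc_weight_finite disc_weight_nonneg by (intro integrableI_nonneg) auto

text \<open>Dominated convergence along radii tending to 1. After the Moebius substitution this tail
  is the part of the kernel far away in the hyperbolic metric.\<close>

lemma disc_weight_tail:
  assumes "e > 0"
  obtains r where "0 < r" "r < 1" "(\<integral>v. indicator {r<..} (norm v) * disc_weight v \<partial>disc_measure) \<le> e"
proof -
  define r where "r n = 1 - 1 / (real n + 2)" for n :: nat
  have "(\<lambda>n. \<integral>v. indicator {r n<..} (norm v) * disc_weight v \<partial>disc_measure) \<longlonglongrightarrow> (\<integral>v. 0 \<partial>disc_measure)"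
  proof (rule integral_dominated_convergence[where w = disc_weight])
    show "AE v in disc_measure. (\<lambda>n. indicator {r n<..} (norm v) * disc_weight v) \<longlonglongrightarrow> 0"
      using AE_disc_measure
    proof eventually_elim
      case (elim v)
      have "r \<longlonglongrightarrow> 1" unfolding r_def by real_asymp
      then have "eventually (\<lambda>n. r n > norm v) sequentially"
        using elim by (rule order_tendstoD)
      then have "eventually (\<lambda>n. indicator {r n<..} (norm v) * disc_weight v = 0) sequentially"
        by eventually_elim auto
      then show ?case by (rule tendsto_eventually)
    qed
  qed (auto simp: integrable_disc_weight disc_weight_nonneg indicator_def)
  then have "eventually (\<lambda>n. (\<integral>v. indicator {r n<..} (norm v) * disc_weight v \<partial>disc_measure) < e) sequentially"
    using assms by (auto dest: order_tendstoD(2))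
  then obtain n where "(\<integral>v. indicator {r n<..} (norm v) * disc_weight v \<partial>disc_measure) < e"
    by (auto simp: eventually_sequentially)
  then show ?thesis using that[of "r n"] by (auto simp: r_def field_simps)
qed

text \<open>In the right half plane the argument of the principal square root is at most \<pi>/4 in
  absolute value, so its real part is at least its modulus divided by sqrt 2; inversion preserves
  this.\<close>

lemma Re_inverse_csqrt_ge:
  assumes "Re x > 0"
  shows "norm x powr (- (1 / 2)) \<le> sqrt 2 * Re (1 / csqrt x)"
proof -
  have nx: "norm x > 0" using assms by auto
  have norm_csqrt: "norm (csqrt x) = sqrt (norm x)" by simp
  have "Re (1 / c) = Re c / (norm c)\<^sup>2" for c
    unfolding Re_divide cmod_power2 by simp
  from this[of "csqrt x"] have "Re (1 / csqrt x) = Re (csqrt x) / norm x"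
    unfolding norm_csqrt by simp
  moreover have "Re (csqrt x) \<ge> sqrt (norm x / 2)"
    using assms by simp
  ultimately have "sqrt 2 * Re (1 / csqrt x) \<ge> sqrt 2 * (sqrt (norm x / 2) / norm x)"
    using nx by (intro mult_left_mono) (auto simp: divide_right_mono)
  also have "sqrt 2 * (sqrt (norm x / 2) / norm x) = sqrt (norm x) / norm x"
    by (simp add: real_sqrt_divide)
  also have "sqrt (norm x) / norm x = norm x powr (- (1 / 2))"
    using nx by (simp add: powr_minus powr_half_sqrt field_simps)
  finally show ?thesis .
qed

text \<open>The substitution of \<open>mobius z v\<close> for w pulls \<open>disc_weight z\<close>
  out and turns the cutoff into a radial one. The remaining power of 1 - v cnj z is dominated by the
  real part of the holomorphic function \<open>f\<close>, and the radial mean value property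
  replaces f by f 0 = 1.\<close>

lemma schur_disc:
  assumes z: "norm z < 1" and [measurable]: "F \<in> borel_measurable borel" and F: "\<And>x. 0 \<le> F x" "\<And>x. F x \<le> 1"
  shows "(\<integral>\<^sup>+w. ennreal (F (norm (mobius z w)) * disc_weight w / (norm (1 - z * cnj w))\<^sup>2) \<partial>disc_measure)
    \<le> ennreal (disc_weight z * (sqrt 2 * (\<integral>v. F (norm v) * disc_weight v \<partial>disc_measure)))"
proof -
  define f where "f v = 1 / csqrt (1 - v * cnj z)" for v
  have Re_pos: "Re (1 - v * cnj z) > 0" if "norm v < 1" for v
  proof -
    have "Re (v * cnj z) \<le> norm (v * cnj z)" by (rule complex_Re_le_cmod)
    also have "\<dots> < 1" using mult_strict_mono'[OF that z] by (simp add: norm_mult)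
    finally show ?thesis by simp
  qed
  have f_hol: "f holomorphic_on ball 0 1"
    unfolding f_def
  proof (intro holomorphic_intros)
    fix v :: complex assume "v \<in> ball 0 1"
    then have *: "Re (1 - v * cnj z) > 0" using Re_pos by simp
    then show "1 - v * cnj z \<notin> \<real>\<^sub>\<le>\<^sub>0" by (auto simp: complex_nonpos_Reals_iff)
    show "csqrt (1 - v * cnj z) \<noteq> 0" using * by (metis csqrt_eq_0 less_irrefl zero_complex.sel(1))
  qed
  have csqrt_m [measurable]: "csqrt \<in> borel_measurable borel"
  proof -
    \<comment> \<open>The branch cut makes \<open>csqrt\<close> discontinuous, so measurability is
      read off from its real and imaginary parts.\<close>
    have "csqrt = (\<lambda>z. of_real (sqrt ((norm z + Re z) / 2)) +
        \<i> * of_real ((if Im z < 0 then - 1 else 1) * sqrt ((norm z - Re z) / 2)))"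
      by (auto simp: fun_eq_iff complex_eq_iff sgn_if)
    then show ?thesis by (subst (asm) eq_commute) (erule subst, measurable)
  qed
  have [measurable]: "f \<in> borel_measurable borel" unfolding f_def by measurable
  have f_bound: "norm (f v) \<le> 1 / sqrt (1 - norm z)" if "norm v < 1" for v
  proof -
    have "norm (v * cnj z) \<le> norm z"
      using that mult_right_mono[of "norm v" 1 "norm z"] by (simp add: norm_mult)
    then have "1 - norm z \<le> norm (1 - v * cnj z)"
      using norm_triangle_ineq2[of 1 "v * cnj z"] by simp
    then show ?thesis using z unfolding f_def norm_divide by (simp add: frac_le)
  qed
  have int: "integrable disc_measure (\<lambda>v. (F (norm v) * disc_weight v) *\<^sub>R f v)"
  proof (rule Bochner_Integration.integrable_bound)
    show "integrable disc_measure (\<lambda>v. disc_weight v * (1 / sqrt (1 - norm z)))"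
      using integrable_disc_weight by (intro integrable_mult_left)
    show "AE v in disc_measure. norm ((F (norm v) * disc_weight v) *\<^sub>R f v) \<le> norm (disc_weight v * (1 / sqrt (1 - norm z)))"
      using AE_disc_measure
    proof eventually_elim
      case (elim v)
      have "\<bar>F (norm v)\<bar> * disc_weight v * norm (f v) \<le> 1 * disc_weight v * (1 / sqrt (1 - norm z))"
        using F f_bound[OF elim] disc_weight_nonneg by (intro mult_mono) (auto simp: abs_of_nonneg)
      then show ?case using z disc_weight_nonneg by (simp add: abs_mult)
    qed
  qed measurable
  have mv: "(\<integral>v. (F (norm v) * disc_weight v) *\<^sub>R f v \<partial>disc_measure) =
      (\<integral>v. (F (norm v) * disc_weight v) *\<^sub>R f 0 \<partial>disc_measure)"
    using radial_mean_value[OF f_hol, of "\<lambda>x. F x * (1 - x\<^sup>2) powr (- (3 / 4))"] int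
    unfolding disc_weight_def by simp
  have "(\<integral>\<^sup>+w. ennreal (F (norm (mobius z w)) * disc_weight w / (norm (1 - z * cnj w))\<^sup>2) \<partial>disc_measure) =
      (\<integral>\<^sup>+v. ennreal (mobius_jac z v) * ennreal (F (norm (mobius z (mobius z v))) * disc_weight (mobius z v)
        / (norm (1 - z * cnj (mobius z v)))\<^sup>2) \<partial>disc_measure)"
    by (rule nn_integral_disc_mobius[OF z]) measurable
  also have "\<dots> \<le> (\<integral>\<^sup>+v. ennreal (disc_weight z * (sqrt 2 * (F (norm v) * disc_weight v * Re (f v)))) \<partial>disc_measure)"
  proof (rule nn_integral_mono_AE)
    show "AE v in disc_measure. ennreal (mobius_jac z v) * ennreal (F (norm (mobius z (mobius z v))) * disc_weight (mobius z v)
        / (norm (1 - z * cnj (mobius z v)))\<^sup>2) \<le> ennreal (disc_weight z * (sqrt 2 * (F (norm v) * disc_weight v * Re (f v))))"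
      using AE_disc_measure
    proof eventually_elim
      case (elim v)
      define P where "P = 1 - (norm z)\<^sup>2"
      define S where "S = 1 - (norm v)\<^sup>2"
      define X where "X = norm (1 - v * cnj z)"
      have pos: "P > 0" "S > 0" "X > 0"
        using norm_less_one_sq_pos[OF z] norm_less_one_sq_pos[OF elim] one_minus_mult_cnj_nz[OF z elim]
        by (auto simp: P_def S_def X_def)
      have "norm (1 - z * cnj (mobius z v)) = norm (cnj (1 - mobius z v * cnj z))" by (simp add: mult.commute)
      also have "\<dots> = norm (complex_of_real P / (1 - v * cnj z))"
        unfolding complex_mod_cnj one_minus_mobius_cnj[OF z elim] P_def ..
      finally have e1: "norm (1 - z * cnj (mobius z v)) = P / X"
        using pos by (simp add: norm_divide X_def)
      have e2: "disc_weight (mobius z v) = (P * S / X\<^sup>2) powr (- (3 / 4))"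
        unfolding disc_weight_def one_minus_norm_mobius_sq[OF z elim] P_def S_def X_def ..
      have e3: "mobius_jac z v = P\<^sup>2 / X ^ 4" by (simp add: mobius_jac_def P_def X_def)
      have Xp: "X\<^sup>2 powr (- (3 / 4)) = X powr (- (3 / 2))"
        using pos by (simp add: powr_powr flip: powr_numeral)
      have Xq: "X powr (- (1 / 2)) = inverse (X\<^sup>2) / X powr (- (3 / 2))"
      proof -
        have "X powr (- (1 / 2)) = X powr (- 2) * X powr (3 / 2)" by (simp flip: powr_add)
        also have "\<dots> = inverse (X\<^sup>2) / X powr (- (3 / 2))"
          using pos by (simp add: powr_minus powr_numeral field_simps)
        finally show ?thesis .
      qed
      \<comment> \<open>The Jacobian P^2 / X^4 and the kernel factor (P / X)^(-2) combine to X^(-2);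
        the weight at the moved point contributes X^(3/2).\<close>
      have "mobius_jac z v * (F (norm v) * disc_weight (mobius z v) / (P / X)\<^sup>2) =
          disc_weight z * (F (norm v) * disc_weight v * X powr (- (1 / 2)))"
      proof -
        have "disc_weight (mobius z v) = disc_weight z * disc_weight v / X powr (- (3 / 2))"
          unfolding e2 using pos Xp by (simp add: powr_divide powr_mult disc_weight_def P_def S_def)
        then show ?thesis unfolding e3 Xq using pos by (simp add: field_simps power2_eq_square power4_eq_xxxx)
      qed
      also have "\<dots> \<le> disc_weight z * (F (norm v) * disc_weight v * (sqrt 2 * Re (f v)))"
        using Re_inverse_csqrt_ge[OF Re_pos[OF elim]] F disc_weight_nonneg
        by (intro mult_left_mono mult_nonneg_nonneg) (auto simp: X_def f_def)
      finally show ?case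
        unfolding e1 using z elim mobius_jac_nonneg
        by (simp add: ennreal_mult'[symmetric] ennreal_leI mult_ac)
    qed
  qed
  also have "\<dots> = ennreal (\<integral>v. disc_weight z * (sqrt 2 * (F (norm v) * disc_weight v * Re (f v))) \<partial>disc_measure)"
  proof (rule nn_integral_eq_integral)
    show "integrable disc_measure (\<lambda>v. disc_weight z * (sqrt 2 * (F (norm v) * disc_weight v * Re (f v))))"
      using integrable_Re[OF int] by simp
    show "AE v in disc_measure. 0 \<le> disc_weight z * (sqrt 2 * (F (norm v) * disc_weight v * Re (f v)))"
      using AE_disc_measure
    proof eventually_elim
      case (elim v)
      have "0 \<le> norm (1 - v * cnj z) powr (- (1 / 2))" by simp
      also have "\<dots> \<le> sqrt 2 * Re (f v)"
        using Re_inverse_csqrt_ge[OF Re_pos[OF elim]] by (simp add: f_def)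
      finally have "Re (f v) \<ge> 0" by (simp add: zero_le_mult_iff)
      then show ?case using F disc_weight_nonneg by simp
    qed
  qed
  also have "(\<integral>v. disc_weight z * (sqrt 2 * (F (norm v) * disc_weight v * Re (f v))) \<partial>disc_measure) =
      disc_weight z * (sqrt 2 * Re (\<integral>v. (F (norm v) * disc_weight v) *\<^sub>R f v \<partial>disc_measure))"
    using int by (simp add: integral_Re[OF int, symmetric])
  also have "Re (\<integral>v. (F (norm v) * disc_weight v) *\<^sub>R f v \<partial>disc_measure) = (\<integral>v. F (norm v) * disc_weight v \<partial>disc_measure)"
  proof -
    have "f 0 = 1" by (simp add: f_def)
    then show ?thesis
      unfolding mv unfolding scaleR_conv_of_real by (simp only: mult_1_right integral_complex_of_real Re_complex_of_real)
  qed
  finally show ?thesis .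
qed

section \<open>The Bergman space of the polydisk\<close>

lemma measurable_vec_lambda [measurable]:
  "vec_lambda \<in> measurable (\<Pi>\<^sub>M i\<in>(UNIV :: 'n::finite set). (borel :: complex measure)) borel"
proof (subst borel_measurable_euclidean_space, intro ballI)
  fix b :: "complex ^ 'n" assume "b \<in> Basis"
  then obtain i c where b: "b = axis i c" by (auto simp: Basis_vec_def)
  have "(\<lambda>x. vec_lambda x \<bullet> b) = (\<lambda>x. x i \<bullet> c)" by (simp add: b inner_axis fun_eq_iff)
  then show "(\<lambda>x. vec_lambda x \<bullet> b) \<in> borel_measurable (\<Pi>\<^sub>M i\<in>UNIV. borel)" by simp
qed

lemma measurable_vec_nth [measurable]: "(\<lambda>x :: complex ^ 'n::finite. x $ i) \<in> borel_measurable borel"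
  by (intro borel_measurable_continuous_onI continuous_intros)

interpretation lborel_product: product_sigma_finite "\<lambda>_ :: 'n::finite. lborel :: complex measure"
  by standard

interpretation disc_product: product_sigma_finite "\<lambda>_ :: 'i. disc_measure"
proof -
  interpret finite_measure disc_measure by (rule finite_measure_disc_measure)
  show "product_sigma_finite (\<lambda>_ :: 'i. disc_measure)" by unfold_locales
qed

lemma lborel_vec_eq:
  "(lborel :: (complex ^ 'n::finite) measure) = distr (\<Pi>\<^sub>M i\<in>UNIV. lborel) borel vec_lambda"
proof (rule lborel_eqI)
  fix l u :: "complex ^ 'n"
  assume le: "\<And>b. b \<in> Basis \<Longrightarrow> l \<bullet> b \<le> u \<bullet> b"
  have ax: "axis i b \<in> (Basis :: (complex ^ 'n) set)" if "b \<in> Basis" for i and b :: complex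
    using that by (auto simp: Basis_vec_def)
  have le': "l $ i \<bullet> b \<le> u $ i \<bullet> b" if "b \<in> Basis" for i b
    using le[OF ax[OF that, of i]] by (simp add: inner_axis)
  have "vec_lambda x \<in> box l u \<longleftrightarrow> (\<forall>i. x i \<in> box (l $ i) (u $ i))" for x
  proof -
    have "vec_lambda x \<in> box l u \<longleftrightarrow> (\<forall>i. \<forall>b\<in>Basis. l \<bullet> axis i b < vec_lambda x \<bullet> axis i b \<and> vec_lambda x \<bullet> axis i b < u \<bullet> axis i b)"
      by (auto simp: mem_box Basis_vec_def)
    then show ?thesis by (simp add: mem_box inner_axis)
  qed
  then have pre: "vec_lambda -` box l u = (\<Pi>\<^sub>E i\<in>UNIV. box (l $ i) (u $ i))"
    by (auto simp: PiE_UNIV_domain)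
  have m: "vec_lambda \<in> measurable (\<Pi>\<^sub>M i\<in>(UNIV :: 'n set). lborel) (borel :: (complex ^ 'n) measure)"
    using measurable_vec_lambda by (simp cong: measurable_cong_sets sets_PiM_cong)
  have "emeasure (distr (\<Pi>\<^sub>M i\<in>UNIV. lborel) borel vec_lambda) (box l u) =
      emeasure (\<Pi>\<^sub>M i\<in>(UNIV :: 'n set). lborel) (\<Pi>\<^sub>E i\<in>UNIV. box (l $ i) (u $ i))"
    using m by (subst emeasure_distr) (simp_all add: pre space_PiM)
  also have "\<dots> = (\<Prod>i\<in>UNIV. emeasure lborel (box (l $ i) (u $ i)))"
    by (rule lborel_product.emeasure_PiM) auto
  also have "\<dots> = (\<Prod>i\<in>UNIV. ennreal (\<Prod>b\<in>Basis. (u $ i - l $ i) \<bullet> b))"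
    using le' by (simp add: emeasure_lborel_box)
  also have "\<dots> = ennreal (\<Prod>i\<in>UNIV. \<Prod>b\<in>Basis. (u $ i - l $ i) \<bullet> b)"
    using le' by (intro prod_ennreal prod_nonneg) (auto simp: inner_diff_left)
  also have "(\<Prod>i\<in>UNIV. \<Prod>b\<in>Basis. (u $ i - l $ i) \<bullet> b) = (\<Prod>(i, b)\<in>UNIV \<times> Basis. (u - l) \<bullet> axis i b)"
    by (subst prod.cartesian_product) (simp add: inner_axis)
  also have "\<dots> = (\<Prod>b\<in>(Basis :: (complex ^ 'n) set). (u - l) \<bullet> b)"
  proof -
    have inj: "inj_on (\<lambda>p. axis (fst p) (snd p)) ((UNIV :: 'n set) \<times> (Basis :: complex set))"
      by (rule inj_onI) (auto simp: axis_eq_axis prod_eq_iff)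
    have im: "(Basis :: (complex ^ 'n) set) = (\<lambda>p. axis (fst p) (snd p)) ` (UNIV \<times> Basis)"
      by (force simp: Basis_vec_def)
    show ?thesis unfolding im by (subst prod.reindex[OF inj]) (simp add: o_def split_beta)
  qed
  finally show "emeasure (distr (\<Pi>\<^sub>M i\<in>UNIV. lborel) borel vec_lambda) (box l u) = (\<Prod>b\<in>Basis. (u - l) \<bullet> b)" .
qed simp

text \<open>Restricting Lebesgue measure to the polydisk and dividing by its volume factorizes over
  the coordinates, because the polydisk is a product and its volume is \<open>pi ^ CARD('n)\<close>.
  This makes coordinatewise Fubini available.\<close>

lemma dv_eq: "(dv :: (complex ^ 'n::finite) measure) = distr (\<Pi>\<^sub>M i\<in>UNIV. disc_measure) borel vec_lambda"
proof -
  have m: "vec_lambda \<in> measurable (\<Pi>\<^sub>M i\<in>(UNIV :: 'n set). lborel) (borel :: (complex ^ 'n) measure)"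
    using measurable_vec_lambda by (simp cong: measurable_cong_sets sets_PiM_cong)
  have m2: "vec_nth \<in> measurable (dv :: (complex ^ 'n) measure) (\<Pi>\<^sub>M i\<in>(UNIV :: 'n set). disc_measure)"
  proof (rule measurable_PiM_single')
    show "(\<lambda>x. x $ i) \<in> measurable dv disc_measure" for i :: 'n
      by (simp cong: measurable_cong_sets)
  qed (auto simp: space_PiM)
  have cyl: "emeasure lborel {x :: complex ^ 'n. \<forall>i. x $ i \<in> A i} = (\<Prod>i\<in>UNIV. emeasure lborel (A i))"
    and cyl_sets: "{x :: complex ^ 'n. \<forall>i. x $ i \<in> A i} \<in> sets borel"
    if A: "\<And>i. A i \<in> sets borel" for A :: "'n \<Rightarrow> complex set"
  proof -
    have "{x :: complex ^ 'n. \<forall>i. x $ i \<in> A i} = (\<Inter>i\<in>UNIV. (\<lambda>x. x $ i) -` A i)" by auto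
    also have "\<dots> \<in> sets borel"
      using measurable_sets[OF measurable_vec_nth A] by (intro sets.finite_INT) auto
    finally show s: "{x :: complex ^ 'n. \<forall>i. x $ i \<in> A i} \<in> sets borel" .
    have "emeasure lborel {x :: complex ^ 'n. \<forall>i. x $ i \<in> A i} =
        emeasure (\<Pi>\<^sub>M i\<in>(UNIV :: 'n set). lborel) (\<Pi>\<^sub>E i\<in>UNIV. A i)"
    proof -
      have "vec_lambda -` {x :: complex ^ 'n. \<forall>i. x $ i \<in> A i} = (\<Pi>\<^sub>E i\<in>UNIV. A i)"
        by (auto simp: PiE_UNIV_domain)
      then show ?thesis
        using s m by (subst lborel_vec_eq, subst emeasure_distr) (simp_all add: space_PiM)
    qed
    then show "emeasure lborel {x :: complex ^ 'n. \<forall>i. x $ i \<in> A i} = (\<Prod>i\<in>UNIV. emeasure lborel (A i))"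
      using A by (subst (asm) lborel_product.emeasure_PiM) auto
  qed
  have pd: "polydisk = {x :: complex ^ 'n. \<forall>i. x $ i \<in> ball 0 1}" by (auto simp: polydisk_def)
  have vol: "emeasure lborel (polydisk :: (complex ^ 'n) set) = ennreal (pi ^ CARD('n))"
    unfolding pd using cyl[of "\<lambda>_. ball 0 1"] by (simp add: emeasure_unit_disc ennreal_power)
  \<comment> \<open>Product measures are determined by their values on rectangles, so the identity
    is proved for the image under \<open>vec_nth\<close> and carried back by
    \<open>vec_lambda\<close>.\<close>
  have "distr (dv :: (complex ^ 'n) measure) (\<Pi>\<^sub>M i\<in>(UNIV :: 'n set). disc_measure) vec_nth = (\<Pi>\<^sub>M i\<in>UNIV. disc_measure)"
  proof (rule disc_product.PiM_eqI)
    fix A :: "'n \<Rightarrow> complex set" assume "\<And>i. i \<in> UNIV \<Longrightarrow> A i \<in> sets disc_measure"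
    then have A: "A i \<in> sets borel" for i by simp
    have "emeasure (distr dv (\<Pi>\<^sub>M i\<in>(UNIV :: 'n set). disc_measure) vec_nth) (PiE UNIV A) =
        emeasure dv {x :: complex ^ 'n. \<forall>i. x $ i \<in> A i}"
    proof -
      have "vec_nth -` PiE UNIV A = {x :: complex ^ 'n. \<forall>i. x $ i \<in> A i}"
        by (auto simp: PiE_UNIV_domain)
      then show ?thesis
        using m2 A by (subst emeasure_distr) (auto intro!: sets_PiM_I_finite)
    qed
    also have "\<dots> = emeasure lborel (polydisk \<inter> {x :: complex ^ 'n. \<forall>i. x $ i \<in> A i}) / ennreal (pi ^ CARD('n))"
      unfolding dv_def vol[symmetric]
      using borel_open[OF open_polydisk] cyl_sets[OF A] by (intro emeasure_uniform_measure) simp_all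
    also have "polydisk \<inter> {x :: complex ^ 'n. \<forall>i. x $ i \<in> A i} = {x. \<forall>i. x $ i \<in> A i \<inter> ball 0 1}"
      unfolding pd by auto
    also have "emeasure lborel \<dots> = (\<Prod>i\<in>UNIV. emeasure lborel (A i \<inter> ball 0 1))"
      by (rule cyl) (use A in auto)
    also have "\<dots> / ennreal (pi ^ CARD('n)) = (\<Prod>i\<in>UNIV. emeasure disc_measure (A i))"
    proof -
      have "emeasure lborel (A i \<inter> ball 0 1) = ennreal pi * emeasure disc_measure (A i)" for i
      proof -
        have "ennreal pi * (x / ennreal pi) = x" for x
          by (simp add: ennreal_times_divide mult.commute[of "ennreal pi"] ennreal_mult_divide_eq)
        then show ?thesis using A by (simp add: emeasure_disc_measure)
      qed
      then have "(\<Prod>i\<in>UNIV. emeasure lborel (A i \<inter> ball 0 1)) =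
          ennreal (pi ^ CARD('n)) * (\<Prod>i\<in>UNIV. emeasure disc_measure (A i))"
        by (simp add: prod.distrib ennreal_power)
      then show ?thesis by (simp add: ennreal_mult_divide_eq mult.commute[of "ennreal (pi ^ _)"] del: ennreal_power)
    qed
    finally show "emeasure (distr dv (\<Pi>\<^sub>M i\<in>(UNIV :: 'n set). disc_measure) vec_nth) (PiE UNIV A) =
      (\<Prod>i\<in>UNIV. emeasure disc_measure (A i))" .
  qed auto
  then have "distr (\<Pi>\<^sub>M i\<in>(UNIV :: 'n set). disc_measure) (borel :: (complex ^ 'n) measure) vec_lambda =
      distr (distr dv (\<Pi>\<^sub>M i\<in>(UNIV :: 'n set). disc_measure) vec_nth) borel vec_lambda"
    by (simp only:)
  also have "\<dots> = distr dv borel (\<lambda>x. x)"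
    using m2 measurable_vec_lambda
    by (subst distr_distr) (simp_all add: o_def vec_nth_inverse cong: measurable_cong_sets sets_PiM_cong)
  also have "\<dots> = dv" by (rule distr_id2) simp
  finally show ?thesis ..
qed

lemma measurable_vec_lambda_disc [measurable]:
  "vec_lambda \<in> measurable (\<Pi>\<^sub>M i\<in>(UNIV :: 'n::finite set). disc_measure) borel"
  using measurable_vec_lambda by (simp cong: measurable_cong_sets sets_PiM_cong)

lemma nn_integral_dv_prod:
  assumes "\<And>i. f i \<in> borel_measurable borel"
  shows "(\<integral>\<^sup>+w. (\<Prod>i\<in>UNIV. f i (w $ i)) \<partial>(dv :: (complex ^ 'n::finite) measure)) = (\<Prod>i\<in>UNIV. \<integral>\<^sup>+v. f i v \<partial>disc_measure)"
proof -
  have [measurable]: "f i \<in> borel_measurable borel" for i by fact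
  have "(\<integral>\<^sup>+w. (\<Prod>i\<in>UNIV. f i (w $ i)) \<partial>(dv :: (complex ^ 'n) measure)) =
      (\<integral>\<^sup>+x. (\<Prod>i\<in>UNIV. f i (x i)) \<partial>(\<Pi>\<^sub>M i\<in>(UNIV :: 'n set). disc_measure))"
    unfolding dv_eq by (subst nn_integral_distr) simp_all
  also have "\<dots> = (\<Prod>i\<in>UNIV. \<integral>\<^sup>+v. f i v \<partial>disc_measure)"
    by (rule disc_product.product_nn_integral_prod) (use assms in \<open>simp_all cong: measurable_cong_sets\<close>)
  finally show ?thesis .
qed

lemma AE_disc_product:
  assumes "finite J"
  shows "AE x in (\<Pi>\<^sub>M i\<in>J. disc_measure). \<forall>i\<in>J. norm (x i) < 1"
proof (rule AE_finite_allI[OF assms])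
  fix i assume i: "i \<in> J"
  let ?N = "\<Pi>\<^sub>E j\<in>J. if j = i then - ball 0 1 else (UNIV :: complex set)"
  show "AE x in (\<Pi>\<^sub>M i\<in>J. disc_measure). norm (x i) < 1"
  proof (rule AE_I')
    have "emeasure (\<Pi>\<^sub>M i\<in>J. disc_measure) ?N =
        (\<Prod>j\<in>J. emeasure disc_measure (if j = i then - ball 0 1 else UNIV))"
      by (rule disc_product.emeasure_PiM[OF assms]) auto
    also have "\<dots> = 0"
      using assms i by (intro prod_zero bexI[of _ i]) (auto simp: emeasure_disc_measure)
    finally show "?N \<in> null_sets (\<Pi>\<^sub>M i\<in>J. disc_measure)"
      using assms by (auto intro!: null_setsI sets_PiM_I_finite)
    show "{x \<in> space (\<Pi>\<^sub>M i\<in>J. disc_measure). \<not> norm (x i) < 1} \<subseteq> ?N"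
      by (auto simp: space_PiM PiE_def Pi_def)
  qed
qed

text \<open>One coordinate is integrated out at a time; the coordinate set is an arbitrary finite J
  so that this becomes an induction. The one-variable kernels enter only through \<open>rep\<close>,
  which lets the same argument serve the Bergman kernel and the normalized Jacobians on
  pseudohyperbolic discs.\<close>

lemma disc_product_reproducing:
  fixes g :: "('i \<Rightarrow> complex) \<Rightarrow> complex" and \<kappa> :: "'i \<Rightarrow> complex \<Rightarrow> complex"
  assumes "finite J" and "g \<in> borel_measurable (\<Pi>\<^sub>M i\<in>J. disc_measure)"
    and \<kappa>: "\<And>i. \<kappa> i \<in> borel_measurable borel"
    and rep: "\<And>i h. h holomorphic_on ball 0 1 \<Longrightarrow> h \<in> borel_measurable borel \<Longrightarrow>
      integrable disc_measure (\<lambda>w. h w * \<kappa> i w) \<Longrightarrow> (\<integral>w. h w * \<kappa> i w \<partial>disc_measure) = h (\<zeta> i)"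
    and \<zeta>: "\<And>i. norm (\<zeta> i) < 1"
    and "\<And>i x. i \<in> J \<Longrightarrow> x \<in> J \<rightarrow>\<^sub>E ball 0 1 \<Longrightarrow> (\<lambda>t. g (x(i := t))) holomorphic_on ball 0 1"
    and "integrable (\<Pi>\<^sub>M i\<in>J. disc_measure) (\<lambda>x. g x * (\<Prod>i\<in>J. \<kappa> i (x i)))"
  shows "(\<integral>x. g x * (\<Prod>i\<in>J. \<kappa> i (x i)) \<partial>(\<Pi>\<^sub>M i\<in>J. disc_measure)) = g (restrict \<zeta> J)"
  using assms(1,2,6,7)
proof (induction J arbitrary: g rule: finite_induct)
  case empty
  then show ?case by (simp add: PiM_empty lebesgue_integral_count_space_finite restrict_def)
next
  case (insert i I)
  note [measurable] = insert.prems(1) \<kappa>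
  let ?f = "\<lambda>x. g x * (\<Prod>j\<in>insert i I. \<kappa> j (x j))"
  let ?P = "\<lambda>x. \<Prod>j\<in>I. \<kappa> j (x j)"
  define g' where "g' x = g (x(i := \<zeta> i))" for x
  have upd: "?f (x(i := t)) = (g (x(i := t)) * \<kappa> i t) * ?P x" for x t
  proof -
    have "(\<Prod>j\<in>I. \<kappa> j ((x(i := t)) j)) = ?P x"
      using insert.hyps by (intro prod.cong) auto
    then show ?thesis using insert.hyps by (simp add: mult_ac)
  qed
  have [measurable]: "?f \<in> borel_measurable (\<Pi>\<^sub>M i\<in>insert i I. disc_measure)"
    by (rule borel_measurable_integrable) (rule insert.prems(3))
  have fin: "(\<integral>\<^sup>+x. \<integral>\<^sup>+t. ennreal (norm (?f (x(i := t)))) \<partial>disc_measure \<partial>(\<Pi>\<^sub>M i\<in>I. disc_measure)) < \<infinity>"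
  proof -
    have "(\<integral>\<^sup>+x. \<integral>\<^sup>+t. ennreal (norm (?f (x(i := t)))) \<partial>disc_measure \<partial>(\<Pi>\<^sub>M i\<in>I. disc_measure)) =
        (\<integral>\<^sup>+x. ennreal (norm (?f x)) \<partial>(\<Pi>\<^sub>M i\<in>insert i I. disc_measure))"
      by (rule disc_product.product_nn_integral_insert[symmetric]) (use insert.hyps in simp_all)
    also have "\<dots> < \<infinity>" using insert.prems(3) by (simp add: integrable_iff_bounded)
    finally show ?thesis .
  qed
  have meas_upd [measurable]: "(\<lambda>t. x(i := t)) \<in> measurable borel (\<Pi>\<^sub>M i\<in>insert i I. disc_measure)"
    if "x \<in> space (\<Pi>\<^sub>M i\<in>I. disc_measure)" for x
    using measurable_component_update[OF that insert.hyps(2)]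
    by (simp only: measurable_cong_sets[OF sets_disc_measure refl])
  have meas_fst [measurable]: "(\<lambda>x. x(i := c)) \<in> measurable (\<Pi>\<^sub>M i\<in>I. disc_measure) (\<Pi>\<^sub>M i\<in>insert i I. disc_measure)" for c
    by (rule measurable_fun_upd) auto
  have sigma_finite_disc: "sigma_finite_measure disc_measure"
    by (rule disc_product.sigma_finite_measures)
  have joint: "(\<lambda>(x, t). ?f (x(i := t))) \<in> borel_measurable ((\<Pi>\<^sub>M i\<in>I. disc_measure) \<Otimes>\<^sub>M disc_measure)"
    using measurable_compose[OF measurable_add_dim[where M = "\<lambda>_. disc_measure" and I = I and i = i], of ?f borel]
    by (simp add: split_beta')
  have meas_nn: "(\<lambda>x. \<integral>\<^sup>+t. ennreal (norm (?f (x(i := t)))) \<partial>disc_measure) \<in> borel_measurable (\<Pi>\<^sub>M i\<in>I. disc_measure)"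
    using measurable_compose[OF joint, of "\<lambda>c. ennreal (norm c)" borel]
    by (intro sigma_finite_measure.borel_measurable_nn_integral[OF sigma_finite_disc]) (simp add: split_beta')
  \<comment> \<open>Finiteness of the iterated norm integral makes almost every slice integrable,
    which \<open>rep\<close> requires.\<close>
  have "AE x in (\<Pi>\<^sub>M i\<in>I. disc_measure). (\<integral>\<^sup>+t. ennreal (norm (?f (x(i := t)))) \<partial>disc_measure) \<noteq> \<infinity>"
    by (rule nn_integral_noteq_infinite) (use fin meas_nn in \<open>auto simp: less_top\<close>)
  then have slice: "AE x in (\<Pi>\<^sub>M i\<in>I. disc_measure).
      integrable disc_measure (\<lambda>t. ?f (x(i := t))) \<and> (\<integral>t. ?f (x(i := t)) \<partial>disc_measure) = g' x * ?P x"
    using AE_disc_product[OF insert.hyps(1)] AE_space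
  proof eventually_elim
    case (elim x)
    have x: "x \<in> space (\<Pi>\<^sub>M i\<in>I. disc_measure)" by fact
    note [measurable] = meas_upd[OF x]
    have "(\<lambda>t. ?f (x(i := t))) \<in> borel_measurable disc_measure"
      by (simp cong: measurable_cong_sets)
    then have int: "integrable disc_measure (\<lambda>t. ?f (x(i := t)))"
      using elim(1) by (simp add: integrable_iff_bounded less_top)
    have "(\<integral>t. ?f (x(i := t)) \<partial>disc_measure) = g' x * ?P x"
    \<comment> \<open>The slice of g times its kernel is integrable after division by the remaining
      product; where that product vanishes both sides are 0.\<close>
    proof (cases "?P x = 0")
      case True
      then show ?thesis unfolding upd by simp
    next
      case False
      have "(\<lambda>t. g (x(i := t))) holomorphic_on ball 0 1"
      proof -
        have "x(i := 0) \<in> insert i I \<rightarrow>\<^sub>E ball 0 1"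
          using elim(2) x by (auto simp: PiE_def extensional_def space_PiM)
        from insert.prems(2)[OF insertI1 this] show ?thesis unfolding fun_upd_upd .
      qed
      moreover have "integrable disc_measure (\<lambda>t. g (x(i := t)) * \<kappa> i t)"
      proof -
        have "integrable disc_measure (\<lambda>t. (g (x(i := t)) * \<kappa> i t * ?P x) * inverse (?P x))"
          by (rule integrable_mult_left) (use int in \<open>simp only: upd\<close>)
        moreover have "(\<lambda>t. (g (x(i := t)) * \<kappa> i t * ?P x) * inverse (?P x)) = (\<lambda>t. g (x(i := t)) * \<kappa> i t)"
          using False by (simp add: fun_eq_iff)
        ultimately show ?thesis by (simp only:)
      qed
      moreover have "(\<lambda>t. g (x(i := t))) \<in> borel_measurable borel" by measurable
      ultimately have "(\<integral>t. g (x(i := t)) * \<kappa> i t \<partial>disc_measure) = g' x"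
        unfolding g'_def by (intro rep)
      then show ?thesis unfolding upd by simp
    qed
    with int show ?case by blast
  qed
  have [measurable]: "g' \<in> borel_measurable (\<Pi>\<^sub>M i\<in>I. disc_measure)"
    unfolding g'_def by measurable
  have int': "integrable (\<Pi>\<^sub>M i\<in>I. disc_measure) (\<lambda>x. g' x * ?P x)"
  proof (rule integrableI_bounded)
    have "(\<integral>\<^sup>+x. ennreal (norm (g' x * ?P x)) \<partial>(\<Pi>\<^sub>M i\<in>I. disc_measure)) \<le>
        (\<integral>\<^sup>+x. \<integral>\<^sup>+t. ennreal (norm (?f (x(i := t)))) \<partial>disc_measure \<partial>(\<Pi>\<^sub>M i\<in>I. disc_measure))"
    proof (rule nn_integral_mono_AE)
      show "AE x in (\<Pi>\<^sub>M i\<in>I. disc_measure). ennreal (norm (g' x * ?P x)) \<le>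
          (\<integral>\<^sup>+t. ennreal (norm (?f (x(i := t)))) \<partial>disc_measure)"
        using slice
      proof eventually_elim
        case (elim x)
        from integral_norm_bound_ennreal[OF elim[THEN conjunct1]]
        show ?case unfolding elim[THEN conjunct2] .
      qed
    qed
    then show "(\<integral>\<^sup>+x. ennreal (norm (g' x * ?P x)) \<partial>(\<Pi>\<^sub>M i\<in>I. disc_measure)) < \<infinity>"
      using fin by (rule le_less_trans)
  qed measurable
  have "(\<integral>x. ?f x \<partial>(\<Pi>\<^sub>M i\<in>insert i I. disc_measure)) =
      (\<integral>x. \<integral>t. ?f (x(i := t)) \<partial>disc_measure \<partial>(\<Pi>\<^sub>M i\<in>I. disc_measure))"
    by (rule disc_product.product_integral_insert) (use insert in simp_all)
  also have "\<dots> = (\<integral>x. g' x * ?P x \<partial>(\<Pi>\<^sub>M i\<in>I. disc_measure))"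
  proof (rule integral_cong_AE)
    show "(\<lambda>x. \<integral>t. ?f (x(i := t)) \<partial>disc_measure) \<in> borel_measurable (\<Pi>\<^sub>M i\<in>I. disc_measure)"
      by (rule sigma_finite_measure.borel_measurable_lebesgue_integral[OF sigma_finite_disc joint])
    show "AE x in (\<Pi>\<^sub>M i\<in>I. disc_measure). (\<integral>t. ?f (x(i := t)) \<partial>disc_measure) = g' x * ?P x"
      using slice by (rule eventually_mono) (rule conjunct2)
  qed measurable
  also have "\<dots> = g' (restrict \<zeta> I)"
  proof (rule insert.IH[OF _ _ int'])
    fix j and x :: "'i \<Rightarrow> complex" assume j: "j \<in> I" and x: "x \<in> I \<rightarrow>\<^sub>E ball 0 1"
    have "x(i := \<zeta> i) \<in> insert i I \<rightarrow>\<^sub>E ball 0 1"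
      using x \<zeta> by (auto simp: PiE_def extensional_def)
    from insert.prems(2)[OF insertI2[OF j] this]
    have "(\<lambda>t. g (x(i := \<zeta> i, j := t))) holomorphic_on ball 0 1" .
    moreover have "x(i := \<zeta> i, j := t) = x(j := t, i := \<zeta> i)" for t
      using j insert.hyps by (intro fun_upd_twist) auto
    ultimately show "(\<lambda>t. g' (x(j := t))) holomorphic_on ball 0 1"
      unfolding g'_def by (simp only:)
  qed measurable
  also have "\<dots> = g (restrict \<zeta> (insert i I))"
  proof -
    have "(restrict \<zeta> I)(i := \<zeta> i) = restrict \<zeta> (insert i I)" by (auto simp: fun_eq_iff)
    then show ?thesis unfolding g'_def by simp
  qed
  finally show ?case .
qed

lemma dv_reproducing:
  fixes f :: "complex ^ 'n::finite \<Rightarrow> complex"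
  assumes [measurable]: "f \<in> borel_measurable borel" and \<kappa> [measurable]: "\<And>i. \<kappa> i \<in> borel_measurable borel"
    and hol: "\<And>i x. x \<in> polydisk \<Longrightarrow> (\<lambda>t. f (\<chi> j. if j = i then t else x $ j)) holomorphic_on ball 0 1"
    and rep: "\<And>i h. h holomorphic_on ball 0 1 \<Longrightarrow> h \<in> borel_measurable borel \<Longrightarrow>
      integrable disc_measure (\<lambda>w. h w * \<kappa> i w) \<Longrightarrow> (\<integral>w. h w * \<kappa> i w \<partial>disc_measure) = h (z $ i)"
    and z: "z \<in> polydisk" and int: "integrable dv (\<lambda>w. f w * (\<Prod>i\<in>UNIV. \<kappa> i (w $ i)))"
  shows "(\<integral>w. f w * (\<Prod>i\<in>UNIV. \<kappa> i (w $ i)) \<partial>dv) = f z"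
proof -
  have [measurable]: "(\<lambda>w. f w * (\<Prod>i\<in>UNIV. \<kappa> i (w $ i))) \<in> borel_measurable borel" by measurable
  have "(\<integral>w. f w * (\<Prod>i\<in>UNIV. \<kappa> i (w $ i)) \<partial>dv) =
      (\<integral>x. f (vec_lambda x) * (\<Prod>i\<in>UNIV. \<kappa> i (x i)) \<partial>(\<Pi>\<^sub>M i\<in>(UNIV :: 'n set). disc_measure))"
    unfolding dv_eq by (subst integral_distr) simp_all
  also have "\<dots> = f (vec_lambda (restrict (\<lambda>i. z $ i) UNIV))"
  proof (rule disc_product_reproducing)
    show "(\<lambda>x. f (vec_lambda x)) \<in> borel_measurable (\<Pi>\<^sub>M i\<in>(UNIV :: 'n set). disc_measure)" by measurable
    show "norm (z $ i) < 1" for i using z by (simp add: polydisk_def)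
    show "integrable (\<Pi>\<^sub>M i\<in>(UNIV :: 'n set). disc_measure) (\<lambda>x. f (vec_lambda x) * (\<Prod>i\<in>UNIV. \<kappa> i (x i)))"
      using int unfolding dv_eq by (subst (asm) integrable_distr_eq) simp_all
    show "(\<lambda>t. f (vec_lambda (x(i := t)))) holomorphic_on ball 0 1"
      if "x \<in> UNIV \<rightarrow>\<^sub>E ball 0 1" for i :: 'n and x
    proof -
      have "vec_lambda x \<in> polydisk" using that by (auto simp: polydisk_def)
      from hol[OF this, of i] show ?thesis unfolding fun_upd_def vec_lambda_beta .
    qed
  qed (use rep in auto)
  finally show ?thesis by (simp add: vec_nth_inverse restrict_def)
qed

section \<open>Point evaluations and normalized kernels\<close>

definition poly_delta :: "complex ^ 'n::finite \<Rightarrow> real"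
  where "poly_delta z = (\<Prod>i\<in>UNIV. 1 - (norm (z $ i))\<^sup>2)"

lemma poly_delta_pos: "z \<in> polydisk \<Longrightarrow> poly_delta z > 0"
  unfolding poly_delta_def polydisk_def by (intro prod_pos ballI norm_less_one_sq_pos) auto

lemma bergman_fun_measurable [measurable]: "bergman_fun f \<in> borel_measurable borel"
  by (rule bergman_functions_measurable[OF bergman_fun])

lemma bergman_fun_outside: "z \<notin> polydisk \<Longrightarrow> bergman_fun f z = 0"
  using bergman_fun[of f] by (simp add: bergman_functions_def)

lemma bergman_fun_slice:
  "z \<in> polydisk \<Longrightarrow> (\<lambda>t. bergman_fun f (\<chi> j. if j = i then t else z $ j)) holomorphic_on ball 0 1"
  using bergman_fun[of f] by (simp add: bergman_functions_def polydisk_analytic_def)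

lemma bergman_fun_continuous: "continuous_on polydisk (bergman_fun f)"
  using bergman_fun[of f] by (simp add: bergman_functions_def polydisk_analytic_def)

lemma bergman_fun_square_integrable: "integrable dv (\<lambda>w. (norm (bergman_fun f w))\<^sup>2)"
  using bergman_fun[of f] by (simp add: bergman_functions_def)

lemma bergman_inner_self: "bergman_inner f f = of_real ((norm f)\<^sup>2)"
proof -
  have "bergman_inner f f = complex_of_real (\<integral>w. (norm (bergman_fun f w))\<^sup>2 \<partial>dv)"
    unfolding bergman_inner_def integral_complex_of_real[symmetric]
    by (simp only: complex_norm_square)
  moreover have "(\<integral>w. (norm (bergman_fun f w))\<^sup>2 \<partial>dv) \<ge> 0" by simp
  ultimately show ?thesis by (simp add: norm_bergman_def)
qed

lemma norm_bergman_sq: "(norm f)\<^sup>2 = (\<integral>w. (norm (bergman_fun f w))\<^sup>2 \<partial>dv)"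
proof -
  have "bergman_inner f f = complex_of_real (\<integral>w. (norm (bergman_fun f w))\<^sup>2 \<partial>dv)"
    unfolding bergman_inner_def integral_complex_of_real[symmetric]
    by (simp only: complex_norm_square)
  then show ?thesis unfolding bergman_inner_self of_real_eq_iff .
qed

text \<open>The conjugate of the kernel is a product of one-variable kernels, so the reproducing
  property of the disc applies in every coordinate. The factor \<open>poly_delta z\<close> is the
  reciprocal of the norm of the unnormalized reproducing kernel.\<close>

lemma bergman_inner_kernel:
  fixes f :: "'n::finite bergman"
  assumes z: "z \<in> polydisk"
  shows "bergman_inner f (normalized_kernel z) = of_real (poly_delta z) * bergman_fun f z"
proof -
  define \<kappa> where "\<kappa> i w = 1 / (1 - z $ i * cnj w)\<^sup>2" for i w
  have \<kappa> [measurable]: "\<kappa> i \<in> borel_measurable borel" for i unfolding \<kappa>_def by measurable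
  have eq: "bergman_fun f w * cnj (bergman_fun (normalized_kernel z) w) =
      of_real (poly_delta z) * (bergman_fun f w * (\<Prod>i\<in>UNIV. \<kappa> i (w $ i)))" for w
  proof (cases "w \<in> polydisk")
    case True
    then show ?thesis
      by (simp add: bergman_fun_normalized_kernel[OF z] normalized_kernel_fun_def prod_dividef
          poly_delta_def \<kappa>_def mult.commute[of "cnj _"] del: of_real_diff)
  qed (simp add: bergman_fun_outside)
  have "poly_delta z \<noteq> 0" using poly_delta_pos[OF z] by simp
  have "integrable dv (\<lambda>w. of_real (poly_delta z) * (bergman_fun f w * (\<Prod>i\<in>UNIV. \<kappa> i (w $ i))))"
    using bergman_functions_integrable_mult[OF bergman_fun bergman_fun, of f "normalized_kernel z"]
    unfolding eq .
  from integrable_mult_right[OF this, of "inverse (of_real (poly_delta z))"]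
  have int: "integrable dv (\<lambda>w. bergman_fun f w * (\<Prod>i\<in>UNIV. \<kappa> i (w $ i)))"
    using \<open>poly_delta z \<noteq> 0\<close> by (simp add: mult.assoc[symmetric])
  have zi: "norm (z $ i) < 1" for i using z by (simp add: polydisk_def)
  have "bergman_inner f (normalized_kernel z) =
      of_real (poly_delta z) * (\<integral>w. bergman_fun f w * (\<Prod>i\<in>UNIV. \<kappa> i (w $ i)) \<partial>dv)"
    unfolding bergman_inner_def eq by simp
  also have "(\<integral>w. bergman_fun f w * (\<Prod>i\<in>UNIV. \<kappa> i (w $ i)) \<partial>dv) = bergman_fun f z"
  proof (rule dv_reproducing[OF bergman_fun_measurable \<kappa> bergman_fun_slice _ z int])
    fix i and h :: "complex \<Rightarrow> complex"
    assume "h holomorphic_on ball 0 1" "h \<in> borel_measurable borel"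
      "integrable disc_measure (\<lambda>w. h w * \<kappa> i w)"
    then show "(\<integral>w. h w * \<kappa> i w \<partial>disc_measure) = h (z $ i)"
      unfolding \<kappa>_def by (rule disc_reproducing[OF zi])
  qed
  finally show ?thesis .
qed

lemma bergman_inner_normalized_kernels:
  assumes "z \<in> polydisk" "w \<in> polydisk"
  shows "bergman_inner (normalized_kernel w) (normalized_kernel z) =
    of_real (poly_delta z * poly_delta w) / (\<Prod>i\<in>UNIV. (1 - z $ i * cnj (w $ i))\<^sup>2)"
  unfolding bergman_inner_kernel[OF assms(1)] bergman_fun_normalized_kernel[OF assms(2)]
    normalized_kernel_fun_def prod_dividef poly_delta_def using assms by simp

lemma norm_normalized_kernel: 
  assumes "z \<in> polydisk"
  shows "norm (normalized_kernel z) = 1"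
proof -
  have "(\<Prod>i\<in>UNIV. (1 - z $ i * cnj (z $ i))\<^sup>2) = complex_of_real (poly_delta z * poly_delta z)"
  proof -
    have "1 - z $ i * cnj (z $ i) = complex_of_real (1 - (norm (z $ i))\<^sup>2)" for i
      by (simp add: of_real_norm_sq)
    then show ?thesis
      by (simp only: of_real_power[symmetric] of_real_prod[symmetric] prod_power_distrib[symmetric]
          poly_delta_def power2_eq_square[of "prod _ _"])
  qed
  moreover have "poly_delta z \<noteq> 0" using poly_delta_pos[OF assms] by simp
  ultimately have "bergman_inner (normalized_kernel z) (normalized_kernel z) = 1"
    unfolding bergman_inner_normalized_kernels[OF assms assms] by simp
  then have "(norm (normalized_kernel z))\<^sup>2 = 1"
    unfolding bergman_inner_self by (metis of_real_eq_1_iff)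
  then show ?thesis by (simp add: power2_eq_1_iff) (metis norm_ge_zero neg_0_le_iff_le not_one_le_zero)
qed

lemma norm_bergman_fun_le:
  assumes "z \<in> polydisk"
  shows "poly_delta z * norm (bergman_fun f z) \<le> norm f"
  using norm_bergman_inner_le[of f "normalized_kernel z"] poly_delta_pos[OF assms]
  by (simp add: bergman_inner_kernel[OF assms] norm_normalized_kernel[OF assms] norm_mult)

text \<open>A product of pseudohyperbolic discs of radius \<rho>. Unlike a ball of
  \<open>polydisk_dist\<close> it has an indicator that factorizes, which fits coordinatewise
  integration.\<close>

definition polydisk_nbhd :: "complex ^ 'n::finite \<Rightarrow> real \<Rightarrow> (complex ^ 'n) set"
  where "polydisk_nbhd z \<rho> = {w \<in> polydisk. \<forall>i. norm (mobius (z $ i) (w $ i)) < \<rho>}"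

lemma measurable_polydisk_nbhd [measurable]: "polydisk_nbhd z \<rho> \<in> sets borel"
proof -
  have [measurable]: "(polydisk :: (complex ^ 'a) set) \<in> sets borel" by (rule borel_open[OF open_polydisk])
  have "polydisk_nbhd z \<rho> = polydisk \<inter> (\<Inter>i\<in>UNIV. {w. norm (mobius (z $ i) (w $ i)) < \<rho>})"
    by (auto simp: polydisk_nbhd_def)
  also have "\<dots> \<in> sets borel" by (intro sets.Int sets.finite_INT) measurable
  finally show ?thesis .
qed

text \<open>The square of f is again holomorphic in each variable, so it equals its average against
  the normalized Jacobian on the neighbourhood. The estimate |1 - w cnj z| \<ge> (1 - |z|^2) / 2
  bounds each Jacobian by 16 / (1 - |z|^2)^2, which is the origin of the constant.\<close>

lemma bergman_submean:
  fixes f :: "'n::finite bergman"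
  assumes z: "z \<in> polydisk" and \<rho>: "0 < \<rho>" "\<rho> < 1"
  shows "(poly_delta z)\<^sup>2 * (norm (bergman_fun f z))\<^sup>2 \<le>
    (16 / \<rho>\<^sup>2) ^ CARD('n) * (\<integral>w. indicator (polydisk_nbhd z \<rho>) w * (norm (bergman_fun f w))\<^sup>2 \<partial>dv)"
proof -
  \<comment> \<open>The Jacobian cut off to the pseudohyperbolic disc of radius \<rho> has total
    mass \<rho>^2, the normalized area of the disc of radius \<rho> around 0.\<close>
  define \<kappa> where "\<kappa> i w = complex_of_real (indicator {..<\<rho>} (norm (mobius (z $ i) w)) * mobius_jac (z $ i) w / \<rho>\<^sup>2)" for i w
  have \<kappa> [measurable]: "\<kappa> i \<in> borel_measurable borel" for i unfolding \<kappa>_def by measurable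
  have zi: "norm (z $ i) < 1" for i using z by (simp add: polydisk_def)
  have P: "1 - (norm (z $ i))\<^sup>2 > 0" for i using norm_less_one_sq_pos[OF zi] .
  define g where "g w = (bergman_fun f w)\<^sup>2" for w
  have g [measurable]: "g \<in> borel_measurable borel" unfolding g_def by measurable
  have rep: "(\<integral>w. h w * \<kappa> i w \<partial>disc_measure) = h (z $ i)"
    if h: "h holomorphic_on ball 0 1" and [measurable]: "h \<in> borel_measurable borel"
      and int: "integrable disc_measure (\<lambda>w. h w * \<kappa> i w)" for i h
  proof -
    let ?F = "\<lambda>x. indicator {..<\<rho>} x / \<rho>\<^sup>2"
    have eq: "h w * \<kappa> i w = (?F (norm (mobius (z $ i) w)) * mobius_jac (z $ i) w) *\<^sub>R h w" for w
      by (simp add: \<kappa>_def scaleR_conv_of_real)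
    have "(\<integral>w. (?F (norm (mobius (z $ i) w)) * mobius_jac (z $ i) w) *\<^sub>R h w \<partial>disc_measure) =
        (\<integral>v. ?F (norm v) \<partial>disc_measure) *\<^sub>R h (z $ i)"
      by (rule radial_mobius_mean_value[OF zi h]) (use int in \<open>simp_all only: eq, measurable\<close>)
    also have "(\<integral>v. ?F (norm v) \<partial>disc_measure) = 1"
    proof -
      have "(\<lambda>v::complex. ?F (norm v)) = (\<lambda>v. indicator (ball 0 \<rho>) v / \<rho>\<^sup>2)"
        by (auto simp: fun_eq_iff indicator_def)
      then have "(\<integral>v. ?F (norm v) \<partial>disc_measure) = measure disc_measure (ball 0 \<rho>) / \<rho>\<^sup>2"
        by simp
      also have "measure disc_measure (ball 0 \<rho>) = \<rho>\<^sup>2"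
        using emeasure_disc_ball[of \<rho>] \<rho> by (simp add: measure_def)
      also have "\<rho>\<^sup>2 / \<rho>\<^sup>2 = 1" using \<rho> by simp
      finally show ?thesis .
    qed
    finally show ?thesis unfolding eq by simp
  qed
  have bound: "norm (g w * (\<Prod>i\<in>UNIV. \<kappa> i (w $ i))) \<le>
      (16 / \<rho>\<^sup>2) ^ CARD('n) / (poly_delta z)\<^sup>2 * (indicator (polydisk_nbhd z \<rho>) w * (norm (bergman_fun f w))\<^sup>2)" for w
  proof (cases "w \<in> polydisk_nbhd z \<rho>")
    case True
    then have wi: "norm (w $ i) < 1" for i by (simp add: polydisk_nbhd_def polydisk_def)
    have "norm (\<Prod>i\<in>UNIV. \<kappa> i (w $ i)) \<le> (\<Prod>i\<in>(UNIV :: 'n set). 16 / \<rho>\<^sup>2 / (1 - (norm (z $ i))\<^sup>2)\<^sup>2)"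
      unfolding prod_norm[symmetric]
    proof (intro prod_mono conjI norm_ge_zero)
      fix i
      have "norm (w $ i * cnj (z $ i)) \<le> norm (z $ i)"
        using mult_right_mono[of "norm (w $ i)" 1 "norm (z $ i)"] wi[of i] by (simp add: norm_mult)
      then have "norm (1 - w $ i * cnj (z $ i)) \<ge> 1 - norm (z $ i)"
        using norm_triangle_ineq2[of 1 "w $ i * cnj (z $ i)"] by simp
      moreover have "1 - norm (z $ i) \<ge> (1 - (norm (z $ i))\<^sup>2) / 2"
      proof -
        have "1 - (norm (z $ i))\<^sup>2 = (1 - norm (z $ i)) * (1 + norm (z $ i))"
          by (simp add: power2_eq_square algebra_simps)
        also have "\<dots> \<le> (1 - norm (z $ i)) * 2" using zi[of i] by (intro mult_left_mono) auto
        finally show ?thesis by simp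
      qed
      ultimately have "((1 - (norm (z $ i))\<^sup>2) / 2) ^ 4 \<le> norm (1 - w $ i * cnj (z $ i)) ^ 4"
        using P[of i] by (intro power_mono) auto
      then have "mobius_jac (z $ i) (w $ i) \<le> (1 - (norm (z $ i))\<^sup>2)\<^sup>2 / ((1 - (norm (z $ i))\<^sup>2) / 2) ^ 4"
        unfolding mobius_jac_def using P[of i] by (intro divide_left_mono mult_pos_pos) auto
      also have "\<dots> = 16 / (1 - (norm (z $ i))\<^sup>2)\<^sup>2"
        using P[of i] by (simp add: power_divide field_simps)
      finally have "mobius_jac (z $ i) (w $ i) / \<rho>\<^sup>2 \<le> 16 / (1 - (norm (z $ i))\<^sup>2)\<^sup>2 / \<rho>\<^sup>2"
        using \<rho> by (intro divide_right_mono) auto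
      then show "norm (\<kappa> i (w $ i)) \<le> 16 / \<rho>\<^sup>2 / (1 - (norm (z $ i))\<^sup>2)\<^sup>2"
        using True mobius_jac_nonneg[of "z $ i" "w $ i"] unfolding \<kappa>_def norm_of_real
        by (simp add: polydisk_nbhd_def mult.commute)
    qed
    also have "\<dots> = (16 / \<rho>\<^sup>2) ^ CARD('n) / (poly_delta z)\<^sup>2"
      by (simp add: prod.distrib prod_dividef poly_delta_def prod_power_distrib power_divide)
    finally have "norm (\<Prod>i\<in>UNIV. \<kappa> i (w $ i)) \<le> (16 / \<rho>\<^sup>2) ^ CARD('n) / (poly_delta z)\<^sup>2" .
    from mult_right_mono[OF this, of "(norm (bergman_fun f w))\<^sup>2"] show ?thesis
      using True by (simp add: norm_mult g_def norm_power mult.commute[of "norm (bergman_fun f w) ^ 2"])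
  next
    case False
    then have "g w * (\<Prod>i\<in>UNIV. \<kappa> i (w $ i)) = 0"
    proof (cases "w \<in> polydisk")
      case True
      with False obtain i where "\<not> norm (mobius (z $ i) (w $ i)) < \<rho>" by (auto simp: polydisk_nbhd_def)
      then have "\<kappa> i (w $ i) = 0" by (simp add: \<kappa>_def)
      then show ?thesis by (metis mult_zero_right prod_zero finite UNIV_I)
    qed (simp add: g_def bergman_fun_outside)
    then show ?thesis using False by simp
  qed
  have int_ind: "integrable dv (\<lambda>w. indicator (polydisk_nbhd z \<rho>) w * (norm (bergman_fun f w))\<^sup>2)"
    using integrable_mult_indicator[of "polydisk_nbhd z \<rho>" dv, OF _ bergman_fun_square_integrable[of f]]
    by simp
  have int: "integrable dv (\<lambda>w. g w * (\<Prod>i\<in>UNIV. \<kappa> i (w $ i)))"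
  proof (rule Bochner_Integration.integrable_bound[OF integrable_mult_right[OF int_ind, of "(16 / \<rho>\<^sup>2) ^ CARD('n) / (poly_delta z)\<^sup>2"]])
    show "(\<lambda>w. g w * (\<Prod>i\<in>UNIV. \<kappa> i (w $ i))) \<in> borel_measurable dv" by measurable
    show "AE w in dv. norm (g w * (\<Prod>i\<in>UNIV. \<kappa> i (w $ i))) \<le>
      norm ((16 / \<rho>\<^sup>2) ^ CARD('n) / (poly_delta z)\<^sup>2 * (indicator (polydisk_nbhd z \<rho>) w * (norm (bergman_fun f w))\<^sup>2))"
      using bound by (intro AE_I2) (simp add: order_trans[OF _ abs_ge_self])
  qed
  have "(\<lambda>t. g (\<chi> j. if j = i then t else x $ j)) holomorphic_on ball 0 1" if "x \<in> polydisk" for i x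
    unfolding g_def by (intro holomorphic_on_power bergman_fun_slice that)
  then have "(\<integral>w. g w * (\<Prod>i\<in>UNIV. \<kappa> i (w $ i)) \<partial>dv) = g z"
    by (rule dv_reproducing[OF g \<kappa> _ rep z int])
  then have "(norm (bergman_fun f z))\<^sup>2 = norm (\<integral>w. g w * (\<Prod>i\<in>UNIV. \<kappa> i (w $ i)) \<partial>dv)"
    by (simp add: g_def norm_power)
  also have "\<dots> \<le> (\<integral>w. norm (g w * (\<Prod>i\<in>UNIV. \<kappa> i (w $ i))) \<partial>dv)" by (rule integral_norm_bound)
  also have "\<dots> \<le> (\<integral>w. (16 / \<rho>\<^sup>2) ^ CARD('n) / (poly_delta z)\<^sup>2 * (indicator (polydisk_nbhd z \<rho>) w * (norm (bergman_fun f w))\<^sup>2) \<partial>dv)"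
    using bound by (intro integral_mono integrable_norm int integrable_mult_right int_ind) auto
  finally have "(norm (bergman_fun f z))\<^sup>2 \<le>
      (16 / \<rho>\<^sup>2) ^ CARD('n) / (poly_delta z)\<^sup>2 * (\<integral>w. indicator (polydisk_nbhd z \<rho>) w * (norm (bergman_fun f w))\<^sup>2 \<partial>dv)"
    by simp
  from mult_left_mono[OF this, of "(poly_delta z)\<^sup>2"] show ?thesis
    using poly_delta_pos[OF z] by simp
qed

section \<open>The Schur test on the polydisk\<close>

definition poly_weight :: "complex ^ 'n::finite \<Rightarrow> real"
  where "poly_weight w = (\<Prod>i\<in>UNIV. disc_weight (w $ i))"

lemma poly_weight_pos: "w \<in> polydisk \<Longrightarrow> poly_weight w > 0"
  unfolding poly_weight_def polydisk_def by (intro prod_pos) (auto intro: disc_weight_pos)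

lemma poly_weight_nonneg: "poly_weight w \<ge> 0"
  unfolding poly_weight_def by (intro prod_nonneg) (auto intro: disc_weight_nonneg)

lemma measurable_poly_weight [measurable]: "poly_weight \<in> borel_measurable borel"
  unfolding poly_weight_def by measurable

definition kernel_abs :: "complex ^ 'n::finite \<Rightarrow> complex ^ 'n \<Rightarrow> real"
  where "kernel_abs z w = (\<Prod>i\<in>UNIV. 1 / (norm (1 - z $ i * cnj (w $ i)))\<^sup>2)"

text \<open>A majorant for |\<phi> z - \<phi> w| when \<phi> has values in [-1, 1] and oscillates by
  at most 1 - \<rho> within pseudohyperbolic distance \<rho>: once some coordinate is far, the sum
  contributes at least the trivial bound 2. It is itself at least 1 - \<rho>, so the unweighted
  kernel is bounded by a multiple of the weighted one.\<close>

definition far_weight :: "real \<Rightarrow> complex ^ 'n::finite \<Rightarrow> complex ^ 'n \<Rightarrow> real"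
  where "far_weight \<rho> z w = (1 - \<rho>) + 2 * (\<Sum>i\<in>UNIV. indicator {\<rho><..} (norm (mobius (z $ i) (w $ i))))"

lemma prod_mono_ennreal:
  fixes f g :: "'i \<Rightarrow> ennreal"
  shows "(\<And>i. i \<in> I \<Longrightarrow> f i \<le> g i) \<Longrightarrow> prod f I \<le> prod g I"
  by (induction I rule: infinite_finite_induct) (auto intro: mult_mono)

lemma schur_polydisk_factor:
  fixes z :: "complex ^ 'n::finite"
  assumes z: "z \<in> polydisk" and [measurable]: "\<And>i. F i \<in> borel_measurable borel"
    and F: "\<And>i x. 0 \<le> F i x" "\<And>i x. F i x \<le> 1"
  shows "(\<integral>\<^sup>+w. ennreal ((\<Prod>i\<in>UNIV. F i (norm (mobius (z $ i) (w $ i)))) * (poly_weight w * kernel_abs z w)) \<partial>dv)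
    \<le> ennreal (poly_weight z * (\<Prod>i\<in>UNIV. sqrt 2 * (\<integral>v. F i (norm v) * disc_weight v \<partial>disc_measure)))"
proof -
  define f where "f i v = F i (norm (mobius (z $ i) v)) * disc_weight v / (norm (1 - z $ i * cnj v))\<^sup>2" for i v
  have [measurable]: "f i \<in> borel_measurable borel" for i unfolding f_def by measurable
  have f0: "f i v \<ge> 0" for i v using F disc_weight_nonneg by (simp add: f_def)
  have "(\<integral>\<^sup>+w. ennreal ((\<Prod>i\<in>UNIV. F i (norm (mobius (z $ i) (w $ i)))) * (poly_weight w * kernel_abs z w)) \<partial>dv) =
      (\<integral>\<^sup>+w. (\<Prod>i\<in>UNIV. ennreal (f i (w $ i))) \<partial>dv)"
  proof (rule nn_integral_cong)
    fix w
    have "(\<Prod>i\<in>UNIV. ennreal (f i (w $ i))) = ennreal (\<Prod>i\<in>UNIV. f i (w $ i))"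
      by (rule prod_ennreal) (rule f0)
    then show "ennreal ((\<Prod>i\<in>UNIV. F i (norm (mobius (z $ i) (w $ i)))) * (poly_weight w * kernel_abs z w)) =
        (\<Prod>i\<in>UNIV. ennreal (f i (w $ i)))"
      by (simp add: f_def poly_weight_def kernel_abs_def prod.distrib[symmetric])
  qed
  also have "\<dots> = (\<Prod>i\<in>UNIV. \<integral>\<^sup>+v. ennreal (f i v) \<partial>disc_measure)"
    by (rule nn_integral_dv_prod) measurable
  also have "\<dots> \<le> (\<Prod>i\<in>UNIV. ennreal (disc_weight (z $ i) * (sqrt 2 * (\<integral>v. F i (norm v) * disc_weight v \<partial>disc_measure))))"
    unfolding f_def using z F by (intro prod_mono_ennreal schur_disc) (auto simp: polydisk_def)
  also have "\<dots> = ennreal (poly_weight z * (\<Prod>i\<in>UNIV. sqrt 2 * (\<integral>v. F i (norm v) * disc_weight v \<partial>disc_measure)))"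
    using F disc_weight_nonneg
    by (subst prod_ennreal) (auto simp: poly_weight_def prod.distrib intro!: mult_nonneg_nonneg integral_nonneg)
  finally show ?thesis .
qed

lemma far_weight_nonneg: "\<rho> < 1 \<Longrightarrow> far_weight \<rho> z w \<ge> 0"
  unfolding far_weight_def by (intro add_nonneg_nonneg mult_nonneg_nonneg sum_nonneg) auto

lemma kernel_abs_nonneg: "kernel_abs z w \<ge> 0"
  unfolding kernel_abs_def by (intro prod_nonneg) auto

text \<open>The constant part of \<open>far_weight\<close> is small because \<rho> is near 1. In
  each summand of the rest one coordinate carries a tail of the one-variable Schur integral, which
  is small as well, while the other coordinates contribute bounded factors.\<close>

lemma schur_polydisk:
  assumes "\<epsilon> > 0"
  obtains \<rho> where "1 / 2 \<le> \<rho>" "\<rho> < 1"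
    "\<And>z :: complex ^ 'n::finite. z \<in> polydisk \<Longrightarrow>
      (\<integral>\<^sup>+w. ennreal (far_weight \<rho> z w * (poly_weight w * kernel_abs z w)) \<partial>dv) \<le> ennreal (\<epsilon> * poly_weight z)"
proof -
  define C where "C = (\<integral>v. disc_weight v \<partial>disc_measure)"
  define n where "n = CARD('n)"
  define D where "D = (sqrt 2 * (C + 1)) ^ n"
  have C: "C \<ge> 0" unfolding C_def by (intro Bochner_Integration.integral_nonneg disc_weight_nonneg)
  have D: "D \<ge> 0" unfolding D_def using C by simp
  \<comment> \<open>The constant part costs e D and each of the n tails 2 (2 e D), so e (D + 4 n D)
    has to be at most \<epsilon>; the additional 1 keeps the denominator positive.\<close>
  define e where "e = \<epsilon> / (4 * (D * (n + 1) + 1))"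
  have e: "e > 0" using assms D by (auto simp: e_def intro!: divide_pos_pos add_nonneg_pos mult_pos_pos)
  obtain r where r: "0 < r" "r < 1" "(\<integral>v. indicator {r<..} (norm v) * disc_weight v \<partial>disc_measure) \<le> e"
    using disc_weight_tail[OF e] .
  \<comment> \<open>Three requirements: a small tail beyond \<rho>, a small value of 1 - \<rho>, and
    the lower bound 1/2 that is used when kernels are averaged over neighbourhoods of radius
    1/2.\<close>
  define \<rho> where "\<rho> = max (max r (1 / 2)) (1 - e)"
  have \<rho>: "r \<le> \<rho>" "1 / 2 \<le> \<rho>" "\<rho> < 1" "1 - \<rho> \<le> e" using r e unfolding \<rho>_def by linarith+
  have "(\<integral>\<^sup>+w. ennreal (far_weight \<rho> z w * (poly_weight w * kernel_abs z w)) \<partial>dv) \<le> ennreal (\<epsilon> * poly_weight z)"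
    if z: "z \<in> polydisk" for z :: "complex ^ 'n"
  proof -
    let ?K = "\<lambda>w. poly_weight w * kernel_abs z w"
    define I where "I i w = (\<Prod>j\<in>UNIV. (if j = i then indicator {\<rho><..} else (\<lambda>_. 1)) (norm (mobius (z $ j) (w $ j))) :: real)"
      for i :: 'n and w :: "complex ^ 'n"
    have [measurable]: "I i \<in> borel_measurable borel" for i
      unfolding I_def by (intro borel_measurable_prod) (auto split: if_splits)
    have [measurable]: "kernel_abs z \<in> borel_measurable borel" unfolding kernel_abs_def by measurable
    have I: "I i w = indicator {\<rho><..} (norm (mobius (z $ i) (w $ i)))" for i w
    proof -
      have "I i w = (\<Prod>j\<in>UNIV. if j = i then indicator {\<rho><..} (norm (mobius (z $ j) (w $ j))) else 1)"
        unfolding I_def by (intro prod.cong) auto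
      then show ?thesis by simp
    qed
    have one: "(\<integral>\<^sup>+w. ennreal (?K w) \<partial>dv) \<le> ennreal (poly_weight z * D)"
    proof -
      have "(\<integral>\<^sup>+w. ennreal ((\<Prod>i\<in>(UNIV :: 'n set). 1) * ?K w) \<partial>dv) \<le>
          ennreal (poly_weight z * (\<Prod>i\<in>(UNIV :: 'n set). sqrt 2 * (\<integral>v. 1 * disc_weight v \<partial>disc_measure)))"
        by (rule schur_polydisk_factor[OF z]) auto
      also have "(\<Prod>i\<in>(UNIV :: 'n set). sqrt 2 * (\<integral>v. 1 * disc_weight v \<partial>disc_measure)) \<le> D"
        unfolding D_def n_def using C by (auto simp: C_def intro!: power_mono)
      finally show ?thesis using poly_weight_nonneg[of z]
        by (auto simp: mult_left_mono ennreal_leI elim!: order_trans)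
    qed
    have tail: "(\<integral>\<^sup>+w. ennreal (I i w * ?K w) \<partial>dv) \<le> ennreal (poly_weight z * (2 * e * D))" for i
    proof -
      let ?F = "\<lambda>j. if j = i then indicator {\<rho><..} else (\<lambda>_. 1::real)"
      have "(\<integral>\<^sup>+w. ennreal (I i w * ?K w) \<partial>dv) \<le>
          ennreal (poly_weight z * (\<Prod>j\<in>UNIV. sqrt 2 * (\<integral>v. ?F j (norm v) * disc_weight v \<partial>disc_measure)))"
        unfolding I_def by (rule schur_polydisk_factor[OF z]) (auto simp: indicator_def)
      also have "\<dots> \<le> ennreal (poly_weight z * (2 * e * D))"
      proof (intro ennreal_leI mult_left_mono poly_weight_nonneg)
        have "(\<integral>v. indicator {\<rho><..} (norm v) * disc_weight v \<partial>disc_measure) \<le>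
            (\<integral>v. indicator {r<..} (norm v) * disc_weight v \<partial>disc_measure)"
        proof (rule integral_mono)
          have int: "integrable disc_measure (\<lambda>v. indicator {s<..} (norm v) * disc_weight v)" for s
            by (rule Bochner_Integration.integrable_bound[OF integrable_disc_weight])
              (auto simp: indicator_def disc_weight_nonneg)
          show "integrable disc_measure (\<lambda>v. indicator {\<rho><..} (norm v) * disc_weight v)"
            "integrable disc_measure (\<lambda>v. indicator {r<..} (norm v) * disc_weight v)" by (rule int)+
          show "indicator {\<rho><..} (norm v) * disc_weight v \<le> indicator {r<..} (norm v) * disc_weight v" for v
            using \<rho>(1) disc_weight_nonneg by (intro mult_right_mono) (auto simp: indicator_def)
        qed
        with r(3) have t: "(\<integral>v. indicator {\<rho><..} (norm v) * disc_weight v \<partial>disc_measure) \<le> e" by linarith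
        have t0: "(\<integral>v. indicator {\<rho><..} (norm v) * disc_weight v \<partial>disc_measure) \<ge> 0"
          by (intro Bochner_Integration.integral_nonneg mult_nonneg_nonneg disc_weight_nonneg) auto
        have "(\<Prod>j\<in>UNIV. sqrt 2 * (\<integral>v. ?F j (norm v) * disc_weight v \<partial>disc_measure)) =
            (sqrt 2 * (\<integral>v. ?F i (norm v) * disc_weight v \<partial>disc_measure)) *
            (\<Prod>j\<in>UNIV - {i}. sqrt 2 * (\<integral>v. ?F j (norm v) * disc_weight v \<partial>disc_measure))"
          by (rule prod.remove) auto
        also have "\<dots> \<le> (2 * e) * (\<Prod>j\<in>UNIV - {i}. sqrt 2 * (C + 1))"
        proof (rule mult_mono)
          show "sqrt 2 * (\<integral>v. ?F i (norm v) * disc_weight v \<partial>disc_measure) \<le> 2 * e"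
            using t t0 by (intro mult_mono) (auto intro: real_le_lsqrt)
          show "(\<Prod>j\<in>UNIV - {i}. sqrt 2 * (\<integral>v. ?F j (norm v) * disc_weight v \<partial>disc_measure)) \<le>
              (\<Prod>j\<in>UNIV - {i}. sqrt 2 * (C + 1))"
            using C by (intro prod_mono conjI) (auto simp: C_def)
          show "0 \<le> (\<Prod>j\<in>UNIV - {i}. sqrt 2 * (\<integral>v. ?F j (norm v) * disc_weight v \<partial>disc_measure))"
            using C by (intro prod_nonneg) (auto simp: C_def)
        qed (use e in simp)
        also have "(\<Prod>j\<in>UNIV - {i}. sqrt 2 * (C + 1)) = (sqrt 2 * (C + 1)) ^ (n - 1)"
          by (simp add: n_def card_Diff_singleton)
        also have "(2 * e) * (sqrt 2 * (C + 1)) ^ (n - 1) \<le> (2 * e) * D"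
        proof -
          have "sqrt 2 * (C + 1) \<ge> 1 * 1" using C by (intro mult_mono) auto
          then show ?thesis unfolding D_def using e by (intro mult_left_mono power_increasing) auto
        qed
        finally show "(\<Prod>j\<in>UNIV. sqrt 2 * (\<integral>v. ?F j (norm v) * disc_weight v \<partial>disc_measure)) \<le> 2 * e * D" .
      qed
      finally show ?thesis .
    qed
    have K0: "?K w \<ge> 0" for w using poly_weight_nonneg kernel_abs_nonneg by (intro mult_nonneg_nonneg)
    have I0: "I i w \<ge> 0" for i w unfolding I by simp
    have "(\<integral>\<^sup>+w. ennreal (far_weight \<rho> z w * ?K w) \<partial>dv) =
        (\<integral>\<^sup>+w. ennreal (1 - \<rho>) * ennreal (?K w) + 2 * (\<Sum>i\<in>UNIV. ennreal (I i w * ?K w)) \<partial>dv)"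
    proof (rule nn_integral_cong)
      fix w
      have "far_weight \<rho> z w * ?K w = (1 - \<rho>) * ?K w + 2 * (\<Sum>i\<in>UNIV. I i w * ?K w)"
        by (simp add: far_weight_def I distrib_right sum_distrib_right)
      also have "ennreal \<dots> = ennreal ((1 - \<rho>) * ?K w) + ennreal (2 * (\<Sum>i\<in>UNIV. I i w * ?K w))"
        using K0 I0 \<rho> poly_weight_nonneg kernel_abs_nonneg
        by (intro ennreal_plus mult_nonneg_nonneg sum_nonneg) auto
      also have "ennreal ((1 - \<rho>) * ?K w) = ennreal (1 - \<rho>) * ennreal (?K w)"
        using K0 \<rho> by (intro ennreal_mult) auto
      also have "ennreal (2 * (\<Sum>i\<in>UNIV. I i w * ?K w)) = ennreal 2 * ennreal (\<Sum>i\<in>UNIV. I i w * ?K w)"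
        using K0 I0 poly_weight_nonneg kernel_abs_nonneg
        by (intro ennreal_mult mult_nonneg_nonneg sum_nonneg) auto
      also have "ennreal (\<Sum>i\<in>UNIV. I i w * ?K w) = (\<Sum>i\<in>UNIV. ennreal (I i w * ?K w))"
        using K0 I0 poly_weight_nonneg kernel_abs_nonneg
        by (intro sum_ennreal[symmetric] mult_nonneg_nonneg) auto
      finally show "ennreal (far_weight \<rho> z w * ?K w) =
          ennreal (1 - \<rho>) * ennreal (?K w) + 2 * (\<Sum>i\<in>UNIV. ennreal (I i w * ?K w))"
        by simp
    qed
    also have "\<dots> = ennreal (1 - \<rho>) * (\<integral>\<^sup>+w. ennreal (?K w) \<partial>dv) + 2 * (\<Sum>i\<in>UNIV. \<integral>\<^sup>+w. ennreal (I i w * ?K w) \<partial>dv)"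
      by (simp add: nn_integral_add nn_integral_cmult nn_integral_sum)
    also have "\<dots> \<le> ennreal e * ennreal (poly_weight z * D) + 2 * (\<Sum>i\<in>(UNIV :: 'n set). ennreal (poly_weight z * (2 * e * D)))"
      using one tail \<rho>(4) by (intro add_mono mult_mono sum_mono ennreal_leI) auto
    also have "\<dots> = ennreal (e * (poly_weight z * D) + 2 * (n * (poly_weight z * (2 * e * D))))"
    proof -
      have "2 * (\<Sum>i\<in>(UNIV :: 'n set). ennreal x) = ennreal (2 * (real n * x))" if "x \<ge> 0" for x :: real
        using that by (simp add: n_def ennreal_mult ennreal_of_nat_eq_real_of_nat)
      moreover have "ennreal a + ennreal b = ennreal (a + b)" if "a \<ge> 0" "b \<ge> 0" for a b
        using that by simp
      ultimately show ?thesis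
        using e D poly_weight_nonneg[of z] by (simp only: ennreal_mult[symmetric] mult_nonneg_nonneg
          of_nat_0_le_iff zero_le_numeral less_imp_le)
    qed
    also have "\<dots> \<le> ennreal (\<epsilon> * poly_weight z)"
    proof (rule ennreal_leI)
      have "e * (4 * (D * (n + 1) + 1)) = \<epsilon>"
      proof -
        have "4 * (D * (real n + 1) + 1) > 0" using D by (intro mult_pos_pos add_nonneg_pos mult_nonneg_nonneg) auto
        moreover have "\<epsilon> / x * x = \<epsilon>" if "x > 0" for x :: real using that by simp
        ultimately show ?thesis unfolding e_def by (simp only: of_nat_1 of_nat_add)
      qed
      then have "e * (D + 4 * n * D) \<le> \<epsilon>"
      proof -
        have "e * (D + 4 * n * D) + (4 * e + 3 * (D * e)) = e * (4 * (D * (n + 1) + 1))"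
          by (simp add: algebra_simps)
        moreover have "0 \<le> D * e" using D e by simp
        moreover assume "e * (4 * (D * (n + 1) + 1)) = \<epsilon>"
        ultimately show ?thesis using e by linarith
      qed
      then have "poly_weight z * (e * (D + 4 * n * D)) \<le> poly_weight z * \<epsilon>"
        by (intro mult_left_mono poly_weight_nonneg)
      then show "e * (poly_weight z * D) + 2 * (n * (poly_weight z * (2 * e * D))) \<le> \<epsilon> * poly_weight z"
        by (simp add: algebra_simps)
    qed
    finally show ?thesis .
  qed
  then show ?thesis using that \<rho> by blast
qed

section \<open>Inner product calculus\<close>

lemma bergman_inner_add_right: "bergman_inner f (g + h) = bergman_inner f g + bergman_inner f h"
  by (simp add: bergman_inner_commute[of f] bergman_inner_add_left)

lemma bergman_inner_scale_right: "bergman_inner f (bergman_scale c g) = cnj c * bergman_inner f g"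
  by (simp add: bergman_inner_commute[of f] bergman_inner_scale_left)

lemma bergman_scale_minus_one: "bergman_scale (- 1) f = - f"
  using bergman_scale_scaleR[of "- 1" f] by simp

lemma bergman_inner_minus_left: "bergman_inner (- f) g = - bergman_inner f g"
  by (simp add: bergman_scale_minus_one[symmetric] bergman_inner_scale_left)

lemma bergman_inner_diff_left: "bergman_inner (f - g) h = bergman_inner f h - bergman_inner g h"
  using bergman_inner_add_left[of f "- g" h] by (simp add: bergman_inner_minus_left)

lemma bergman_inner_diff_right: "bergman_inner f (g - h) = bergman_inner f g - bergman_inner f h"
  by (simp add: bergman_inner_commute[of f] bergman_inner_diff_left)

lemma bergman_inner_zero_left [simp]: "bergman_inner 0 g = 0"
  using bergman_inner_diff_left[of 0 0 g] by simp

lemma bergman_inner_zero_right [simp]: "bergman_inner g 0 = 0"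
  using bergman_inner_diff_right[of g 0 0] by simp

lemma bergman_inner_sum_left: "bergman_inner (\<Sum>i\<in>I. f i) g = (\<Sum>i\<in>I. bergman_inner (f i) g)"
  by (induction I rule: infinite_finite_induct) (auto simp: bergman_inner_add_left)

lemma bergman_fun_add: "bergman_fun (f + g) w = bergman_fun f w + bergman_fun g w"
  by (simp add: plus_bergman.rep_eq)

lemma bergman_fun_diff: "bergman_fun (f - g) w = bergman_fun f w - bergman_fun g w"
  unfolding minus_bergman_def plus_bergman.rep_eq uminus_bergman.rep_eq by simp

lemma bergman_fun_scale: "bergman_fun (bergman_scale c f) w = c * bergman_fun f w"
  by (simp add: bergman_scale.rep_eq)

lemma bergman_eqI: "(\<And>g. bergman_inner g f = bergman_inner g h) \<Longrightarrow> f = h"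
proof -
  assume "\<And>g. bergman_inner g f = bergman_inner g h"
  then have "bergman_inner (f - h) (f - h) = 0" by (simp add: bergman_inner_diff_right)
  then show ?thesis by (simp add: bergman_inner_self)
qed

lemma norm_bergman_le_inner:
  assumes "\<And>g. norm (bergman_inner g f) \<le> C * norm g" "C \<ge> 0"
  shows "norm f \<le> C"
proof (cases "f = 0")
  case False
  have "(norm f)\<^sup>2 = norm (bergman_inner f f)" by (simp add: bergman_inner_self norm_power)
  also have "\<dots> \<le> C * norm f" by (rule assms)
  finally show ?thesis using False by (simp add: power2_eq_square)
qed (use assms in simp)

lemma integral_cauchy_schwarz:
  fixes f g :: "'a \<Rightarrow> real"
  assumes [measurable]: "f \<in> borel_measurable M" "g \<in> borel_measurable M"
    and f: "integrable M (\<lambda>x. (f x)\<^sup>2)" and g: "integrable M (\<lambda>x. (g x)\<^sup>2)"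
  shows "integrable M (\<lambda>x. f x * g x)"
    and "\<bar>\<integral>x. f x * g x \<partial>M\<bar> \<le> sqrt (\<integral>x. (f x)\<^sup>2 \<partial>M) * sqrt (\<integral>x. (g x)\<^sup>2 \<partial>M)"
proof -
  show int: "integrable M (\<lambda>x. f x * g x)"
  proof (rule Bochner_Integration.integrable_bound)
    show "integrable M (\<lambda>x. (f x)\<^sup>2 + (g x)\<^sup>2)" using f g by simp
    show "AE x in M. norm (f x * g x) \<le> norm ((f x)\<^sup>2 + (g x)\<^sup>2)"
    proof (rule AE_I2)
      fix x
      have "2 * \<bar>f x\<bar> * \<bar>g x\<bar> \<le> (f x)\<^sup>2 + (g x)\<^sup>2"
        using sum_squares_bound[of "\<bar>f x\<bar>" "\<bar>g x\<bar>"] by simp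
      moreover have "0 \<le> \<bar>f x\<bar> * \<bar>g x\<bar>" by simp
      moreover have "norm (f x * g x) = \<bar>f x\<bar> * \<bar>g x\<bar>" by (simp add: abs_mult)
      moreover have "norm ((f x)\<^sup>2 + (g x)\<^sup>2) = (f x)\<^sup>2 + (g x)\<^sup>2" by simp
      ultimately show "norm (f x * g x) \<le> norm ((f x)\<^sup>2 + (g x)\<^sup>2)" by linarith
    qed
  qed measurable
  define a where "a = (\<integral>x. (f x)\<^sup>2 \<partial>M)"
  define b where "b = (\<integral>x. f x * g x \<partial>M)"
  define c where "c = (\<integral>x. (g x)\<^sup>2 \<partial>M)"
  have a: "a \<ge> 0" and c: "c \<ge> 0" by (simp_all add: a_def c_def)
  have quad: "0 \<le> a - 2 * s * b + s\<^sup>2 * c" for s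
  proof -
    have "0 \<le> (\<integral>x. (f x - s * g x)\<^sup>2 \<partial>M)" by simp
    also have "(\<lambda>x. (f x - s * g x)\<^sup>2) = (\<lambda>x. (f x)\<^sup>2 - 2 * s * (f x * g x) + s\<^sup>2 * (g x)\<^sup>2)"
      by (simp add: fun_eq_iff power2_eq_square algebra_simps)
    also have "(\<integral>x. (f x)\<^sup>2 - 2 * s * (f x * g x) + s\<^sup>2 * (g x)\<^sup>2 \<partial>M) = a - 2 * s * b + s\<^sup>2 * c"
      using f g int by (simp add: a_def b_def c_def)
    finally show ?thesis .
  qed
  have "b\<^sup>2 \<le> a * c"
  proof (cases "c = 0")
    case True
    have "b = 0"
    proof (rule ccontr)
      assume "b \<noteq> 0"
      \<comment> \<open>With c = 0 the quadratic is affine in s and takes the value -1 here.\<close>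
      then show False using quad[of "(a + 1) / (2 * b)"] True by simp
    qed
    then show ?thesis using a True by simp
  next
    case False
    have "0 \<le> (a - 2 * (b / c) * b + (b / c)\<^sup>2 * c) * c" using quad[of "b / c"] c by (intro mult_nonneg_nonneg)
    also have "\<dots> = a * c - b\<^sup>2" using False by (simp add: field_simps power2_eq_square)
    finally show ?thesis by simp
  qed
  then have "\<bar>b\<bar> \<le> sqrt (a * c)" by (intro real_le_rsqrt) simp
  then show "\<bar>\<integral>x. f x * g x \<partial>M\<bar> \<le> sqrt (\<integral>x. (f x)\<^sup>2 \<partial>M) * sqrt (\<integral>x. (g x)\<^sup>2 \<partial>M)"
    by (simp add: a_def b_def c_def real_sqrt_mult)
qed

section \<open>Norm continuity of kernels and normal families\<close>

definition bergman_kernel :: "complex ^ 'n::finite \<Rightarrow> 'n bergman"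
  where "bergman_kernel z = bergman_scale (of_real (1 / poly_delta z)) (normalized_kernel z)"

lemma bergman_inner_bergman_kernel:
  "z \<in> polydisk \<Longrightarrow> bergman_inner f (bergman_kernel z) = bergman_fun f z"
  using poly_delta_pos[of z]
  by (simp add: bergman_kernel_def bergman_inner_scale_right bergman_inner_kernel)

lemma normalized_kernel_eq:
  "z \<in> polydisk \<Longrightarrow> normalized_kernel z = bergman_scale (of_real (poly_delta z)) (bergman_kernel z)"
  unfolding bergman_kernel_def vector_space.vector_space_assms(3)[OF vector_space_bergman_scale]
  using poly_delta_pos[of z]
  by (simp add: vector_space.vector_space_assms(4)[OF vector_space_bergman_scale])

lemma bergman_fun_bergman_kernel:
  assumes "z \<in> polydisk" "w \<in> polydisk"
  shows "bergman_fun (bergman_kernel z) w = (\<Prod>i\<in>UNIV. 1 / (1 - w $ i * cnj (z $ i))\<^sup>2)"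
proof -
  have "(\<Prod>i\<in>UNIV. complex_of_real (1 - (norm (z $ i))\<^sup>2)) = of_real (poly_delta z)"
    by (simp only: poly_delta_def of_real_prod)
  then show ?thesis
    using poly_delta_pos[OF assms(1)] assms
    by (simp add: bergman_kernel_def bergman_fun_scale bergman_fun_normalized_kernel
        normalized_kernel_fun_def prod_dividef del: of_real_diff)
qed

lemma norm_bergman_fun_diff_le:
  assumes "z \<in> polydisk" "w \<in> polydisk"
  shows "norm (bergman_fun f z - bergman_fun f w) \<le> norm f * norm (bergman_kernel z - bergman_kernel w)"
  using norm_bergman_inner_le[of f "bergman_kernel z - bergman_kernel w"]
  by (simp add: bergman_inner_diff_right bergman_inner_bergman_kernel assms)

text \<open>The squared norm of a difference of kernels expands into four kernel values, which are
  continuous. This is what makes norm-bounded families of Bergman functions equicontinuous.\<close>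

lemma bergman_kernel_tendsto:
  fixes z :: "complex ^ 'n::finite"
  assumes z: "z \<in> polydisk"
  shows "((\<lambda>w. norm (bergman_kernel w - bergman_kernel z)) \<longlongrightarrow> 0) (at z within polydisk)"
proof -
  define k where "k a b = (\<Prod>i\<in>UNIV. 1 / (1 - b $ i * cnj (a $ i))\<^sup>2)" for a b :: "complex ^ 'n"
  have nz: "1 - z $ i * cnj (z $ i) \<noteq> 0" for i
    using one_minus_mult_cnj_nz[of "z $ i" "z $ i"] z by (simp add: polydisk_def)
  have "((\<lambda>w. Re (k w w) - Re (k w z) - Re (k z w) + Re (k z z)) \<longlongrightarrow>
      Re (k z z) - Re (k z z) - Re (k z z) + Re (k z z)) (at z within polydisk)"
    unfolding k_def by (intro tendsto_intros) (use nz in auto)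
  then have lim: "((\<lambda>w. Re (k w w) - Re (k w z) - Re (k z w) + Re (k z z)) \<longlongrightarrow> 0) (at z within polydisk)" by simp
  have eq: "(norm (bergman_kernel w - bergman_kernel z))\<^sup>2 = Re (k w w) - Re (k w z) - Re (k z w) + Re (k z z)"
    if w: "w \<in> polydisk" for w
  proof -
    have "complex_of_real ((norm (bergman_kernel w - bergman_kernel z))\<^sup>2) =
        k w w - k w z - (k z w - k z z)"
      unfolding bergman_inner_self[symmetric] bergman_inner_diff_right bergman_inner_diff_left
      by (simp add: bergman_inner_bergman_kernel bergman_fun_bergman_kernel z w k_def)
    from arg_cong[OF this, of Re] show ?thesis by simp
  qed
  have "((\<lambda>w. (norm (bergman_kernel w - bergman_kernel z))\<^sup>2) \<longlongrightarrow> 0) (at z within polydisk)"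
    by (rule Lim_transform_eventually[OF lim]) (simp add: eq eventually_at_filter)
  from tendsto_real_sqrt[OF this] show ?thesis by simp
qed

lemma bergman_fatou:
  fixes f :: "nat \<Rightarrow> 'n::finite bergman"
  assumes [measurable]: "g \<in> borel_measurable borel"
    and conv: "\<And>z. z \<in> polydisk \<Longrightarrow> (\<lambda>n. bergman_fun (f n) z) \<longlonglongrightarrow> g z"
    and bound: "\<And>n. norm (f n) \<le> B"
  shows "(\<integral>\<^sup>+z. ennreal ((norm (g z))\<^sup>2) \<partial>dv) \<le> ennreal (B\<^sup>2)"
proof -
  have "AE z in dv. z \<in> polydisk" by (simp add: AE_dv)
  then have "(\<integral>\<^sup>+z. ennreal ((norm (g z))\<^sup>2) \<partial>dv) =
      (\<integral>\<^sup>+z. liminf (\<lambda>n. ennreal ((norm (bergman_fun (f n) z))\<^sup>2)) \<partial>dv)"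
  proof (rule nn_integral_cong_AE[OF eventually_mono])
    fix z :: "complex ^ 'n" assume elim: "z \<in> polydisk" 
    have "(\<lambda>n. ennreal ((norm (bergman_fun (f n) z))\<^sup>2)) \<longlonglongrightarrow> ennreal ((norm (g z))\<^sup>2)"
      by (intro tendsto_ennrealI tendsto_power tendsto_norm conv elim)
    from lim_imp_Liminf[OF _ this]
    show "ennreal ((norm (g z))\<^sup>2) = liminf (\<lambda>n. ennreal ((norm (bergman_fun (f n) z))\<^sup>2))" by simp
  qed
  also have "\<dots> \<le> liminf (\<lambda>n. \<integral>\<^sup>+z. ennreal ((norm (bergman_fun (f n) z))\<^sup>2) \<partial>dv)"
    by (rule nn_integral_liminf) measurable
  also have "\<dots> = liminf (\<lambda>n. ennreal ((norm (f n))\<^sup>2))"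
    by (simp add: norm_bergman_sq nn_integral_eq_integral bergman_fun_square_integrable)
  also have "\<dots> \<le> ennreal (B\<^sup>2)"
  proof -
    have "liminf (\<lambda>n. ennreal ((norm (f n))\<^sup>2)) \<le> liminf (\<lambda>n. ennreal (B\<^sup>2))"
      using bound by (intro Liminf_mono always_eventually allI ennreal_leI power_mono) auto
    then show ?thesis by (simp add: Liminf_const)
  qed
  finally show ?thesis .
qed

lemma bergman_norm_le_of_pointwise_limit:
  assumes "\<And>z. z \<in> polydisk \<Longrightarrow> (\<lambda>n. bergman_fun (f n) z) \<longlonglongrightarrow> bergman_fun g z"
    and "\<And>n. norm (f n) \<le> B"
  shows "norm g \<le> B"
proof -
  have B: "B \<ge> 0" using assms(2)[of 0] norm_ge_zero[of "f 0"] by linarith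
  have "ennreal ((norm g)\<^sup>2) = (\<integral>\<^sup>+z. ennreal ((norm (bergman_fun g z))\<^sup>2) \<partial>dv)"
    by (simp add: norm_bergman_sq nn_integral_eq_integral bergman_fun_square_integrable)
  also have "\<dots> \<le> ennreal (B\<^sup>2)" by (rule bergman_fatou[OF _ assms]) auto
  finally show ?thesis using B by (simp add: power2_le_iff_abs_le)
qed

text \<open>A diagonal sequence converges on a countable dense set; norm continuity of the kernels
  extends convergence to all points and gives continuity of the limit. Holomorphy in each variable
  comes from the one-variable Montel theorem on slices, square integrability from Fatou. The theorem
  takes the place of weak compactness of balls, and completeness is deduced from it.\<close>

theorem bergman_montel:
  fixes f :: "nat \<Rightarrow> 'n::finite bergman"
  assumes bound: "\<And>n. norm (f n) \<le> B"
  shows "\<exists>(r :: nat \<Rightarrow> nat) g. strict_mono r \<and> norm g \<le> B \<and>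
    (\<forall>z\<in>polydisk. (\<lambda>n. bergman_fun (f (r n)) z) \<longlonglongrightarrow> bergman_fun g z)"
proof -
  have B: "B \<ge> 0" using bound[of 0] norm_ge_zero[of "f 0"] by linarith
  obtain Q0 :: "(complex ^ 'n) set" where Q0: "countable Q0" "\<And>X. open X \<Longrightarrow> X \<noteq> {} \<Longrightarrow> \<exists>d\<in>Q0. d \<in> X"
    using countable_dense_exists by metis
  define Q where "Q = Q0 \<inter> polydisk"
  have Q: "countable Q" "Q \<subseteq> polydisk" using Q0 by (auto simp: Q_def)
  \<comment> \<open>Evaluations are not uniformly bounded near the boundary; multiplication by
    \<open>poly_delta z\<close> gives one bound for all points, as the diagonal argument
    demands.\<close>
  have "norm (of_real (poly_delta z) * bergman_fun (f n) z) \<le> B" if "z \<in> Q" for n z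
  proof -
    have z: "z \<in> polydisk" using that Q by auto
    show ?thesis using norm_bergman_fun_le[OF z, of "f n"] bound[of n] poly_delta_pos[OF z]
      by (simp add: norm_mult)
  qed
  then obtain r :: "nat \<Rightarrow> nat" where r: "strict_mono r"
    and rlim: "\<And>z. z \<in> Q \<Longrightarrow> \<exists>l. (\<lambda>n. of_real (poly_delta z) * bergman_fun (f (r n)) z) \<longlonglongrightarrow> l"
    using function_convergent_subsequence[OF Q(1), of "\<lambda>n z. of_real (poly_delta z) * bergman_fun (f n) z" B]
    by blast
  have convQ: "convergent (\<lambda>n. bergman_fun (f (r n)) z)" if zQ: "z \<in> Q" for z
  proof -
    obtain l where "(\<lambda>n. of_real (poly_delta z) * bergman_fun (f (r n)) z) \<longlonglongrightarrow> l" using rlim[OF zQ] by blast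
    from tendsto_mult_left[OF this, of "1 / of_real (poly_delta z)"]
    have "(\<lambda>n. 1 / of_real (poly_delta z) * (of_real (poly_delta z) * bergman_fun (f (r n)) z))
        \<longlonglongrightarrow> 1 / of_real (poly_delta z) * l" .
    moreover have "poly_delta z \<noteq> 0" using poly_delta_pos[of z] zQ Q by force
    ultimately show ?thesis by (auto simp: convergent_def)
  qed
  have conv: "convergent (\<lambda>n. bergman_fun (f (r n)) z)" if z: "z \<in> polydisk" for z
  proof (rule Cauchy_convergent, rule CauchyI)
    fix e :: real assume e: "e > 0"
    have "e / (3 * (B + 1)) > 0" using e B by simp
    then have "eventually (\<lambda>w. norm (bergman_kernel w - bergman_kernel z) < e / (3 * (B + 1))) (at z within polydisk)"
      using order_tendstoD(2)[OF bergman_kernel_tendsto[OF z]] by blast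
    then obtain S where S: "open S" "z \<in> S"
      "\<And>w. w \<in> S \<Longrightarrow> w \<noteq> z \<Longrightarrow> w \<in> polydisk \<Longrightarrow> norm (bergman_kernel w - bergman_kernel z) < e / (3 * (B + 1))"
      unfolding eventually_at_topological by blast
    have "open (S \<inter> polydisk)" "S \<inter> polydisk \<noteq> {}" using S z open_polydisk by auto
    then obtain q where q: "q \<in> Q" "q \<in> S" "q \<in> polydisk" using Q0(2) by (auto simp: Q_def)
    have "norm (bergman_kernel q - bergman_kernel z) < e / (3 * (B + 1))"
      using S(3)[of q] q e B by (cases "q = z") auto
    then have "(B + 1) * norm (bergman_kernel q - bergman_kernel z) < e / 3"
      using B by (simp add: field_simps)
    then have near: "norm (bergman_fun (f n) q - bergman_fun (f n) z) < e / 3" for n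
    proof -
      have "norm (bergman_fun (f n) q - bergman_fun (f n) z) \<le> norm (f n) * norm (bergman_kernel q - bergman_kernel z)"
        by (rule norm_bergman_fun_diff_le[OF q(3) z])
      also have "\<dots> \<le> (B + 1) * norm (bergman_kernel q - bergman_kernel z)"
        using bound[of n] by (intro mult_right_mono) auto
      finally show ?thesis using \<open>(B + 1) * _ < e / 3\<close> by linarith
    qed
    have "Cauchy (\<lambda>n. bergman_fun (f (r n)) q)"
      using convQ[OF q(1)] by (rule convergent_Cauchy)
    then obtain M where M: "\<And>m n. m \<ge> M \<Longrightarrow> n \<ge> M \<Longrightarrow> norm (bergman_fun (f (r m)) q - bergman_fun (f (r n)) q) < e / 3"
      using e unfolding Cauchy_iff by (metis divide_pos_pos zero_less_numeral)
    have "norm (bergman_fun (f (r m)) z - bergman_fun (f (r n)) z) < e" if "m \<ge> M" "n \<ge> M" for m n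
      using M[OF that] near[of "r m"] near[of "r n"] by norm
    then show "\<exists>M. \<forall>m\<ge>M. \<forall>n\<ge>M. norm (bergman_fun (f (r m)) z - bergman_fun (f (r n)) z) < e" by blast
  qed
  define g where "g z = (if z \<in> polydisk then lim (\<lambda>n. bergman_fun (f (r n)) z) else 0)" for z
  have g: "(\<lambda>n. bergman_fun (f (r n)) z) \<longlonglongrightarrow> g z" if "z \<in> polydisk" for z
    using conv[OF that] that by (simp add: g_def convergent_LIMSEQ_iff)
  have cont: "continuous_on polydisk g"
    unfolding continuous_on_def
  proof
    fix z :: "complex ^ 'n" assume z: "z \<in> polydisk"
    have le: "norm (g w - g z) \<le> B * norm (bergman_kernel w - bergman_kernel z)" if w: "w \<in> polydisk" for w
    proof (rule tendsto_upperbound[OF tendsto_norm[OF tendsto_diff[OF g[OF w] g[OF z]]]])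
      show "\<forall>\<^sub>F n in sequentially. norm (bergman_fun (f (r n)) w - bergman_fun (f (r n)) z) \<le>
          B * norm (bergman_kernel w - bergman_kernel z)"
        by (intro always_eventually allI order_trans[OF norm_bergman_fun_diff_le[OF w z]]
            mult_right_mono bound norm_ge_zero)
    qed simp
    have "((\<lambda>w. g w - g z) \<longlongrightarrow> 0) (at z within polydisk)"
    proof (rule Lim_null_comparison)
      show "\<forall>\<^sub>F w in at z within polydisk. norm (g w - g z) \<le> B * norm (bergman_kernel w - bergman_kernel z)"
        using le by (simp add: eventually_at_filter)
      show "((\<lambda>w. B * norm (bergman_kernel w - bergman_kernel z)) \<longlongrightarrow> 0) (at z within polydisk)"
        using tendsto_mult_left[OF bergman_kernel_tendsto[OF z], of B] by simp
    qed
    then show "(g \<longlongrightarrow> g z) (at z within polydisk)" by (simp add: LIM_zero_iff)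
  qed
  have slice: "(\<lambda>t. g (\<chi> j. if j = i then t else z $ j)) holomorphic_on ball 0 1" if z: "z \<in> polydisk" for z i
  proof -
    let ?u = "\<lambda>t. \<chi> j. if j = i then t else z $ j"
    have u: "?u t \<in> polydisk" if "t \<in> ball 0 1" for t
      using z that by (auto simp: polydisk_def)
    let ?h = "\<lambda>n t. bergman_fun (f (r n)) (?u t)"
    have hb: "\<exists>C. \<forall>h\<in>range ?h. \<forall>t\<in>K. norm (h t) \<le> C" if K: "compact K" "K \<subseteq> ball 0 1" for K
    proof -
      have "continuous_on K (\<lambda>t. inverse (poly_delta (?u t)))"
      proof (rule continuous_on_inverse)
        have "continuous_on K (\<lambda>t. ?u t $ j)" for j
          by (cases "j = i") auto
        then show "continuous_on K (\<lambda>t. poly_delta (?u t))"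
          unfolding poly_delta_def
          by (intro continuous_on_prod continuous_on_diff continuous_on_const continuous_on_power continuous_on_norm)
        show "\<forall>t\<in>K. poly_delta (?u t) \<noteq> 0"
        proof
          fix t assume "t \<in> K"
          then have "?u t \<in> polydisk" using u K by blast
          from poly_delta_pos[OF this] show "poly_delta (?u t) \<noteq> 0" by linarith
        qed
      qed
      from compact_imp_bounded[OF compact_continuous_image[OF this K(1)]]
      obtain C where C: "\<And>t. t \<in> K \<Longrightarrow> norm (inverse (poly_delta (?u t))) \<le> C"
        unfolding bounded_iff by blast
      have "norm (?h n t) \<le> C * B" if t: "t \<in> K" for n t
      proof -
        have ut: "?u t \<in> polydisk" using u K t by blast
        note d = poly_delta_pos[OF ut]
        have "norm (?h n t) = inverse (poly_delta (?u t)) * (poly_delta (?u t) * norm (?h n t))" using d by simp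
        also have "\<dots> \<le> C * B"
        proof (rule mult_mono)
          show "inverse (poly_delta (?u t)) \<le> C" using C[OF t] d by simp
          show "poly_delta (?u t) * norm (?h n t) \<le> B"
            using norm_bergman_fun_le[OF ut, of "f (r n)"] bound[of "r n"] by linarith
          show "0 \<le> C" using C[OF t] norm_ge_zero order_trans by blast
        qed (use d in auto)
        finally show ?thesis .
      qed
      then show ?thesis by blast
    qed
    \<comment> \<open>Montel provides a holomorphic limit along a further subsequence only, but the
      sequence already converges pointwise to g, so this limit is the slice of g.\<close>
    obtain G \<sigma> where G: "G holomorphic_on ball 0 1" "strict_mono (\<sigma> :: nat \<Rightarrow> nat)"
      "\<And>t. t \<in> ball 0 1 \<Longrightarrow> (\<lambda>n. ?h (\<sigma> n) t) \<longlonglongrightarrow> G t"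
    proof (rule Montel[of "ball 0 1" "range ?h" ?h])
      show "h holomorphic_on ball 0 1" if "h \<in> range ?h" for h
        using that bergman_fun_slice[OF z] by blast
    qed (use hb in auto)
    show ?thesis
    proof (rule holomorphic_transform[OF G(1)])
      fix t :: complex assume t: "t \<in> ball 0 1"
      have "(\<lambda>n. ?h (\<sigma> n) t) \<longlonglongrightarrow> g (?u t)"
        using LIMSEQ_subseq_LIMSEQ[OF g[OF u[OF t]] G(2)] by (simp add: o_def)
      then show "G t = g (?u t)" using G(3)[OF t] LIMSEQ_unique by blast
    qed
  qed
  have meas: "g \<in> borel_measurable borel"
  proof -
    have "(\<lambda>w. if w \<in> polydisk then g w else 0) \<in> borel_measurable borel"
      by (rule borel_measurable_continuous_on_if) (use cont borel_open[OF open_polydisk] in auto)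
    also have "(\<lambda>w. if w \<in> polydisk then g w else 0) = g" by (auto simp: g_def)
    finally show ?thesis .
  qed
  have "(\<integral>\<^sup>+z. ennreal ((norm (g z))\<^sup>2) \<partial>dv) \<le> ennreal (B\<^sup>2)"
    by (rule bergman_fatou[OF meas g bound])
  then have "(\<integral>\<^sup>+z. ennreal ((norm (g z))\<^sup>2) \<partial>dv) < \<infinity>"
    by (rule le_less_trans) simp
  then have "integrable dv (\<lambda>z. (norm (g z))\<^sup>2)"
    using meas by (intro integrableI_nonneg) simp_all
  moreover have "g z = 0" if "z \<notin> polydisk" for z using that by (simp add: g_def)
  ultimately have mem: "g \<in> bergman_functions"
    unfolding bergman_functions_def polydisk_analytic_def using slice cont by blast
  have eq: "bergman_fun (Bergman g) = g" using mem by (rule Bergman_inverse)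
  show ?thesis
  proof (intro exI[of _ r] exI[of _ "Bergman g"] conjI r ballI)
    show lim: "(\<lambda>n. bergman_fun (f (r n)) z) \<longlonglongrightarrow> bergman_fun (Bergman g) z" if "z \<in> polydisk" for z
      unfolding eq by (rule g[OF that])
    from lim show "norm (Bergman g) \<le> B" by (rule bergman_norm_le_of_pointwise_limit[OF _ bound])
  qed
qed

text \<open>A subsequence converges pointwise to some g by \<open>bergman_montel\<close>. Lower
  semicontinuity of the norm, applied to differences of f n and later terms of the subsequence,
  upgrades this to norm convergence of the whole sequence. Completeness is the input for the Riesz
  theorem.\<close>

lemma bergman_Cauchy_convergent:
  fixes f :: "nat \<Rightarrow> 'n::finite bergman"
  assumes "Cauchy f"
  shows "convergent f"
proof -
  obtain B where B: "\<And>n. norm (f n) \<le> B"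
    using cauchy_imp_bounded[OF assms] by (auto simp: bounded_iff)
  obtain r g where r: "strict_mono r" and "norm g \<le> B"
    and g: "\<And>z. z \<in> polydisk \<Longrightarrow> (\<lambda>n. bergman_fun (f (r n)) z) \<longlonglongrightarrow> bergman_fun g z"
    using bergman_montel[of f B, OF B] by blast
  have "f \<longlonglongrightarrow> g"
  proof (rule LIMSEQ_I)
    fix e :: real assume e: "e > 0"
    then obtain M where M: "\<And>m n. m \<ge> M \<Longrightarrow> n \<ge> M \<Longrightarrow> norm (f m - f n) < e / 2"
      using assms unfolding Cauchy_iff by (metis half_gt_zero)
    \<comment> \<open>Shifting the index of the subsequence by M keeps all of its terms in the range
      of the Cauchy estimate.\<close>
    have "norm (f n - g) \<le> e / 2" if n: "n \<ge> M" for n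
    proof (rule bergman_norm_le_of_pointwise_limit[where f = "\<lambda>m. f n - f (r (m + M))"])
      fix z :: "complex ^ 'n" assume z: "z \<in> polydisk"
      show "(\<lambda>m. bergman_fun (f n - f (r (m + M))) z) \<longlonglongrightarrow> bergman_fun (f n - g) z"
        unfolding bergman_fun_diff
        by (intro tendsto_diff tendsto_const LIMSEQ_ignore_initial_segment[OF g[OF z]])
    next
      fix m
      have "r (m + M) \<ge> M" using seq_suble[OF r, of "m + M"] by simp
      then show "norm (f n - f (r (m + M))) \<le> e / 2" using M[OF n] by (simp add: less_imp_le)
    qed
    then show "\<exists>no. \<forall>n\<ge>no. norm (f n - g) < e"
    proof (intro exI[of _ M] allI impI)
      fix n assume "n \<ge> M"
      from \<open>\<And>n. n \<ge> M \<Longrightarrow> norm (f n - g) \<le> e / 2\<close>[OF this] e show "norm (f n - g) < e" by linarith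
    qed
  qed
  then show ?thesis by (auto simp: convergent_def)
qed

instance bergman :: (finite) banach
  by standard (rule bergman_Cauchy_convergent)

section \<open>Toeplitz operators with slowly varying symbols\<close>

text \<open>The representing vector is the minimizer of |x|^2 - 2 l x. The parallelogram law makes
  minimizing sequences Cauchy, and the first variation at the minimum identifies l.\<close>

lemma riesz_representation:
  fixes l :: "'a :: {real_inner, complete_space} \<Rightarrow> real"
  assumes l: "bounded_linear l"
  shows "\<exists>t. \<forall>x. l x = inner x t"
proof -
  interpret l: bounded_linear l by (rule l)
  obtain K where K: "\<And>x. norm (l x) \<le> norm x * K" and "K \<ge> 0" using l.nonneg_bounded by blast
  define J where "J x = (norm x)\<^sup>2 - 2 * l x" for x
  have low: "J x \<ge> - K\<^sup>2" for x
  proof -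
    have "2 * l x \<le> 2 * (norm x * K)" using K[of x] by simp
    moreover have "0 \<le> (norm x - K)\<^sup>2" by simp
    ultimately show ?thesis unfolding J_def by (simp add: power2_diff)
  qed
  define m where "m = (INF x. J x)"
  have bdd: "bdd_below (range J)" using low by (intro bdd_belowI2) auto
  have m: "m \<le> J x" for x unfolding m_def by (rule cINF_lower[OF bdd]) simp
  have "\<exists>x. J x < m + 1 / (real n + 1)" for n :: nat
  proof -
    have "m < m + 1 / (real n + 1)" by simp
    then show ?thesis unfolding m_def by (subst (asm) cINF_less_iff[OF _ bdd]) auto
  qed
  then obtain x where x: "\<And>n. J (x n) < m + 1 / (real n + 1)" by metis
  have par: "(norm (a - b))\<^sup>2 = 2 * J a + 2 * J b - 4 * J ((1 / 2) *\<^sub>R (a + b))" for a b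
    by (simp add: J_def l.add l.scaleR power2_norm_eq_inner inner_add inner_diff inner_commute algebra_simps)
  have "Cauchy x"
  proof (rule CauchyI)
    fix e :: real assume e: "e > 0"
    obtain M :: nat where M: "4 / e\<^sup>2 < real M" using reals_Archimedean2 by blast
    have "norm (x i - x j) < e" if "i \<ge> M" "j \<ge> M" for i j
    proof -
      have "1 / (real i + 1) \<le> 1 / (real M + 1)" "1 / (real j + 1) \<le> 1 / (real M + 1)"
        using that by (auto simp: frac_le)
      then have "(norm (x i - x j))\<^sup>2 < 4 * (1 / (real M + 1))"
        unfolding par using x[of i] x[of j] m[of "(1 / 2) *\<^sub>R (x i + x j)"] by linarith
      also have "\<dots> < e\<^sup>2"
      proof -
        have "4 < e\<^sup>2 * real M" using M e by (simp add: field_simps)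
        then have "4 < e\<^sup>2 * (real M + 1)" using zero_less_power[OF e, of 2] by (simp only: distrib_left)
        then show ?thesis by (simp add: field_simps)
      qed
      finally show ?thesis using e by (simp add: power2_less_imp_less)
    qed
    then show "\<exists>M. \<forall>m\<ge>M. \<forall>n\<ge>M. norm (x m - x n) < e" by blast
  qed
  then obtain t where t: "x \<longlonglongrightarrow> t" using Cauchy_convergent convergent_def by blast
  have "(\<lambda>n. J (x n)) \<longlonglongrightarrow> J t"
    unfolding J_def by (intro tendsto_intros l.tendsto t)
  moreover have "(\<lambda>n. m + 1 / (real n + 1)) \<longlonglongrightarrow> m + 0"
    by (intro tendsto_intros) real_asymp
  ultimately have "J t \<le> m + 0"
    by (rule LIMSEQ_le) (use x in \<open>auto intro: less_imp_le\<close>)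
  then have min: "J t \<le> J y" for y using m[of y] by linarith
  have "l h = inner h t" for h
  proof (rule ccontr)
    define b where "b = inner h t - l h"
    define a where "a = (norm h)\<^sup>2"
    assume "l h \<noteq> inner h t"
    then have b: "b \<noteq> 0" by (simp add: b_def)
    have a: "a \<ge> 0" by (simp add: a_def)
    have "J (t + s *\<^sub>R h) = J t + 2 * s * b + s\<^sup>2 * a" for s
    proof -
      have "(norm (t + s *\<^sub>R h))\<^sup>2 = (norm t)\<^sup>2 + 2 * s * inner h t + s\<^sup>2 * (norm h)\<^sup>2"
        unfolding power2_norm_eq_inner by (simp add: inner_add inner_commute algebra_simps power2_eq_square)
      then show ?thesis by (simp add: J_def l.add l.scaleR a_def b_def algebra_simps)
    qed
    then have "0 \<le> 2 * s * b + s\<^sup>2 * a" for s using min[of "t + s *\<^sub>R h"] by simp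
    then have quad: "0 \<le> 2 * s * b + s\<^sup>2 * a" for s .
    \<comment> \<open>Dividing by a + 1 instead of a covers a = 0; the quadratic becomes a negative
      multiple of b^2.\<close>
    define s where "s = - b / (a + 1)"
    have sc: "s * (a + 1) = - b" using a by (simp add: s_def)
    have "0 \<le> (2 * s * b + s\<^sup>2 * a) * (a + 1)\<^sup>2"
      by (intro mult_nonneg_nonneg quad) simp
    also have "\<dots> = 2 * (s * (a + 1)) * b * (a + 1) + (s * (a + 1))\<^sup>2 * a"
      by (simp add: power2_eq_square algebra_simps)
    also have "\<dots> = - (b\<^sup>2) * (a + 2)" unfolding sc by (simp add: power2_eq_square algebra_simps)
    finally have "b\<^sup>2 * (a + 2) \<le> 0" by simp
    moreover have "b\<^sup>2 * (a + 2) > 0" using a b by simp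
    ultimately show False by simp
  qed
  then show ?thesis by blast
qed

text \<open>The Riesz theorem is available for the real inner product, so the real part of l is
  represented first; evaluation at f multiplied by the imaginary unit recovers the imaginary
  part.\<close>

lemma bergman_riesz:
  fixes l :: "'n::finite bergman \<Rightarrow> complex"
  assumes add: "\<And>f g. l (f + g) = l f + l g" and scale: "\<And>c f. l (bergman_scale c f) = c * l f"
    and bound: "\<And>f. norm (l f) \<le> norm f * C"
  obtains t where "\<And>f. l f = bergman_inner f t"
proof -
  have "bounded_linear (\<lambda>f. Re (l f))"
  proof (rule bounded_linear_intro)
    show "Re (l (r *\<^sub>R f)) = r *\<^sub>R Re (l f)" for r f
      by (simp add: scaleR_bergman_def scale)
    show "norm (Re (l f)) \<le> norm f * C" for f
      using abs_Re_le_cmod[of "l f"] bound[of f] by simp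
  qed (simp add: add)
  then obtain t where t: "\<And>f. Re (l f) = inner f t" using riesz_representation by blast
  have "l f = bergman_inner f t" for f
  proof (rule complex_eqI)
    show "Re (l f) = Re (bergman_inner f t)" using t by (simp add: inner_bergman_def)
    have "Re (l (bergman_scale \<i> f)) = Re (bergman_inner (bergman_scale \<i> f) t)"
      using t by (simp add: inner_bergman_def)
    then show "Im (l f) = Im (bergman_inner f t)" by (simp add: scale bergman_inner_scale_left)
  qed
  then show ?thesis by (rule that)
qed

text \<open>The inner product of A f with g is a bounded complex linear functional of f; the
  representing vector plays the role of the adjoint applied to g.\<close>

lemma adjoint_vector:
  fixes A :: "'n::finite bergman_op"
  assumes "clinear_op A"
  obtains t where "\<And>f. bergman_inner (A f) g = bergman_inner f t"
proof (rule bergman_riesz[of "\<lambda>f. bergman_inner (A f) g" "norm A * norm g"])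
  show "bergman_inner (A (f + h)) g = bergman_inner (A f) g + bergman_inner (A h) g" for f h
    by (simp add: blinfun.add_right bergman_inner_add_left)
  show "bergman_inner (A (bergman_scale c f)) g = c * bergman_inner (A f) g" for c f
    using assms by (simp add: clinear_op_def bergman_inner_scale_left)
  show "norm (bergman_inner (A f) g) \<le> norm f * (norm A * norm g)" for f
  proof -
    have "norm (bergman_inner (A f) g) \<le> norm (A f) * norm g" by (rule norm_bergman_inner_le)
    also have "\<dots> \<le> (norm A * norm f) * norm g" by (intro mult_right_mono norm_blinfun) simp
    finally show ?thesis by (simp add: mult_ac)
  qed
qed (rule that)

section \<open>Toeplitz operators of bounded real symbols\<close>

definition unit_symbol :: "(complex ^ 'n::finite \<Rightarrow> real) \<Rightarrow> bool"
  where "unit_symbol \<phi> \<longleftrightarrow> \<phi> \<in> borel_measurable borel \<and> (\<forall>z. \<bar>\<phi> z\<bar> \<le> 1)"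

lemma square_integrable_inner:
  fixes u v :: "complex ^ 'n::finite \<Rightarrow> complex"
  assumes [measurable]: "u \<in> borel_measurable borel" "v \<in> borel_measurable borel"
    and u: "integrable dv (\<lambda>w. (norm (u w))\<^sup>2)" and v: "integrable dv (\<lambda>w. (norm (v w))\<^sup>2)"
  shows "integrable dv (\<lambda>w. u w * cnj (v w))"
    and "norm (\<integral>w. u w * cnj (v w) \<partial>dv) \<le> sqrt (\<integral>w. (norm (u w))\<^sup>2 \<partial>dv) * sqrt (\<integral>w. (norm (v w))\<^sup>2 \<partial>dv)"
proof -
  have m: "(\<lambda>w. norm (u w)) \<in> borel_measurable dv" "(\<lambda>w. norm (v w)) \<in> borel_measurable dv" by measurable
  note cs = integral_cauchy_schwarz[OF m u v]
  show "integrable dv (\<lambda>w. u w * cnj (v w))"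
  proof (rule Bochner_Integration.integrable_bound[OF cs(1)])
    show "(\<lambda>w. u w * cnj (v w)) \<in> borel_measurable dv" by measurable
  qed (simp add: norm_mult)
  have "norm (\<integral>w. u w * cnj (v w) \<partial>dv) \<le> (\<integral>w. norm (u w) * norm (v w) \<partial>dv)"
    using integral_norm_bound[of dv "\<lambda>w. u w * cnj (v w)"] by (simp add: norm_mult)
  also have "\<dots> \<le> sqrt (\<integral>w. (norm (u w))\<^sup>2 \<partial>dv) * sqrt (\<integral>w. (norm (v w))\<^sup>2 \<partial>dv)"
    using cs(2) by linarith
  finally show "norm (\<integral>w. u w * cnj (v w) \<partial>dv) \<le> sqrt (\<integral>w. (norm (u w))\<^sup>2 \<partial>dv) * sqrt (\<integral>w. (norm (v w))\<^sup>2 \<partial>dv)" .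
qed

lemma unit_symbol_square_integrable:
  assumes "unit_symbol \<phi>"
  shows "integrable dv (\<lambda>w. (norm (of_real (\<phi> w) * bergman_fun h w))\<^sup>2)"
    and "(\<integral>w. (norm (of_real (\<phi> w) * bergman_fun h w))\<^sup>2 \<partial>dv) \<le> (norm h)\<^sup>2"
proof -
  have [measurable]: "\<phi> \<in> borel_measurable borel" using assms by (simp add: unit_symbol_def)
  have le: "(norm (of_real (\<phi> w) * bergman_fun h w))\<^sup>2 \<le> (norm (bergman_fun h w))\<^sup>2" for w
  proof (rule power_mono)
    show "norm (of_real (\<phi> w) * bergman_fun h w) \<le> norm (bergman_fun h w)"
      using assms mult_right_mono[of "\<bar>\<phi> w\<bar>" 1 "norm (bergman_fun h w)"]
      by (simp add: norm_mult unit_symbol_def)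
  qed simp
  show int: "integrable dv (\<lambda>w. (norm (of_real (\<phi> w) * bergman_fun h w))\<^sup>2)"
  proof (rule Bochner_Integration.integrable_bound[OF bergman_fun_square_integrable[of h]])
    show "AE w in dv. norm ((norm (of_real (\<phi> w) * bergman_fun h w))\<^sup>2) \<le> norm ((norm (bergman_fun h w))\<^sup>2)"
      using le by (intro AE_I2) (simp only: real_norm_def abs_power2)
  qed measurable
  show "(\<integral>w. (norm (of_real (\<phi> w) * bergman_fun h w))\<^sup>2 \<partial>dv) \<le> (norm h)\<^sup>2"
    unfolding norm_bergman_sq by (rule integral_mono[OF int bergman_fun_square_integrable le])
qed

definition toeplitz_form :: "(complex ^ 'n::finite \<Rightarrow> real) \<Rightarrow> 'n bergman \<Rightarrow> 'n bergman \<Rightarrow> complex"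
  where "toeplitz_form \<phi> h g = (\<integral>w. (of_real (\<phi> w) * bergman_fun h w) * cnj (bergman_fun g w) \<partial>dv)"

lemma toeplitz_form_integrable:
  assumes "unit_symbol \<phi>"
  shows "integrable dv (\<lambda>w. (of_real (\<phi> w) * bergman_fun h w) * cnj (bergman_fun g w))"
proof -
  have [measurable]: "\<phi> \<in> borel_measurable borel" using assms by (simp add: unit_symbol_def)
  show ?thesis
    by (rule square_integrable_inner(1)[OF _ _ unit_symbol_square_integrable(1)[OF assms] bergman_fun_square_integrable])
      measurable
qed

lemma norm_toeplitz_form_le:
  assumes "unit_symbol \<phi>"
  shows "norm (toeplitz_form \<phi> h g) \<le> norm h * norm g"
proof -
  have [measurable]: "\<phi> \<in> borel_measurable borel" using assms by (simp add: unit_symbol_def)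
  have "norm (toeplitz_form \<phi> h g) \<le> sqrt (\<integral>w. (norm (of_real (\<phi> w) * bergman_fun h w))\<^sup>2 \<partial>dv) *
      sqrt (\<integral>w. (norm (bergman_fun g w))\<^sup>2 \<partial>dv)"
    unfolding toeplitz_form_def
    by (rule square_integrable_inner(2)[OF _ _ unit_symbol_square_integrable(1)[OF assms] bergman_fun_square_integrable])
      measurable
  also have "\<dots> \<le> sqrt ((norm h)\<^sup>2) * sqrt ((norm g)\<^sup>2)"
    using unit_symbol_square_integrable(2)[OF assms]
    by (intro mult_mono real_sqrt_le_mono) (simp_all add: norm_bergman_sq)
  finally show ?thesis by simp
qed

lemma toeplitz_form_commute: "toeplitz_form \<phi> g h = cnj (toeplitz_form \<phi> h g)"
  unfolding toeplitz_form_def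
  by (subst Bochner_Integration.integral_cnj[symmetric]) (simp add: mult_ac)

definition toeplitz_vec :: "(complex ^ 'n::finite \<Rightarrow> real) \<Rightarrow> 'n bergman \<Rightarrow> 'n bergman"
  where "toeplitz_vec \<phi> h = (SOME t. \<forall>g. bergman_inner t g = toeplitz_form \<phi> h g)"

lemma toeplitz_vec_inner:
  assumes "unit_symbol \<phi>"
  shows "bergman_inner (toeplitz_vec \<phi> h) g = toeplitz_form \<phi> h g"
proof -
  obtain t where t: "\<And>g. toeplitz_form \<phi> g h = bergman_inner g t"
  proof (rule bergman_riesz[of "\<lambda>g. toeplitz_form \<phi> g h" "norm h"])
    show "toeplitz_form \<phi> (f + g) h = toeplitz_form \<phi> f h + toeplitz_form \<phi> g h" for f g
      unfolding toeplitz_form_def bergman_fun_add distrib_left distrib_right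
      by (intro Bochner_Integration.integral_add toeplitz_form_integrable assms)
    show "toeplitz_form \<phi> (bergman_scale c f) h = c * toeplitz_form \<phi> f h" for c f
      unfolding toeplitz_form_def bergman_fun_scale
      by (subst integral_mult_right_zero[symmetric]) (simp add: mult_ac)
  qed (use norm_toeplitz_form_le[OF assms] in auto)
  have "\<exists>t. \<forall>g. bergman_inner t g = toeplitz_form \<phi> h g"
    using t by (intro exI[of _ t] allI)
      (simp add: bergman_inner_commute[of _ t] toeplitz_form_commute[of \<phi> h])
  from someI_ex[OF this] show ?thesis by (simp add: toeplitz_vec_def)
qed

definition toeplitz :: "(complex ^ 'n::finite \<Rightarrow> real) \<Rightarrow> 'n bergman_op"
  where "toeplitz \<phi> = Blinfun (toeplitz_vec \<phi>)"

lemma toeplitz_apply_vec: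
  assumes "unit_symbol \<phi>"
  shows "blinfun_apply (toeplitz \<phi>) = toeplitz_vec \<phi>"
proof -
  note inner = toeplitz_vec_inner[OF assms]
  have "bounded_linear (toeplitz_vec \<phi>)"
  proof (rule bounded_linear_intro[of _ 1])
    show "toeplitz_vec \<phi> (f + g) = toeplitz_vec \<phi> f + toeplitz_vec \<phi> g" for f g
    proof (rule bergman_eqI)
      fix k
      have "toeplitz_form \<phi> (f + g) k = toeplitz_form \<phi> f k + toeplitz_form \<phi> g k"
        unfolding toeplitz_form_def bergman_fun_add distrib_left distrib_right
        by (intro Bochner_Integration.integral_add toeplitz_form_integrable assms)
      then show "bergman_inner k (toeplitz_vec \<phi> (f + g)) = bergman_inner k (toeplitz_vec \<phi> f + toeplitz_vec \<phi> g)"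
        by (simp add: bergman_inner_commute[of k] bergman_inner_add_left inner)
    qed
    show "toeplitz_vec \<phi> (r *\<^sub>R f) = r *\<^sub>R toeplitz_vec \<phi> f" for r f
    proof (rule bergman_eqI)
      fix k
      have "toeplitz_form \<phi> (r *\<^sub>R f) k = of_real r * toeplitz_form \<phi> f k"
        unfolding toeplitz_form_def scaleR_bergman_def bergman_fun_scale
        by (subst integral_mult_right_zero[symmetric]) (simp add: mult_ac)
      then show "bergman_inner k (toeplitz_vec \<phi> (r *\<^sub>R f)) = bergman_inner k (r *\<^sub>R toeplitz_vec \<phi> f)"
        by (simp add: bergman_inner_commute[of k] scaleR_bergman_def bergman_inner_scale_left inner[unfolded scaleR_bergman_def])
    qed
    show "norm (toeplitz_vec \<phi> f) \<le> norm f * 1" for f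
    proof (rule norm_bergman_le_inner)
      fix g
      show "norm (bergman_inner g (toeplitz_vec \<phi> f)) \<le> norm f * 1 * norm g"
        using norm_toeplitz_form_le[OF assms, of f g]
        by (simp add: bergman_inner_commute[of g] inner)
    qed simp
  qed
  then show ?thesis unfolding toeplitz_def by (rule bounded_linear_Blinfun_apply)
qed

lemma toeplitz_inner:
  "unit_symbol \<phi> \<Longrightarrow> bergman_inner (toeplitz \<phi> h) g = toeplitz_form \<phi> h g"
  by (simp add: toeplitz_apply_vec toeplitz_vec_inner)

lemma toeplitz_selfadjoint:
  "unit_symbol \<phi> \<Longrightarrow> bergman_inner (toeplitz \<phi> h) g = bergman_inner h (toeplitz \<phi> g)"
  by (simp add: toeplitz_inner bergman_inner_commute[of h] toeplitz_form_commute[of \<phi> h])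

lemma norm_toeplitz_le:
  assumes "unit_symbol \<phi>"
  shows "norm (toeplitz \<phi>) \<le> 1"
proof (rule norm_blinfun_bound)
  show "norm (toeplitz \<phi> f) \<le> 1 * norm f" for f
  proof (rule norm_bergman_le_inner)
    show "norm (bergman_inner g (toeplitz \<phi> f)) \<le> 1 * norm f * norm g" for g
      using norm_toeplitz_form_le[OF assms, of f g]
      by (simp add: bergman_inner_commute[of g] toeplitz_inner[OF assms])
  qed simp
qed simp

lemma norm_toeplitz_apply_le: "unit_symbol \<phi> \<Longrightarrow> norm (toeplitz \<phi> h) \<le> norm h"
  using norm_blinfun[of "toeplitz \<phi>" h] mult_right_mono[OF norm_toeplitz_le, of \<phi> "norm h"] by simp

lemma clinear_toeplitz:
  assumes "unit_symbol \<phi>"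
  shows "clinear_op (toeplitz \<phi>)"
proof -
  have "is_adjoint_op (toeplitz \<phi>) (toeplitz \<phi>)"
    by (simp add: is_adjoint_op_def toeplitz_selfadjoint[OF assms])
  then show ?thesis by (rule clinear_op_adjoint)
qed

text \<open>The component of \<phi> h orthogonal to the Bergman space, that is, the Hankel operator
  with symbol \<phi> applied to h. It is a plain function because in general it is not
  holomorphic.\<close>

definition toeplitz_defect :: "(complex ^ 'n::finite \<Rightarrow> real) \<Rightarrow> 'n bergman \<Rightarrow> complex ^ 'n \<Rightarrow> complex"
  where "toeplitz_defect \<phi> h w = of_real (\<phi> w) * bergman_fun h w - bergman_fun (toeplitz \<phi> h) w"

text \<open>One parameter serves as radius \<rho> and as tolerance 1 - \<rho>. The classes shrink as
  \<rho> tends to 1, so finitely many smallness requirements are met together by taking the maximum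
  of their parameters.\<close>

definition slow_symbol :: "real \<Rightarrow> (complex ^ 'n::finite \<Rightarrow> real) \<Rightarrow> bool"
  where "slow_symbol \<rho> \<phi> \<longleftrightarrow> unit_symbol \<phi> \<and> (\<forall>z\<in>polydisk. \<forall>w\<in>polydisk.
    (\<forall>i. norm (mobius (z $ i) (w $ i)) \<le> \<rho>) \<longrightarrow> \<bar>\<phi> z - \<phi> w\<bar> \<le> 1 - \<rho>)"

lemma slow_symbol_mono:
  assumes "\<rho> \<le> \<rho>'" "slow_symbol \<rho>' \<phi>"
  shows "slow_symbol \<rho> \<phi>"
  unfolding slow_symbol_def
proof (intro conjI ballI impI)
  show "unit_symbol \<phi>" using assms by (simp add: slow_symbol_def)
  fix z w :: "complex ^ 'a"
  assume zw: "z \<in> polydisk" "w \<in> polydisk" and "\<forall>i. norm (mobius (z $ i) (w $ i)) \<le> \<rho>"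
  then have "\<forall>i. norm (mobius (z $ i) (w $ i)) \<le> \<rho>'" using assms(1) by (meson order_trans)
  then have "\<bar>\<phi> z - \<phi> w\<bar> \<le> 1 - \<rho>'" using assms(2) zw by (simp add: slow_symbol_def)
  then show "\<bar>\<phi> z - \<phi> w\<bar> \<le> 1 - \<rho>" using assms(1) by linarith
qed

lemma slow_symbol_far_weight:
  assumes "slow_symbol \<rho> \<phi>" "z \<in> polydisk" "w \<in> polydisk" "\<rho> < 1"
  shows "\<bar>\<phi> z - \<phi> w\<bar> \<le> far_weight \<rho> z w"
proof (cases "\<forall>i. norm (mobius (z $ i) (w $ i)) \<le> \<rho>")
  case True
  then have "\<bar>\<phi> z - \<phi> w\<bar> \<le> 1 - \<rho>" using assms by (simp add: slow_symbol_def)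
  also have "\<dots> \<le> far_weight \<rho> z w" unfolding far_weight_def by (simp add: sum_nonneg)
  finally show ?thesis .
next
  case False
  then obtain i where "norm (mobius (z $ i) (w $ i)) > \<rho>" by (auto simp: not_le)
  then have "1 \<le> (\<Sum>i\<in>{i}. indicator {\<rho><..} (norm (mobius (z $ i) (w $ i))) :: real)" by simp
  also have "\<dots> \<le> (\<Sum>i\<in>UNIV. indicator {\<rho><..} (norm (mobius (z $ i) (w $ i))))"
    by (rule sum_mono2) auto
  finally have "2 \<le> far_weight \<rho> z w" unfolding far_weight_def using assms(4) by linarith
  moreover have "\<bar>\<phi> z\<bar> \<le> 1" "\<bar>\<phi> w\<bar> \<le> 1" using assms(1) by (auto simp: slow_symbol_def unit_symbol_def)
  ultimately show ?thesis by linarith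
qed

lemma far_weight_commute: "far_weight \<rho> z w = far_weight \<rho> w z"
  unfolding far_weight_def by (simp add: norm_mobius_commute)

lemma kernel_abs_commute: "kernel_abs z w = kernel_abs w z"
proof -
  have "norm (1 - a * cnj b) = norm (1 - b * cnj a)" for a b
  proof -
    have "norm (1 - a * cnj b) = norm (cnj (1 - a * cnj b))" by (simp only: complex_mod_cnj)
    then show ?thesis by (simp add: mult.commute)
  qed
  then show ?thesis unfolding kernel_abs_def by metis
qed

lemma measurable_weights [measurable]:
  assumes [measurable]: "f \<in> borel_measurable M" "g \<in> borel_measurable M"
  shows "(\<lambda>x. far_weight \<rho> (f x) (g x)) \<in> borel_measurable M"
    "(\<lambda>x. kernel_abs (f x) (g x)) \<in> borel_measurable M"
  unfolding far_weight_def kernel_abs_def by measurable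

text \<open>Pointwise, a(w) b(z) is at most half the sum of a(w)^2 p(z) / p(w) and b(z)^2 p(w) /
  p(z), where p is \<open>poly_weight\<close>. After Tonelli each half contains one Schur integral;
  by symmetry of \<open>far_weight\<close> and \<open>kernel_abs\<close> the same hypothesis bounds
  both.\<close>

lemma schur_test:
  fixes a b :: "complex ^ 'n::finite \<Rightarrow> real"
  assumes [measurable]: "a \<in> borel_measurable borel" "b \<in> borel_measurable borel"
    and nonneg: "\<And>w. a w \<ge> 0" "\<And>w. b w \<ge> 0"
    and zero: "\<And>w. w \<notin> polydisk \<Longrightarrow> a w = 0" "\<And>w. w \<notin> polydisk \<Longrightarrow> b w = 0"
    and a: "integrable dv (\<lambda>w. (a w)\<^sup>2)" and b: "integrable dv (\<lambda>w. (b w)\<^sup>2)"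
    and \<rho>: "\<rho> < 1" and \<epsilon>: "\<epsilon> > 0"
    and schur: "\<And>z :: complex ^ 'n. z \<in> polydisk \<Longrightarrow>
      (\<integral>\<^sup>+w. ennreal (far_weight \<rho> z w * (poly_weight w * kernel_abs z w)) \<partial>dv) \<le> ennreal (\<epsilon> * poly_weight z)"
  shows "(\<integral>\<^sup>+z. \<integral>\<^sup>+w. ennreal (far_weight \<rho> z w * kernel_abs z w * a w * b z) \<partial>dv \<partial>dv) \<le>
    ennreal (\<epsilon> / 2 * ((\<integral>w. (a w)\<^sup>2 \<partial>dv) + (\<integral>w. (b w)\<^sup>2 \<partial>dv)))"
proof -
  interpret dv: finite_measure "dv :: (complex ^ 'n) measure" by (rule finite_measure_dv)
  interpret pair: pair_sigma_finite "dv :: (complex ^ 'n) measure" "dv :: (complex ^ 'n) measure"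
    by standard
  define q where "q c z = ennreal ((c z)\<^sup>2 / (2 * poly_weight z))" for c and z :: "complex ^ 'n"
  define S where "S z w = ennreal (far_weight \<rho> z w * (poly_weight w * kernel_abs z w))" for z w :: "complex ^ 'n"
  have [measurable]: "q a \<in> borel_measurable borel" "q b \<in> borel_measurable borel" unfolding q_def by measurable
  have [measurable]: "(\<lambda>x. S (f x) (g x)) \<in> borel_measurable M"
    if [measurable]: "f \<in> borel_measurable M" "g \<in> borel_measurable M" for f g and M :: "'x measure"
    unfolding S_def by measurable
  have le: "ennreal (far_weight \<rho> z w * kernel_abs z w * a w * b z) \<le> q a w * S w z + q b z * S z w" for z w
  proof (cases "z \<in> polydisk \<and> w \<in> polydisk")
    case True
    define s where "s = poly_weight z / poly_weight w"
    have pz: "poly_weight z > 0" and pw: "poly_weight w > 0" using True poly_weight_pos by auto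
    define \<Theta> where "\<Theta> = far_weight \<rho> z w * kernel_abs z w"
    have \<Theta>: "\<Theta> \<ge> 0" unfolding \<Theta>_def using far_weight_nonneg[OF \<rho>] kernel_abs_nonneg by (intro mult_nonneg_nonneg)
    have "0 \<le> (a w * poly_weight z - b z * poly_weight w)\<^sup>2" by simp
    then have "2 * (a w * b z) * (poly_weight z * poly_weight w) \<le> (a w)\<^sup>2 * (poly_weight z)\<^sup>2 + (b z)\<^sup>2 * (poly_weight w)\<^sup>2"
      by (simp add: power2_diff power_mult_distrib mult_ac)
    then have "a w * b z \<le> (a w)\<^sup>2 / (2 * poly_weight w) * poly_weight z + (b z)\<^sup>2 / (2 * poly_weight z) * poly_weight w"
      using pz pw by (simp add: field_simps power2_eq_square)
    from mult_left_mono[OF this \<Theta>]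
    have "\<Theta> * a w * b z \<le> (a w)\<^sup>2 / (2 * poly_weight w) * (\<Theta> * poly_weight z) + (b z)\<^sup>2 / (2 * poly_weight z) * (\<Theta> * poly_weight w)"
      by (simp add: algebra_simps)
    then have "ennreal (\<Theta> * a w * b z) \<le> ennreal ((a w)\<^sup>2 / (2 * poly_weight w) * (\<Theta> * poly_weight z) + (b z)\<^sup>2 / (2 * poly_weight z) * (\<Theta> * poly_weight w))"
      by (rule ennreal_leI)
    also have "\<dots> = ennreal ((a w)\<^sup>2 / (2 * poly_weight w) * (\<Theta> * poly_weight z)) + ennreal ((b z)\<^sup>2 / (2 * poly_weight z) * (\<Theta> * poly_weight w))"
      using pz pw \<Theta> by (intro ennreal_plus) auto
    also have "\<dots> = q a w * ennreal (\<Theta> * poly_weight z) + q b z * ennreal (\<Theta> * poly_weight w)"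
      unfolding q_def using pz pw \<Theta>
      by (intro arg_cong2[of _ _ _ _ "(+)"] ennreal_mult) auto
    finally show ?thesis
      unfolding S_def \<Theta>_def far_weight_commute[of \<rho> w z] kernel_abs_commute[of w z] by (simp add: mult_ac)
  next
    case False
    then have "a w * b z = 0" using zero by auto
    then show ?thesis by auto
  qed
  have main: "(\<integral>\<^sup>+w. q c w * (\<integral>\<^sup>+z. S w z \<partial>dv) \<partial>dv) \<le> ennreal (\<epsilon> / 2 * (\<integral>w. (c w)\<^sup>2 \<partial>dv))"
    if [measurable]: "c \<in> borel_measurable borel" and c: "integrable dv (\<lambda>w. (c w)\<^sup>2)" for c
  proof -
    have "(\<integral>\<^sup>+w. q c w * (\<integral>\<^sup>+z. S w z \<partial>dv) \<partial>dv) \<le> (\<integral>\<^sup>+w. ennreal (\<epsilon> / 2 * (c w)\<^sup>2) \<partial>dv)"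
    proof (rule nn_integral_mono_AE)
      show "AE w in dv. q c w * (\<integral>\<^sup>+z. S w z \<partial>dv) \<le> ennreal (\<epsilon> / 2 * (c w)\<^sup>2)"
        unfolding AE_dv
      proof (intro AE_I2 impI)
        fix w :: "complex ^ 'n" assume w: "w \<in> polydisk"
        have "q c w * (\<integral>\<^sup>+z. S w z \<partial>dv) \<le> q c w * ennreal (\<epsilon> * poly_weight w)"
          unfolding S_def by (intro mult_left_mono schur w) simp
        also have "\<dots> = ennreal ((c w)\<^sup>2 / (2 * poly_weight w) * (\<epsilon> * poly_weight w))"
          unfolding q_def using poly_weight_pos[OF w] \<epsilon> by (intro ennreal_mult[symmetric]) auto
        also have "(c w)\<^sup>2 / (2 * poly_weight w) * (\<epsilon> * poly_weight w) = \<epsilon> / 2 * (c w)\<^sup>2"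
          using poly_weight_pos[OF w] by simp
        finally show "q c w * (\<integral>\<^sup>+z. S w z \<partial>dv) \<le> ennreal (\<epsilon> / 2 * (c w)\<^sup>2)" .
      qed
    qed
    also have "\<dots> = ennreal (\<integral>w. \<epsilon> / 2 * (c w)\<^sup>2 \<partial>dv)"
      using c \<epsilon> by (intro nn_integral_eq_integral) auto
    finally show ?thesis by simp
  qed
  have "(\<integral>\<^sup>+z. \<integral>\<^sup>+w. ennreal (far_weight \<rho> z w * kernel_abs z w * a w * b z) \<partial>dv \<partial>dv) \<le>
      (\<integral>\<^sup>+z. \<integral>\<^sup>+w. q a w * S w z + q b z * S z w \<partial>dv \<partial>dv)"
    by (intro nn_integral_mono le)
  also have "\<dots> = (\<integral>\<^sup>+z. (\<integral>\<^sup>+w. q a w * S w z \<partial>dv) + (\<integral>\<^sup>+w. q b z * S z w \<partial>dv) \<partial>dv)"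
    by (intro nn_integral_cong nn_integral_add) measurable
  also have "\<dots> = (\<integral>\<^sup>+z. \<integral>\<^sup>+w. q a w * S w z \<partial>dv \<partial>dv) + (\<integral>\<^sup>+z. \<integral>\<^sup>+w. q b z * S z w \<partial>dv \<partial>dv)"
    by (intro nn_integral_add) measurable
  also have "(\<integral>\<^sup>+z. \<integral>\<^sup>+w. q a w * S w z \<partial>dv \<partial>dv) = (\<integral>\<^sup>+w. \<integral>\<^sup>+z. q a w * S w z \<partial>dv \<partial>dv)"
    by (rule pair.Fubini') measurable
  also have "\<dots> = (\<integral>\<^sup>+w. q a w * (\<integral>\<^sup>+z. S w z \<partial>dv) \<partial>dv)"
    by (intro nn_integral_cong nn_integral_cmult) measurable
  also have "(\<integral>\<^sup>+z. \<integral>\<^sup>+w. q b z * S z w \<partial>dv \<partial>dv) = (\<integral>\<^sup>+z. q b z * (\<integral>\<^sup>+w. S z w \<partial>dv) \<partial>dv)"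
    by (intro nn_integral_cong nn_integral_cmult) measurable
  also have "(\<integral>\<^sup>+w. q a w * (\<integral>\<^sup>+z. S w z \<partial>dv) \<partial>dv) + (\<integral>\<^sup>+z. q b z * (\<integral>\<^sup>+w. S z w \<partial>dv) \<partial>dv) \<le>
      ennreal (\<epsilon> / 2 * (\<integral>w. (a w)\<^sup>2 \<partial>dv)) + ennreal (\<epsilon> / 2 * (\<integral>w. (b w)\<^sup>2 \<partial>dv))"
    by (intro add_mono main a b) measurable
  also have "\<dots> = ennreal (\<epsilon> / 2 * ((\<integral>w. (a w)\<^sup>2 \<partial>dv) + (\<integral>w. (b w)\<^sup>2 \<partial>dv)))"
    using \<epsilon> by (simp add: distrib_left flip: ennreal_plus)
  finally show ?thesis .
qed

lemma toeplitz_defect_measurable: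
  assumes "unit_symbol \<phi>"
  shows "toeplitz_defect \<phi> h \<in> borel_measurable borel"
proof -
  have [measurable]: "\<phi> \<in> borel_measurable borel" using assms by (simp add: unit_symbol_def)
  show ?thesis unfolding toeplitz_defect_def by measurable
qed

lemma toeplitz_defect_square_integrable:
  assumes "unit_symbol \<phi>"
  shows "integrable dv (\<lambda>w. (norm (toeplitz_defect \<phi> h w))\<^sup>2)"
proof (rule Bochner_Integration.integrable_bound)
  have [measurable]: "toeplitz_defect \<phi> h \<in> borel_measurable borel" by (rule toeplitz_defect_measurable[OF assms])
  show "(\<lambda>w. (norm (toeplitz_defect \<phi> h w))\<^sup>2) \<in> borel_measurable dv" by measurable
  show "integrable dv (\<lambda>w. 2 * (norm (of_real (\<phi> w) * bergman_fun h w))\<^sup>2 + 2 * (norm (bergman_fun (toeplitz \<phi> h) w))\<^sup>2)"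
    by (intro Bochner_Integration.integrable_add integrable_mult_right unit_symbol_square_integrable(1)[OF assms]
        bergman_fun_square_integrable)
  have "(norm (a - b))\<^sup>2 \<le> 2 * (norm a)\<^sup>2 + 2 * (norm b)\<^sup>2" for a b :: complex
  proof -
    have "(norm (a - b))\<^sup>2 \<le> (norm a + norm b)\<^sup>2" by (intro power_mono norm_triangle_ineq4) simp
    also have "\<dots> \<le> 2 * (norm a)\<^sup>2 + 2 * (norm b)\<^sup>2"
      using sum_squares_bound[of "norm a" "norm b"] by (simp add: power2_sum)
    finally show ?thesis .
  qed
  then show "AE w in dv. norm ((norm (toeplitz_defect \<phi> h w))\<^sup>2) \<le>
      norm (2 * (norm (of_real (\<phi> w) * bergman_fun h w))\<^sup>2 + 2 * (norm (bergman_fun (toeplitz \<phi> h) w))\<^sup>2)"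
    unfolding toeplitz_defect_def by (intro AE_I2) simp
qed

lemma toeplitz_defect_orthogonal:
  assumes "unit_symbol \<phi>"
  shows "(\<integral>w. toeplitz_defect \<phi> h w * cnj (bergman_fun g w) \<partial>dv) = 0"
proof -
  have "(\<integral>w. toeplitz_defect \<phi> h w * cnj (bergman_fun g w) \<partial>dv) =
      toeplitz_form \<phi> h g - bergman_inner (toeplitz \<phi> h) g"
    unfolding toeplitz_defect_def left_diff_distrib toeplitz_form_def bergman_inner_def
    by (intro Bochner_Integration.integral_diff toeplitz_form_integrable assms
        bergman_functions_integrable_mult bergman_fun)
  then show ?thesis by (simp add: toeplitz_inner[OF assms])
qed

text \<open>Let G be the defect and K the reproducing kernel. Integrating (\<phi> z - \<phi> w) h(w)
  K(z, w) cnj (G z) over both variables gives the squared norm of G: the term with \<phi> z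
  reproduces h and pairs \<phi> h with G, while the term with \<phi> w pairs the kernel at w with G
  and vanishes. The Schur test bounds the integral by a small multiple of the sum of the squared
  norms of h and G.\<close>

lemma toeplitz_defect_small:
  assumes "\<epsilon> > 0"
  shows "\<exists>\<rho>. 1 / 2 \<le> \<rho> \<and> \<rho> < 1 \<and> (\<forall>\<phi> (h :: 'n::finite bergman). slow_symbol \<rho> \<phi> \<longrightarrow>
    (\<integral>w. (norm (toeplitz_defect \<phi> h w))\<^sup>2 \<partial>dv) \<le> \<epsilon> * (norm h)\<^sup>2)"
proof -
  interpret dv: finite_measure "dv :: (complex ^ 'n) measure" by (rule finite_measure_dv)
  interpret pair: pair_sigma_finite "dv :: (complex ^ 'n) measure" "dv :: (complex ^ 'n) measure"
    by standard
  \<comment> \<open>The bound e \<le> 1 lets the term e/2 times the squared norm of G be absorbed on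
    the left.\<close>
  define e where "e = min \<epsilon> 1"
  have e: "e > 0" "e \<le> \<epsilon>" "e \<le> 1" using assms by (auto simp: e_def)
  obtain \<rho> where \<rho>: "1 / 2 \<le> \<rho>" "\<rho> < 1"
    and schur: "\<And>z :: complex ^ 'n. z \<in> polydisk \<Longrightarrow>
      (\<integral>\<^sup>+w. ennreal (far_weight \<rho> z w * (poly_weight w * kernel_abs z w)) \<partial>dv) \<le> ennreal (e * poly_weight z)"
    using schur_polydisk[OF e(1)] by blast
  have "(\<integral>w. (norm (toeplitz_defect \<phi> h w))\<^sup>2 \<partial>dv) \<le> \<epsilon> * (norm h)\<^sup>2"
    if slow: "slow_symbol \<rho> \<phi>" for \<phi> and h :: "'n bergman"
  proof -
    have us: "unit_symbol \<phi>" using slow by (simp add: slow_symbol_def)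
    have [measurable]: "\<phi> \<in> borel_measurable borel" using us by (simp add: unit_symbol_def)
    define G where "G = toeplitz_defect \<phi> h"
    have [measurable]: "G \<in> borel_measurable borel"
      unfolding G_def by (rule toeplitz_defect_measurable[OF us])
    have G2: "integrable dv (\<lambda>w. (norm (G w))\<^sup>2)" unfolding G_def by (rule toeplitz_defect_square_integrable[OF us])
    have G0: "G w = 0" if "w \<notin> polydisk" for w
      using that by (simp add: G_def toeplitz_defect_def bergman_fun_outside)
    have orth: "(\<integral>w. G w * cnj (bergman_fun g w) \<partial>dv) = 0" for g
      unfolding G_def by (rule toeplitz_defect_orthogonal[OF us])
    define K where "K z w = (\<Prod>i\<in>UNIV. 1 / (1 - z $ i * cnj (w $ i))\<^sup>2)" for z w :: "complex ^ 'n"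
    have [measurable]: "(\<lambda>x. K (f x) (g x)) \<in> borel_measurable M"
      if [measurable]: "f \<in> borel_measurable M" "g \<in> borel_measurable M" for f g and M :: "'x measure"
      unfolding K_def by measurable
    have normK: "norm (K z w) = kernel_abs z w" for z w
      unfolding K_def kernel_abs_def prod_norm[symmetric] by (simp add: norm_divide norm_power)
    define \<Psi> where "\<Psi> z w = bergman_fun h w * K z w * cnj (G z)" for z w
    have [measurable]: "(\<lambda>x. \<Psi> (f x) (g x)) \<in> borel_measurable M"
      if [measurable]: "f \<in> borel_measurable M" "g \<in> borel_measurable M" for f g and M :: "'x measure"
      unfolding \<Psi>_def by measurable
    define N where "N = (norm h)\<^sup>2 + (\<integral>w. (norm (G w))\<^sup>2 \<partial>dv)"
    have far: "(\<integral>\<^sup>+z. \<integral>\<^sup>+w. ennreal (far_weight \<rho> z w * norm (\<Psi> z w)) \<partial>dv \<partial>dv) \<le> ennreal (e / 2 * N)"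
    proof -
      have "(\<integral>\<^sup>+z. \<integral>\<^sup>+w. ennreal (far_weight \<rho> z w * kernel_abs z w * norm (bergman_fun h w) * norm (G z)) \<partial>dv \<partial>dv) \<le>
          ennreal (e / 2 * ((\<integral>w. (norm (bergman_fun h w))\<^sup>2 \<partial>dv) + (\<integral>w. (norm (G w))\<^sup>2 \<partial>dv)))"
        by (rule schur_test[OF _ _ _ _ _ _ bergman_fun_square_integrable G2 \<rho>(2) e(1) schur])
          (auto simp: bergman_fun_outside G0)
      then show ?thesis by (simp add: \<Psi>_def norm_mult normK N_def norm_bergman_sq mult_ac)
    qed
    \<comment> \<open>Since \<open>far_weight\<close> is at least 1 - \<rho>, the weighted estimate
      \<open>far\<close> also controls the integrand without weight.\<close>
    have int: "integrable (dv \<Otimes>\<^sub>M dv) (\<lambda>(z, w). \<Psi> z w)"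
    proof (rule integrableI_bounded)
      have "(\<integral>\<^sup>+x. ennreal (norm (case x of (z, w) \<Rightarrow> \<Psi> z w)) \<partial>(dv \<Otimes>\<^sub>M dv)) = (\<integral>\<^sup>+z. \<integral>\<^sup>+w. ennreal (norm (\<Psi> z w)) \<partial>dv \<partial>dv)"
        by (subst dv.nn_integral_fst[symmetric]) simp_all
      also have "\<dots> \<le> (\<integral>\<^sup>+z. \<integral>\<^sup>+w. ennreal (1 / (1 - \<rho>)) * ennreal (far_weight \<rho> z w * norm (\<Psi> z w)) \<partial>dv \<partial>dv)"
      proof (intro nn_integral_mono)
        fix z w :: "complex ^ 'n"
        have "1 - \<rho> \<le> far_weight \<rho> z w" unfolding far_weight_def by (simp add: sum_nonneg)
        then have "(1 - \<rho>) * norm (\<Psi> z w) \<le> far_weight \<rho> z w * norm (\<Psi> z w)" by (intro mult_right_mono) auto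
        then have "norm (\<Psi> z w) \<le> 1 / (1 - \<rho>) * (far_weight \<rho> z w * norm (\<Psi> z w))"
          using \<rho>(2) by (simp add: field_simps)
        then show "ennreal (norm (\<Psi> z w)) \<le> ennreal (1 / (1 - \<rho>)) * ennreal (far_weight \<rho> z w * norm (\<Psi> z w))"
          using \<rho>(2) far_weight_nonneg[OF \<rho>(2), of z w] by (subst ennreal_mult[symmetric]) (auto intro: ennreal_leI)
      qed
      also have "\<dots> = ennreal (1 / (1 - \<rho>)) * (\<integral>\<^sup>+z. \<integral>\<^sup>+w. ennreal (far_weight \<rho> z w * norm (\<Psi> z w)) \<partial>dv \<partial>dv)"
        by (simp add: nn_integral_cmult)
      also have "\<dots> \<le> ennreal (1 / (1 - \<rho>)) * ennreal (e / 2 * N)"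
        using far by (rule mult_left_mono) simp
      also have "\<dots> < \<infinity>" by (simp add: ennreal_mult_less_top)
      finally show "(\<integral>\<^sup>+x. ennreal (norm (case x of (z, w) \<Rightarrow> \<Psi> z w)) \<partial>(dv \<Otimes>\<^sub>M dv)) < \<infinity>" .
    qed measurable
    have int_sym: "integrable (dv \<Otimes>\<^sub>M dv) (\<lambda>(z, w). of_real (s z w) * \<Psi> z w)"
      if [measurable]: "(\<lambda>(z, w). s z w) \<in> borel_measurable (borel \<Otimes>\<^sub>M borel)" and s: "\<And>z w. \<bar>s z w\<bar> \<le> 1"
      for s :: "complex ^ 'n \<Rightarrow> complex ^ 'n \<Rightarrow> real"
    proof (rule Bochner_Integration.integrable_bound[OF int])
      have "(\<lambda>(z, w). s z w) \<in> borel_measurable (dv \<Otimes>\<^sub>M dv)"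
        using that(1) by (simp cong: measurable_cong_sets sets_pair_measure_cong)
      then show "(\<lambda>(z, w). of_real (s z w) * \<Psi> z w) \<in> borel_measurable (dv \<Otimes>\<^sub>M dv)" by measurable
      show "AE x in dv \<Otimes>\<^sub>M dv. norm (case x of (z, w) \<Rightarrow> of_real (s z w) * \<Psi> z w) \<le> norm (case x of (z, w) \<Rightarrow> \<Psi> z w)"
        using s mult_right_mono[OF s norm_ge_zero] by (intro AE_I2) (auto simp: norm_mult split: prod.split)
    qed
    have \<phi>1: "\<bar>\<phi> z\<bar> \<le> 1" for z using us by (simp add: unit_symbol_def)
    have F1: "integrable (dv \<Otimes>\<^sub>M dv) (\<lambda>(z, w). of_real (\<phi> z) * \<Psi> z w)"
      by (rule int_sym[of "\<lambda>z w. \<phi> z"]) (measurable, rule \<phi>1)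
    have F2: "integrable (dv \<Otimes>\<^sub>M dv) (\<lambda>(z, w). of_real (\<phi> w) * \<Psi> z w)"
      by (rule int_sym[of "\<lambda>z w. \<phi> w"]) (measurable, rule \<phi>1)
    have AEp: "AE z in (dv :: (complex ^ 'n) measure). z \<in> polydisk" by (simp add: AE_dv)
    have K_fun: "K z w = bergman_fun (bergman_kernel w) z" if "z \<in> polydisk" "w \<in> polydisk" for z w
      using that by (simp add: K_def bergman_fun_bergman_kernel)
    have K_cnj: "K z w = cnj (K w z)" for z w by (simp add: K_def mult.commute)
    \<comment> \<open>The inner integral reproduces h at z; orthogonality of G to the Bergman space
      then leaves the squared norm of G.\<close>
    have self: "(\<integral>z. \<integral>w. of_real (\<phi> z) * \<Psi> z w \<partial>dv \<partial>dv) = of_real (\<integral>w. (norm (G w))\<^sup>2 \<partial>dv)"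
    proof -
      have "(\<integral>w. of_real (\<phi> z) * \<Psi> z w \<partial>dv) = of_real (\<phi> z) * bergman_fun h z * cnj (G z)" if z: "z \<in> polydisk" for z
      proof -
        have "(\<integral>w. of_real (\<phi> z) * \<Psi> z w \<partial>dv) =
            (\<integral>w. (of_real (\<phi> z) * cnj (G z)) * (bergman_fun h w * cnj (bergman_fun (bergman_kernel z) w)) \<partial>dv)"
        proof (rule integral_cong_AE)
          show "AE w in dv. of_real (\<phi> z) * \<Psi> z w =
              (of_real (\<phi> z) * cnj (G z)) * (bergman_fun h w * cnj (bergman_fun (bergman_kernel z) w))"
            using AEp
          proof eventually_elim
            case (elim w)
            then show ?case using z by (simp add: \<Psi>_def K_cnj[of z w] K_fun mult_ac)
          qed
        qed measurable
        also have "\<dots> = (of_real (\<phi> z) * cnj (G z)) * bergman_inner h (bergman_kernel z)"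
          by (simp add: bergman_inner_def)
        finally show ?thesis by (simp add: bergman_inner_bergman_kernel z mult_ac)
      qed
      then have "(\<integral>z. \<integral>w. of_real (\<phi> z) * \<Psi> z w \<partial>dv \<partial>dv) = (\<integral>z. (of_real (\<phi> z) * bergman_fun h z) * cnj (G z) \<partial>dv)"
        using AEp by (intro integral_cong_AE) auto
      also have "\<dots> = (\<integral>z. G z * cnj (G z) + bergman_fun (toeplitz \<phi> h) z * cnj (G z) \<partial>dv)"
        by (rule Bochner_Integration.integral_cong) (simp_all add: G_def toeplitz_defect_def algebra_simps)
      also have "\<dots> = (\<integral>z. G z * cnj (G z) \<partial>dv) + (\<integral>z. bergman_fun (toeplitz \<phi> h) z * cnj (G z) \<partial>dv)"
        by (intro Bochner_Integration.integral_add square_integrable_inner(1) G2 bergman_fun_square_integrable) measurable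
      also have "(\<integral>z. bergman_fun (toeplitz \<phi> h) z * cnj (G z) \<partial>dv) = cnj (\<integral>z. G z * cnj (bergman_fun (toeplitz \<phi> h) z) \<partial>dv)"
        by (subst Bochner_Integration.integral_cnj[symmetric]) (simp add: mult.commute)
      also have "(\<integral>z. G z * cnj (G z) \<partial>dv) = of_real (\<integral>w. (norm (G w))\<^sup>2 \<partial>dv)"
        unfolding integral_complex_of_real[symmetric] by (simp only: complex_norm_square)
      finally show ?thesis by (simp add: orth)
    qed
    \<comment> \<open>For fixed w the kernel is a Bergman function of z, to which G is
      orthogonal.\<close>
    have zero: "(\<integral>w. \<integral>z. of_real (\<phi> w) * \<Psi> z w \<partial>dv \<partial>dv) = 0"
    proof -
      have "(\<integral>z. of_real (\<phi> w) * \<Psi> z w \<partial>dv) = 0" if w: "w \<in> polydisk" for w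
      proof -
        have "(\<integral>z. of_real (\<phi> w) * \<Psi> z w \<partial>dv) =
            (\<integral>z. (of_real (\<phi> w) * bergman_fun h w) * cnj (G z * cnj (bergman_fun (bergman_kernel w) z)) \<partial>dv)"
        proof (rule integral_cong_AE)
          show "AE z in dv. of_real (\<phi> w) * \<Psi> z w =
              (of_real (\<phi> w) * bergman_fun h w) * cnj (G z * cnj (bergman_fun (bergman_kernel w) z))"
            using AEp
          proof eventually_elim
            case (elim z)
            then show ?case using w by (simp add: \<Psi>_def K_fun mult_ac)
          qed
        qed measurable
        also have "\<dots> = (of_real (\<phi> w) * bergman_fun h w) * cnj (\<integral>z. G z * cnj (bergman_fun (bergman_kernel w) z) \<partial>dv)"
          by (subst integral_mult_right_zero, subst Bochner_Integration.integral_cnj) simp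
        finally show ?thesis by (simp add: orth)
      qed
      then show ?thesis
        using AEp by (intro integral_eq_zero_AE) auto
    qed
    have "complex_of_real (\<integral>w. (norm (G w))\<^sup>2 \<partial>dv) =
        (\<integral>x. (case x of (z, w) \<Rightarrow> of_real (\<phi> z) * \<Psi> z w) \<partial>(dv \<Otimes>\<^sub>M dv)) -
        (\<integral>x. (case x of (z, w) \<Rightarrow> of_real (\<phi> w) * \<Psi> z w) \<partial>(dv \<Otimes>\<^sub>M dv))"
      using pair.integral_fst[OF F1] pair.integral_snd[OF F2] self zero by simp
    also have "\<dots> = (\<integral>x. (case x of (z, w) \<Rightarrow> of_real (\<phi> z) * \<Psi> z w) - (case x of (z, w) \<Rightarrow> of_real (\<phi> w) * \<Psi> z w) \<partial>(dv \<Otimes>\<^sub>M dv))"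
      by (rule Bochner_Integration.integral_diff[OF F1 F2, symmetric])
    also have "\<dots> = (\<integral>x. (case x of (z, w) \<Rightarrow> of_real (\<phi> z - \<phi> w) * \<Psi> z w) \<partial>(dv \<Otimes>\<^sub>M dv))"
      by (rule Bochner_Integration.integral_cong) (auto simp: algebra_simps)
    finally have eq: "complex_of_real (\<integral>w. (norm (G w))\<^sup>2 \<partial>dv) =
        (\<integral>x. (case x of (z, w) \<Rightarrow> of_real (\<phi> z - \<phi> w) * \<Psi> z w) \<partial>(dv \<Otimes>\<^sub>M dv))" .
    have intd: "integrable (dv \<Otimes>\<^sub>M dv) (\<lambda>(z, w). of_real (\<phi> z - \<phi> w) * \<Psi> z w)"
      using Bochner_Integration.integrable_diff[OF F1 F2] by (simp add: split_beta' algebra_simps)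
    have "ennreal (norm (complex_of_real (\<integral>w. (norm (G w))\<^sup>2 \<partial>dv))) \<le>
        (\<integral>\<^sup>+x. ennreal (norm (case x of (z, w) \<Rightarrow> of_real (\<phi> z - \<phi> w) * \<Psi> z w)) \<partial>(dv \<Otimes>\<^sub>M dv))"
      unfolding eq by (rule integral_norm_bound_ennreal[OF intd])
    also have "\<dots> = (\<integral>\<^sup>+z. \<integral>\<^sup>+w. ennreal (norm (of_real (\<phi> z - \<phi> w) * \<Psi> z w)) \<partial>dv \<partial>dv)"
      by (subst dv.nn_integral_fst[symmetric]) simp_all
    also have "\<dots> \<le> (\<integral>\<^sup>+z. \<integral>\<^sup>+w. ennreal (far_weight \<rho> z w * norm (\<Psi> z w)) \<partial>dv \<partial>dv)"
    proof (intro nn_integral_mono ennreal_leI)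
      fix z w :: "complex ^ 'n"
      show "norm (of_real (\<phi> z - \<phi> w) * \<Psi> z w) \<le> far_weight \<rho> z w * norm (\<Psi> z w)"
      proof (cases "z \<in> polydisk \<and> w \<in> polydisk")
        case True
        then show ?thesis unfolding norm_mult norm_of_real
          using slow_symbol_far_weight[OF slow _ _ \<rho>(2)] by (intro mult_right_mono) auto
      next
        case False
        then show ?thesis by (auto simp: \<Psi>_def bergman_fun_outside G0)
      qed
    qed
    also note far
    finally have "(\<integral>w. (norm (G w))\<^sup>2 \<partial>dv) \<le> e / 2 * N"
      using e by (simp add: N_def ennreal_le_iff add_nonneg_nonneg)
    moreover have "e / 2 * (\<integral>w. (norm (G w))\<^sup>2 \<partial>dv) \<le> 1 / 2 * (\<integral>w. (norm (G w))\<^sup>2 \<partial>dv)"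
      using e by (intro mult_right_mono) auto
    ultimately have "(\<integral>w. (norm (G w))\<^sup>2 \<partial>dv) \<le> e * (norm h)\<^sup>2"
      unfolding N_def by (simp add: distrib_left)
    also have "\<dots> \<le> \<epsilon> * (norm h)\<^sup>2" using e by (intro mult_right_mono) auto
    finally show ?thesis by (simp add: G_def)
  qed
  then show ?thesis using \<rho> by blast
qed

section \<open>The Bessel inequality for localized kernels and the commutator algebra\<close>

text \<open>This is cosh^2 of \<open>beta_dist u v\<close> for points of the disc, because
  \<open>norm (mobius u v)\<close> is the hyperbolic tangent of that distance. Its reciprocal is the
  modulus of the inner product of the normalized kernels of the disc at u and v.\<close>

definition cosh2 :: "complex \<Rightarrow> complex \<Rightarrow> real"
  where "cosh2 u v = (norm (1 - u * cnj v))\<^sup>2 / ((1 - (norm u)\<^sup>2) * (1 - (norm v)\<^sup>2))"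

lemma norm_one_minus_commute: "norm (1 - u * cnj v) = norm (1 - v * cnj u)"
proof -
  have "norm (1 - u * cnj v) = norm (cnj (1 - u * cnj v))" by (simp only: complex_mod_cnj)
  then show ?thesis by (simp add: mult.commute)
qed

lemma cosh2_commute: "cosh2 u v = cosh2 v u"
  unfolding cosh2_def by (simp add: norm_one_minus_commute[of u v] mult.commute)

lemma inverse_cosh2:
  assumes "norm u < 1" "norm v < 1"
  shows "1 / cosh2 u v = 1 - (norm (mobius u v))\<^sup>2"
  unfolding one_minus_norm_mobius_sq[OF assms] cosh2_def norm_one_minus_commute[of u v] by simp

lemma cosh2_pos:
  assumes "norm u < 1" "norm v < 1"
  shows "cosh2 u v > 0"
  unfolding cosh2_def
  using norm_less_one_sq_pos[OF assms(1)] norm_less_one_sq_pos[OF assms(2)] one_minus_mult_cnj_nz[OF assms(2,1)]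
  by (intro divide_pos_pos mult_pos_pos zero_less_power) auto

text \<open>An algebraic substitute for the triangle inequality: cosh (x + y) = cosh x cosh y + sinh
  x sinh y \<le> 2 cosh x cosh y, squared. The addition formula appears as a polynomial identity for
  (1 - a cnj c) (1 - |b|^2).\<close>

lemma cosh2_quasi_triangle:
  assumes a: "norm a < 1" and b: "norm b < 1" and c: "norm c < 1"
  shows "cosh2 a c \<le> 4 * cosh2 a b * cosh2 b c"
proof -
  note pos = norm_less_one_sq_pos[OF a] norm_less_one_sq_pos[OF b] norm_less_one_sq_pos[OF c]
  have le: "norm (u - v) \<le> norm (1 - u * cnj v)" if "norm u < 1" "norm v < 1" for u v
  proof -
    have "(norm (1 - u * cnj v))\<^sup>2 - (norm (v - u))\<^sup>2 \<ge> 0"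
      unfolding norm_diff_sq_mobius using norm_less_one_sq_pos that by (intro mult_nonneg_nonneg) (auto intro: less_imp_le)
    then have "(norm (u - v))\<^sup>2 \<le> (norm (1 - u * cnj v))\<^sup>2" by (simp add: norm_minus_commute)
    then show ?thesis by (rule power2_le_imp_le) simp
  qed
  have "(1 - a * cnj c) * of_real (1 - (norm b)\<^sup>2) = (1 - a * cnj b) * (1 - b * cnj c) - (a - b) * cnj (c - b)"
    by (simp add: of_real_norm_sq algebra_simps)
  then have "norm (1 - a * cnj c) * (1 - (norm b)\<^sup>2) = norm ((1 - a * cnj b) * (1 - b * cnj c) - (a - b) * cnj (c - b))"
    using pos(2) by (metis abs_of_pos norm_mult norm_of_real)
  also have "\<dots> \<le> norm (1 - a * cnj b) * norm (1 - b * cnj c) + norm (a - b) * norm (b - c)"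
    using norm_triangle_ineq4[of "(1 - a * cnj b) * (1 - b * cnj c)" "(a - b) * cnj (c - b)"]
    unfolding norm_mult complex_mod_cnj norm_minus_commute[of c b] .
  also have "\<dots> \<le> norm (1 - a * cnj b) * norm (1 - b * cnj c) + norm (1 - a * cnj b) * norm (1 - b * cnj c)"
    by (intro add_left_mono mult_mono le a b c) auto
  finally have "norm (1 - a * cnj c) * (1 - (norm b)\<^sup>2) \<le> 2 * (norm (1 - a * cnj b) * norm (1 - b * cnj c))" by simp
  from power_mono[OF this, of 2]
  have "(norm (1 - a * cnj c))\<^sup>2 * (1 - (norm b)\<^sup>2)\<^sup>2 \<le> 4 * ((norm (1 - a * cnj b))\<^sup>2 * (norm (1 - b * cnj c))\<^sup>2)"
    using pos(2) by (simp add: power_mult_distrib)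
  moreover have "x / (p * r) \<le> 4 * (y / (p * q)) * (w / (q * r))"
    if "x * q\<^sup>2 \<le> 4 * (y * w)" "p > 0" "q > 0" "r > 0" for x y w p q r :: real
  proof -
    have "x \<le> 4 * (y * w) / q\<^sup>2" using that by (simp add: pos_le_divide_eq)
    from divide_right_mono[OF this, of "p * r"] that show ?thesis
      by (simp add: power2_eq_square mult_ac)
  qed
  ultimately show ?thesis using pos unfolding cosh2_def by simp
qed

section \<open>Hyperbolic distance, Bessel inequality and overlap\<close>

lemma beta_dist_nonneg:
  assumes "norm u < 1" "norm v < 1"
  shows "beta_dist u v \<ge> 0"
proof -
  have "(1 + norm (mobius u v)) / (1 - norm (mobius u v)) \<ge> 1"
    using norm_mobius_less_one[OF assms] by simp
  then show ?thesis by (simp add: beta_dist_def)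
qed

lemma beta_dist_le_imp:
  assumes "norm u < 1" "norm v < 1" "beta_dist u v \<le> C"
  shows "norm (mobius u v) \<le> 1 - exp (- (2 * C))" and "cosh2 u v \<le> exp (2 * C)"
proof -
  define m where "m = norm (mobius u v)"
  have m: "0 \<le> m" "m < 1" using norm_mobius_less_one[OF assms(1,2)] by (auto simp: m_def)
  have "ln ((1 + m) / (1 - m)) \<le> 2 * C" using assms(3) by (simp add: beta_dist_def m_def)
  then have "exp (ln ((1 + m) / (1 - m))) \<le> exp (2 * C)" by (simp only: exp_le_cancel_iff)
  then have "(1 + m) / (1 - m) \<le> exp (2 * C)" using m by simp
  moreover have "1 / (1 - m) \<le> (1 + m) / (1 - m)" using m by (intro divide_right_mono) auto
  ultimately have e: "1 / (1 - m) \<le> exp (2 * C)" by linarith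
  then have "1 \<le> exp (2 * C) * (1 - m)" using m by (simp add: field_simps)
  from mult_left_mono[OF this, of "exp (- (2 * C))"] have "exp (- (2 * C)) \<le> 1 - m"
    by (simp add: mult.assoc[symmetric] flip: exp_add)
  then show "norm (mobius u v) \<le> 1 - exp (- (2 * C))" by (simp add: m_def)
  have "cosh2 u v = 1 / (1 - m\<^sup>2)"
    using inverse_cosh2[OF assms(1,2)] cosh2_pos[OF assms(1,2)] by (simp add: m_def) (metis inverse_eq_divide inverse_inverse_eq)
  also have "\<dots> \<le> 1 / (1 - m)"
  proof (rule divide_left_mono)
    have "m\<^sup>2 \<le> m" using m by (simp add: power2_eq_square mult_left_le)
    then show "1 - m \<le> 1 - m\<^sup>2" by simp
    then show "0 < (1 - m\<^sup>2) * (1 - m)" using m by (intro mult_pos_pos) auto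
  qed simp
  finally show "cosh2 u v \<le> exp (2 * C)" using e by simp
qed

lemma polydisk_dist_ge_beta:
  fixes z w :: "complex ^ 'n::finite"
  assumes "z \<in> polydisk" "w \<in> polydisk"
  shows "beta_dist (z $ i) (w $ i) \<le> polydisk_dist z w"
  unfolding polydisk_dist_def
  by (rule member_le_sum) (use assms beta_dist_nonneg in \<open>auto simp: polydisk_def\<close>)

lemma polydisk_nbhd_subset_ball:
  fixes z :: "complex ^ 'n::finite"
  assumes z: "z \<in> polydisk" and a: "a > 0"
  shows "\<exists>\<rho>. 0 < \<rho> \<and> \<rho> < 1 \<and> (\<forall>z\<in>(polydisk :: (complex ^ 'n) set). polydisk_nbhd z \<rho> \<subseteq> polydisk_ball z a)"
proof -
  define E where "E = exp (2 * a / CARD('n))"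
  have E: "E > 1" using a by (simp add: E_def)
  \<comment> \<open>The hyperbolic tangent of a / n: pseudohyperbolic distance below \<rho> in every
    coordinate means \<open>beta_dist\<close> below a / n in every coordinate.\<close>
  define \<rho> where "\<rho> = (E - 1) / (E + 1)"
  have \<rho>: "0 < \<rho>" "\<rho> < 1" using E by (auto simp: \<rho>_def field_simps)
  have r: "(1 + \<rho>) / (1 - \<rho>) = E" using E by (simp add: \<rho>_def field_simps)
  have "polydisk_nbhd z \<rho> \<subseteq> polydisk_ball z a" if z: "z \<in> polydisk" for z :: "complex ^ 'n"
  proof
    fix w assume w: "w \<in> polydisk_nbhd z \<rho>"
    have "beta_dist (z $ i) (w $ i) < a / CARD('n)" for i
    proof -
      define m where "m = norm (mobius (z $ i) (w $ i))"
      have m: "0 \<le> m" "m < \<rho>" using w by (auto simp: m_def polydisk_nbhd_def)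
      have "(1 + m) / (1 - m) < (1 + \<rho>) / (1 - \<rho>)"
        using m \<rho> by (intro frac_less2) auto
      then have "ln ((1 + m) / (1 - m)) < ln E" unfolding r using m \<rho> E by (intro ln_less_cancel_iff[THEN iffD2]) auto
      then show ?thesis by (simp add: beta_dist_def m_def E_def mult.commute)
    qed
    then have "polydisk_dist z w < (\<Sum>i\<in>(UNIV :: 'n set). a / CARD('n))"
      unfolding polydisk_dist_def by (intro sum_strict_mono) auto
    then show "w \<in> polydisk_ball z a" using w by (simp add: polydisk_ball_def polydisk_nbhd_def)
  qed
  then show ?thesis using \<rho> by blast
qed

text \<open>Each coefficient is bounded by an integral over its neighbourhood, and at most N
  neighbourhoods overlap. The function may depend on the index as long as there is a common majorant
  u, as happens for \<open>toeplitz \<phi> h\<close> minus \<phi> (p x) h. Indices are kept apart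
  from points since p may take a value several times.\<close>

lemma bergman_bessel:
  fixes f :: "'a \<Rightarrow> 'n::finite bergman" and p :: "'a \<Rightarrow> complex ^ 'n"
  assumes F: "finite F" and p: "\<And>x. x \<in> F \<Longrightarrow> p x \<in> polydisk" and \<rho>: "0 < \<rho>" "\<rho> < 1"
    and overlap: "\<And>w. w \<in> polydisk \<Longrightarrow> card {x \<in> F. w \<in> polydisk_nbhd (p x) \<rho>} \<le> N"
    and u: "integrable dv u" "\<And>w. u w \<ge> 0"
    and le: "\<And>x w. x \<in> F \<Longrightarrow> w \<in> polydisk_nbhd (p x) \<rho> \<Longrightarrow> (norm (bergman_fun (f x) w))\<^sup>2 \<le> u w"
  shows "(\<Sum>x\<in>F. (norm (bergman_inner (f x) (normalized_kernel (p x))))\<^sup>2) \<le>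
    (16 / \<rho>\<^sup>2) ^ CARD('n) * (real N * (\<integral>w. u w \<partial>dv))"
proof -
  have int: "integrable dv (\<lambda>w. indicator (polydisk_nbhd (p x) \<rho>) w * u w)" for x
    using integrable_mult_indicator[of "polydisk_nbhd (p x) \<rho>" dv, OF _ u(1)] by simp
  have "(\<Sum>x\<in>F. (norm (bergman_inner (f x) (normalized_kernel (p x))))\<^sup>2) \<le>
      (\<Sum>x\<in>F. (16 / \<rho>\<^sup>2) ^ CARD('n) * (\<integral>w. indicator (polydisk_nbhd (p x) \<rho>) w * u w \<partial>dv))"
  proof (rule sum_mono)
    fix x assume x: "x \<in> F"
    have "(norm (bergman_inner (f x) (normalized_kernel (p x))))\<^sup>2 = (poly_delta (p x))\<^sup>2 * (norm (bergman_fun (f x) (p x)))\<^sup>2"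
      using p[OF x] by (simp add: bergman_inner_kernel norm_mult power_mult_distrib)
    also have "\<dots> \<le> (16 / \<rho>\<^sup>2) ^ CARD('n) *
        (\<integral>w. indicator (polydisk_nbhd (p x) \<rho>) w * (norm (bergman_fun (f x) w))\<^sup>2 \<partial>dv)"
      by (rule bergman_submean[OF p[OF x] \<rho>])
    also have "\<dots> \<le> (16 / \<rho>\<^sup>2) ^ CARD('n) * (\<integral>w. indicator (polydisk_nbhd (p x) \<rho>) w * u w \<partial>dv)"
    proof (rule mult_left_mono, rule integral_mono[OF _ int])
      show "integrable dv (\<lambda>w. indicator (polydisk_nbhd (p x) \<rho>) w * (norm (bergman_fun (f x) w))\<^sup>2)"
        using integrable_mult_indicator[of "polydisk_nbhd (p x) \<rho>" dv, OF _ bergman_fun_square_integrable[of "f x"]] by simp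
      show "indicator (polydisk_nbhd (p x) \<rho>) w * (norm (bergman_fun (f x) w))\<^sup>2 \<le>
          indicator (polydisk_nbhd (p x) \<rho>) w * u w" for w
        using le[OF x, of w] by (cases "w \<in> polydisk_nbhd (p x) \<rho>") simp_all
    qed simp
    finally show "(norm (bergman_inner (f x) (normalized_kernel (p x))))\<^sup>2 \<le>
        (16 / \<rho>\<^sup>2) ^ CARD('n) * (\<integral>w. indicator (polydisk_nbhd (p x) \<rho>) w * u w \<partial>dv)" .
  qed
  also have "\<dots> = (16 / \<rho>\<^sup>2) ^ CARD('n) * (\<integral>w. (\<Sum>x\<in>F. indicator (polydisk_nbhd (p x) \<rho>) w * u w) \<partial>dv)"
    using int by (simp add: sum_distrib_left)
  also have "\<dots> \<le> (16 / \<rho>\<^sup>2) ^ CARD('n) * (\<integral>w. real N * u w \<partial>dv)"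
  proof (intro mult_left_mono integral_mono Bochner_Integration.integrable_sum int integrable_mult_right u(1))
    fix w
    have "(\<Sum>x\<in>F. indicator (polydisk_nbhd (p x) \<rho>) w) = real (card {x \<in> F. w \<in> polydisk_nbhd (p x) \<rho>})"
      using F by (simp add: indicator_def sum.If_cases Int_def)
    also have "\<dots> \<le> real N"
    proof (cases "w \<in> polydisk")
      case False
      then have "{x \<in> F. w \<in> polydisk_nbhd (p x) \<rho>} = {}" by (auto simp: polydisk_nbhd_def)
      then have "card {x \<in> F. w \<in> polydisk_nbhd (p x) \<rho>} = 0" by (simp only: card.empty)
      then show ?thesis by linarith
    next
      case True
      from overlap[OF this] show ?thesis by (rule of_nat_mono)
    qed
    finally show "(\<Sum>x\<in>F. indicator (polydisk_nbhd (p x) \<rho>) w * u w) \<le> real N * u w"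
      unfolding sum_distrib_right[symmetric] using u(2) by (intro mult_right_mono)
  qed simp
  finally show ?thesis by simp
qed

lemma norm_inner_normalized_kernels:
  fixes z w :: "complex ^ 'n::finite"
  assumes "z \<in> polydisk" "w \<in> polydisk"
  shows "norm (bergman_inner (normalized_kernel w) (normalized_kernel z)) = (\<Prod>i\<in>UNIV. 1 / cosh2 (z $ i) (w $ i))"
proof -
  have "norm (bergman_inner (normalized_kernel w) (normalized_kernel z)) =
      poly_delta z * poly_delta w / (\<Prod>i\<in>UNIV. (norm (1 - z $ i * cnj (w $ i)))\<^sup>2)"
    unfolding bergman_inner_normalized_kernels[OF assms] norm_divide norm_of_real prod_norm[symmetric] norm_power
    using poly_delta_pos[OF assms(1)] poly_delta_pos[OF assms(2)] by (simp add: abs_mult)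
  then show ?thesis by (simp add: cosh2_def poly_delta_def prod_dividef prod.distrib)
qed

text \<open>Separation is known for \<Gamma>, not for its image under \<gamma>. If \<gamma> z is
  near w then z is at bounded distance from w, so the normalized kernels at z and w have an inner
  product bounded below; the Bessel inequality over the separated set bounds the number of such z.
  This replaces a volume count.\<close>

lemma separated_overlap:
  fixes \<Gamma> :: "(complex ^ 'n::finite) set"
  assumes sep: "separated_set \<Gamma>" and \<gamma>: "\<And>z. z \<in> \<Gamma> \<Longrightarrow> \<gamma> z \<in> polydisk"
    and C: "\<And>z. z \<in> \<Gamma> \<Longrightarrow> polydisk_dist z (\<gamma> z) \<le> C"
  shows "\<exists>N. \<forall>F w. finite F \<longrightarrow> F \<subseteq> \<Gamma> \<longrightarrow> w \<in> polydisk \<longrightarrow> card {z \<in> F. w \<in> polydisk_nbhd (\<gamma> z) (1 / 2)} \<le> N"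
proof -
  obtain a where a: "a > 0" "\<And>u v. u \<in> \<Gamma> \<Longrightarrow> v \<in> \<Gamma> \<Longrightarrow> u \<noteq> v \<Longrightarrow> polydisk_ball u a \<inter> polydisk_ball v a = {}"
    and \<Gamma>: "\<Gamma> \<subseteq> polydisk"
    using sep unfolding separated_set_def by blast
  obtain \<rho> where \<rho>: "0 < \<rho>" "\<rho> < 1" "\<And>z :: complex ^ 'n. z \<in> polydisk \<Longrightarrow> polydisk_nbhd z \<rho> \<subseteq> polydisk_ball z a"
    using polydisk_nbhd_subset_ball[OF zero_in_polydisk a(1)] by blast
  \<comment> \<open>The factors are the constant of the quasi-triangle inequality, the bound for
    \<open>cosh2\<close> at distance C, and 1 / (1 - (1/2)^2) for the radius 1/2.\<close>
  define M where "M = 4 * exp (2 * C) * (4 / 3)"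
  have M: "M > 0" by (simp add: M_def)
  define K where "K = (16 / \<rho>\<^sup>2) ^ CARD('n) * (M ^ CARD('n))\<^sup>2"
  have "real (card {z \<in> F. w \<in> polydisk_nbhd (\<gamma> z) (1 / 2)}) \<le> K"
    if F: "finite F" "F \<subseteq> \<Gamma>" and w: "w \<in> polydisk" for F w
  proof -
    define S where "S = {z \<in> F. w \<in> polydisk_nbhd (\<gamma> z) (1 / 2)}"
    have S: "finite S" "S \<subseteq> \<Gamma>" "S \<subseteq> polydisk" using F \<Gamma> by (auto simp: S_def)
    have "(\<Sum>z\<in>S. (norm (bergman_inner (normalized_kernel w) (normalized_kernel z)))\<^sup>2) \<le>
        (16 / \<rho>\<^sup>2) ^ CARD('n) * (real 1 * (\<integral>v. (norm (bergman_fun (normalized_kernel w) v))\<^sup>2 \<partial>dv))"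
    proof (rule bergman_bessel[OF S(1) _ \<rho>(1,2), where p = "\<lambda>z. z"])
      fix v :: "complex ^ 'n"
      \<comment> \<open>Disjoint balls put each point into at most one neighbourhood, so the Bessel
        inequality holds with overlap 1.\<close>
      have "\<exists>x. {x \<in> S. v \<in> polydisk_nbhd x \<rho>} \<subseteq> {x}"
      proof (rule ccontr)
        assume "\<nexists>x. {x \<in> S. v \<in> polydisk_nbhd x \<rho>} \<subseteq> {x}"
        then obtain x y where "x \<in> S" "y \<in> S" "x \<noteq> y" "v \<in> polydisk_nbhd x \<rho>" "v \<in> polydisk_nbhd y \<rho>" by blast
        then have "v \<in> polydisk_ball x a \<inter> polydisk_ball y a" using S \<rho>(3) by blast
        then show False using a(2)[of x y] \<open>x \<in> S\<close> \<open>y \<in> S\<close> \<open>x \<noteq> y\<close> S(2) by blast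
      qed
      then obtain x where "{x \<in> S. v \<in> polydisk_nbhd x \<rho>} \<subseteq> {x}" ..
      from card_mono[OF _ this] show "card {x \<in> S. v \<in> polydisk_nbhd x \<rho>} \<le> 1" by simp
    qed (use S bergman_fun_square_integrable in auto)
    also have "(\<integral>v. (norm (bergman_fun (normalized_kernel w) v))\<^sup>2 \<partial>dv) = 1"
      using norm_normalized_kernel[OF w] by (simp add: norm_bergman_sq[symmetric])
    finally have upper: "(\<Sum>z\<in>S. (norm (bergman_inner (normalized_kernel w) (normalized_kernel z)))\<^sup>2) \<le> (16 / \<rho>\<^sup>2) ^ CARD('n)"
      by simp
    have "1 / (M ^ CARD('n))\<^sup>2 \<le> (norm (bergman_inner (normalized_kernel w) (normalized_kernel z)))\<^sup>2" if z: "z \<in> S" for z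
    proof -
      have zp: "z \<in> polydisk" "\<gamma> z \<in> polydisk" using z S \<gamma> by auto
      have "(\<Prod>i\<in>(UNIV :: 'n set). 1 / M) \<le> (\<Prod>i\<in>UNIV. 1 / cosh2 (z $ i) (w $ i))"
      proof (intro prod_mono conjI)
        fix i :: 'n
        have n: "norm (z $ i) < 1" "norm (\<gamma> z $ i) < 1" "norm (w $ i) < 1" using zp w by (auto simp: polydisk_def)
        have "beta_dist (z $ i) (\<gamma> z $ i) \<le> C"
          using polydisk_dist_ge_beta[OF zp, of i] C[of z] z S by force
        then have 1: "cosh2 (z $ i) (\<gamma> z $ i) \<le> exp (2 * C)" by (rule beta_dist_le_imp[OF n(1,2)])
        have "norm (mobius (\<gamma> z $ i) (w $ i)) < 1 / 2" using z by (simp add: S_def polydisk_nbhd_def)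
        then have "(norm (mobius (\<gamma> z $ i) (w $ i)))\<^sup>2 \<le> (1 / 2)\<^sup>2" by (intro power_mono) auto
        then have "1 / cosh2 (\<gamma> z $ i) (w $ i) \<ge> 3 / 4"
          unfolding inverse_cosh2[OF n(2,3)] by (simp add: power2_eq_square)
        then have 2: "cosh2 (\<gamma> z $ i) (w $ i) \<le> 4 / 3" using cosh2_pos[OF n(2,3)] by (simp add: field_simps)
        have "cosh2 (z $ i) (w $ i) \<le> 4 * cosh2 (z $ i) (\<gamma> z $ i) * cosh2 (\<gamma> z $ i) (w $ i)"
          by (rule cosh2_quasi_triangle[OF n])
        also have "\<dots> \<le> 4 * exp (2 * C) * (4 / 3)"
          using 1 2 cosh2_pos[OF n(2,3)] cosh2_pos[OF n(1,2)] by (intro mult_mono) auto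
        finally have "cosh2 (z $ i) (w $ i) \<le> M" by (simp add: M_def)
        then show "1 / M \<le> 1 / cosh2 (z $ i) (w $ i)"
          using cosh2_pos[OF n(1,3)] M by (intro divide_left_mono) auto
      qed (use M in auto)
      then have "1 / M ^ CARD('n) \<le> norm (bergman_inner (normalized_kernel w) (normalized_kernel z))"
        by (simp add: norm_inner_normalized_kernels[OF zp(1) w] power_one_over)
      from power_mono[OF this, of 2] show ?thesis using M by (simp add: power_divide)
    qed
    then have "(\<Sum>z\<in>S. 1 / (M ^ CARD('n))\<^sup>2) \<le>
        (\<Sum>z\<in>S. (norm (bergman_inner (normalized_kernel w) (normalized_kernel z)))\<^sup>2)"
      by (rule sum_mono)
    then have "real (card S) * (1 / (M ^ CARD('n))\<^sup>2) \<le> (16 / \<rho>\<^sup>2) ^ CARD('n)"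
      using upper by simp
    then show ?thesis unfolding S_def[symmetric] K_def using M by (simp add: field_simps)
  qed
  then have "\<forall>F w. finite F \<longrightarrow> F \<subseteq> \<Gamma> \<longrightarrow> w \<in> polydisk \<longrightarrow> card {z \<in> F. w \<in> polydisk_nbhd (\<gamma> z) (1 / 2)} \<le> nat \<lceil>K\<rceil>"
    by (metis (no_types, lifting) le_nat_iff nat_le_iff of_int_of_nat_eq le_ceiling_iff ceiling_mono ceiling_of_nat nat_int nat_mono)
  then show ?thesis by blast
qed

section \<open>Operators almost commuting with slow symbols\<close>

definition toeplitz_commutator :: "'n::finite bergman_op \<Rightarrow> (complex ^ 'n \<Rightarrow> real) \<Rightarrow> 'n bergman_op"
  where "toeplitz_commutator A \<phi> = (A o\<^sub>L toeplitz \<phi>) - (toeplitz \<phi> o\<^sub>L A)"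

definition slowly_commuting :: "'n::finite bergman_op set"
  where "slowly_commuting = {A. clinear_op A \<and> (\<forall>\<epsilon>>0. \<exists>\<rho>. 1 / 2 \<le> \<rho> \<and> \<rho> < 1 \<and>
    (\<forall>\<phi>. slow_symbol \<rho> \<phi> \<longrightarrow> norm (toeplitz_commutator A \<phi>) \<le> \<epsilon>))}"

lemma slowly_commutingI:
  assumes "clinear_op A"
    and "\<And>\<epsilon>. \<epsilon> > 0 \<Longrightarrow> \<exists>\<rho>. 1 / 2 \<le> \<rho> \<and> \<rho> < 1 \<and>
      (\<forall>\<phi>. slow_symbol \<rho> \<phi> \<longrightarrow> norm (toeplitz_commutator A \<phi>) \<le> \<epsilon>)"
  shows "A \<in> slowly_commuting"
  using assms by (simp add: slowly_commuting_def)

lemma slowly_commutingD: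
  assumes "A \<in> slowly_commuting" "\<epsilon> > 0"
  obtains \<rho> where "1 / 2 \<le> \<rho>" "\<rho> < 1"
    "\<And>\<phi>. slow_symbol \<rho> \<phi> \<Longrightarrow> norm (toeplitz_commutator A \<phi>) \<le> \<epsilon>"
  using assms unfolding slowly_commuting_def by blast

lemma slowly_commutingD2:
  fixes A B :: "'n::finite bergman_op"
  assumes "A \<in> slowly_commuting" "B \<in> slowly_commuting" "\<epsilon> > 0"
  obtains \<rho> where "1 / 2 \<le> \<rho>" "\<rho> < 1"
    "\<And>\<phi>. slow_symbol \<rho> \<phi> \<Longrightarrow> norm (toeplitz_commutator A \<phi>) \<le> \<epsilon>"
    "\<And>\<phi>. slow_symbol \<rho> \<phi> \<Longrightarrow> norm (toeplitz_commutator B \<phi>) \<le> \<epsilon>"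
proof -
  obtain \<rho>1 where 1: "1 / 2 \<le> \<rho>1" "\<rho>1 < 1"
    "\<And>\<phi>. slow_symbol \<rho>1 \<phi> \<Longrightarrow> norm (toeplitz_commutator A \<phi>) \<le> \<epsilon>"
    using slowly_commutingD[OF assms(1,3)] by blast
  obtain \<rho>2 where 2: "1 / 2 \<le> \<rho>2" "\<rho>2 < 1"
    "\<And>\<phi>. slow_symbol \<rho>2 \<phi> \<Longrightarrow> norm (toeplitz_commutator B \<phi>) \<le> \<epsilon>"
    using slowly_commutingD[OF assms(2,3)] by blast
  show ?thesis
  proof (rule that[of "max \<rho>1 \<rho>2"])
    fix \<phi> :: "complex ^ 'n \<Rightarrow> real" assume "slow_symbol (max \<rho>1 \<rho>2) \<phi>"
    then have "slow_symbol \<rho>1 \<phi>" "slow_symbol \<rho>2 \<phi>" by (auto intro: slow_symbol_mono[rotated])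
    then show "norm (toeplitz_commutator A \<phi>) \<le> \<epsilon>" "norm (toeplitz_commutator B \<phi>) \<le> \<epsilon>"
      using 1(3) 2(3) by auto
  qed (use 1 2 in auto)
qed

lemma norm_blinfun_compose_le: "norm (A o\<^sub>L B) \<le> norm A * norm B"
  by (rule norm_blinfun_compose)

lemma norm_op_scale_le: "norm (op_scale c A) \<le> norm c * norm A"
proof (rule norm_blinfun_bound)
  show "norm (op_scale c A f) \<le> norm c * norm A * norm f" for f
    using mult_left_mono[OF norm_blinfun[of A f], of "norm c"]
    by (simp add: op_scale_apply norm_bergman_scale mult.assoc)
qed simp

lemma commutator_norm_le:
  assumes "unit_symbol \<phi>"
  shows "norm (toeplitz_commutator A \<phi>) \<le> 2 * norm A"
proof -
  have "norm (A o\<^sub>L toeplitz \<phi>) \<le> norm A * norm (toeplitz \<phi>)" "norm (toeplitz \<phi> o\<^sub>L A) \<le> norm (toeplitz \<phi>) * norm A"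
    by (rule norm_blinfun_compose)+
  moreover have "norm A * norm (toeplitz \<phi>) \<le> norm A * 1" "norm (toeplitz \<phi>) * norm A \<le> 1 * norm A"
    by (intro mult_left_mono mult_right_mono norm_toeplitz_le assms norm_ge_zero)+
  ultimately show ?thesis
    using norm_triangle_ineq4[of "A o\<^sub>L toeplitz \<phi>" "toeplitz \<phi> o\<^sub>L A"]
    unfolding toeplitz_commutator_def by linarith
qed

lemma slow_symbol_unit: "slow_symbol \<rho> \<phi> \<Longrightarrow> unit_symbol \<phi>"
  by (simp add: slow_symbol_def)

text \<open>The commutator is bounded by twice the norm of the operator, uniformly over all symbols,
  so the parameter \<rho> of a nearby operator can be used.\<close>

lemma closure_slowly_commuting: "closure slowly_commuting \<subseteq> (slowly_commuting :: 'n::finite bergman_op set)"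
proof
  fix A :: "'n bergman_op" assume A: "A \<in> closure slowly_commuting"
  show "A \<in> slowly_commuting"
  proof (rule slowly_commutingI)
    have "slowly_commuting \<subseteq> {A :: 'n bergman_op. clinear_op A}" by (auto simp: slowly_commuting_def)
    from closure_minimal[OF this closed_clinear_op] A show "clinear_op A" by blast
    fix \<epsilon> :: real assume \<epsilon>: "\<epsilon> > 0"
    then obtain B where B: "B \<in> slowly_commuting" "dist B A < \<epsilon> / 4"
      using A unfolding closure_approachable by (metis divide_pos_pos zero_less_numeral)
    obtain \<rho> where \<rho>: "1 / 2 \<le> \<rho>" "\<rho> < 1"
      "\<And>\<phi>. slow_symbol \<rho> \<phi> \<Longrightarrow> norm (toeplitz_commutator B \<phi>) \<le> \<epsilon> / 2"
      using slowly_commutingD[OF B(1), of "\<epsilon> / 2"] \<epsilon> by auto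
    have "norm (toeplitz_commutator A \<phi>) \<le> \<epsilon>" if "slow_symbol \<rho> \<phi>" for \<phi>
    proof -
      have "toeplitz_commutator A \<phi> =
          (toeplitz_commutator (A - B) \<phi>) + (toeplitz_commutator B \<phi>)"
        by (rule blinfun_eqI) (simp add: toeplitz_commutator_def blinfun.diff_left blinfun.add_left blinfun.diff_right)
      then have "norm (toeplitz_commutator A \<phi>) \<le>
          norm (toeplitz_commutator (A - B) \<phi>) + norm (toeplitz_commutator B \<phi>)"
        using norm_triangle_ineq by metis
      moreover have "norm (toeplitz_commutator (A - B) \<phi>) \<le> 2 * norm (A - B)"
        by (rule commutator_norm_le[OF slow_symbol_unit[OF that]])
      moreover have "norm (A - B) < \<epsilon> / 4" using B(2) by (simp add: dist_norm norm_minus_commute)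
      ultimately show ?thesis using \<rho>(3)[OF that] by linarith
    qed
    then show "\<exists>\<rho>. 1 / 2 \<le> \<rho> \<and> \<rho> < 1 \<and> (\<forall>\<phi>. slow_symbol \<rho> \<phi> \<longrightarrow> norm (toeplitz_commutator A \<phi>) \<le> \<epsilon>)"
      using \<rho> by blast
  qed
qed

text \<open>Taking the commutator with T = \<open>toeplitz \<phi>\<close> is a derivation: [A B, T]
  = A [B, T] + [A, T] B.\<close>

lemma slowly_commuting_compose:
  assumes A: "A \<in> slowly_commuting" and B: "B \<in> slowly_commuting"
  shows "A o\<^sub>L B \<in> slowly_commuting"
proof (rule slowly_commutingI)
  show "clinear_op (A o\<^sub>L B)" using A B by (simp add: slowly_commuting_def clinear_op_def)
  fix \<epsilon> :: real assume \<epsilon>: "\<epsilon> > 0"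
  define e where "e = \<epsilon> / (norm A + norm B + 1)"
  have pos: "norm A + norm B + 1 > 0" by (intro add_nonneg_pos) auto
  have e: "e > 0" "(norm A + norm B) * e \<le> \<epsilon>"
    using \<epsilon> pos by (auto simp: e_def field_simps)
  obtain \<rho> where \<rho>: "1 / 2 \<le> \<rho>" "\<rho> < 1"
    "\<And>\<phi>. slow_symbol \<rho> \<phi> \<Longrightarrow> norm (toeplitz_commutator A \<phi>) \<le> e"
    "\<And>\<phi>. slow_symbol \<rho> \<phi> \<Longrightarrow> norm (toeplitz_commutator B \<phi>) \<le> e"
    using slowly_commutingD2[OF A B e(1)] by blast
  have "norm (toeplitz_commutator (A o\<^sub>L B) \<phi>) \<le> \<epsilon>" if s: "slow_symbol \<rho> \<phi>" for \<phi>
  proof -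
    have "toeplitz_commutator (A o\<^sub>L B) \<phi> =
        (A o\<^sub>L toeplitz_commutator B \<phi>) + (toeplitz_commutator A \<phi> o\<^sub>L B)"
      by (rule blinfun_eqI) (simp add: toeplitz_commutator_def blinfun.diff_left blinfun.add_left blinfun.diff_right)
    then have "norm (toeplitz_commutator (A o\<^sub>L B) \<phi>) \<le>
        norm (A o\<^sub>L (toeplitz_commutator B \<phi>)) + norm ((toeplitz_commutator A \<phi>) o\<^sub>L B)"
      using norm_triangle_ineq by metis
    also have "\<dots> \<le> norm A * e + e * norm B"
    proof (rule add_mono)
      have "norm (A o\<^sub>L (toeplitz_commutator B \<phi>)) \<le> norm A * norm (toeplitz_commutator B \<phi>)"
        by (rule norm_blinfun_compose)
      also have "\<dots> \<le> norm A * e" using \<rho>(4)[OF s] by (rule mult_left_mono) simp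
      finally show "norm (A o\<^sub>L (toeplitz_commutator B \<phi>)) \<le> norm A * e" .
      have "norm ((toeplitz_commutator A \<phi>) o\<^sub>L B) \<le> norm (toeplitz_commutator A \<phi>) * norm B"
        by (rule norm_blinfun_compose)
      also have "\<dots> \<le> e * norm B" using \<rho>(3)[OF s] by (rule mult_right_mono) simp
      finally show "norm ((toeplitz_commutator A \<phi>) o\<^sub>L B) \<le> e * norm B" .
    qed
    also have "\<dots> \<le> \<epsilon>" using e(2) by (simp add: algebra_simps)
    finally show ?thesis .
  qed
  then show "\<exists>\<rho>. 1 / 2 \<le> \<rho> \<and> \<rho> < 1 \<and> (\<forall>\<phi>. slow_symbol \<rho> \<phi> \<longrightarrow>
      norm (toeplitz_commutator (A o\<^sub>L B) \<phi>) \<le> \<epsilon>)"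
    using \<rho> by blast
qed

text \<open>Symbols are real, so T = \<open>toeplitz \<phi>\<close> is self-adjoint and [B, T] is
  minus the adjoint of [A, T] when B is the adjoint of A.\<close>

lemma slowly_commuting_adjoint:
  assumes A: "A \<in> slowly_commuting" and adj: "is_adjoint_op A B"
  shows "B \<in> slowly_commuting"
proof (rule slowly_commutingI)
  show "clinear_op B" using adj by (rule clinear_op_adjoint)
  fix \<epsilon> :: real assume \<epsilon>: "\<epsilon> > 0"
  obtain \<rho> where \<rho>: "1 / 2 \<le> \<rho>" "\<rho> < 1"
    "\<And>\<phi>. slow_symbol \<rho> \<phi> \<Longrightarrow> norm (toeplitz_commutator A \<phi>) \<le> \<epsilon>"
    using slowly_commutingD[OF A \<epsilon>] by blast
  have "norm (toeplitz_commutator B \<phi>) \<le> \<epsilon>" if s: "slow_symbol \<rho> \<phi>" for \<phi>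
  proof (rule norm_blinfun_bound)
    fix g
    let ?D = "toeplitz_commutator A \<phi>"
    note u = slow_symbol_unit[OF s]
    have AB: "bergman_inner (A f) h = bergman_inner f (B h)" for f h using adj by (simp add: is_adjoint_op_def)
    show "norm ((toeplitz_commutator B \<phi>) g) \<le> \<epsilon> * norm g"
    proof (rule norm_bergman_le_inner)
      fix f
      have "bergman_inner f ((toeplitz_commutator B \<phi>) g) = - bergman_inner (?D f) g"
        by (simp add: toeplitz_commutator_def blinfun.diff_left bergman_inner_diff_right bergman_inner_diff_left AB[symmetric]
            toeplitz_selfadjoint[OF u] toeplitz_selfadjoint[OF u, symmetric, of f])
      also have "norm \<dots> \<le> norm (?D f) * norm g" using norm_bergman_inner_le[of "?D f" g] by simp
      also have "\<dots> \<le> (\<epsilon> * norm f) * norm g"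
      proof (rule mult_right_mono)
        have "norm (?D f) \<le> norm ?D * norm f" by (rule norm_blinfun)
        also have "\<dots> \<le> \<epsilon> * norm f" using \<rho>(3)[OF s] by (rule mult_right_mono) simp
        finally show "norm (?D f) \<le> \<epsilon> * norm f" .
      qed simp
      finally show "norm (bergman_inner f ((toeplitz_commutator B \<phi>) g)) \<le> \<epsilon> * norm g * norm f"
        by (simp add: mult_ac)
    qed (use \<epsilon> in simp)
  qed (use \<epsilon> in simp)
  then show "\<exists>\<rho>. 1 / 2 \<le> \<rho> \<and> \<rho> < 1 \<and> (\<forall>\<phi>. slow_symbol \<rho> \<phi> \<longrightarrow> norm (toeplitz_commutator B \<phi>) \<le> \<epsilon>)"
    using \<rho> by blast
qed

lemma subspace_slowly_commuting: "module.subspace op_scale (slowly_commuting :: 'n::finite bergman_op set)"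
proof (rule module.subspaceI[OF vector_space_op_scale[folded module_iff_vector_space]])
  show "0 \<in> (slowly_commuting :: 'n bergman_op set)"
  proof (rule slowly_commutingI)
    fix \<epsilon> :: real assume "\<epsilon> > 0"
    moreover have "toeplitz_commutator (0 :: 'n bergman_op) \<phi> = 0" for \<phi>
      by (rule blinfun_eqI) (simp add: toeplitz_commutator_def blinfun.diff_left blinfun.zero_right)
    ultimately show "\<exists>\<rho>. 1 / 2 \<le> \<rho> \<and> \<rho> < 1 \<and> (\<forall>\<phi>. slow_symbol \<rho> \<phi> \<longrightarrow>
        norm (toeplitz_commutator (0 :: 'n bergman_op) \<phi>) \<le> \<epsilon>)"
      by (intro exI[of _ "1 / 2"]) auto
  qed (rule clinear_op_zero)
next
  fix A B :: "'n bergman_op" assume A: "A \<in> slowly_commuting" and B: "B \<in> slowly_commuting"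
  show "A + B \<in> slowly_commuting"
  proof (rule slowly_commutingI)
    show "clinear_op (A + B)" using A B by (intro clinear_op_add) (auto simp: slowly_commuting_def)
    fix \<epsilon> :: real assume \<epsilon>: "\<epsilon> > 0"
    obtain \<rho> where \<rho>: "1 / 2 \<le> \<rho>" "\<rho> < 1"
      "\<And>\<phi>. slow_symbol \<rho> \<phi> \<Longrightarrow> norm (toeplitz_commutator A \<phi>) \<le> \<epsilon> / 2"
      "\<And>\<phi>. slow_symbol \<rho> \<phi> \<Longrightarrow> norm (toeplitz_commutator B \<phi>) \<le> \<epsilon> / 2"
      using slowly_commutingD2[OF A B, of "\<epsilon> / 2"] \<epsilon> by auto
    have "norm (toeplitz_commutator (A + B) \<phi>) \<le> \<epsilon>" if s: "slow_symbol \<rho> \<phi>" for \<phi>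
    proof -
      have "toeplitz_commutator (A + B) \<phi> =
          (toeplitz_commutator A \<phi>) + (toeplitz_commutator B \<phi>)"
        by (rule blinfun_eqI) (simp add: toeplitz_commutator_def blinfun.diff_left blinfun.add_left blinfun.add_right)
      then show ?thesis
        using norm_triangle_ineq[of "toeplitz_commutator A \<phi>" "toeplitz_commutator B \<phi>"]
          \<rho>(3)[OF s] \<rho>(4)[OF s] by simp
    qed
    then show "\<exists>\<rho>. 1 / 2 \<le> \<rho> \<and> \<rho> < 1 \<and> (\<forall>\<phi>. slow_symbol \<rho> \<phi> \<longrightarrow>
        norm (toeplitz_commutator (A + B) \<phi>) \<le> \<epsilon>)"
      using \<rho> by blast
  qed
next
  fix c and A :: "'n bergman_op" assume A: "A \<in> slowly_commuting"
  show "op_scale c A \<in> slowly_commuting"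
  proof (rule slowly_commutingI)
    show "clinear_op (op_scale c A)" using A by (intro clinear_op_scale) (auto simp: slowly_commuting_def)
    fix \<epsilon> :: real assume \<epsilon>: "\<epsilon> > 0"
    have c: "norm c + 1 > 0" by (intro add_nonneg_pos) auto
    obtain \<rho> where \<rho>: "1 / 2 \<le> \<rho>" "\<rho> < 1"
      "\<And>\<phi>. slow_symbol \<rho> \<phi> \<Longrightarrow> norm (toeplitz_commutator A \<phi>) \<le> \<epsilon> / (norm c + 1)"
      using slowly_commutingD[OF A, of "\<epsilon> / (norm c + 1)"] \<epsilon> c by auto
    have "norm (toeplitz_commutator (op_scale c A) \<phi>) \<le> \<epsilon>" if s: "slow_symbol \<rho> \<phi>" for \<phi>
    proof -
      have "toeplitz \<phi> (bergman_scale c f) = bergman_scale c (toeplitz \<phi> f)" for f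
        using clinear_toeplitz[OF slow_symbol_unit[OF s]] by (simp add: clinear_op_def)
      then have "toeplitz_commutator (op_scale c A) \<phi> = op_scale c (toeplitz_commutator A \<phi>)"
        by (intro blinfun_eqI) (simp add: toeplitz_commutator_def blinfun.diff_left op_scale_apply linear_simps[OF bounded_linear_bergman_scale])
      then have "norm (toeplitz_commutator (op_scale c A) \<phi>) \<le> norm c * norm (toeplitz_commutator A \<phi>)"
        by (simp add: norm_op_scale_le)
      also have "\<dots> \<le> norm c * (\<epsilon> / (norm c + 1))" by (intro mult_left_mono \<rho>(3)[OF s]) simp
      also have "\<dots> \<le> \<epsilon>" using \<epsilon> c by (simp add: field_simps)
      finally show ?thesis .
    qed
    then show "\<exists>\<rho>. 1 / 2 \<le> \<rho> \<and> \<rho> < 1 \<and> (\<forall>\<phi>. slow_symbol \<rho> \<phi> \<longrightarrow>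
        norm (toeplitz_commutator (op_scale c A) \<phi>) \<le> \<epsilon>)"
      using \<rho> by blast
  qed
qed

lemma cstar_subalgebra_slowly_commuting: "cstar_subalgebra (slowly_commuting :: 'n::finite bergman_op set)"
proof -
  have "closed (slowly_commuting :: 'n bergman_op set)"
    using closure_slowly_commuting closure_subset by (metis closure_eq subset_antisym)
  moreover have "\<forall>A\<in>slowly_commuting. clinear_op A" by (simp add: slowly_commuting_def)
  ultimately show ?thesis
    unfolding cstar_subalgebra_def
    using subspace_slowly_commuting slowly_commuting_compose slowly_commuting_adjoint by blast
qed

section \<open>Membership of the generators\<close>

lemma bounded_linear_bergman_inner_left: "bounded_linear (\<lambda>f. bergman_inner f g)"
proof (rule bounded_linear_intro)
  show "bergman_inner (r *\<^sub>R f) g = r *\<^sub>R bergman_inner f g" for r f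
    by (simp add: scaleR_bergman_def bergman_inner_scale_left scaleR_conv_of_real)
  show "norm (bergman_inner f g) \<le> norm f * norm g" for f by (rule norm_bergman_inner_le)
qed (rule bergman_inner_add_left)

text \<open>On the neighbourhood of p x the Bergman function T h - \<phi>(p x) h, with T =
  \<open>toeplitz \<phi>\<close>, equals (\<phi> - \<phi>(p x)) h minus the defect of h. The first
  summand is small pointwise since the radius 1/2 is at most \<rho>, the second in mean square, and
  \<open>bergman_bessel\<close> sums both. The constant 64 is 16 / (1/2)^2.\<close>

lemma localized_defect_bessel:
  fixes h :: "'n::finite bergman" and p :: "'a \<Rightarrow> complex ^ 'n"
  assumes F: "finite F" and p: "\<And>x. x \<in> F \<Longrightarrow> p x \<in> polydisk"
    and overlap: "\<And>w. w \<in> polydisk \<Longrightarrow> card {x \<in> F. w \<in> polydisk_nbhd (p x) (1 / 2)} \<le> N"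
    and slow: "slow_symbol \<rho> \<phi>" and \<rho>: "1 / 2 \<le> \<rho>" "\<rho> < 1"
    and defect: "(\<integral>w. (norm (toeplitz_defect \<phi> h w))\<^sup>2 \<partial>dv) \<le> \<eta>\<^sup>2 / 4 * (norm h)\<^sup>2" and \<eta>: "1 - \<rho> \<le> \<eta> / 2"
  shows "(\<Sum>x\<in>F. (norm (bergman_inner (toeplitz \<phi> h - bergman_scale (of_real (\<phi> (p x))) h) (normalized_kernel (p x))))\<^sup>2)
    \<le> 64 ^ CARD('n) * real N * (\<eta>\<^sup>2 * (norm h)\<^sup>2)"
proof -
  note us = slow_symbol_unit[OF slow]
  \<comment> \<open>From (a + b)^2 \<le> 2 a^2 + 2 b^2. With the bounds \<eta>^2 / 4 for the defect
    and \<eta> / 2 for the oscillation its integral is at most \<eta>^2 times the squared norm of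
    h.\<close>
  define u where "u w = 2 * (norm (toeplitz_defect \<phi> h w))\<^sup>2 + 2 * ((1 - \<rho>)\<^sup>2 * (norm (bergman_fun h w))\<^sup>2)" for w
  have u: "integrable dv u" unfolding u_def
    by (intro Bochner_Integration.integrable_add integrable_mult_right toeplitz_defect_square_integrable[OF us] bergman_fun_square_integrable)
  have "(\<Sum>x\<in>F. (norm (bergman_inner (toeplitz \<phi> h - bergman_scale (of_real (\<phi> (p x))) h) (normalized_kernel (p x))))\<^sup>2)
    \<le> (16 / (1 / 2)\<^sup>2) ^ CARD('n) * (real N * (\<integral>w. u w \<partial>dv))"
  proof (rule bergman_bessel[OF F p _ _ overlap u])
    fix x w assume x: "x \<in> F" and w: "w \<in> polydisk_nbhd (p x) (1 / 2)"
    have m: "norm (mobius (p x $ i) (w $ i)) \<le> \<rho>" for i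
    proof -
      have "norm (mobius (p x $ i) (w $ i)) < 1 / 2" using w by (simp add: polydisk_nbhd_def)
      then show ?thesis using \<rho> by linarith
    qed
    have "\<bar>\<phi> (p x) - \<phi> w\<bar> \<le> 1 - \<rho>"
      using slow p[OF x] w m by (simp add: slow_symbol_def polydisk_nbhd_def)
    then have d: "(\<phi> w - \<phi> (p x))\<^sup>2 \<le> (1 - \<rho>)\<^sup>2"
      using power_mono[of "\<bar>\<phi> (p x) - \<phi> w\<bar>" "1 - \<rho>" 2] by (simp add: power2_commute)
    have "bergman_fun (toeplitz \<phi> h - bergman_scale (of_real (\<phi> (p x))) h) w =
        of_real (\<phi> w - \<phi> (p x)) * bergman_fun h w - toeplitz_defect \<phi> h w"
      by (simp add: bergman_fun_diff bergman_fun_scale toeplitz_defect_def algebra_simps)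
    then have "(norm (bergman_fun (toeplitz \<phi> h - bergman_scale (of_real (\<phi> (p x))) h) w))\<^sup>2 \<le>
        (norm (of_real (\<phi> w - \<phi> (p x)) * bergman_fun h w) + norm (toeplitz_defect \<phi> h w))\<^sup>2"
      by (simp only:) (intro power_mono norm_triangle_ineq4 norm_ge_zero)
    also have "\<dots> \<le> 2 * (norm (of_real (\<phi> w - \<phi> (p x)) * bergman_fun h w))\<^sup>2 + 2 * (norm (toeplitz_defect \<phi> h w))\<^sup>2"
      using sum_squares_bound[of "norm (of_real (\<phi> w - \<phi> (p x)) * bergman_fun h w)" "norm (toeplitz_defect \<phi> h w)"]
      by (simp add: power2_sum)
    also have "(norm (of_real (\<phi> w - \<phi> (p x)) * bergman_fun h w))\<^sup>2 = (\<phi> w - \<phi> (p x))\<^sup>2 * (norm (bergman_fun h w))\<^sup>2"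
      unfolding norm_mult norm_of_real by (simp add: power_mult_distrib)
    also have "2 * ((\<phi> w - \<phi> (p x))\<^sup>2 * (norm (bergman_fun h w))\<^sup>2) + 2 * (norm (toeplitz_defect \<phi> h w))\<^sup>2 \<le> u w"
      using mult_right_mono[OF d, of "(norm (bergman_fun h w))\<^sup>2"] by (simp add: u_def)
    finally show "(norm (bergman_fun (toeplitz \<phi> h - bergman_scale (of_real (\<phi> (p x))) h) w))\<^sup>2 \<le> u w" by simp
  qed (auto simp: u_def)
  also have "(\<integral>w. u w \<partial>dv) = 2 * (\<integral>w. (norm (toeplitz_defect \<phi> h w))\<^sup>2 \<partial>dv) + 2 * ((1 - \<rho>)\<^sup>2 * (norm h)\<^sup>2)"
    unfolding u_def norm_bergman_sq
    by (simp add: toeplitz_defect_square_integrable[OF us] bergman_fun_square_integrable)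
  also have "\<dots> \<le> \<eta>\<^sup>2 * (norm h)\<^sup>2"
  proof -
    have "(1 - \<rho>)\<^sup>2 \<le> (\<eta> / 2)\<^sup>2" using \<eta> \<rho> by (intro power_mono) auto
    then have "(1 - \<rho>)\<^sup>2 * (norm h)\<^sup>2 \<le> (\<eta> / 2)\<^sup>2 * (norm h)\<^sup>2" by (rule mult_right_mono) simp
    then show ?thesis using defect by (simp add: power_divide)
  qed
  also have "(16 / (1 / 2)\<^sup>2) = (64 :: real)" by (simp add: power2_eq_square)
  finally show ?thesis by (simp add: mult.assoc mult_left_mono)
qed

lemma sum_norm_mult_le:
  fixes f g :: "'a \<Rightarrow> complex"
  assumes "(\<Sum>x\<in>F. (norm (f x))\<^sup>2) \<le> A\<^sup>2" "(\<Sum>x\<in>F. (norm (g x))\<^sup>2) \<le> B\<^sup>2" "A \<ge> 0" "B \<ge> 0"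
  shows "(\<Sum>x\<in>F. norm (f x) * norm (g x)) \<le> A * B"
proof -
  have "(\<Sum>x\<in>F. norm (f x) * norm (g x))\<^sup>2 \<le> (\<Sum>x\<in>F. (norm (f x))\<^sup>2) * (\<Sum>x\<in>F. (norm (g x))\<^sup>2)"
    by (rule Cauchy_Schwarz_ineq_sum)
  also have "\<dots> \<le> A\<^sup>2 * B\<^sup>2" using assms by (intro mult_mono) (auto intro: sum_nonneg)
  also have "\<dots> = (A * B)\<^sup>2" by (simp add: power_mult_distrib)
  finally show ?thesis by (rule power2_le_imp_le) (use assms in simp)
qed

text \<open>In the pairing of the commutator with h and g each rank one term involves
  \<open>toeplitz \<phi> h\<close> at \<gamma> z and \<open>toeplitz \<phi> g\<close> at z. Up to
  errors that are square summable by the Bessel inequality, the Toeplitz operator acts there as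
  multiplication by \<phi>(\<gamma> z) and \<phi> z, and these numbers differ little because
  \<gamma> moves points by a bounded distance. Cauchy-Schwarz sums the three products.\<close>

lemma localized_ops0_slowly_commuting: "localized_ops0 \<subseteq> (slowly_commuting :: 'n::finite bergman_op set)"
proof
  fix T :: "'n bergman_op" assume T: "T \<in> localized_ops0"
  obtain \<Gamma> c \<gamma> C where sep: "separated_set \<Gamma>" and c: "bounded (c ` \<Gamma>)" and \<gamma>0: "\<gamma> ` \<Gamma> \<subseteq> polydisk"
    and C: "C \<ge> 0" "\<And>z. z \<in> \<Gamma> \<Longrightarrow> polydisk_dist z (\<gamma> z) \<le> C"
    and sum: "\<And>h. ((\<lambda>z. blinfun_apply (op_scale (c z) (rank_one (normalized_kernel z) (normalized_kernel (\<gamma> z)))) h)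
          has_sum blinfun_apply T h) \<Gamma>"
    using T unfolding localized_ops0_def by blast
  have \<Gamma>: "\<Gamma> \<subseteq> polydisk" using sep by (simp add: separated_set_def)
  have \<gamma>: "\<gamma> z \<in> polydisk" if "z \<in> \<Gamma>" for z using \<gamma>0 that by blast
  obtain B where B: "\<And>z. z \<in> \<Gamma> \<Longrightarrow> norm (c z) \<le> B" and "B \<ge> 0"
  proof -
    obtain B where "\<And>z. z \<in> \<Gamma> \<Longrightarrow> norm (c z) \<le> B" using c by (auto simp: bounded_iff)
    then show ?thesis using that[of "max B 0"] by (simp add: le_max_iff_disj)
  qed
  obtain N1 where N1: "\<And>F w. finite F \<Longrightarrow> F \<subseteq> \<Gamma> \<Longrightarrow> w \<in> polydisk \<Longrightarrow> card {z \<in> F. w \<in> polydisk_nbhd (\<gamma> z) (1 / 2)} \<le> N1"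
    using separated_overlap[OF sep \<gamma> C(2)] by blast
  have zero: "polydisk_dist z z \<le> 0" for z :: "complex ^ 'n"
    by (simp add: polydisk_dist_def beta_dist_def mobius_def)
  obtain N2 where N2: "\<And>F w. finite F \<Longrightarrow> F \<subseteq> \<Gamma> \<Longrightarrow> w \<in> polydisk \<Longrightarrow> card {z \<in> F. w \<in> polydisk_nbhd z (1 / 2)} \<le> N2"
    using separated_overlap[OF sep, of "\<lambda>z. z" 0] \<Gamma> zero by blast
  define N where "N = max N1 N2"
  have Ng: "card {z \<in> F. w \<in> polydisk_nbhd (\<gamma> z) (1 / 2)} \<le> N" and Nz: "card {z \<in> F. w \<in> polydisk_nbhd z (1 / 2)} \<le> N"
    if "finite F" "F \<subseteq> \<Gamma>" "w \<in> polydisk" for F w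
    using N1[OF that] N2[OF that] by (auto simp: N_def)
  define K where "K = 64 ^ CARD('n) * real N"
  have K: "K \<ge> 0" by (simp add: K_def)
  show "T \<in> slowly_commuting"
  proof (rule slowly_commutingI)
    have "T \<in> localized_ops"
      unfolding localized_ops_def
      using T closure_subset module.span_superset[OF vector_space_op_scale[folded module_iff_vector_space]] by blast
    then show "clinear_op T" using localized_ops_clinear by blast
    fix \<epsilon> :: real assume \<epsilon>: "\<epsilon> > 0"
    \<comment> \<open>Three error terms arise, each at most B K \<eta> times the norms of h and
      g.\<close>
    define \<eta> where "\<eta> = \<epsilon> / (3 * B * K + 1)"
    have pos: "3 * B * K + 1 > 0" using \<open>B \<ge> 0\<close> K by (intro add_nonneg_pos mult_nonneg_nonneg) auto
    have \<eta>: "\<eta> > 0" "3 * B * K * \<eta> \<le> \<epsilon>"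
      using \<epsilon> pos by (auto simp: \<eta>_def field_simps)
    obtain \<rho>1 where \<rho>1: "1 / 2 \<le> \<rho>1" "\<rho>1 < 1" "\<And>\<phi> (h :: 'n bergman). slow_symbol \<rho>1 \<phi> \<Longrightarrow>
        (\<integral>w. (norm (toeplitz_defect \<phi> h w))\<^sup>2 \<partial>dv) \<le> \<eta>\<^sup>2 / 4 * (norm h)\<^sup>2"
      using toeplitz_defect_small[of "\<eta>\<^sup>2 / 4", where 'n = 'n] \<eta> by auto
    \<comment> \<open>The requirements are a small defect, a radius that covers hyperbolic distance
      C, and an oscillation of at most \<eta> / 2.\<close>
    define \<rho> where "\<rho> = max (max \<rho>1 (1 - exp (- (2 * C)))) (1 - \<eta> / 2)"
    have \<rho>: "1 / 2 \<le> \<rho>" "\<rho> < 1" "\<rho>1 \<le> \<rho>" "1 - exp (- (2 * C)) \<le> \<rho>" "1 - \<rho> \<le> \<eta> / 2"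
      using \<rho>1 \<eta> exp_gt_zero[of "- (2 * C)"] unfolding \<rho>_def by linarith+
    have "norm (toeplitz_commutator T \<phi>) \<le> \<epsilon>" if slow: "slow_symbol \<rho> \<phi>" for \<phi>
    proof (rule norm_blinfun_bound)
      fix h
      note us = slow_symbol_unit[OF slow]
      have defect: "(\<integral>w. (norm (toeplitz_defect \<phi> h w))\<^sup>2 \<partial>dv) \<le> \<eta>\<^sup>2 / 4 * (norm h)\<^sup>2" for h :: "'n bergman"
        by (rule \<rho>1(3)[OF slow_symbol_mono[OF \<rho>(3) slow]])
      show "norm (toeplitz_commutator T \<phi> h) \<le> \<epsilon> * norm h"
      proof (rule norm_bergman_le_inner)
        fix g
        let ?k = "normalized_kernel :: complex ^ 'n \<Rightarrow> 'n bergman"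
        define t where "t z = c z * (bergman_inner (toeplitz \<phi> h) (?k (\<gamma> z)) * bergman_inner (?k z) g -
            bergman_inner h (?k (\<gamma> z)) * bergman_inner (?k z) (toeplitz \<phi> g))" for z
        have hs: "((\<lambda>z. c z * bergman_inner h (?k (\<gamma> z)) * bergman_inner (?k z) g) has_sum bergman_inner (T h) g) \<Gamma>" for h g
          using has_sum_bounded_linear[OF bounded_linear_bergman_inner_left[of g] sum[of h]]
          by (simp add: o_def op_scale_apply rank_one_apply bergman_inner_scale_left mult.assoc)
        have "((\<lambda>z. c z * bergman_inner (toeplitz \<phi> h) (?k (\<gamma> z)) * bergman_inner (?k z) g -
            c z * bergman_inner h (?k (\<gamma> z)) * bergman_inner (?k z) (toeplitz \<phi> g)) has_sum
            (bergman_inner (T (toeplitz \<phi> h)) g - bergman_inner (T h) (toeplitz \<phi> g))) \<Gamma>"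
          using has_sum_add[OF hs[of "toeplitz \<phi> h" g] has_sum_uminusI[OF hs[of h "toeplitz \<phi> g"]]]
          by simp
        also have "bergman_inner (T (toeplitz \<phi> h)) g - bergman_inner (T h) (toeplitz \<phi> g) = bergman_inner (toeplitz_commutator T \<phi> h) g"
          by (simp add: toeplitz_commutator_def blinfun.diff_left bergman_inner_diff_left toeplitz_selfadjoint[OF us])
        finally have hst: "(t has_sum bergman_inner (toeplitz_commutator T \<phi> h) g) \<Gamma>"
          unfolding t_def by (simp add: right_diff_distrib mult.assoc)
        have partial: "norm (\<Sum>z\<in>F. t z) \<le> \<epsilon> * norm h * norm g" if F: "finite F" "F \<subseteq> \<Gamma>" for F
        proof -
          have Fp: "z \<in> polydisk" "\<gamma> z \<in> polydisk" if "z \<in> F" for z using that F \<Gamma> \<gamma> by auto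
          define k where "k = sqrt K"
          have k: "k \<ge> 0" "k\<^sup>2 = K" using K by (auto simp: k_def)
          define a where "a z = bergman_inner (toeplitz \<phi> h - bergman_scale (of_real (\<phi> (\<gamma> z))) h) (?k (\<gamma> z))" for z
          define b where "b z = bergman_inner (toeplitz \<phi> g - bergman_scale (of_real (\<phi> z)) g) (?k z)" for z
          define hz where "hz z = bergman_inner h (?k (\<gamma> z))" for z
          define gz where "gz z = bergman_inner g (?k z)" for z
          have a: "(\<Sum>z\<in>F. (norm (a z))\<^sup>2) \<le> (k * \<eta> * norm h)\<^sup>2"
            using localized_defect_bessel[of F \<gamma> N, OF F(1) Fp(2) Ng[OF F] slow \<rho>(1,2) defect \<rho>(5), of h]
            by (simp add: a_def power_mult_distrib k K_def mult_ac)
          have b: "(\<Sum>z\<in>F. (norm (b z))\<^sup>2) \<le> (k * \<eta> * norm g)\<^sup>2"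
            using localized_defect_bessel[of F "\<lambda>z. z" N, OF F(1) Fp(1) Nz[OF F] slow \<rho>(1,2) defect \<rho>(5), of g]
            by (simp add: b_def power_mult_distrib k K_def mult_ac)
          have sq: "(16 / (1 / 2)\<^sup>2) = (64 :: real)" by (simp add: power2_eq_square)
          have hz: "(\<Sum>z\<in>F. (norm (hz z))\<^sup>2) \<le> (k * norm h)\<^sup>2"
            using bergman_bessel[of F \<gamma> "1 / 2" N "\<lambda>w. (norm (bergman_fun h w))\<^sup>2" "\<lambda>_. h", OF F(1) Fp(2) _ _ Ng[OF F] bergman_fun_square_integrable]
            by (simp add: hz_def power_mult_distrib k K_def norm_bergman_sq sq)
          have gz: "(\<Sum>z\<in>F. (norm (gz z))\<^sup>2) \<le> (k * norm g)\<^sup>2"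
            using bergman_bessel[of F "\<lambda>z. z" "1 / 2" N "\<lambda>w. (norm (bergman_fun g w))\<^sup>2" "\<lambda>_. g", OF F(1) Fp(1) _ _ Nz[OF F] bergman_fun_square_integrable]
            by (simp add: gz_def power_mult_distrib k K_def norm_bergman_sq sq)
          have t: "norm (t z) \<le> B * (norm (a z) * norm (gz z) + \<eta> * (norm (hz z) * norm (gz z)) + norm (hz z) * norm (b z))"
            if z: "z \<in> F" for z
          proof -
            have z\<Gamma>: "z \<in> \<Gamma>" using z F by auto
            have "\<bar>\<phi> z - \<phi> (\<gamma> z)\<bar> \<le> 1 - \<rho>"
            proof -
              have "norm (mobius (z $ i) (\<gamma> z $ i)) \<le> \<rho>" for i
              proof -
                have "beta_dist (z $ i) (\<gamma> z $ i) \<le> C"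
                  using polydisk_dist_ge_beta[OF Fp[OF z], of i] C(2)[OF z\<Gamma>] by linarith
                then have "norm (mobius (z $ i) (\<gamma> z $ i)) \<le> 1 - exp (- (2 * C))"
                  using Fp[OF z] by (intro beta_dist_le_imp(1)) (auto simp: polydisk_def)
                then show ?thesis using \<rho>(4) by linarith
              qed
              then show ?thesis using slow Fp[OF z] by (simp add: slow_symbol_def)
            qed
            then have d: "\<bar>\<phi> (\<gamma> z) - \<phi> z\<bar> \<le> \<eta>" using \<rho>(5) \<eta>(1) by linarith
            have "bergman_inner (?k z) f = cnj (bergman_inner f (?k z))" for f by (rule bergman_inner_commute)
            \<comment> \<open>Replacing the Toeplitz operator by point values of \<phi> splits the
              term into the error at \<gamma> z, the difference of the two values, and the error at
              z.\<close>
            then have "t z = c z * (a z * cnj (gz z) + of_real (\<phi> (\<gamma> z) - \<phi> z) * (hz z * cnj (gz z)) - hz z * cnj (b z))"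
              unfolding t_def a_def b_def hz_def gz_def
              by (simp add: bergman_inner_diff_left bergman_inner_scale_left algebra_simps)
            then have "norm (t z) = norm (c z) * norm (a z * cnj (gz z) + of_real (\<phi> (\<gamma> z) - \<phi> z) * (hz z * cnj (gz z)) - hz z * cnj (b z))"
              by (simp only: norm_mult)
            also have "\<dots> \<le> B * (norm (a z) * norm (gz z) + \<eta> * (norm (hz z) * norm (gz z)) + norm (hz z) * norm (b z))"
            proof (rule mult_mono[OF B[OF z\<Gamma>]])
              have "norm (a z * cnj (gz z) + of_real (\<phi> (\<gamma> z) - \<phi> z) * (hz z * cnj (gz z)) - hz z * cnj (b z)) \<le>
                  norm (a z * cnj (gz z)) + norm (of_real (\<phi> (\<gamma> z) - \<phi> z) * (hz z * cnj (gz z))) + norm (hz z * cnj (b z))"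
                by (meson norm_triangle_ineq4 norm_triangle_ineq order_trans add_right_mono)
              also have "\<dots> \<le> norm (a z) * norm (gz z) + \<eta> * (norm (hz z) * norm (gz z)) + norm (hz z) * norm (b z)"
                unfolding norm_mult norm_of_real complex_mod_cnj
                using mult_right_mono[OF d, of "norm (hz z) * norm (gz z)"] by simp
              finally show "norm (a z * cnj (gz z) + of_real (\<phi> (\<gamma> z) - \<phi> z) * (hz z * cnj (gz z)) - hz z * cnj (b z)) \<le>
                  norm (a z) * norm (gz z) + \<eta> * (norm (hz z) * norm (gz z)) + norm (hz z) * norm (b z)" .
            qed (use \<open>B \<ge> 0\<close> in auto)
            finally show ?thesis .
          qed
          have "norm (\<Sum>z\<in>F. t z) \<le> (\<Sum>z\<in>F. B * (norm (a z) * norm (gz z) + \<eta> * (norm (hz z) * norm (gz z)) + norm (hz z) * norm (b z)))"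
            by (rule sum_norm_le[OF t])
          also have "\<dots> = B * ((\<Sum>z\<in>F. norm (a z) * norm (gz z)) + \<eta> * (\<Sum>z\<in>F. norm (hz z) * norm (gz z)) + (\<Sum>z\<in>F. norm (hz z) * norm (b z)))"
            by (simp only: sum_distrib_left[symmetric] sum.distrib)
          also have "\<dots> \<le> B * ((k * \<eta> * norm h) * (k * norm g) + \<eta> * ((k * norm h) * (k * norm g)) + (k * norm h) * (k * \<eta> * norm g))"
            using k(1) \<eta>(1) \<open>B \<ge> 0\<close>
            by (intro mult_left_mono[of _ _ B] add_mono mult_left_mono[of _ _ \<eta>] sum_norm_mult_le a b hz gz) auto
          also have "\<dots> = (3 * B * k\<^sup>2 * \<eta>) * (norm h * norm g)"
            by (simp add: power2_eq_square algebra_simps)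
          also have "\<dots> \<le> \<epsilon> * (norm h * norm g)"
            using \<eta>(2) by (intro mult_right_mono) (auto simp: k(2))
          finally show ?thesis by (simp add: mult.assoc)
        qed
        have "norm (bergman_inner (toeplitz_commutator T \<phi> h) g) \<le> \<epsilon> * norm h * norm g"
        proof (rule tendsto_upperbound[OF tendsto_norm[OF hst[unfolded has_sum_def]]])
          show "\<forall>\<^sub>F F in finite_subsets_at_top \<Gamma>. norm (\<Sum>z\<in>F. t z) \<le> \<epsilon> * norm h * norm g"
            by (rule eventually_finite_subsets_at_top_weakI) (rule partial)
        qed simp
        then show "norm (bergman_inner g (toeplitz_commutator T \<phi> h)) \<le> \<epsilon> * norm h * norm g"
          by (simp add: bergman_inner_commute[of g])
      qed (use \<epsilon> in simp)
    qed (use \<epsilon> in simp)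
    then show "\<exists>\<rho>. 1 / 2 \<le> \<rho> \<and> \<rho> < 1 \<and> (\<forall>\<phi>. slow_symbol \<rho> \<phi> \<longrightarrow> norm (toeplitz_commutator T \<phi>) \<le> \<epsilon>)"
      using \<rho> by blast
  qed
qed

lemma cstar_generated_slowly_commuting:
  "cstar_generated localized_ops \<subseteq> (slowly_commuting :: 'n::finite bergman_op set)"
proof -
  have "module.span op_scale localized_ops0 \<subseteq> (slowly_commuting :: 'n bergman_op set)"
    by (rule module.span_minimal[OF vector_space_op_scale[folded module_iff_vector_space]
          localized_ops0_slowly_commuting subspace_slowly_commuting])
  from closure_mono[OF this] have "localized_ops \<subseteq> (slowly_commuting :: 'n bergman_op set)"
    unfolding localized_ops_def using closure_slowly_commuting by blast
  then show ?thesis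
    unfolding cstar_generated_def using cstar_subalgebra_slowly_commuting by blast
qed

section \<open>From diagonal to off-diagonal matrix elements\<close>

text \<open>By contradiction: bounded functions violating the claim have a locally uniform limit by
  Montel, which vanishes on a real segment and hence everywhere. The point is that \<epsilon> does
  not depend on the function, since later one function arises for each point of the
  polydisk.\<close>

lemma small_on_real_segment:
  fixes M :: real
  assumes c: "0 < c" "c \<le> \<rho>" and r: "r < \<rho>" and \<delta>: "\<delta> > 0"
  shows "\<exists>\<epsilon>>0. \<forall>f. f holomorphic_on ball 0 \<rho> \<longrightarrow> (\<forall>t\<in>ball 0 \<rho>. norm (f t) \<le> M) \<longrightarrow>
    (\<forall>x::real. \<bar>x\<bar> < c \<longrightarrow> norm (f (of_real x)) \<le> \<epsilon>) \<longrightarrow> (\<forall>t. norm t \<le> r \<longrightarrow> norm (f t) \<le> \<delta>)"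
proof (rule ccontr)
  assume neg: "\<not> ?thesis"
  have "\<exists>f t. f holomorphic_on ball 0 \<rho> \<and> (\<forall>t\<in>ball 0 \<rho>. norm (f t) \<le> M) \<and>
      (\<forall>x::real. \<bar>x\<bar> < c \<longrightarrow> norm (f (of_real x)) \<le> 1 / (real n + 1)) \<and> norm t \<le> r \<and> norm (f t) > \<delta>" for n :: nat
  proof -
    have "1 / (real n + 1) > 0" by simp
    with neg show ?thesis by (meson not_le)
  qed
  then obtain f t where f: "\<And>n :: nat. f n holomorphic_on ball 0 \<rho>" "\<And>n t. t \<in> ball 0 \<rho> \<Longrightarrow> norm (f n t) \<le> M"
    "\<And>n x. \<bar>x\<bar> < c \<Longrightarrow> norm (f n (of_real x)) \<le> 1 / (real n + 1)" "\<And>n. norm (t n) \<le> r" "\<And>n. norm (f n (t n)) > \<delta>"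
    by metis
  obtain g \<sigma> where g: "g holomorphic_on ball 0 \<rho>" "strict_mono (\<sigma> :: nat \<Rightarrow> nat)"
    "\<And>x. x \<in> ball 0 \<rho> \<Longrightarrow> (\<lambda>n. f (\<sigma> n) x) \<longlonglongrightarrow> g x"
    "\<And>K. compact K \<Longrightarrow> K \<subseteq> ball 0 \<rho> \<Longrightarrow> uniform_limit K (f \<circ> \<sigma>) g sequentially"
  proof (rule Montel[of "ball 0 \<rho>" "range f" f])
    show "h holomorphic_on ball 0 \<rho>" if "h \<in> range f" for h using that f(1) by blast
    show "\<exists>B. \<forall>h\<in>range f. \<forall>z\<in>K. norm (h z) \<le> B" if "compact K" "K \<subseteq> ball 0 \<rho>" for K
      using f(2) that(2) by (intro exI[of _ M]) blast
  qed auto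
  have real0: "g (of_real x) = 0" if "\<bar>x\<bar> < c" for x
  proof -
    have "(\<lambda>n. 1 / (real n + 1)) \<longlonglongrightarrow> 0" by real_asymp
    from LIMSEQ_subseq_LIMSEQ[OF this g(2)] have "(\<lambda>n. 1 / (real (\<sigma> n) + 1)) \<longlonglongrightarrow> 0" by (simp add: o_def)
    then have "(\<lambda>n. f (\<sigma> n) (of_real x)) \<longlonglongrightarrow> 0"
      by (rule Lim_null_comparison[rotated]) (use f(3)[OF that] in auto)
    moreover have "(\<lambda>n. f (\<sigma> n) (of_real x)) \<longlonglongrightarrow> g (of_real x)" using that c by (intro g(3)) simp
    ultimately show ?thesis using LIMSEQ_unique by blast
  qed
  have g0: "g w = 0" if "w \<in> ball 0 \<rho>" for w
  proof (rule analytic_continuation[OF g(1)])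
    show "(0::complex) islimpt complex_of_real ` {-c<..<c}"
      unfolding islimpt_approachable
    proof (intro allI impI)
      fix e :: real assume "e > 0"
      then have "complex_of_real (min e c / 2) \<in> complex_of_real ` {-c<..<c}" "complex_of_real (min e c / 2) \<noteq> 0"
        "dist (complex_of_real (min e c / 2)) 0 < e"
        using c by (intro imageI, auto simp: norm_mult norm_divide min_def)
      then show "\<exists>x'\<in>complex_of_real ` {-c<..<c}. x' \<noteq> 0 \<and> dist x' 0 < e" by blast
    qed
    show "g z = 0" if "z \<in> complex_of_real ` {-c<..<c}" for z using that real0 by auto
  qed (use that c in auto)
  have "uniform_limit (cball 0 r) (f \<circ> \<sigma>) g sequentially"
    using r by (intro g(4)) auto
  then have "\<forall>\<^sub>F n in sequentially. \<forall>x\<in>cball 0 r. dist ((f \<circ> \<sigma>) n x) (g x) < \<delta>"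
    using \<delta> by (rule uniform_limitD)
  then obtain n where "\<forall>x\<in>cball 0 r. dist ((f \<circ> \<sigma>) n x) (g x) < \<delta>"
    by (auto simp: eventually_sequentially)
  then have "dist (f (\<sigma> n) (t (\<sigma> n))) (g (t (\<sigma> n))) < \<delta>" using f(4) by auto
  moreover have "g (t (\<sigma> n)) = 0" using f(4)[of "\<sigma> n"] r by (intro g0) simp
  ultimately show False using f(5)[of "\<sigma> n"] by simp
qed

text \<open>The coordinates are released from the real segment to the disc one after another; I is
  the set of those already released. The target \<delta> has to vary in the induction, since
  releasing one more coordinate requires the new bound given by
  \<open>small_on_real_segment\<close>.\<close>

lemma small_on_real_points:
  fixes I :: "'i::finite set" and M :: real
  assumes c: "0 < c" "c \<le> \<rho>" and r: "r < \<rho>" and \<delta>: "\<delta> > 0"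
  shows "\<exists>\<epsilon>>0. \<forall>F :: ('i \<Rightarrow> complex) \<Rightarrow> complex.
    (\<forall>x i. (\<forall>j. norm (x j) < \<rho>) \<longrightarrow> (\<lambda>t. F (x(i := t))) holomorphic_on ball 0 \<rho>) \<longrightarrow>
    (\<forall>x. (\<forall>j. norm (x j) < \<rho>) \<longrightarrow> norm (F x) \<le> M) \<longrightarrow>
    (\<forall>x. (\<forall>j. \<exists>y::real. \<bar>y\<bar> < c \<and> x j = of_real y) \<longrightarrow> norm (F x) \<le> \<epsilon>) \<longrightarrow>
    (\<forall>x. (\<forall>j\<in>I. norm (x j) \<le> r) \<longrightarrow> (\<forall>j. j \<notin> I \<longrightarrow> (\<exists>y::real. \<bar>y\<bar> < c \<and> x j = of_real y)) \<longrightarrow> norm (F x) \<le> \<delta>)"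
  using finite[of I] \<delta>
proof (induction I arbitrary: \<delta> rule: finite_induct)
  case empty
  then show ?case by (intro exI[of _ \<delta>]) simp
next
  case (insert i I)
  obtain \<epsilon>1 where \<epsilon>1: "\<epsilon>1 > 0" "\<forall>f. f holomorphic_on ball 0 \<rho> \<longrightarrow> (\<forall>t\<in>ball 0 \<rho>. norm (f t) \<le> M) \<longrightarrow>
    (\<forall>x::real. \<bar>x\<bar> < c \<longrightarrow> norm (f (of_real x)) \<le> \<epsilon>1) \<longrightarrow> (\<forall>t. norm t \<le> r \<longrightarrow> norm (f t) \<le> \<delta>)"
    using small_on_real_segment[OF c r insert.prems, of M] by blast
  obtain \<epsilon> where \<epsilon>: "\<epsilon> > 0" and IH: "\<forall>F :: ('i \<Rightarrow> complex) \<Rightarrow> complex.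
    (\<forall>x i. (\<forall>j. norm (x j) < \<rho>) \<longrightarrow> (\<lambda>t. F (x(i := t))) holomorphic_on ball 0 \<rho>) \<longrightarrow>
    (\<forall>x. (\<forall>j. norm (x j) < \<rho>) \<longrightarrow> norm (F x) \<le> M) \<longrightarrow>
    (\<forall>x. (\<forall>j. \<exists>y::real. \<bar>y\<bar> < c \<and> x j = of_real y) \<longrightarrow> norm (F x) \<le> \<epsilon>) \<longrightarrow>
    (\<forall>x. (\<forall>j\<in>I. norm (x j) \<le> r) \<longrightarrow> (\<forall>j. j \<notin> I \<longrightarrow> (\<exists>y::real. \<bar>y\<bar> < c \<and> x j = of_real y)) \<longrightarrow> norm (F x) \<le> \<epsilon>1)"
    using insert.IH[OF \<epsilon>1(1)] by blast
  show ?case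
  proof (intro exI[of _ \<epsilon>] conjI \<epsilon> allI impI)
    fix F :: "('i \<Rightarrow> complex) \<Rightarrow> complex" and x :: "'i \<Rightarrow> complex"
    assume hol: "\<forall>x i. (\<forall>j. norm (x j) < \<rho>) \<longrightarrow> (\<lambda>t. F (x(i := t))) holomorphic_on ball 0 \<rho>"
      and bd: "\<forall>x. (\<forall>j. norm (x j) < \<rho>) \<longrightarrow> norm (F x) \<le> M"
      and sm: "\<forall>x. (\<forall>j. \<exists>y::real. \<bar>y\<bar> < c \<and> x j = of_real y) \<longrightarrow> norm (F x) \<le> \<epsilon>"
      and x: "\<forall>j\<in>insert i I. norm (x j) \<le> r" "\<forall>j. j \<notin> insert i I \<longrightarrow> (\<exists>y::real. \<bar>y\<bar> < c \<and> x j = of_real y)"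
    have xin: "norm (x j) < \<rho>" for j
    proof (cases "j \<in> insert i I")
      case True
      then show ?thesis using x(1) r by force
    next
      case False
      then obtain y :: real where "\<bar>y\<bar> < c" "x j = of_real y" using x(2) by blast
      then show ?thesis using c by simp
    qed
    have "norm (F (x(i := x i))) \<le> \<delta>"
    proof (rule \<epsilon>1(2)[rule_format, of "\<lambda>t. F (x(i := t))"])
      show "(\<lambda>t. F (x(i := t))) holomorphic_on ball 0 \<rho>" using hol xin by blast
      show "norm (F (x(i := t))) \<le> M" if "t \<in> ball 0 \<rho>" for t
        using that xin by (intro bd[rule_format]) auto
      show "norm (F (x(i := complex_of_real y))) \<le> \<epsilon>1" if "\<bar>y\<bar> < c" for y
      proof (rule IH[THEN spec, THEN mp, THEN mp, THEN mp, THEN spec, THEN mp, THEN mp, OF hol bd sm])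
        show "\<forall>j\<in>I. norm ((x(i := complex_of_real y)) j) \<le> r" using x(1) insert.hyps by auto
        show "\<forall>j. j \<notin> I \<longrightarrow> (\<exists>y'::real. \<bar>y'\<bar> < c \<and> (x(i := complex_of_real y)) j = of_real y')"
          using x(2) that by auto
      qed
      show "norm (x i) \<le> r" using x(1) by simp
    qed
    then show "norm (F x) \<le> \<delta>" by simp
  qed
qed

section \<open>Matrix elements seen from a point\<close>

definition mobius_vec :: "complex ^ 'n::finite \<Rightarrow> ('n \<Rightarrow> complex) \<Rightarrow> complex ^ 'n"
  where "mobius_vec z t = (\<chi> i. mobius (z $ i) (t i))"

lemma mobius_vec_polydisk:
  "z \<in> polydisk \<Longrightarrow> (\<And>i. norm (t i) < 1) \<Longrightarrow> mobius_vec z t \<in> polydisk"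
  by (simp add: mobius_vec_def polydisk_def norm_mobius_less_one)

text \<open>Up to a unimodular constant this is the image of the kernel at \<open>t\<close> under the unitary operator
  of composition with the automorphism of the polydisk that exchanges \<open>0\<close> and \<open>z\<close>.\<close>

definition moved_kernel :: "complex ^ 'n::finite \<Rightarrow> ('n \<Rightarrow> complex) \<Rightarrow> 'n bergman"
  where "moved_kernel z t = bergman_scale (\<Prod>i\<in>UNIV. of_real (1 - (norm (z $ i))\<^sup>2) / (1 - z $ i * cnj (t i))\<^sup>2)
    (bergman_kernel (mobius_vec z t))"

text \<open>The modulus of the scaling constant depends on t but not on z. This makes all
  comparisons between moved and normalized kernels uniform in the base point.\<close>

lemma moved_kernel_scale:
  fixes z :: "complex ^ 'n::finite"
  assumes z: "z \<in> polydisk" and t: "\<And>i. norm (t i) < 1"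
  obtains c where "moved_kernel z t = bergman_scale c (normalized_kernel (mobius_vec z t))"
    "norm c = (\<Prod>i\<in>UNIV. 1 / (1 - (norm (t i))\<^sup>2))"
proof -
  define d where "d = (\<Prod>i\<in>UNIV. complex_of_real (1 - (norm (z $ i))\<^sup>2) / (1 - z $ i * cnj (t i))\<^sup>2)"
  define w where "w = mobius_vec z t"
  have w: "w \<in> polydisk" unfolding w_def by (rule mobius_vec_polydisk[OF z t])
  have "moved_kernel z t = bergman_scale (d * of_real (1 / poly_delta w)) (normalized_kernel w)"
    unfolding moved_kernel_def d_def[symmetric] w_def[symmetric] bergman_kernel_def
      vector_space.vector_space_assms(3)[OF vector_space_bergman_scale] ..
  moreover have "norm (d * of_real (1 / poly_delta w)) = (\<Prod>i\<in>UNIV. 1 / (1 - (norm (t i))\<^sup>2))"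
  proof -
    have "norm (d * of_real (1 / poly_delta w)) = norm d / poly_delta w"
      using poly_delta_pos[OF w] by (simp add: norm_mult norm_divide)
    also have "\<dots> = (\<Prod>i\<in>UNIV. norm (complex_of_real (1 - (norm (z $ i))\<^sup>2) / (1 - z $ i * cnj (t i))\<^sup>2) / (1 - (norm (mobius (z $ i) (t i)))\<^sup>2))"
      unfolding d_def prod_norm[symmetric] prod_dividef[symmetric] poly_delta_def w_def mobius_vec_def vec_lambda_beta ..
    also have "\<dots> = (\<Prod>i\<in>UNIV. 1 / (1 - (norm (t i))\<^sup>2))"
    proof (rule prod.cong)
      fix i
      have zi: "norm (z $ i) < 1" using z by (simp add: polydisk_def)
      have P: "1 - (norm (z $ i))\<^sup>2 > 0" "1 - (norm (t i))\<^sup>2 > 0" "norm (1 - t i * cnj (z $ i)) \<noteq> 0"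
        using norm_less_one_sq_pos[OF zi] norm_less_one_sq_pos[OF t] one_minus_mult_cnj_nz[OF zi t] by auto
      have "norm (complex_of_real (1 - (norm (z $ i))\<^sup>2)) = 1 - (norm (z $ i))\<^sup>2" unfolding norm_of_real using P by simp
      moreover have cancel: "a / n\<^sup>2 / (a * b / n\<^sup>2) = 1 / b" if "a > 0" "n \<noteq> 0" for a b n :: real using that by simp
      ultimately show "norm (complex_of_real (1 - (norm (z $ i))\<^sup>2) / (1 - z $ i * cnj (t i))\<^sup>2) / (1 - (norm (mobius (z $ i) (t i)))\<^sup>2) =
          1 / (1 - (norm (t i))\<^sup>2)"
        unfolding one_minus_norm_mobius_sq[OF zi t] norm_divide norm_power norm_one_minus_commute[of "z $ i" "t i"]
        using P cancel by metis
    qed simp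
    finally show ?thesis .
  qed
  ultimately show ?thesis using that w_def by blast
qed

text \<open>The inner product is conjugate linear on the right: the scalar factor becomes
  holomorphic in \<tau> after conjugation, and the pairing with the kernel evaluates f along a
  Moebius image of \<tau>.\<close>

lemma moved_kernel_holomorphic:
  fixes z :: "complex ^ 'n::finite"
  assumes z: "z \<in> polydisk" and t: "\<And>i. norm (t i) < 1"
  shows "(\<lambda>\<tau>. bergman_inner f (moved_kernel z (t(i := \<tau>)))) holomorphic_on ball 0 1"
proof (rule holomorphic_transform)
  define w where "w = mobius_vec z t"
  have w: "w \<in> polydisk" unfolding w_def by (rule mobius_vec_polydisk[OF z t])
  have zi: "norm (z $ j) < 1" for j using z by (simp add: polydisk_def)
  let ?G = "\<lambda>\<tau>. (\<Prod>j\<in>UNIV. of_real (1 - (norm (z $ j))\<^sup>2) / (1 - cnj (z $ j) * (if j = i then \<tau> else t j))\<^sup>2) *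
      bergman_fun f (\<chi> j. if j = i then mobius (z $ i) \<tau> else w $ j)"
  show "?G holomorphic_on ball 0 1"
  proof (intro holomorphic_on_mult holomorphic_on_prod holomorphic_on_divide holomorphic_on_const holomorphic_on_power holomorphic_on_diff)
    show "(\<lambda>\<tau>. if j = i then \<tau> else t j) holomorphic_on ball 0 1" for j
      by (cases "j = i") (auto intro: holomorphic_intros)
    show "(1 - cnj (z $ j) * (if j = i then \<tau> else t j))\<^sup>2 \<noteq> 0" if "\<tau> \<in> ball 0 1" for j \<tau>
    proof -
      have "norm (if j = i then \<tau> else t j) < 1" using that t by simp
      from one_minus_mult_cnj_nz[OF zi this, of j] show ?thesis by (simp add: mult.commute)
    qed
    have "(\<lambda>\<tau>. bergman_fun f (\<chi> j. if j = i then \<tau> else w $ j)) holomorphic_on ball 0 1" by (rule bergman_fun_slice[OF w])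
    from holomorphic_on_compose_gen[OF holomorphic_on_mobius[OF zi] this] mobius_image_disc[OF zi]
    show "(\<lambda>\<tau>. bergman_fun f (\<chi> j. if j = i then mobius (z $ i) \<tau> else w $ j)) holomorphic_on ball 0 1"
      by (simp add: o_def)
  qed
  fix \<tau> :: complex assume \<tau>: "\<tau> \<in> ball 0 1"
  have t': "norm ((t(i := \<tau>)) j) < 1" for j using t \<tau> by simp
  have eq: "mobius_vec z (t(i := \<tau>)) = (\<chi> j. if j = i then mobius (z $ i) \<tau> else w $ j)"
    by (simp add: mobius_vec_def w_def vec_eq_iff)
  have "bergman_inner f (moved_kernel z (t(i := \<tau>))) =
      cnj (\<Prod>j\<in>UNIV. of_real (1 - (norm (z $ j))\<^sup>2) / (1 - z $ j * cnj ((t(i := \<tau>)) j))\<^sup>2) * bergman_fun f (mobius_vec z (t(i := \<tau>)))"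
    unfolding moved_kernel_def bergman_inner_scale_right bergman_inner_bergman_kernel[OF mobius_vec_polydisk[OF z t']] ..
  also have "cnj (\<Prod>j\<in>UNIV. of_real (1 - (norm (z $ j))\<^sup>2) / (1 - z $ j * cnj ((t(i := \<tau>)) j))\<^sup>2) =
      (\<Prod>j\<in>UNIV. of_real (1 - (norm (z $ j))\<^sup>2) / (1 - cnj (z $ j) * (if j = i then \<tau> else t j))\<^sup>2)"
    unfolding cnj_prod by (intro prod.cong) simp_all
  finally show "?G \<tau> = bergman_inner f (moved_kernel z (t(i := \<tau>)))" unfolding eq ..
qed

lemma holomorphic_on_cnj_cnj_disc:
  assumes "f holomorphic_on ball 0 \<rho>"
  shows "(\<lambda>t. cnj (f (cnj t))) holomorphic_on ball 0 \<rho>"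
proof -
  have "cnj ` ball 0 \<rho> = ball 0 \<rho>"
  proof (intro equalityI subsetI)
    fix x :: complex assume "x \<in> ball 0 \<rho>"
    then show "x \<in> cnj ` ball 0 \<rho>" by (intro image_eqI[of _ _ "cnj x"]) auto
  qed auto
  then show ?thesis
    using holomorphic_on_compose_cnj_cnj[of f "ball 0 \<rho>"] assms by (simp add: o_def)
qed

text \<open>The flag \<open>False\<close> marks the variables of the vector to which A is applied;
  they are conjugated so that the form is holomorphic in all 2 n variables. Up to scaling, Berezin
  values occur at the points where x (i, False) is the conjugate of x (i, True), a totally real
  set.\<close>

definition moved_form :: "'n::finite bergman_op \<Rightarrow> complex ^ 'n \<Rightarrow> ('n \<times> bool \<Rightarrow> complex) \<Rightarrow> complex"
  where "moved_form A z x = bergman_inner (A (moved_kernel z (\<lambda>i. cnj (x (i, False))))) (moved_kernel z (\<lambda>i. x (i, True)))"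

lemma moved_form_holomorphic:
  fixes A :: "'n::finite bergman_op"
  assumes A: "clinear_op A" and z: "z \<in> polydisk" and x: "\<And>j. norm (x j) < 1"
  shows "(\<lambda>t. moved_form A z (x(j := t))) holomorphic_on ball 0 1"
proof (cases j)
  case (Pair i b)
  show ?thesis
  proof (cases b)
    case True
    have "(\<lambda>k. (x(j := t)) (k, True)) = (\<lambda>k. x (k, True))(i := t)" "(\<lambda>k. cnj ((x(j := t)) (k, False))) = (\<lambda>k. cnj (x (k, False)))" for t
      using Pair True by (auto simp: fun_eq_iff)
    then show ?thesis unfolding moved_form_def
      using moved_kernel_holomorphic[OF z, of "\<lambda>k. x (k, True)"] x by simp
  next
    case False
    let ?g = "moved_kernel z (\<lambda>k. x (k, True))"
    \<comment> \<open>To read off holomorphy in a left variable, A is moved to the right, where the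
      form becomes the conjugate of a pairing of h with a moved kernel.\<close>
    obtain h where h: "\<And>f. bergman_inner (A f) ?g = bergman_inner f h"
      using adjoint_vector[OF A] by blast
    have eq: "(\<lambda>k. (x(j := t)) (k, True)) = (\<lambda>k. x (k, True))" "(\<lambda>k. cnj ((x(j := t)) (k, False))) = (\<lambda>k. cnj (x (k, False)))(i := cnj t)" for t
      using Pair False by (auto simp: fun_eq_iff)
    have "moved_form A z (x(j := t)) = cnj (bergman_inner h (moved_kernel z ((\<lambda>k. cnj (x (k, False)))(i := cnj t))))" for t
      unfolding moved_form_def eq h by (rule bergman_inner_commute)
    moreover have "(\<lambda>t. bergman_inner h (moved_kernel z ((\<lambda>k. cnj (x (k, False)))(i := t)))) holomorphic_on ball 0 1"
      using x by (intro moved_kernel_holomorphic[OF z]) simp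
    ultimately show ?thesis using holomorphic_on_cnj_cnj_disc by auto
  qed
qed

lemma moved_form_eq:
  fixes A :: "'n::finite bergman_op"
  assumes A: "clinear_op A" and z: "z \<in> polydisk" and x: "\<And>j. norm (x j) < 1"
  shows "norm (moved_form A z x) =
    norm (bergman_inner (A (normalized_kernel (mobius_vec z (\<lambda>i. cnj (x (i, False)))))) (normalized_kernel (mobius_vec z (\<lambda>i. x (i, True))))) *
    (\<Prod>i\<in>UNIV. 1 / (1 - (norm (x (i, False)))\<^sup>2)) * (\<Prod>i\<in>UNIV. 1 / (1 - (norm (x (i, True)))\<^sup>2))"
proof -
  obtain c where c: "moved_kernel z (\<lambda>i. cnj (x (i, False))) = bergman_scale c (normalized_kernel (mobius_vec z (\<lambda>i. cnj (x (i, False)))))"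
    "norm c = (\<Prod>i\<in>UNIV. 1 / (1 - (norm (cnj (x (i, False))))\<^sup>2))"
    by (rule moved_kernel_scale[OF z, of "\<lambda>i. cnj (x (i, False))"]) (use x in auto)
  obtain d where d: "moved_kernel z (\<lambda>i. x (i, True)) = bergman_scale d (normalized_kernel (mobius_vec z (\<lambda>i. x (i, True))))"
    "norm d = (\<Prod>i\<in>UNIV. 1 / (1 - (norm (x (i, True)))\<^sup>2))"
    by (rule moved_kernel_scale[OF z, of "\<lambda>i. x (i, True)"]) (use x in auto)
  have "A (bergman_scale c f) = bergman_scale c (A f)" for f using A by (simp add: clinear_op_def)
  then show ?thesis
    unfolding moved_form_def c(1) d(1)
    by (simp add: bergman_inner_scale_left bergman_inner_scale_right norm_mult c(2) d(2))
qed

lemma moved_form_bound: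
  fixes A :: "'n::finite bergman_op"
  assumes A: "clinear_op A" and z: "z \<in> polydisk" and R: "R < 1" and x: "\<And>j. norm (x j) \<le> R"
  shows "norm (moved_form A z x) \<le> norm A * (1 / (1 - R\<^sup>2)) ^ CARD('n) * (1 / (1 - R\<^sup>2)) ^ CARD('n)"
proof -
  have x1: "norm (x j) < 1" for j using x[of j] R by linarith
  have R0: "0 \<le> R" using x[of undefined] norm_ge_zero order_trans by blast
  have R2: "1 - R\<^sup>2 > 0" using R R0 by (simp add: abs_square_less_1)
  have fac: "0 \<le> 1 / (1 - (norm (x j))\<^sup>2) \<and> 1 / (1 - (norm (x j))\<^sup>2) \<le> 1 / (1 - R\<^sup>2)" for j
  proof -
    have "(norm (x j))\<^sup>2 \<le> R\<^sup>2" using x by (intro power_mono) auto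
    then show ?thesis using R2 norm_less_one_sq_pos[OF x1] by (auto intro!: divide_left_mono)
  qed
  have prod: "(\<Prod>i\<in>UNIV. 1 / (1 - (norm (x (i, b)))\<^sup>2)) \<le> (1 / (1 - R\<^sup>2)) ^ CARD('n)" for b
    using prod_mono[of "UNIV :: 'n set" "\<lambda>i. 1 / (1 - (norm (x (i, b)))\<^sup>2)" "\<lambda>_. 1 / (1 - R\<^sup>2)"] fac by simp
  have prod0: "(\<Prod>i\<in>UNIV. 1 / (1 - (norm (x (i, b)))\<^sup>2)) \<ge> 0" for b using fac by (intro prod_nonneg) blast
  let ?k = "\<lambda>t. normalized_kernel (mobius_vec z t)"
  have k1: "norm (?k t) = 1" if "\<And>i. norm (t i) < 1" for t
    by (rule norm_normalized_kernel[OF mobius_vec_polydisk[OF z that]])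
  have "norm (bergman_inner (A (?k (\<lambda>i. cnj (x (i, False))))) (?k (\<lambda>i. x (i, True)))) \<le>
      norm (A (?k (\<lambda>i. cnj (x (i, False))))) * norm (?k (\<lambda>i. x (i, True)))" by (rule norm_bergman_inner_le)
  also have "\<dots> \<le> norm A"
    using norm_blinfun[of A "?k (\<lambda>i. cnj (x (i, False)))"] k1 x1 by simp
  finally show ?thesis
    unfolding moved_form_eq[OF A z x1] using prod prod0 R2
    by (intro mult_mono mult_nonneg_nonneg) auto
qed

text \<open>The Cauchy estimate for the derivative on discs of radius (R - R') / 2, which stay
  inside the ball of radius R.\<close>

lemma holomorphic_lipschitz:
  assumes f: "f holomorphic_on ball 0 R" and M: "\<And>x. norm x < R \<Longrightarrow> norm (f x) \<le> M" and R: "R' < R"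
    and xy: "norm x < R'" "norm y < R'"
  shows "norm (f x - f y) \<le> 2 * M / (R - R') * norm (x - y)"
proof (rule field_differentiable_bound[where S = "ball 0 R'" and f' = "deriv f"])
  define s where "s = (R - R') / 2"
  have s: "s > 0" using R by (simp add: s_def)
  fix w :: complex assume w: "w \<in> ball 0 R'"
  have sub: "cball w s \<subseteq> ball 0 R"
  proof
    fix v assume v: "v \<in> cball w s"
    have "norm v \<le> norm w + dist w v" using norm_triangle_ineq4[of w "w - v"] by (simp add: dist_norm)
    also have "\<dots> < R' + (R - R')" using v w s by (simp add: s_def)
    finally show "v \<in> ball 0 R" by simp
  qed
  have "norm ((deriv ^^ 1) f w) \<le> fact 1 * M / s ^ 1"
  proof (rule Cauchy_inequality)
    show "f holomorphic_on ball w s" "continuous_on (cball w s) f"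
      using holomorphic_on_subset[OF f] holomorphic_on_imp_continuous_on[OF holomorphic_on_subset[OF f sub]] sub
      by (auto simp: subset_iff)
    show "norm (f v) \<le> M" if "norm (w - v) = s" for v
    proof -
      have "v \<in> cball w s" using that by (simp add: dist_norm)
      then show ?thesis using sub M by auto
    qed
  qed (use s in auto)
  then show "norm (deriv f w) \<le> 2 * M / (R - R')" by (simp add: s_def mult.commute)
  have "w \<in> ball 0 R" using w R by simp
  with f show "(f has_field_derivative deriv f w) (at w within ball 0 R')"
    by (metis has_field_derivative_at_within holomorphic_derivI open_ball)
qed (use xy in auto)

text \<open>Only separate holomorphy is known. Near t0 the function is the sum of two one-variable
  restrictions, a constant and the mixed second difference \<open>E\<close>. Applying the Lipschitz
  bound in both variables gives E = O(|t - t0|^2), so E has derivative 0 at t0.\<close>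

lemma holomorphic_on_affine_pair:
  assumes g1: "\<And>v. norm v < R \<Longrightarrow> (\<lambda>u. g u v) holomorphic_on ball 0 R"
    and g2: "\<And>u. norm u < R \<Longrightarrow> (\<lambda>v. g u v) holomorphic_on ball 0 R"
    and M: "\<And>u v. norm u < R \<Longrightarrow> norm v < R \<Longrightarrow> norm (g u v) \<le> M" and R: "R' < R"
    and S: "open S" and pq: "\<And>t. t \<in> S \<Longrightarrow> norm (p + a * t) < R'" "\<And>t. t \<in> S \<Longrightarrow> norm (q + c * t) < R'"
  shows "(\<lambda>t. g (p + a * t) (q + c * t)) holomorphic_on S"
  unfolding holomorphic_on_open[OF S]
proof
  fix t0 assume t0: "t0 \<in> S"
  let ?u = "\<lambda>t. p + a * t" and ?v = "\<lambda>t. q + c * t"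
  define L where "L = 2 * M / (R - R')"
  have lt: "norm (?u t) < R" "norm (?v t) < R" if "t \<in> S" for t using pq[OF that] R by auto
  define E where "E t = g (?u t) (?v t) - g (?u t) (?v t0) - (g (?u t0) (?v t) - g (?u t0) (?v t0))" for t
  have E: "norm (E t) \<le> 2 * L / (R - R') * norm a * norm c * (norm (t - t0))\<^sup>2" if t: "t \<in> S" for t
  proof -
    have lips: "norm (g (?u t) v - g (?u t0) v) \<le> L * norm (?u t - ?u t0)" if "norm v < R" for v
      unfolding L_def by (rule holomorphic_lipschitz[OF g1[OF that] M[OF _ that] R pq(1)[OF t] pq(1)[OF t0]])
    have "norm ((g (?u t) (?v t) - g (?u t0) (?v t)) - (g (?u t) (?v t0) - g (?u t0) (?v t0))) \<le>
        2 * (L * norm (?u t - ?u t0)) / (R - R') * norm (?v t - ?v t0)"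
      by (rule holomorphic_lipschitz[OF holomorphic_on_diff[OF g2[OF lt(1)[OF t]] g2[OF lt(1)[OF t0]]] lips R pq(2)[OF t] pq(2)[OF t0]])
    also have "norm (?u t - ?u t0) = norm a * norm (t - t0)" by (simp add: norm_mult flip: right_diff_distrib)
    also have "norm (?v t - ?v t0) = norm c * norm (t - t0)" by (simp add: norm_mult flip: right_diff_distrib)
    finally show ?thesis unfolding E_def by (simp add: algebra_simps power2_eq_square)
  qed
  define C where "C = 2 * L / (R - R') * norm a * norm c"
  have dE: "(E has_field_derivative 0) (at t0)"
    unfolding has_field_derivative_iff
  proof (rule Lim_null_comparison)
    have "\<forall>\<^sub>F t in at t0. t \<in> S" using S t0 by (metis at_within_open eventually_at_topological)
    then show "\<forall>\<^sub>F t in at t0. norm ((E t - E t0) / (t - t0)) \<le> C * norm (t - t0)"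
    proof (rule eventually_mono)
      fix t assume "t \<in> S"
      have "norm (E t) \<le> C * norm (t - t0) * norm (t - t0)"
        using E[OF \<open>t \<in> S\<close>] by (simp add: C_def power2_eq_square mult.assoc)
      moreover have "E t0 = 0" by (simp add: E_def)
      ultimately show "norm ((E t - E t0) / (t - t0)) \<le> C * norm (t - t0)"
        by (cases "t = t0") (simp_all add: norm_divide divide_le_eq)
    qed
    have "((\<lambda>t. C * norm (t - t0)) \<longlongrightarrow> C * norm (t0 - t0)) (at t0)" by (intro tendsto_intros)
    then show "((\<lambda>t. C * norm (t - t0)) \<longlongrightarrow> 0) (at t0)" by simp
  qed
  have 1: "(\<lambda>t. g (?u t) (?v t0)) holomorphic_on S"
    by (rule holomorphic_on_compose_gen[OF _ g1[OF lt(2)[OF t0]], unfolded o_def])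
      (use lt in \<open>auto intro!: holomorphic_intros\<close>)
  have 2: "(\<lambda>t. g (?u t0) (?v t)) holomorphic_on S"
    by (rule holomorphic_on_compose_gen[OF _ g2[OF lt(1)[OF t0]], unfolded o_def])
      (use lt in \<open>auto intro!: holomorphic_intros\<close>)
  note d = DERIV_add[OF DERIV_add[OF dE holomorphic_derivI[OF 1 S t0]] DERIV_diff[OF holomorphic_derivI[OF 2 S t0] DERIV_const[of "g (?u t0) (?v t0)"]]]
  have "(\<lambda>t. E t + g (?u t) (?v t0) + (g (?u t0) (?v t) - g (?u t0) (?v t0))) = (\<lambda>t. g (?u t) (?v t))"
    by (simp add: E_def)
  with d show "\<exists>f'. ((\<lambda>t. g (?u t) (?v t)) has_field_derivative f') (at t0)" by auto
qed

text \<open>A linear substitution with components \<xi> + i \<zeta> and \<xi> - i \<zeta> maps real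
  points to the totally real set on which the form has Berezin values. Smallness at real points of
  the substituted function thus spreads to a polydisk around 0 for the form itself. That polydisk
  contains real points again, and a second application, now without substitution, reaches the radius
  r.\<close>

lemma offdiagonal_small:
  fixes A :: "'n::finite bergman_op"
  assumes A: "clinear_op A" and r: "0 < r" "r < 1" and \<delta>: "\<delta> > 0"
  shows "\<exists>\<epsilon>>0. \<forall>z\<in>polydisk. (\<forall>t. (\<forall>i. norm (t i) \<le> 1 / 2) \<longrightarrow>
      norm (bergman_inner (A (normalized_kernel (mobius_vec z t))) (normalized_kernel (mobius_vec z t))) \<le> \<epsilon>) \<longrightarrow>
    (\<forall>s t. (\<forall>i. norm (s i) \<le> r \<and> norm (t i) \<le> r) \<longrightarrow>
      norm (bergman_inner (A (normalized_kernel (mobius_vec z s))) (normalized_kernel (mobius_vec z t))) \<le> \<delta>)"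
proof -
  define R where "R = (1 + r) / 2"
  have R: "r < R" "0 < R" "R < 1" using r by (auto simp: R_def)
  \<comment> \<open>The second application needs a radius above r that is at least the half-length
    1/4 of the real segment.\<close>
  define R' where "R' = max R (1 / 4)"
  have R': "r < R'" "1 / 4 \<le> R'" "R' < 1" using R by (auto simp: R'_def)
  \<comment> \<open>Coordinates below 2/5 lead to substituted coordinates below 4/5, where
    \<open>moved_form_bound\<close> applies.\<close>
  define M1 where "M1 = norm A * (1 / (1 - (4 / 5)\<^sup>2)) ^ CARD('n) * (1 / (1 - (4 / 5)\<^sup>2)) ^ CARD('n)"
  define M2 where "M2 = norm A * (1 / (1 - R'\<^sup>2)) ^ CARD('n) * (1 / (1 - R'\<^sup>2)) ^ CARD('n)"
  obtain \<delta>1 where \<delta>1: "\<delta>1 > 0" and step2: "\<forall>F :: ('n \<times> bool \<Rightarrow> complex) \<Rightarrow> complex.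
    (\<forall>x i. (\<forall>j. norm (x j) < R') \<longrightarrow> (\<lambda>t. F (x(i := t))) holomorphic_on ball 0 (R')) \<longrightarrow>
    (\<forall>x. (\<forall>j. norm (x j) < R') \<longrightarrow> norm (F x) \<le> M2) \<longrightarrow>
    (\<forall>x. (\<forall>j. \<exists>y::real. \<bar>y\<bar> < 1 / 4 \<and> x j = of_real y) \<longrightarrow> norm (F x) \<le> \<delta>1) \<longrightarrow>
    (\<forall>x. (\<forall>j. norm (x j) \<le> r) \<longrightarrow> norm (F x) \<le> \<delta>)"
    using small_on_real_points[where c = "1 / 4" and \<rho> = R' and r = r and \<delta> = \<delta> and I = "UNIV :: ('n \<times> bool) set" and M = M2] R' \<delta> by auto
  obtain \<epsilon>0 where \<epsilon>0: "\<epsilon>0 > 0" and step1: "\<forall>F :: ('n \<times> bool \<Rightarrow> complex) \<Rightarrow> complex.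
    (\<forall>x i. (\<forall>j. norm (x j) < 2 / 5) \<longrightarrow> (\<lambda>t. F (x(i := t))) holomorphic_on ball 0 (2 / 5)) \<longrightarrow>
    (\<forall>x. (\<forall>j. norm (x j) < 2 / 5) \<longrightarrow> norm (F x) \<le> M1) \<longrightarrow>
    (\<forall>x. (\<forall>j. \<exists>y::real. \<bar>y\<bar> < 1 / 4 \<and> x j = of_real y) \<longrightarrow> norm (F x) \<le> \<epsilon>0) \<longrightarrow>
    (\<forall>x. (\<forall>j. norm (x j) \<le> 1 / 4) \<longrightarrow> norm (F x) \<le> \<delta>1)"
    using small_on_real_points[where c = "1 / 4" and \<rho> = "2 / 5" and r = "1 / 4" and \<delta> = \<delta>1 and I = "UNIV :: ('n \<times> bool) set" and M = M1] \<delta>1 by auto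
  \<comment> \<open>On real points the substituted coordinates have modulus at most 1/4 + 1/4, and
    4/3 = 1 / (1 - (1/2)^2) bounds the scaling factors there.\<close>
  define L where "L = (4 / 3 :: real) ^ CARD('n)"
  have L: "L > 0" by (simp add: L_def)
  define \<epsilon> where "\<epsilon> = \<epsilon>0 / (L * L)"
  have \<epsilon>: "\<epsilon> > 0" using \<epsilon>0 L by (simp add: \<epsilon>_def)
  have "norm (bergman_inner (A (normalized_kernel (mobius_vec z s))) (normalized_kernel (mobius_vec z t))) \<le> \<delta>"
    if z: "z \<in> polydisk" and diag: "\<And>t. (\<And>i. norm (t i) \<le> 1 / 2) \<Longrightarrow>
      norm (bergman_inner (A (normalized_kernel (mobius_vec z t))) (normalized_kernel (mobius_vec z t))) \<le> \<epsilon>"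
    and st: "\<And>i. norm (s i) \<le> r" "\<And>i. norm (t i) \<le> r" for z s t
  proof -
    define sw :: "('n \<times> bool \<Rightarrow> complex) \<Rightarrow> 'n \<times> bool \<Rightarrow> complex" where
      "sw x p = (if snd p then x (fst p, True) + \<i> * x (fst p, False) else x (fst p, True) - \<i> * x (fst p, False))" for x p
    have sw_bound: "norm (sw x p) \<le> norm (x (fst p, True)) + norm (x (fst p, False))" for x p
      using norm_triangle_ineq[of "x (fst p, True)" "\<i> * x (fst p, False)"]
        norm_triangle_ineq4[of "x (fst p, True)" "\<i> * x (fst p, False)"]
      by (simp add: sw_def norm_mult)
    have small1: "norm (moved_form A z (sw x)) \<le> \<delta>1" if x: "\<And>j. norm (x j) \<le> 1 / 4" for x
    proof (rule step1[rule_format, of "\<lambda>x. moved_form A z (sw x)", OF _ _ _ x])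
      fix x :: "'n \<times> bool \<Rightarrow> complex" and j assume x: "\<And>j. norm (x j) < 2 / 5"
      have sw1: "norm (sw x p) < 1" for p
        using sw_bound[of x p] x[of "(fst p, True)"] x[of "(fst p, False)"] by linarith
      obtain i :: 'n and b where j: "j = (i, b :: bool)" by (cases j)
      define g where "g u v = moved_form A z ((sw x)((i, True) := u, (i, False) := v))" for u v
      define p q a c where "p = (if b then \<i> * x (i, False) else x (i, True))"
        and "q = (if b then - \<i> * x (i, False) else x (i, True))"
        and "a = (if b then 1 else \<i>)" and "c = (if b then 1 else - \<i>)"
      have pq: "norm p < 2 / 5" "norm q < 2 / 5" "norm a = 1" "norm c = 1"
        using x[of "(i, False)"] x[of "(i, True)"] by (auto simp: p_def q_def a_def c_def norm_mult)
      \<comment> \<open>Changing one coordinate of x moves the two coordinates (i, True) and (i,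
        False) of the form simultaneously along a line, hence
        \<open>holomorphic_on_affine_pair\<close>.\<close>
      have eq: "sw (x(j := t)) = (sw x)((i, True) := p + a * t, (i, False) := q + c * t)" for t
        by (rule ext) (auto simp: sw_def j p_def q_def a_def c_def)
      have "(\<lambda>t. g (p + a * t) (q + c * t)) holomorphic_on ball 0 (2 / 5)"
      proof (rule holomorphic_on_affine_pair[where R = "9 / 10" and R' = "4 / 5"])
        fix v :: complex assume v: "norm v < 9 / 10"
        have hol: "(\<lambda>u. moved_form A z (((sw x)((i, e) := v))(j := u))) holomorphic_on ball 0 (9 / 10)" for e j
        proof (rule holomorphic_on_subset[OF moved_form_holomorphic[OF A z]])
          show "norm (((sw x)((i, e) := v)) k) < 1" for k using sw1 v by simp
        qed (simp add: subset_ball)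
        have "(\<lambda>u. g u v) = (\<lambda>u. moved_form A z (((sw x)((i, False) := v))((i, True) := u)))"
          unfolding g_def by (simp add: fun_upd_twist)
        then show "(\<lambda>u. g u v) holomorphic_on ball 0 (9 / 10)"
          using hol by simp
        show "(\<lambda>u. g v u) holomorphic_on ball 0 (9 / 10)"
          unfolding g_def by (rule hol)
      next
        fix u v :: complex assume uv: "norm u < 9 / 10" "norm v < 9 / 10"
        have sw45: "norm (sw x k) \<le> 9 / 10" for k
          using sw_bound[of x k] x[of "(fst k, True)"] x[of "(fst k, False)"] by linarith
        show "norm (g u v) \<le> norm A * (1 / (1 - (9 / 10)\<^sup>2)) ^ CARD('n) * (1 / (1 - (9 / 10)\<^sup>2)) ^ CARD('n)"
          unfolding g_def using uv sw45 by (intro moved_form_bound[OF A z]) auto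
      next
        fix t :: complex assume "t \<in> ball 0 (2 / 5)"
        then have t: "norm t < 2 / 5" by simp
        show "norm (p + a * t) < 4 / 5" "norm (q + c * t) < 4 / 5"
          using norm_triangle_ineq[of p "a * t"] norm_triangle_ineq[of q "c * t"] pq t by (simp_all add: norm_mult)
      qed auto
      then show "(\<lambda>t. moved_form A z (sw (x(j := t)))) holomorphic_on ball 0 (2 / 5)"
        unfolding eq g_def .
    next
      fix x :: "'n \<times> bool \<Rightarrow> complex" assume x: "\<And>j. norm (x j) < 2 / 5"
      have "norm (sw x p) \<le> 4 / 5" for p
        using sw_bound[of x p] x[of "(fst p, True)"] x[of "(fst p, False)"] by linarith
      then show "norm (moved_form A z (sw x)) \<le> M1"
        unfolding M1_def by (intro moved_form_bound[OF A z]) auto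
    next
      fix x :: "'n \<times> bool \<Rightarrow> complex" assume "\<And>j. \<exists>y::real. \<bar>y\<bar> < 1 / 4 \<and> x j = of_real y"
      then obtain y :: "'n \<times> bool \<Rightarrow> real" where y: "\<And>j. \<bar>y j\<bar> < 1 / 4" "\<And>j. x j = of_real (y j)" by metis
      have le: "norm (sw x p) \<le> 1 / 2" for p
        using sw_bound[of x p] y(1)[of "(fst p, True)"] y(1)[of "(fst p, False)"] by (simp add: y(2))
      then have lt: "norm (sw x p) < 1" for p using le_less_trans[OF le] by simp
      \<comment> \<open>For real x both arguments of the form belong to the same kernel, so the
        diagonal hypothesis applies.\<close>
      have cn: "cnj (sw x (i, False)) = sw x (i, True)" for i by (simp add: sw_def y(2))
      have fac: "0 \<le> 1 / (1 - (norm (sw x p))\<^sup>2) \<and> 1 / (1 - (norm (sw x p))\<^sup>2) \<le> 4 / 3" for p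
      proof -
        have "(norm (sw x p))\<^sup>2 \<le> (1 / 2)\<^sup>2" using le by (intro power_mono) auto
        then have "3 / 4 \<le> 1 - (norm (sw x p))\<^sup>2" by (simp add: power2_eq_square)
        then show ?thesis by (simp add: field_simps)
      qed
      have prod: "(\<Prod>i\<in>UNIV. 1 / (1 - (norm (sw x (i, b)))\<^sup>2)) \<le> L" for b
        using prod_mono[of "UNIV :: 'n set" "\<lambda>i. 1 / (1 - (norm (sw x (i, b)))\<^sup>2)" "\<lambda>_. 4 / 3"] fac by (simp add: L_def)
      have prod0: "(\<Prod>i\<in>UNIV. 1 / (1 - (norm (sw x (i, b)))\<^sup>2)) \<ge> 0" for b using fac by (intro prod_nonneg) blast
      have "norm (moved_form A z (sw x)) \<le> \<epsilon> * L * L"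
        unfolding moved_form_eq[OF A z lt] cn using prod prod0 L \<epsilon> le
        by (intro mult_mono mult_nonneg_nonneg diag) auto
      then show "norm (moved_form A z (sw x)) \<le> \<epsilon>0" using L by (simp add: \<epsilon>_def)
    qed
    have small2: "norm (moved_form A z u) \<le> \<delta>1" if u: "\<And>j. norm (u j) \<le> 1 / 4" for u
    proof -
      \<comment> \<open>The inverse of the substitution. Its components are means of two numbers up
        to unimodular factors, so the bound 1/4 is preserved.\<close>
      define x where "x p = (if snd p then (u (fst p, True) + u (fst p, False)) / 2 else (u (fst p, True) - u (fst p, False)) / (2 * \<i>))" for p
      have "sw x = u"
        by (rule ext) (auto simp: sw_def x_def field_simps)
      moreover have "norm (x p) \<le> 1 / 4" for p
        using norm_triangle_ineq[of "u (fst p, True)" "u (fst p, False)"] norm_triangle_ineq4[of "u (fst p, True)" "u (fst p, False)"]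
          u[of "(fst p, True)"] u[of "(fst p, False)"]
        by (auto simp: x_def norm_divide norm_mult)
      ultimately show ?thesis using small1[of x] by simp
    qed
    define u :: "'n \<times> bool \<Rightarrow> complex" where "u p = (if snd p then t (fst p) else cnj (s (fst p)))" for p
    have u: "norm (u j) \<le> r" for j using st by (simp add: u_def)
    have u1: "norm (u j) < 1" for j using u[of j] r by linarith
    have "norm (moved_form A z u) \<le> \<delta>"
    proof (rule step2[rule_format, of "moved_form A z", OF _ _ _ u])
      fix x :: "'n \<times> bool \<Rightarrow> complex" and j assume x: "\<And>j. norm (x j) < R'"
      have "norm (x j) < 1" for j using x[of j] R' by linarith
      then show "(\<lambda>t. moved_form A z (x(j := t))) holomorphic_on ball 0 R'"
        using holomorphic_on_subset[OF moved_form_holomorphic[OF A z]] R' by (metis subset_ball less_imp_le)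
    next
      fix x :: "'n \<times> bool \<Rightarrow> complex" assume x: "\<And>j. norm (x j) < R'"
      then show "norm (moved_form A z x) \<le> M2"
        unfolding M2_def using R' by (intro moved_form_bound[OF A z]) (auto intro: less_imp_le)
    next
      fix x :: "'n \<times> bool \<Rightarrow> complex" assume x: "\<And>j. \<exists>y::real. \<bar>y\<bar> < 1 / 4 \<and> x j = of_real y"
      have "norm (x j) \<le> 1 / 4" for j using x[of j] by auto
      then show "norm (moved_form A z x) \<le> \<delta>1" by (rule small2)
    qed
    \<comment> \<open>The scaling factors of the moved kernels are at least 1, so passing back to
      normalized kernels does not increase the modulus.\<close>
    moreover have ge1: "(\<Prod>i\<in>UNIV. 1 / (1 - (norm (u (i, b)))\<^sup>2)) \<ge> 1" for b
    proof (intro prod_ge_1)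
      fix i
      show "1 \<le> 1 / (1 - (norm (u (i, b)))\<^sup>2)" using norm_less_one_sq_pos[OF u1, of "(i, b)"] by (simp add: le_divide_eq)
    qed
    moreover have ge: "n \<le> n * a * b" if "n \<ge> 0" "a \<ge> 1" "b \<ge> 1" for n a b :: real
    proof -
      have "n * 1 * 1 \<le> n * a * b" using that by (intro mult_mono mult_nonneg_nonneg) auto
      then show ?thesis by simp
    qed
    moreover have eq: "norm (moved_form A z u) =
        norm (bergman_inner (A (normalized_kernel (mobius_vec z s))) (normalized_kernel (mobius_vec z t))) *
        (\<Prod>i\<in>UNIV. 1 / (1 - (norm (u (i, False)))\<^sup>2)) * (\<Prod>i\<in>UNIV. 1 / (1 - (norm (u (i, True)))\<^sup>2))"
      unfolding moved_form_eq[OF A z u1] by (simp add: u_def)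
    ultimately have "norm (bergman_inner (A (normalized_kernel (mobius_vec z s))) (normalized_kernel (mobius_vec z t))) \<le> norm (moved_form A z u)"
      unfolding eq by - (rule ge[OF norm_ge_zero ge1 ge1])
    with \<open>norm (moved_form A z u) \<le> \<delta>\<close> show ?thesis by simp
  qed
  then have "\<forall>z\<in>polydisk. (\<forall>t. (\<forall>i. norm (t i) \<le> 1 / 2) \<longrightarrow>
      norm (bergman_inner (A (normalized_kernel (mobius_vec z t))) (normalized_kernel (mobius_vec z t))) \<le> \<epsilon>) \<longrightarrow>
    (\<forall>s t. (\<forall>i. norm (s i) \<le> r \<and> norm (t i) \<le> r) \<longrightarrow>
      norm (bergman_inner (A (normalized_kernel (mobius_vec z s))) (normalized_kernel (mobius_vec z t))) \<le> \<delta>)"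
    by simp
  then show ?thesis using \<epsilon> by (intro exI[of _ \<epsilon>] conjI)
qed

section \<open>Partitions of bounded multiplicity\<close>

text \<open>The square root of a tent, so that the squares of the integer translates sum to 1. It is
  Hoelder continuous of exponent 1/2 only, and slowness of the cells has to be bought with squares
  of the tolerance.\<close>

definition tent_root :: "real \<Rightarrow> real"
  where "tent_root t = sqrt (max 0 (1 - \<bar>t\<bar>))"

lemma tent_root_bounds: "0 \<le> tent_root t" "tent_root t \<le> 1"
  by (auto simp: tent_root_def)

lemma tent_root_nonzero: "tent_root t \<noteq> 0 \<longleftrightarrow> \<bar>t\<bar> < 1"
  by (auto simp: tent_root_def)

lemma tent_root_sq: "(tent_root t)\<^sup>2 = max 0 (1 - \<bar>t\<bar>)"
  by (simp add: tent_root_def)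

lemma tent_root_diff: "\<bar>tent_root s - tent_root t\<bar> \<le> sqrt \<bar>s - t\<bar>"
proof -
  have "tent_root s \<le> tent_root t + sqrt \<bar>s - t\<bar>" for s t
  proof -
    have "tent_root s \<le> sqrt (max 0 (1 - \<bar>t\<bar>) + \<bar>s - t\<bar>)"
      unfolding tent_root_def by (intro real_sqrt_le_mono) auto
    also have "\<dots> \<le> tent_root t + sqrt \<bar>s - t\<bar>"
      unfolding tent_root_def by (rule sqrt_add_le_add_sqrt) auto
    finally show ?thesis .
  qed
  from this[of s t] this[of t s] show ?thesis by (simp add: abs_minus_commute)
qed

lemma tent_root_support: "{k :: int. tent_root (t - of_int k) \<noteq> 0} \<subseteq> {\<lfloor>t\<rfloor>, \<lfloor>t\<rfloor> + 1}"
proof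
  fix k :: int assume "k \<in> {k. tent_root (t - of_int k) \<noteq> 0}"
  then have "\<bar>t - of_int k\<bar> < 1" by (simp add: tent_root_nonzero)
  then show "k \<in> {\<lfloor>t\<rfloor>, \<lfloor>t\<rfloor> + 1}" by simp linarith
qed

lemma tent_root_sum:
  assumes K: "finite K" "{\<lfloor>t\<rfloor>, \<lfloor>t\<rfloor> + 1} \<subseteq> K"
  shows "(\<Sum>k\<in>K. (tent_root (t - of_int k))\<^sup>2) = 1"
proof -
  have "(\<Sum>k\<in>K. (tent_root (t - of_int k))\<^sup>2) = (\<Sum>k\<in>{\<lfloor>t\<rfloor>, \<lfloor>t\<rfloor> + 1}. (tent_root (t - of_int k))\<^sup>2)"
    using tent_root_support[of t] by (intro sum.mono_neutral_right K) auto
  also have "\<dots> = 1"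
    unfolding tent_root_sq by simp linarith
  finally show ?thesis .
qed

section \<open>The half plane model\<close>

definition cayley :: "complex \<Rightarrow> complex"
  where "cayley z = \<i> * (1 + z) / (1 - z)"

lemma cayley_diff_cnj:
  assumes "z \<noteq> 1" "w \<noteq> 1"
  shows "cayley z - cnj (cayley w) = 2 * \<i> * (1 - z * cnj w) / ((1 - z) * (1 - cnj w))"
proof -
  have "1 - z \<noteq> 0" "1 - cnj w \<noteq> 0" using assms by (auto simp: complex_eq_iff)
  then show ?thesis by (simp add: cayley_def divide_simps) (simp add: algebra_simps)
qed

lemma Im_cayley:
  assumes "norm z < 1"
  shows "Im (cayley z) = (1 - (norm z)\<^sup>2) / (norm (1 - z))\<^sup>2"
proof -
  have z: "z \<noteq> 1" using assms by auto
  have "complex_of_real (2 * Im (cayley z)) * \<i> = 2 * \<i> * (1 - z * cnj z) / ((1 - z) * cnj (1 - z))"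
    using cayley_diff_cnj[OF z z] complex_diff_cnj[of "cayley z"] by simp
  also have "\<dots> = complex_of_real (2 * ((1 - (norm z)\<^sup>2) / (norm (1 - z))\<^sup>2)) * \<i>"
    unfolding complex_norm_square[symmetric] by simp
  finally have "2 * Im (cayley z) = 2 * ((1 - (norm z)\<^sup>2) / (norm (1 - z))\<^sup>2)"
    by (simp only: mult_cancel_right of_real_eq_iff) simp
  then show ?thesis by (simp only: mult_cancel_left) simp
qed

lemma Im_cayley_pos:
  assumes "norm z < 1"
  shows "Im (cayley z) > 0"
proof -
  have "z \<noteq> 1" using assms by auto
  then show ?thesis unfolding Im_cayley[OF assms] using norm_less_one_sq_pos[OF assms] by simp
qed

text \<open>The half plane formula for cosh^2 of the hyperbolic distance, which is |p - cnj q|^2 /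
  (4 Im p Im q) for the image points p and q. All distance estimates for cells are read off from
  it.\<close>

lemma cosh2_cayley:
  assumes z: "norm z < 1" and w: "norm w < 1"
  shows "4 * Im (cayley z) * Im (cayley w) * cosh2 z w =
    (Re (cayley z) - Re (cayley w))\<^sup>2 + (Im (cayley z) + Im (cayley w))\<^sup>2"
proof -
  have 1: "z \<noteq> 1" "w \<noteq> 1" using z w by auto
  have "(Re (cayley z) - Re (cayley w))\<^sup>2 + (Im (cayley z) + Im (cayley w))\<^sup>2 = (norm (cayley z - cnj (cayley w)))\<^sup>2"
    by (simp add: cmod_power2)
  also have "\<dots> = (2 * norm (1 - z * cnj w) / (norm (1 - z) * norm (cnj (1 - w))))\<^sup>2"
    unfolding cayley_diff_cnj[OF 1] by (simp add: norm_mult norm_divide)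
  also have "\<dots> = 4 * Im (cayley z) * Im (cayley w) * cosh2 z w"
  proof -
    have "(2 * a / (b * c))\<^sup>2 = 4 * (p / b\<^sup>2) * (q / c\<^sup>2) * (a\<^sup>2 / (p * q))" if "p > 0" "q > 0" for a b c p q :: real
      using that by (simp add: power_mult_distrib power_divide)
    then show ?thesis
      unfolding Im_cayley[OF z] Im_cayley[OF w] cosh2_def complex_mod_cnj
      using norm_less_one_sq_pos[OF z] norm_less_one_sq_pos[OF w] by blast
  qed
  finally show ?thesis ..
qed

text \<open>Discarding part of the sum of squares in \<open>cosh2_cayley\<close> bounds first the
  ratio of heights and then the horizontal distance in units of the height.\<close>

lemma cosh2_cayley_bounds:
  assumes z: "norm z < 1" and w: "norm w < 1" and \<sigma>: "cosh2 z w \<le> \<sigma>"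
  shows "Im (cayley w) \<le> 4 * \<sigma> * Im (cayley z)"
    and "\<bar>Re (cayley z) - Re (cayley w)\<bar> \<le> 4 * \<sigma> * Im (cayley z)"
proof -
  define x y x' y' where "x = Re (cayley z)" and "y = Im (cayley z)" and "x' = Re (cayley w)" and "y' = Im (cayley w)"
  have y: "y > 0" "y' > 0" using Im_cayley_pos z w by (simp_all add: y_def y'_def)
  have \<sigma>0: "\<sigma> > 0" using cosh2_pos[OF z w] \<sigma> by linarith
  have "(x - x')\<^sup>2 + (y + y')\<^sup>2 = 4 * y * y' * cosh2 z w"
    using cosh2_cayley[OF z w] by (simp add: x_def y_def x'_def y'_def)
  also have "\<dots> \<le> 4 * y * y' * \<sigma>" using y \<sigma> by (intro mult_left_mono) auto
  finally have le: "(x - x')\<^sup>2 + (y + y')\<^sup>2 \<le> 4 * y * y' * \<sigma>" .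
  moreover have "y' * y' \<le> (y + y')\<^sup>2" using y by (simp add: power2_eq_square algebra_simps)
  moreover have "4 * y * y' * \<sigma> = (4 * \<sigma> * y) * y'" by simp
  ultimately have "y' * y' \<le> (4 * \<sigma> * y) * y'" using zero_le_power2[of "x - x'"] by linarith
  then show y': "Im (cayley w) \<le> 4 * \<sigma> * Im (cayley z)" using y by (simp add: y_def[symmetric] y'_def[symmetric])
  have "(x - x')\<^sup>2 \<le> (4 * \<sigma> * y) * y'" using le using zero_le_power2[of "y + y'"] \<open>4 * y * y' * \<sigma> = (4 * \<sigma> * y) * y'\<close> by linarith
  also have "\<dots> \<le> (4 * \<sigma> * y) * (4 * \<sigma> * y)"
    using y' y \<sigma>0 by (intro mult_left_mono) (auto simp: y_def y'_def)
  finally have "\<bar>x - x'\<bar>\<^sup>2 \<le> (4 * \<sigma> * y)\<^sup>2" by (simp add: power2_eq_square)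
  then have "\<bar>x - x'\<bar> \<le> 4 * \<sigma> * y" by (rule power2_le_imp_le) (use y \<sigma>0 in simp)
  then show "\<bar>Re (cayley z) - Re (cayley w)\<bar> \<le> 4 * \<sigma> * Im (cayley z)" by (simp add: x_def x'_def y_def)
qed

text \<open>Horizontal strips of hyperbolic width \<open>R\<close> in the half plane, each cut into pieces whose
  length is \<open>M\<close> in the units of the strip.  Every point meets at most four cells,
  however slowly the cell functions vary.\<close>

definition cell :: "real \<Rightarrow> real \<Rightarrow> int \<times> int \<Rightarrow> complex \<Rightarrow> real"
  where "cell R M q z = tent_root (ln (Im (cayley z)) / R - of_int (fst q)) *
    tent_root (Re (cayley z) / (M * exp (of_int (fst q) * R)) - of_int (snd q))"

lemma cell_bounds: "0 \<le> cell R M q z" "cell R M q z \<le> 1"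
  using tent_root_bounds by (auto simp: cell_def intro: mult_le_one)

lemma cell_measurable [measurable]: "cell R M q \<in> borel_measurable borel"
proof -
  have [measurable]: "cayley \<in> borel_measurable borel" unfolding cayley_def by measurable
  have [measurable]: "tent_root \<in> borel_measurable borel" unfolding tent_root_def by measurable
  show ?thesis unfolding cell_def by measurable
qed

text \<open>A height meets at most two strips, and in each strip the real part meets at most two
  pieces. Pieces of different strips have different lengths, hence the dependent product.\<close>

lemma cell_support_card:
  "finite {q. cell R M q z \<noteq> 0}" "card {q. cell R M q z \<noteq> 0} \<le> 4"
proof -
  define S where "S t = {\<lfloor>t\<rfloor>, \<lfloor>t\<rfloor> + 1}" for t :: real
  have S: "finite (S t)" "card (S t) = 2" for t by (simp_all add: S_def)
  let ?B = "SIGMA k:S (ln (Im (cayley z)) / R). S (Re (cayley z) / (M * exp (of_int k * R)))"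
  have sub: "{q. cell R M q z \<noteq> 0} \<subseteq> ?B"
  proof
    fix q assume "q \<in> {q. cell R M q z \<noteq> 0}"
    then have "fst q \<in> S (ln (Im (cayley z)) / R)" "snd q \<in> S (Re (cayley z) / (M * exp (of_int (fst q) * R)))"
      using subsetD[OF tent_root_support, of "fst q" "ln (Im (cayley z)) / R"]
        subsetD[OF tent_root_support, of "snd q" "Re (cayley z) / (M * exp (of_int (fst q) * R))"]
      by (simp_all add: cell_def S_def)
    then show "q \<in> ?B" by (cases q) simp
  qed
  have fin: "finite ?B" using S by auto
  have "card ?B = 4" by (subst card_SigmaI) (use S in auto)
  with sub fin show "finite {q. cell R M q z \<noteq> 0}" "card {q. cell R M q z \<noteq> 0} \<le> 4"
    using finite_subset card_mono[OF fin sub] by auto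
qed

lemma cell_sum:
  "\<exists>m0 :: nat. \<forall>m\<ge>m0. (\<Sum>q\<in>{- int m..int m} \<times> {- int m..int m}. (cell R M q z)\<^sup>2) = 1"
proof -
  define a where "a = ln (Im (cayley z)) / R"
  define b where "b k = Re (cayley z) / (M * exp (of_int k * R))" for k :: int
  define k where "k = \<lfloor>a\<rfloor>"
  \<comment> \<open>Large enough for the window to contain both strips and, in each, both pieces
    that may meet the point; from then on the sum is exactly 1.\<close>
  define m0 where "m0 = nat (\<bar>k\<bar> + 1) + nat (\<bar>\<lfloor>b k\<rfloor>\<bar> + 1) + nat (\<bar>\<lfloor>b (k + 1)\<rfloor>\<bar> + 1)"
  have "(\<Sum>q\<in>{- int m..int m} \<times> {- int m..int m}. (cell R M q z)\<^sup>2) = 1" if m: "m \<ge> m0" for m :: nat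
  proof -
    have K: "{\<lfloor>a\<rfloor>, \<lfloor>a\<rfloor> + 1} \<subseteq> {- int m..int m}" using m by (auto simp: m0_def k_def)
    have L: "{\<lfloor>b l\<rfloor>, \<lfloor>b l\<rfloor> + 1} \<subseteq> {- int m..int m}" if "l \<in> {k, k + 1}" for l
      using that m by (auto simp: m0_def)
    have "(\<Sum>q\<in>{- int m..int m} \<times> {- int m..int m}. (cell R M q z)\<^sup>2) =
        (\<Sum>l\<in>{- int m..int m}. (tent_root (a - of_int l))\<^sup>2 * (\<Sum>l'\<in>{- int m..int m}. (tent_root (b l - of_int l'))\<^sup>2))"
      unfolding sum.cartesian_product[symmetric] sum_distrib_left
      by (simp add: sum.cartesian_product split_beta cell_def power_mult_distrib a_def b_def)
    also have "\<dots> = (\<Sum>l\<in>{- int m..int m}. (tent_root (a - of_int l))\<^sup>2)"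
    proof (rule sum.cong)
      fix l assume "l \<in> {- int m..int m}"
      show "(tent_root (a - of_int l))\<^sup>2 * (\<Sum>l'\<in>{- int m..int m}. (tent_root (b l - of_int l'))\<^sup>2) = (tent_root (a - of_int l))\<^sup>2"
      proof (cases "l \<in> {k, k + 1}")
        case True
        then show ?thesis using tent_root_sum[OF _ L[OF True]] by simp
      next
        case False
        then have "tent_root (a - of_int l) = 0" using tent_root_support[of a] by (auto simp: k_def)
        then show ?thesis by simp
      qed
    qed simp
    also have "\<dots> = 1" by (rule tent_root_sum[OF _ K]) simp
    finally show ?thesis .
  qed
  then show ?thesis by blast
qed

lemma mobius_le_imp_cosh2_le:
  assumes u: "norm u < 1" and v: "norm v < 1" and \<rho>: "norm (mobius u v) \<le> \<rho>" "\<rho> < 1"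
  shows "cosh2 u v \<le> 1 / (1 - \<rho>\<^sup>2)"
proof -
  have "\<rho> \<ge> 0" using \<rho> norm_ge_zero order_trans by blast
  then have p: "1 - \<rho>\<^sup>2 > 0" using \<rho> by (simp add: abs_square_less_1)
  have "1 - \<rho>\<^sup>2 \<le> 1 - (norm (mobius u v))\<^sup>2" using \<rho> by (simp add: power_mono)
  also have "\<dots> = 1 / cosh2 u v" using inverse_cosh2[OF u v] by simp
  finally show ?thesis using p cosh2_pos[OF u v] by (simp add: field_simps)
qed

lemma cosh2_le_imp_mobius_le:
  assumes u: "norm u < 1" and v: "norm v < 1" and \<sigma>: "cosh2 u v \<le> \<sigma>" "\<sigma> \<ge> 1"
  shows "norm (mobius u v) \<le> sqrt (1 - 1 / \<sigma>)"
proof (rule real_le_rsqrt)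
  have "1 / \<sigma> \<le> 1 / cosh2 u v" using cosh2_pos[OF u v] \<sigma> by (intro divide_left_mono) auto
  then show "(norm (mobius u v))\<^sup>2 \<le> 1 - 1 / \<sigma>" unfolding inverse_cosh2[OF u v] by simp
qed

text \<open>R is chosen first, so that the possible change ln (4 \<sigma>) of the logarithmic height
  is small in units of R, and then M, so that horizontal moves at the top of a strip are small
  compared with a piece.\<close>

lemma cell_slow:
  assumes \<rho>: "0 \<le> \<rho>" "\<rho> < 1" and \<delta>: "\<delta> > 0"
  shows "\<exists>R M. R > 0 \<and> M > 0 \<and> (\<forall>q z w. norm z < 1 \<longrightarrow> norm w < 1 \<longrightarrow> norm (mobius z w) \<le> \<rho> \<longrightarrow>
    \<bar>cell R M q z - cell R M q w\<bar> \<le> \<delta>)"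
proof -
  define \<sigma> where "\<sigma> = 1 / (1 - \<rho>\<^sup>2)"
  have "0 < 1 - \<rho>\<^sup>2" "1 - \<rho>\<^sup>2 \<le> 1" using \<rho> by (simp_all add: abs_square_less_1)
  then have \<sigma>: "\<sigma> \<ge> 1" by (simp add: \<sigma>_def)
  then have ln\<sigma>: "ln (4 * \<sigma>) > 0" by simp
  \<comment> \<open>The choices make ln (4 \<sigma>) / R and 4 \<sigma> exp R / M both equal to
    (\<delta> / 2)^2; the square compensates for the square root in
    \<open>tent_root_diff\<close>.\<close>
  define R where "R = ln (4 * \<sigma>) * 4 / \<delta>\<^sup>2"
  define M where "M = 16 * \<sigma> * exp R / \<delta>\<^sup>2"
  have R: "R > 0" using ln\<sigma> \<delta> by (simp add: R_def)
  have M: "M > 0" using \<sigma> \<delta> by (simp add: M_def)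
  \<comment> \<open>The condition that z lies in the strip bounds its height by exp R times the unit
    exp (k R) of the strip. If neither point lies in it both cells vanish, and the remaining case is
    symmetric.\<close>
  have half: "\<bar>cell R M q z - cell R M q w\<bar> \<le> \<delta>"
    if z: "norm z < 1" and w: "norm w < 1" and c: "cosh2 z w \<le> \<sigma>"
      and nz: "tent_root (ln (Im (cayley z)) / R - of_int (fst q)) \<noteq> 0" for q z w
  proof -
    define y y' where "y = Im (cayley z)" and "y' = Im (cayley w)"
    define x x' where "x = Re (cayley z)" and "x' = Re (cayley w)"
    have y: "y > 0" "y' > 0" using Im_cayley_pos z w by (simp_all add: y_def y'_def)
    have "ln y' \<le> ln (4 * \<sigma> * y)" "ln y \<le> ln (4 * \<sigma> * y')"
      using cosh2_cayley_bounds(1)[OF z w c] cosh2_cayley_bounds(1)[OF w z, unfolded cosh2_commute[of w z], OF c] y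
      by (simp_all add: y_def y'_def)
    then have ln: "\<bar>ln y - ln y'\<bar> \<le> ln (4 * \<sigma>)" using y \<sigma> by (simp add: ln_mult)
    let ?k = "real_of_int (fst q)" and ?l = "real_of_int (snd q)"
    have 1: "\<bar>tent_root (ln y / R - ?k) - tent_root (ln y' / R - ?k)\<bar> \<le> \<delta> / 2"
    proof -
      have "\<bar>tent_root (ln y / R - ?k) - tent_root (ln y' / R - ?k)\<bar> \<le> sqrt \<bar>(ln y - ln y') / R\<bar>"
        using tent_root_diff[of "ln y / R - ?k" "ln y' / R - ?k"] by (simp add: diff_divide_distrib)
      also have "\<dots> \<le> sqrt ((\<delta> / 2)\<^sup>2)"
      proof (rule real_sqrt_le_mono)
        have "\<bar>(ln y - ln y') / R\<bar> \<le> ln (4 * \<sigma>) / R" using ln R by (simp add: divide_right_mono)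
        also have "\<dots> = (\<delta> / 2)\<^sup>2" using ln\<sigma> \<delta> by (simp add: R_def power_divide)
        finally show "\<bar>(ln y - ln y') / R\<bar> \<le> (\<delta> / 2)\<^sup>2" .
      qed
      finally show ?thesis using \<delta> by simp
    qed
    define N where "N = M * exp (?k * R)"
    have N: "N > 0" using M by (simp add: N_def)
    have 2: "\<bar>tent_root (x / N - ?l) - tent_root (x' / N - ?l)\<bar> \<le> \<delta> / 2"
    proof -
      have "\<bar>tent_root (x / N - ?l) - tent_root (x' / N - ?l)\<bar> \<le> sqrt \<bar>(x - x') / N\<bar>"
        using tent_root_diff[of "x / N - ?l" "x' / N - ?l"] by (simp add: diff_divide_distrib)
      also have "\<dots> \<le> sqrt ((\<delta> / 2)\<^sup>2)"
      proof (rule real_sqrt_le_mono)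
        have "ln y / R - ?k < 1" using nz by (simp add: tent_root_nonzero y_def)
        then have "ln y < (?k + 1) * R" using R by (simp add: field_simps)
        then have "y < exp ((?k + 1) * R)" using y by (metis exp_less_mono exp_ln)
        then have "y \<le> exp R * exp (?k * R)" unfolding distrib_right exp_add by (simp add: mult.commute)
        then have "4 * \<sigma> * y \<le> 4 * \<sigma> * (exp R * exp (?k * R))" using \<sigma> by (intro mult_left_mono) auto
        moreover have "\<bar>x - x'\<bar> \<le> 4 * \<sigma> * y"
          using cosh2_cayley_bounds(2)[OF z w c] by (simp add: x_def x'_def y_def)
        ultimately have "\<bar>x - x'\<bar> / N \<le> 4 * \<sigma> * (exp R * exp (?k * R)) / N" using N by (intro divide_right_mono) auto
        also have "\<dots> = (\<delta> / 2)\<^sup>2" using \<sigma> \<delta> by (simp add: N_def M_def power_divide)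
        finally show "\<bar>(x - x') / N\<bar> \<le> (\<delta> / 2)\<^sup>2" using N by simp
      qed
      finally show ?thesis using \<delta> by simp
    qed
    have mult: "\<bar>a * b - a' * b'\<bar> \<le> \<bar>a - a'\<bar> + \<bar>b - b'\<bar>" if "0 \<le> a'" "a' \<le> 1" "0 \<le> b" "b \<le> 1" for a b a' b' :: real
    proof -
      have "a * b - a' * b' = (a - a') * b + a' * (b - b')" by (simp add: algebra_simps)
      then have "\<bar>a * b - a' * b'\<bar> \<le> \<bar>a - a'\<bar> * b + a' * \<bar>b - b'\<bar>"
        using abs_triangle_ineq[of "(a - a') * b" "a' * (b - b')"] that by (simp add: abs_mult)
      also have "\<dots> \<le> \<bar>a - a'\<bar> + \<bar>b - b'\<bar>" using that by (intro add_mono mult_left_le mult_left_le_one_le) auto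
      finally show ?thesis .
    qed
    show ?thesis
      unfolding cell_def y_def[symmetric] y'_def[symmetric] x_def[symmetric] x'_def[symmetric] N_def[symmetric]
      using mult[of "tent_root (ln y' / R - ?k)" "tent_root (x / N - ?l)" "tent_root (ln y / R - ?k)" "tent_root (x' / N - ?l)"]
        1 2 tent_root_bounds by fastforce
  qed
  have "\<bar>cell R M q z - cell R M q w\<bar> \<le> \<delta>" if z: "norm z < 1" and w: "norm w < 1" and m: "norm (mobius z w) \<le> \<rho>" for q z w
  proof -
    have c: "cosh2 z w \<le> \<sigma>" unfolding \<sigma>_def by (rule mobius_le_imp_cosh2_le[OF z w m \<rho>(2)])
    show ?thesis
    proof (cases "tent_root (ln (Im (cayley z)) / R - of_int (fst q)) \<noteq> 0")
      case True
      then show ?thesis by (rule half[OF z w c])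
    next
      case zz: False
      show ?thesis
      proof (cases "tent_root (ln (Im (cayley w)) / R - of_int (fst q)) \<noteq> 0")
        case True
        from half[OF w z c[unfolded cosh2_commute[of z w]] this] show ?thesis by (simp add: abs_minus_commute)
      next
        case False
        then show ?thesis using zz \<delta> by (simp add: cell_def)
      qed
    qed
  qed
  then show ?thesis using R M by blast
qed

text \<open>In strip k heights are comparable to exp (k R) and a piece has length of order M exp (k
  R). The distance formula is invariant under scaling, so the bound depends on R and M but not on
  the cell.\<close>

lemma cell_diameter:
  assumes R: "R > 0" and M: "M > 0"
  shows "\<exists>r. 0 < r \<and> r < 1 \<and> (\<forall>q z w. norm z < 1 \<longrightarrow> norm w < 1 \<longrightarrow> cell R M q z \<noteq> 0 \<longrightarrow> cell R M q w \<noteq> 0 \<longrightarrow>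
    norm (mobius z w) \<le> r)"
proof -
  define \<sigma> where "\<sigma> = (M\<^sup>2 + 1) * exp R ^ 4"
  have "M\<^sup>2 + 1 > 1" "exp R ^ 4 > 1" using M one_less_power[of "exp R" 4] R by simp_all
  then have \<sigma>: "\<sigma> > 1" unfolding \<sigma>_def by (rule less_1_mult)
  have "cosh2 z w \<le> \<sigma>" if z: "norm z < 1" and w: "norm w < 1" and "cell R M q z \<noteq> 0" "cell R M q w \<noteq> 0" for q z w
  proof -
    let ?k = "real_of_int (fst q)" and ?l = "real_of_int (snd q)"
    define E where "E = exp (?k * R)"
    define N where "N = M * E"
    have E: "E > 0" by (simp add: E_def)
    have N: "N > 0" using M E by (simp add: N_def)
    define y y' where "y = Im (cayley z)" and "y' = Im (cayley w)"
    define x x' where "x = Re (cayley z)" and "x' = Re (cayley w)"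
    have yp: "y > 0" "y' > 0" using Im_cayley_pos z w by (simp_all add: y_def y'_def)
    have *: "\<bar>ln y / R - ?k\<bar> < 1" "\<bar>x / N - ?l\<bar> < 1" "\<bar>ln y' / R - ?k\<bar> < 1" "\<bar>x' / N - ?l\<bar> < 1"
      using that(3,4) by (auto simp: cell_def tent_root_nonzero y_def x_def y'_def x'_def N_def E_def)
    have bounds: "E \<le> exp R * t \<and> t \<le> exp R * E" if "t > 0" "\<bar>ln t / R - ?k\<bar> < 1" for t
    proof -
      have "-1 < ln t / R - ?k" "ln t / R - ?k < 1" using that(2) by auto
      then have "?k * R \<le> R + ln t" "ln t \<le> R + ?k * R" using R by (simp_all add: field_simps)
      then have "exp (?k * R) \<le> exp (R + ln t)" "exp (ln t) \<le> exp (R + ?k * R)" by simp_all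
      then show ?thesis using that(1) by (simp add: exp_add E_def)
    qed
    have yy: "E \<le> exp R * y" "y \<le> exp R * E" "E \<le> exp R * y'" "y' \<le> exp R * E"
      using bounds[OF yp(1) *(1)] bounds[OF yp(2) *(3)] by auto
    have "\<bar>x / N - x' / N\<bar> \<le> 2" using *(2,4) by linarith
    then have "\<bar>x - x'\<bar> \<le> 2 * N" using N by (simp add: diff_divide_distrib[symmetric] divide_le_eq)
    then have "(x - x')\<^sup>2 \<le> (2 * N)\<^sup>2" using power_mono[of "\<bar>x - x'\<bar>" "2 * N" 2] by simp
    moreover have "(y + y')\<^sup>2 \<le> (2 * (exp R * E))\<^sup>2" using yy yp by (intro power_mono) auto
    ultimately have "4 * y * y' * cosh2 z w \<le> (2 * N)\<^sup>2 + (2 * (exp R * E))\<^sup>2"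
      using cosh2_cayley[OF z w] by (simp add: x_def x'_def y_def y'_def)
    also have "\<dots> = 4 * (M\<^sup>2 + exp R ^ 2) * (E * E)" by (simp add: N_def power_mult_distrib power2_eq_square algebra_simps)
    also have "\<dots> \<le> 4 * (M\<^sup>2 + exp R ^ 2) * ((exp R * y) * (exp R * y'))"
      using yy E by (intro mult_left_mono mult_mono) auto
    also have "\<dots> = 4 * y * y' * ((M\<^sup>2 + exp R ^ 2) * exp R ^ 2)" by (simp add: power2_eq_square algebra_simps)
    finally have "cosh2 z w \<le> (M\<^sup>2 + exp R ^ 2) * exp R ^ 2" using yp by simp
    also have "\<dots> \<le> \<sigma>"
    proof -
      have e1: "1 \<le> exp R ^ 2" using R by (intro one_le_power) simp
      have "M\<^sup>2 * 1 \<le> M\<^sup>2 * exp R ^ 2" by (rule mult_left_mono[OF e1]) simp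
      then have "M\<^sup>2 + exp R ^ 2 \<le> (M\<^sup>2 + 1) * exp R ^ 2" by (simp add: distrib_right)
      then have "(M\<^sup>2 + exp R ^ 2) * exp R ^ 2 \<le> ((M\<^sup>2 + 1) * exp R ^ 2) * exp R ^ 2" by (intro mult_right_mono) auto
      also have "\<dots> = \<sigma>" by (simp add: \<sigma>_def mult.assoc flip: power_add)
      finally show ?thesis .
    qed
    finally show ?thesis .
  qed
  then have "norm (mobius z w) \<le> sqrt (1 - 1 / \<sigma>)"
    if "norm z < 1" "norm w < 1" "cell R M q z \<noteq> 0" "cell R M q w \<noteq> 0" for q z w
    using cosh2_le_imp_mobius_le[of z w \<sigma>] that \<sigma> by simp
  moreover have "0 < sqrt (1 - 1 / \<sigma>)" "sqrt (1 - 1 / \<sigma>) < 1" using \<sigma> by simp_all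
  ultimately show ?thesis by blast
qed

section \<open>Partitions of the polydisk and averaging over signs\<close>

definition poly_cell :: "real \<Rightarrow> real \<Rightarrow> ('n::finite \<Rightarrow> int \<times> int) \<Rightarrow> complex ^ 'n \<Rightarrow> real"
  where "poly_cell R M j z = (\<Prod>i\<in>UNIV. cell R M (j i) (z $ i))"

lemma poly_cell_bounds: "0 \<le> poly_cell R M j z" "poly_cell R M j z \<le> 1"
  unfolding poly_cell_def by (auto intro!: prod_nonneg prod_le_1 simp: cell_bounds)

lemma poly_cell_measurable [measurable]: "poly_cell R M j \<in> borel_measurable borel"
  unfolding poly_cell_def by measurable

lemma poly_cell_support_card:
  fixes z :: "complex ^ 'n::finite"
  shows "finite {j. poly_cell R M j z \<noteq> 0}" "card {j. poly_cell R M j z \<noteq> 0} \<le> 4 ^ CARD('n)"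
proof -
  let ?S = "\<lambda>i. {q. cell R M q (z $ i) \<noteq> 0}"
  have eq: "{j. poly_cell R M j z \<noteq> 0} = PiE UNIV ?S"
    by (auto simp: poly_cell_def PiE_UNIV_domain Pi_def)
  show "finite {j. poly_cell R M j z \<noteq> 0}"
    unfolding eq by (intro finite_PiE cell_support_card) simp
  have "card (PiE UNIV ?S) = (\<Prod>i\<in>UNIV. card (?S i))" by (intro card_PiE) simp
  also have "\<dots> \<le> (\<Prod>i\<in>(UNIV :: 'n set). 4)" by (intro prod_mono) (simp add: cell_support_card)
  also have "\<dots> = 4 ^ CARD('n)" by (rule prod_constant)
  finally show "card {j. poly_cell R M j z \<noteq> 0} \<le> 4 ^ CARD('n)" unfolding eq .
qed

text \<open>Over a product window the sum of products factorizes into sums in single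
  coordinates.\<close>

lemma poly_cell_sum:
  fixes z :: "complex ^ 'n::finite"
  shows "\<exists>m0 :: nat. \<forall>m\<ge>m0. (\<Sum>j\<in>PiE UNIV (\<lambda>_. {- int m..int m} \<times> {- int m..int m}). (poly_cell R M j z)\<^sup>2) = 1"
proof -
  have "\<forall>i. \<exists>m0 :: nat. \<forall>m\<ge>m0. (\<Sum>q\<in>{- int m..int m} \<times> {- int m..int m}. (cell R M q (z $ i))\<^sup>2) = 1"
    by (intro allI cell_sum)
  from choice[OF this] obtain m0 :: "'n \<Rightarrow> nat" where m0: "\<And>i m. m \<ge> m0 i \<Longrightarrow>
      (\<Sum>q\<in>{- int m..int m} \<times> {- int m..int m}. (cell R M q (z $ i))\<^sup>2) = 1"
    by blast
  have "(\<Sum>j\<in>PiE UNIV (\<lambda>_. {- int m..int m} \<times> {- int m..int m}). (poly_cell R M j z)\<^sup>2) = 1"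
    if m: "m \<ge> Max (range m0)" for m
  proof -
    have mi: "m \<ge> m0 i" for i using m by (meson Max_ge finite finite_imageI order_trans rangeI)
    have "(\<Sum>j\<in>PiE UNIV (\<lambda>_. {- int m..int m} \<times> {- int m..int m}). (poly_cell R M j z)\<^sup>2) =
        (\<Prod>i\<in>UNIV. \<Sum>q\<in>{- int m..int m} \<times> {- int m..int m}. (cell R M q (z $ i))\<^sup>2)"
      unfolding poly_cell_def prod_power_distrib by (rule prod_sum_PiE[symmetric]) auto
    then show ?thesis by (simp add: m0[OF mi])
  qed
  then show ?thesis by blast
qed

text \<open>The windows increase with m, so no partial sum exceeds the final value 1.\<close>

lemma poly_cell_sum_le:
  fixes z :: "complex ^ 'n::finite"
  shows "(\<Sum>j\<in>PiE UNIV (\<lambda>_. {- int m..int m} \<times> {- int m..int m}). (poly_cell R M j z)\<^sup>2) \<le> 1"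
proof -
  let ?J = "\<lambda>m :: nat. PiE (UNIV :: 'n set) (\<lambda>_. {- int m..int m} \<times> {- int m..int m})"
  obtain m0 where m0: "\<And>m. m \<ge> m0 \<Longrightarrow> (\<Sum>j\<in>?J m. (poly_cell R M j z)\<^sup>2) = 1"
    using poly_cell_sum[of R M z] by blast
  have "(\<Sum>j\<in>?J m. (poly_cell R M j z)\<^sup>2) \<le> (\<Sum>j\<in>?J (m + m0). (poly_cell R M j z)\<^sup>2)"
    by (intro sum_mono2 PiE_mono finite_PiE) auto
  then show ?thesis using m0[of "m + m0"] by simp
qed

text \<open>At most N = 4 ^ n cells are nonzero at a point, so after division by N all sums with
  coefficients in [-1, 1] are symbols bounded by 1. The price is the constant 1 / N^2 for the sum of
  squares. Finite windows \<open>J m\<close> stand in for the infinite partition.\<close>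

lemma slow_partition:
  assumes \<rho>: "0 \<le> \<rho>" "\<rho> < 1"
  shows "\<exists>(\<phi> :: ('n \<Rightarrow> int \<times> int) \<Rightarrow> complex ^ 'n::finite \<Rightarrow> real) (J :: nat \<Rightarrow> ('n \<Rightarrow> int \<times> int) set) r.
    (\<forall>m. finite (J m)) \<and> 0 < r \<and> r < 1 \<and>
    (\<forall>F e. finite F \<longrightarrow> (\<forall>j. \<bar>e j\<bar> \<le> 1) \<longrightarrow> slow_symbol \<rho> (\<lambda>z. \<Sum>j\<in>F. e j * \<phi> j z)) \<and>
    (\<forall>z m. (\<Sum>j\<in>J m. (\<phi> j z)\<^sup>2) \<le> 1 / (4 ^ CARD('n))\<^sup>2) \<and> (\<forall>z. \<exists>m0. \<forall>m\<ge>m0. (\<Sum>j\<in>J m. (\<phi> j z)\<^sup>2) = 1 / (4 ^ CARD('n))\<^sup>2) \<and>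
    (\<forall>j. \<forall>z\<in>polydisk. \<forall>w\<in>polydisk. \<phi> j z \<noteq> 0 \<longrightarrow> \<phi> j w \<noteq> 0 \<longrightarrow> (\<forall>i. norm (mobius (z $ i) (w $ i)) \<le> r))"
proof -
  \<comment> \<open>At most 2 N cells are nonzero at one of two points, and each changes by at most
    n \<delta> / N, so a sum changes by at most 2 n \<delta> = 1 - \<rho>.\<close>
  define \<delta> where "\<delta> = (1 - \<rho>) / (2 * CARD('n))"
  have \<delta>: "\<delta> > 0" using \<rho> by (simp add: \<delta>_def)
  obtain R M where R: "R > 0" and M: "M > 0" and slow: "\<And>q z w. norm z < 1 \<Longrightarrow> norm w < 1 \<Longrightarrow> norm (mobius z w) \<le> \<rho> \<Longrightarrow>
      \<bar>cell R M q z - cell R M q w\<bar> \<le> \<delta>"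
    using cell_slow[OF \<rho> \<delta>] by blast
  obtain r where r: "0 < r" "r < 1" "\<And>q z w. norm z < 1 \<Longrightarrow> norm w < 1 \<Longrightarrow> cell R M q z \<noteq> 0 \<Longrightarrow> cell R M q w \<noteq> 0 \<Longrightarrow>
      norm (mobius z w) \<le> r"
    using cell_diameter[OF R M] by blast
  define N where "N = (4 :: real) ^ CARD('n)"
  have N: "N > 0" by (simp add: N_def)
  define \<phi> where "\<phi> j z = poly_cell R M j z / N" for j and z :: "complex ^ 'n"
  define J where "J m = PiE (UNIV :: 'n set) (\<lambda>_. {- int m..int m} \<times> {- int m..int m})" for m :: nat
  define S where "S z = {j. poly_cell R M j z \<noteq> 0}" for z :: "complex ^ 'n"
  have S: "finite (S z)" "real (card (S z)) \<le> N" for z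
    using poly_cell_support_card[of R M z] by (simp_all add: S_def N_def flip: of_nat_le_iff)
  have zero: "\<phi> j z = 0" if "j \<notin> S z" for j z using that by (simp add: S_def \<phi>_def)
  have \<phi>0: "0 \<le> \<phi> j z" "\<phi> j z \<le> 1 / N" for j z using poly_cell_bounds[of R M j z] N by (simp_all add: \<phi>_def divide_right_mono)
  have 1: "slow_symbol \<rho> (\<lambda>z. \<Sum>j\<in>F. e j * \<phi> j z)" if F: "finite F" and e: "\<And>j. \<bar>e j\<bar> \<le> 1" for F e
    unfolding slow_symbol_def unit_symbol_def
  proof (intro conjI ballI allI impI)
    show "(\<lambda>z. \<Sum>j\<in>F. e j * \<phi> j z) \<in> borel_measurable borel" unfolding \<phi>_def by measurable
    show "\<bar>\<Sum>j\<in>F. e j * \<phi> j z\<bar> \<le> 1" for z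
    proof -
      have "\<bar>\<Sum>j\<in>F. e j * \<phi> j z\<bar> \<le> (\<Sum>j\<in>F. \<bar>e j * \<phi> j z\<bar>)" by (rule sum_abs)
      also have "\<dots> \<le> (\<Sum>j\<in>F. \<phi> j z)"
        using e \<phi>0 by (intro sum_mono) (simp add: abs_mult mult_left_le_one_le)
      also have "\<dots> = (\<Sum>j\<in>F \<inter> S z. \<phi> j z)" by (intro sum.mono_neutral_right F) (auto simp: zero)
      also have "\<dots> \<le> (\<Sum>j\<in>S z. 1 / N)" by (rule order_trans[OF sum_mono sum_mono2]) (use \<phi>0 N S in auto)
      also have "\<dots> \<le> 1" using S(2)[of z] N by simp
      finally show ?thesis .
    qed
    fix z w :: "complex ^ 'n" assume zw: "z \<in> polydisk" "w \<in> polydisk"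
      and near: "\<forall>i. norm (mobius (z $ i) (w $ i)) \<le> \<rho>"
    have diff: "\<bar>\<phi> j z - \<phi> j w\<bar> \<le> CARD('n) * \<delta> / N" for j
    proof -
      have "\<bar>poly_cell R M j z - poly_cell R M j w\<bar> \<le> (\<Sum>i\<in>UNIV. \<bar>cell R M (j i) (z $ i) - cell R M (j i) (w $ i)\<bar>)"
        using norm_prod_diff[of UNIV "\<lambda>i. cell R M (j i) (z $ i)" "\<lambda>i. cell R M (j i) (w $ i)"] cell_bounds
        by (simp add: poly_cell_def)
      also have "\<dots> \<le> (\<Sum>i\<in>(UNIV :: 'n set). \<delta>)" using zw near by (intro sum_mono slow) (auto simp: polydisk_def)
      finally show ?thesis using N by (simp add: \<phi>_def diff_divide_distrib[symmetric] divide_right_mono)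
    qed
    have "\<bar>(\<Sum>j\<in>F. e j * \<phi> j z) - (\<Sum>j\<in>F. e j * \<phi> j w)\<bar> = \<bar>\<Sum>j\<in>F. e j * (\<phi> j z - \<phi> j w)\<bar>"
      by (simp add: sum_subtractf[symmetric] right_diff_distrib)
    also have "\<dots> \<le> (\<Sum>j\<in>F. \<bar>e j * (\<phi> j z - \<phi> j w)\<bar>)" by (rule sum_abs)
    also have "\<dots> \<le> (\<Sum>j\<in>F. \<bar>\<phi> j z - \<phi> j w\<bar>)"
      using e by (intro sum_mono) (simp add: abs_mult mult_left_le_one_le)
    also have "\<dots> = (\<Sum>j\<in>F \<inter> (S z \<union> S w). \<bar>\<phi> j z - \<phi> j w\<bar>)" by (intro sum.mono_neutral_right F) (auto simp: zero)
    also have "\<dots> \<le> (\<Sum>j\<in>S z \<union> S w. CARD('n) * \<delta> / N)"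
      by (rule order_trans[OF sum_mono sum_mono2]) (use diff \<delta> N S in auto)
    also have "\<dots> = real (card (S z \<union> S w)) * (CARD('n) * \<delta> / N)" by simp
    also have "\<dots> \<le> (2 * N) * (CARD('n) * \<delta> / N)"
    proof (rule mult_right_mono)
      have "real (card (S z \<union> S w)) \<le> real (card (S z)) + real (card (S w))"
        using card_Un_le[of "S z" "S w"] by linarith
      then show "real (card (S z \<union> S w)) \<le> 2 * N" using S(2)[of z] S(2)[of w] by linarith
    qed (use \<delta> N in simp)
    also have "\<dots> = 1 - \<rho>" using N by (simp add: \<delta>_def)
    finally show "\<bar>(\<Sum>j\<in>F. e j * \<phi> j z) - (\<Sum>j\<in>F. e j * \<phi> j w)\<bar> \<le> 1 - \<rho>" .
  qed
  have sum: "(\<Sum>j\<in>J m. (\<phi> j z)\<^sup>2) = (\<Sum>j\<in>J m. (poly_cell R M j z)\<^sup>2) / N\<^sup>2" for m z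
    by (simp add: \<phi>_def power_divide sum_divide_distrib)
  have 2: "(\<Sum>j\<in>J m. (\<phi> j z)\<^sup>2) \<le> 1 / N\<^sup>2" for z m
    unfolding sum unfolding J_def by (intro divide_right_mono poly_cell_sum_le) simp
  have 3: "\<exists>m0. \<forall>m\<ge>m0. (\<Sum>j\<in>J m. (\<phi> j z)\<^sup>2) = 1 / N\<^sup>2" for z
    unfolding sum unfolding J_def using poly_cell_sum[of R M z] by auto
  have 4: "norm (mobius (z $ i) (w $ i)) \<le> r" if "z \<in> polydisk" "w \<in> polydisk" "\<phi> j z \<noteq> 0" "\<phi> j w \<noteq> 0" for j z w i
    using that by (intro r(3)[of _ _ "j i"]) (auto simp: \<phi>_def poly_cell_def polydisk_def)
  have "\<forall>m. finite (J m)" unfolding J_def by (intro allI finite_PiE) auto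
  then show ?thesis
    unfolding N_def[symmetric] by (intro exI[of _ \<phi>] exI[of _ J] exI[of _ r]) (use 1 2 3 4 r in auto)
qed

text \<open>Averaging over the two signs of one index a removes the terms pairing a with the other
  indices and keeps D a a. The constant c varies in the induction to collect these diagonal
  terms.\<close>

lemma sign_average:
  fixes D :: "'j \<Rightarrow> 'j \<Rightarrow> 'a::real_normed_vector"
  assumes "finite J" and "\<And>e. (\<And>j. \<bar>e j\<bar> = (1::real)) \<Longrightarrow> norm (c + (\<Sum>i\<in>J. \<Sum>j\<in>J. (e i * e j) *\<^sub>R D i j)) \<le> B"
  shows "norm (c + (\<Sum>j\<in>J. D j j)) \<le> B"
  using assms
proof (induction J arbitrary: c rule: finite_induct)
  case empty
  from empty[of "\<lambda>_. 1"] show ?case by simp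
next
  case (insert a J)
  have "norm ((c + D a a) + (\<Sum>i\<in>J. \<Sum>j\<in>J. (e i * e j) *\<^sub>R D i j)) \<le> B"
    if e: "\<And>j. \<bar>e j\<bar> = (1::real)" for e
  proof -
    define X where "X = (\<Sum>j\<in>J. e j *\<^sub>R D a j) + (\<Sum>i\<in>J. e i *\<^sub>R D i a)"
    define Y where "Y = (c + D a a) + (\<Sum>i\<in>J. \<Sum>j\<in>J. (e i * e j) *\<^sub>R D i j)"
    have *: "norm (Y + s *\<^sub>R X) \<le> B" if s: "\<bar>s\<bar> = 1" for s :: real
    proof -
      have ne: "j \<noteq> a" if "j \<in> J" for j using that insert.hyps by auto
      have ss: "s * s = 1" using s by (metis abs_mult_self_eq mult_1)
      have upd: "(e(a := s)) j = e j" if "j \<in> J" for j using ne[OF that] by (rule fun_upd_other)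
      have inner: "(\<Sum>j\<in>insert a J. (x * (e(a := s)) j) *\<^sub>R D i j) = (x * s) *\<^sub>R D i a + (\<Sum>j\<in>J. (x * e j) *\<^sub>R D i j)" for i x
      proof -
        have "(\<Sum>j\<in>J. (x * (e(a := s)) j) *\<^sub>R D i j) = (\<Sum>j\<in>J. (x * e j) *\<^sub>R D i j)"
          by (rule sum.cong[OF refl]) (simp only: upd)
        then show ?thesis unfolding sum.insert[OF insert.hyps] fun_upd_same by (simp only:)
      qed
      have "(\<Sum>i\<in>J. ((e(a := s)) i * s) *\<^sub>R D i a + (\<Sum>j\<in>J. ((e(a := s)) i * e j) *\<^sub>R D i j)) =
          (\<Sum>i\<in>J. (e i * s) *\<^sub>R D i a + (\<Sum>j\<in>J. (e i * e j) *\<^sub>R D i j))"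
        by (rule sum.cong[OF refl]) (simp only: upd)
      then have "(\<Sum>i\<in>insert a J. \<Sum>j\<in>insert a J. ((e(a := s)) i * (e(a := s)) j) *\<^sub>R D i j) =
          ((s * s) *\<^sub>R D a a + (\<Sum>j\<in>J. (s * e j) *\<^sub>R D a j)) +
          (\<Sum>i\<in>J. (e i * s) *\<^sub>R D i a + (\<Sum>j\<in>J. (e i * e j) *\<^sub>R D i j))"
        unfolding inner sum.insert[OF insert.hyps] fun_upd_same by (simp only:)
      also have "\<dots> = D a a + s *\<^sub>R X + (\<Sum>i\<in>J. \<Sum>j\<in>J. (e i * e j) *\<^sub>R D i j)"
        by (simp add: ss X_def sum.distrib scaleR_sum_right scaleR_add_right mult.commute)
      finally have "c + (\<Sum>i\<in>insert a J. \<Sum>j\<in>insert a J. ((e(a := s)) i * (e(a := s)) j) *\<^sub>R D i j) = Y + s *\<^sub>R X"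
        by (simp add: Y_def add_ac)
      moreover have "norm (c + (\<Sum>i\<in>insert a J. \<Sum>j\<in>insert a J. ((e(a := s)) i * (e(a := s)) j) *\<^sub>R D i j)) \<le> B"
        using s e by (intro insert.prems) auto
      ultimately show ?thesis by simp
    qed
    \<comment> \<open>X collects the terms linear in the sign of a, so the mean of the two choices
      is Y.\<close>
    have "(Y + X) + (Y - X) = 2 *\<^sub>R Y" by (simp add: scaleR_2)
    then have "2 * norm Y = norm ((Y + X) + (Y - X))" by simp
    also have "\<dots> \<le> norm (Y + X) + norm (Y - X)" by (rule norm_triangle_ineq)
    finally show ?thesis using *[of 1] *[of "-1"] by (simp add: Y_def)
  qed
  from insert.IH[OF this] show ?case using insert.hyps by (simp add: add.assoc)
qed

section \<open>Localization and compactness\<close>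

text \<open>Write \<phi> f and \<phi> g as Toeplitz part plus defect. The mixed pairings vanish by
  orthogonality, so the error is a pairing of two defects, each of them small for slow
  symbols.\<close>

lemma toeplitz_quadratic:
  fixes f g :: "'n::finite bergman"
  assumes \<phi>: "unit_symbol \<phi>"
  shows "(\<integral>w. of_real ((\<phi> w)\<^sup>2) * (bergman_fun f w * cnj (bergman_fun g w)) \<partial>dv) - bergman_inner (toeplitz \<phi> f) (toeplitz \<phi> g) =
    (\<integral>w. toeplitz_defect \<phi> f w * cnj (toeplitz_defect \<phi> g w) \<partial>dv)"
proof -
  let ?d = "\<lambda>f. toeplitz_defect \<phi> f" and ?t = "\<lambda>f. bergman_fun (toeplitz \<phi> f)"
  note [measurable] = toeplitz_defect_measurable[OF \<phi>]
  have 1: "integrable dv (\<lambda>w. ?d f w * cnj (?d g w))"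
    by (rule square_integrable_inner(1)) (auto intro: toeplitz_defect_square_integrable[OF \<phi>])
  have 2: "integrable dv (\<lambda>w. ?d f w * cnj (?t g w))"
    by (rule square_integrable_inner(1)) (auto intro: toeplitz_defect_square_integrable[OF \<phi>] bergman_fun_square_integrable)
  have 3: "integrable dv (\<lambda>w. ?t f w * cnj (?d g w))"
    by (rule square_integrable_inner(1)) (auto intro: toeplitz_defect_square_integrable[OF \<phi>] bergman_fun_square_integrable)
  have 4: "integrable dv (\<lambda>w. ?t f w * cnj (?t g w))"
    by (rule square_integrable_inner(1)) (auto intro: bergman_fun_square_integrable)
  have "(\<integral>w. ?t f w * cnj (?d g w) \<partial>dv) = cnj (\<integral>w. ?d g w * cnj (?t f w) \<partial>dv)"
    by (subst Bochner_Integration.integral_cnj[symmetric]) (simp add: mult.commute)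
  then have zero: "(\<integral>w. ?t f w * cnj (?d g w) \<partial>dv) = 0" by (simp add: toeplitz_defect_orthogonal[OF \<phi>])
  have "of_real ((\<phi> w)\<^sup>2) * (bergman_fun f w * cnj (bergman_fun g w)) =
      ?d f w * cnj (?d g w) + ?d f w * cnj (?t g w) + (?t f w * cnj (?d g w) + ?t f w * cnj (?t g w))" for w
    by (simp add: toeplitz_defect_def power2_eq_square algebra_simps)
  then have "(\<integral>w. of_real ((\<phi> w)\<^sup>2) * (bergman_fun f w * cnj (bergman_fun g w)) \<partial>dv) =
      (\<integral>w. ?d f w * cnj (?d g w) \<partial>dv) + (\<integral>w. ?d f w * cnj (?t g w) \<partial>dv) +
      ((\<integral>w. ?t f w * cnj (?d g w) \<partial>dv) + (\<integral>w. ?t f w * cnj (?t g w) \<partial>dv))"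
    using 1 2 3 4 by simp
  then show ?thesis by (simp add: zero toeplitz_defect_orthogonal[OF \<phi>] bergman_inner_def)
qed

text \<open>Two approximations: the square of \<psi> in the pairing is replaced by a Toeplitz
  operator on each side at the cost of two defects, and A is then commuted past the left one. Both
  errors are small uniformly in \<psi>, which allows signed sums to be inserted.\<close>

lemma slowly_commuting_quadratic:
  fixes A :: "'n::finite bergman_op"
  assumes A: "A \<in> slowly_commuting" and \<epsilon>: "\<epsilon> > 0"
  shows "\<exists>\<rho>. 1 / 2 \<le> \<rho> \<and> \<rho> < 1 \<and> (\<forall>\<psi> h g. slow_symbol \<rho> \<psi> \<longrightarrow>
    norm ((\<integral>w. of_real ((\<psi> w)\<^sup>2) * (bergman_fun (A h) w * cnj (bergman_fun g w)) \<partial>dv) -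
      bergman_inner (A (toeplitz \<psi> h)) (toeplitz \<psi> g)) \<le> \<epsilon> * norm h * norm g)"
proof -
  \<comment> \<open>The product of the two defect bounds gives \<eta> times the norm of A, which has
    to be at most \<epsilon> / 2.\<close>
  define \<eta> where "\<eta> = \<epsilon> / (2 * (norm A + 1))"
  have "norm A + 1 > 0" using norm_ge_zero[of A] by linarith
  then have \<eta>: "\<eta> > 0" "\<eta> * norm A \<le> \<epsilon> / 2" using \<epsilon> by (simp_all add: \<eta>_def field_simps)
  obtain \<rho>1 where \<rho>1: "1 / 2 \<le> \<rho>1" "\<rho>1 < 1" and comm: "\<And>\<phi>. slow_symbol \<rho>1 \<phi> \<Longrightarrow> norm (toeplitz_commutator A \<phi>) \<le> \<epsilon> / 2"
    using slowly_commutingD[OF A, of "\<epsilon> / 2"] \<epsilon> by (metis half_gt_zero)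
  obtain \<rho>2 where \<rho>2: "1 / 2 \<le> \<rho>2" "\<rho>2 < 1" and defect: "\<And>\<phi> h :: 'n bergman. slow_symbol \<rho>2 \<phi> \<Longrightarrow>
      (\<integral>w. (norm (toeplitz_defect \<phi> h w))\<^sup>2 \<partial>dv) \<le> \<eta> * (norm h)\<^sup>2"
    using toeplitz_defect_small[OF \<eta>(1), where 'n = 'n] by blast
  define \<rho> where "\<rho> = max \<rho>1 \<rho>2"
  have "norm ((\<integral>w. of_real ((\<psi> w)\<^sup>2) * (bergman_fun (A h) w * cnj (bergman_fun g w)) \<partial>dv) -
      bergman_inner (A (toeplitz \<psi> h)) (toeplitz \<psi> g)) \<le> \<epsilon> * norm h * norm g"
    if slow: "slow_symbol \<rho> \<psi>" for \<psi> h g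
  proof -
    have s1: "slow_symbol \<rho>1 \<psi>" and s2: "slow_symbol \<rho>2 \<psi>"
      using slow_symbol_mono[OF _ slow] by (auto simp: \<rho>_def)
    have u: "unit_symbol \<psi>" by (rule slow_symbol_unit[OF slow])
    note [measurable] = toeplitz_defect_measurable[OF u]
    have "A (toeplitz \<psi> h) = toeplitz \<psi> (A h) + toeplitz_commutator A \<psi> h"
      by (simp add: toeplitz_commutator_def blinfun.diff_left)
    then have eq: "(\<integral>w. of_real ((\<psi> w)\<^sup>2) * (bergman_fun (A h) w * cnj (bergman_fun g w)) \<partial>dv) -
        bergman_inner (A (toeplitz \<psi> h)) (toeplitz \<psi> g) =
        (\<integral>w. toeplitz_defect \<psi> (A h) w * cnj (toeplitz_defect \<psi> g w) \<partial>dv) -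
        bergman_inner (toeplitz_commutator A \<psi> h) (toeplitz \<psi> g)"
      using toeplitz_quadratic[OF u, of "A h" g] by (simp add: bergman_inner_add_left algebra_simps)
    have "norm (\<integral>w. toeplitz_defect \<psi> (A h) w * cnj (toeplitz_defect \<psi> g w) \<partial>dv) \<le>
        sqrt (\<integral>w. (norm (toeplitz_defect \<psi> (A h) w))\<^sup>2 \<partial>dv) * sqrt (\<integral>w. (norm (toeplitz_defect \<psi> g w))\<^sup>2 \<partial>dv)"
      by (rule square_integrable_inner(2)) (auto intro: toeplitz_defect_square_integrable[OF u])
    also have "\<dots> \<le> sqrt (\<eta> * (norm (A h))\<^sup>2) * sqrt (\<eta> * (norm g)\<^sup>2)"
      by (intro mult_mono real_sqrt_le_mono defect s2) (use \<eta>(1) in simp_all)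
    also have "\<dots> = \<eta> * (norm (A h) * norm g)"
      using \<eta> by (simp add: real_sqrt_mult)
    also have "\<dots> \<le> \<eta> * ((norm A * norm h) * norm g)"
      using \<eta> norm_blinfun[of A h] by (intro mult_left_mono mult_right_mono) auto
    also have "\<dots> = (\<eta> * norm A) * (norm h * norm g)" by simp
    also have "\<dots> \<le> \<epsilon> / 2 * (norm h * norm g)" using \<eta> by (intro mult_right_mono) auto
    finally have 1: "norm (\<integral>w. toeplitz_defect \<psi> (A h) w * cnj (toeplitz_defect \<psi> g w) \<partial>dv) \<le> \<epsilon> / 2 * (norm h * norm g)" .
    have "norm (bergman_inner (toeplitz_commutator A \<psi> h) (toeplitz \<psi> g)) \<le> norm (toeplitz_commutator A \<psi> h) * norm (toeplitz \<psi> g)"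
      by (rule norm_bergman_inner_le)
    also have "\<dots> \<le> (norm (toeplitz_commutator A \<psi>) * norm h) * norm g"
      using norm_blinfun norm_toeplitz_apply_le[OF u] by (intro mult_mono) auto
    also have "\<dots> \<le> (\<epsilon> / 2 * norm h) * norm g" using comm[OF s1] by (intro mult_right_mono) auto
    finally have 2: "norm (bergman_inner (toeplitz_commutator A \<psi> h) (toeplitz \<psi> g)) \<le> \<epsilon> / 2 * (norm h * norm g)" by simp
    show ?thesis unfolding eq
      by (rule order_trans[OF norm_triangle_ineq4]) (use 1 2 in \<open>simp add: mult.assoc\<close>)
  qed
  moreover have "1 / 2 \<le> \<rho>" "\<rho> < 1" using \<rho>1 \<rho>2 by (auto simp: \<rho>_def)
  ultimately show ?thesis by blast
qed

lemma toeplitz_sum: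
  fixes h :: "'n::finite bergman"
  assumes F: "finite F" and \<phi>: "\<And>j. j \<in> F \<Longrightarrow> unit_symbol (\<phi> j)" and u: "unit_symbol (\<lambda>z. \<Sum>j\<in>F. e j * \<phi> j z)"
  shows "toeplitz (\<lambda>z. \<Sum>j\<in>F. e j * \<phi> j z) h = (\<Sum>j\<in>F. e j *\<^sub>R toeplitz (\<phi> j) h)"
proof (rule bergman_eqI)
  fix g :: "'n bergman"
  have "bergman_inner (toeplitz (\<lambda>z. \<Sum>j\<in>F. e j * \<phi> j z) h) g =
      (\<integral>w. (\<Sum>j\<in>F. of_real (e j) * ((of_real (\<phi> j w) * bergman_fun h w) * cnj (bergman_fun g w))) \<partial>dv)"
    unfolding toeplitz_inner[OF u] toeplitz_form_def by (simp add: sum_distrib_right mult.assoc)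
  also have "\<dots> = (\<Sum>j\<in>F. of_real (e j) * toeplitz_form (\<phi> j) h g)"
    unfolding toeplitz_form_def
    by (subst Bochner_Integration.integral_sum) (use toeplitz_form_integrable[OF \<phi>] in auto)
  also have "\<dots> = bergman_inner (\<Sum>j\<in>F. e j *\<^sub>R toeplitz (\<phi> j) h) g"
    by (simp add: bergman_inner_sum_left scaleR_bergman_def bergman_inner_scale_left toeplitz_inner[OF \<phi>] cong: sum.cong)
  finally have "bergman_inner (toeplitz (\<lambda>z. \<Sum>j\<in>F. e j * \<phi> j z) h) g = bergman_inner (\<Sum>j\<in>F. e j *\<^sub>R toeplitz (\<phi> j) h) g" .
  then show "bergman_inner g (toeplitz (\<lambda>z. \<Sum>j\<in>F. e j * \<phi> j z) h) = bergman_inner g (\<Sum>j\<in>F. e j *\<^sub>R toeplitz (\<phi> j) h)"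
    by (simp add: bergman_inner_commute[of _ g])
qed

text \<open>Averaging over all choices of signs removes the off-diagonal terms of the quadratic error.\<close>

lemma partition_quadratic:
  fixes A :: "'n::finite bergman_op" and \<phi> :: "'j \<Rightarrow> complex ^ 'n \<Rightarrow> real"
  assumes F: "finite F"
    and slow: "\<And>F e. finite F \<Longrightarrow> (\<And>j. \<bar>e j\<bar> \<le> 1) \<Longrightarrow> slow_symbol \<rho> (\<lambda>z. \<Sum>j\<in>F. e j * \<phi> j z)"
    and quad: "\<And>\<psi>. slow_symbol \<rho> \<psi> \<Longrightarrow>
      norm ((\<integral>w. of_real ((\<psi> w)\<^sup>2) * (bergman_fun (A h) w * cnj (bergman_fun g w)) \<partial>dv) -
        bergman_inner (A (toeplitz \<psi> h)) (toeplitz \<psi> g)) \<le> B"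
  shows "norm ((\<integral>w. of_real (\<Sum>j\<in>F. (\<phi> j w)\<^sup>2) * (bergman_fun (A h) w * cnj (bergman_fun g w)) \<partial>dv) -
      (\<Sum>j\<in>F. bergman_inner (A (toeplitz (\<phi> j) h)) (toeplitz (\<phi> j) g))) \<le> B"
proof -
  let ?u = "\<lambda>w. bergman_fun (A h) w * cnj (bergman_fun g w)"
  define D where "D i j = (\<integral>w. of_real (\<phi> i w * \<phi> j w) * ?u w \<partial>dv) - bergman_inner (A (toeplitz (\<phi> i) h)) (toeplitz (\<phi> j) g)" for i j
  have unit: "unit_symbol (\<phi> j)" for j
    using slow_symbol_unit[OF slow[of "{j}" "\<lambda>_. 1"]] by simp
  have int: "integrable dv (\<lambda>w. of_real (\<phi> i w * \<phi> j w) * ?u w)" for i j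
  proof -
    have "unit_symbol (\<lambda>w. \<phi> i w * \<phi> j w)"
      using unit[of i] unit[of j] by (auto simp: unit_symbol_def abs_mult intro: mult_le_one)
    from toeplitz_form_integrable[OF this, of "A h" g] show ?thesis by (simp add: mult.assoc)
  qed
  have "norm (0 + (\<Sum>i\<in>F. \<Sum>j\<in>F. (e i * e j) *\<^sub>R D i j)) \<le> B" if e: "\<And>j. \<bar>e j\<bar> = (1::real)" for e
  proof -
    let ?\<psi> = "\<lambda>z. \<Sum>j\<in>F. e j * \<phi> j z"
    have s: "slow_symbol \<rho> ?\<psi>" using e by (intro slow F) simp
    have t: "toeplitz ?\<psi> f = (\<Sum>j\<in>F. e j *\<^sub>R toeplitz (\<phi> j) f)" for f
      by (rule toeplitz_sum[OF F unit slow_symbol_unit[OF s]])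
    have "of_real ((?\<psi> w)\<^sup>2) * ?u w = (\<Sum>i\<in>F. \<Sum>j\<in>F. of_real (e i * e j) * (of_real (\<phi> i w * \<phi> j w) * ?u w))" for w
      unfolding power2_eq_square sum_product unfolding of_real_sum sum_distrib_right by (intro sum.cong refl) (simp add: mult_ac)
    then have "(\<integral>w. of_real ((?\<psi> w)\<^sup>2) * ?u w \<partial>dv) = (\<Sum>i\<in>F. \<Sum>j\<in>F. of_real (e i * e j) * (\<integral>w. of_real (\<phi> i w * \<phi> j w) * ?u w \<partial>dv))"
      using int by (simp add: Bochner_Integration.integral_sum del: of_real_mult)
    moreover have "bergman_inner (A (toeplitz ?\<psi> h)) (toeplitz ?\<psi> g) =
        (\<Sum>i\<in>F. \<Sum>j\<in>F. of_real (e i * e j) * bergman_inner (A (toeplitz (\<phi> i) h)) (toeplitz (\<phi> j) g))"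
    proof -
      have right: "bergman_inner f (\<Sum>j\<in>F. e j *\<^sub>R k j) = (\<Sum>j\<in>F. of_real (e j) * bergman_inner f (k j))" for f and k :: "'j \<Rightarrow> 'n bergman"
        by (simp add: bergman_inner_commute[of f] bergman_inner_sum_left scaleR_bergman_def bergman_inner_scale_left)
      have left: "bergman_inner (r *\<^sub>R f) k = of_real r * bergman_inner f k" for r and f k :: "'n bergman"
        by (simp add: scaleR_bergman_def bergman_inner_scale_left)
      show ?thesis unfolding t blinfun.sum_right blinfun.scaleR_right bergman_inner_sum_left right left
        by (subst sum.swap) (simp add: sum_distrib_left mult.assoc mult.left_commute)
    qed
    ultimately have "(\<Sum>i\<in>F. \<Sum>j\<in>F. (e i * e j) *\<^sub>R D i j) =
        (\<integral>w. of_real ((?\<psi> w)\<^sup>2) * ?u w \<partial>dv) - bergman_inner (A (toeplitz ?\<psi> h)) (toeplitz ?\<psi> g)"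
      by (simp add: D_def scaleR_conv_of_real right_diff_distrib sum_subtractf)
    then show ?thesis using quad[OF s] by simp
  qed
  from sign_average[OF F this] have "norm (\<Sum>j\<in>F. D j j) \<le> B" by simp
  moreover have "(\<Sum>j\<in>F. D j j) = (\<integral>w. of_real (\<Sum>j\<in>F. (\<phi> j w)\<^sup>2) * ?u w \<partial>dv) -
      (\<Sum>j\<in>F. bergman_inner (A (toeplitz (\<phi> j) h)) (toeplitz (\<phi> j) g))"
  proof -
    have "(\<integral>w. of_real (\<Sum>j\<in>F. (\<phi> j w)\<^sup>2) * ?u w \<partial>dv) = (\<integral>w. (\<Sum>j\<in>F. of_real (\<phi> j w * \<phi> j w) * ?u w) \<partial>dv)"
      unfolding of_real_sum sum_distrib_right power2_eq_square ..
    also have "\<dots> = (\<Sum>j\<in>F. \<integral>w. of_real (\<phi> j w * \<phi> j w) * ?u w \<partial>dv)"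
      using int by (intro Bochner_Integration.integral_sum)
    finally show ?thesis by (simp add: D_def sum_subtractf)
  qed
  ultimately show ?thesis by simp
qed

section \<open>Distance to the boundary\<close>

lemma polydisk_face_in_frontier:
  fixes v :: "complex ^ 'n::finite"
  assumes v: "v \<in> polydisk" and a: "norm a = 1"
  shows "v + axis i (a - v $ i) \<in> frontier polydisk"
proof -
  \<comment> \<open>The path moves only coordinate i, along t a; it stays in the polydisk for 0 < t
    < 1 and leaves it at t = 1.\<close>
  define p where "p t = (v + axis i (- (v $ i))) + t *\<^sub>R axis i a" for t :: real
  have pi: "p t $ j = (if j = i then t *\<^sub>R a else v $ j)" for t j
    by (simp add: p_def axis_def)
  have "norm (p 1 $ i) = 1" using a pi[of 1 i] by simp
  then have out: "p 1 \<notin> polydisk" unfolding polydisk_def mem_Collect_eq by (metis less_irrefl)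
  have "(p \<longlongrightarrow> p 1) (at_left 1)"
    unfolding p_def
    by (intro tendsto_intros)
  moreover have "\<forall>\<^sub>F t in at_left 1. p t \<in> polydisk"
  proof (rule eventually_at_leftI[of 0])
    fix t :: real assume "t \<in> {0<..<1}"
    then show "p t \<in> polydisk" using v a by (auto simp: polydisk_def pi)
  qed simp
  ultimately have "p 1 \<in> closure polydisk"
    by (intro Lim_in_closed_set[OF closed_closure _ trivial_limit_at_left_real])
      (auto elim!: eventually_mono intro: subsetD[OF closure_subset])
  with out have "p 1 \<in> frontier polydisk" by (simp add: frontier_def interior_open[OF open_polydisk])
  moreover have "p 1 = v + axis i (a - v $ i)" by (simp add: p_def vec_eq_iff axis_def)
  ultimately show ?thesis by simp
qed

text \<open>Coordinate i is pushed radially onto the unit circle. Together with the reverse estimate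
  below, approach to the boundary means that the smallest of the numbers
  \<open>1 - norm (v $ i)\<close> tends to 0.\<close>

lemma infdist_frontier_polydisk_le:
  fixes v :: "complex ^ 'n::finite"
  assumes v: "v \<in> polydisk"
  shows "infdist v (frontier polydisk) \<le> 1 - norm (v $ i)"
proof -
  \<comment> \<open>At the origin any direction will do; it is set to 1 because \<open>sgn 0\<close>
    is not unimodular.\<close>
  define a where "a = (if v $ i = 0 then 1 else sgn (v $ i))"
  have a: "norm a = 1" by (simp add: a_def norm_sgn)
  have "a - v $ i = of_real (1 - norm (v $ i)) * a"
    by (simp add: a_def sgn_eq left_diff_distrib)
  then have d: "norm (a - v $ i) = 1 - norm (v $ i)"
    using a v by (simp add: norm_mult polydisk_def less_imp_le del: of_real_diff)
  have "infdist v (frontier polydisk) \<le> dist v (v + axis i (a - v $ i))"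
    by (rule infdist_le[OF polydisk_face_in_frontier[OF v a]])
  also have "\<dots> = norm (axis i (a - v $ i) :: complex ^ 'n)" by (simp add: dist_norm)
  also have "\<dots> \<le> (\<Sum>j\<in>UNIV. norm ((axis i (a - v $ i) :: complex ^ 'n) $ j))"
    unfolding norm_vec_def by (rule L2_set_le_sum) simp
  also have "\<dots> = (\<Sum>j\<in>UNIV. if j = i then norm (a - v $ i) else 0)" by (intro sum.cong) (auto simp: axis_def)
  also have "\<dots> = 1 - norm (v $ i)" by (simp add: d)
  finally show ?thesis .
qed

lemma infdist_frontier_polydisk_ge:
  fixes v :: "complex ^ 'n::finite"
  assumes v: "v \<in> polydisk" and d: "\<And>i. d \<le> 1 - norm (v $ i)"
  shows "d \<le> infdist v (frontier polydisk)"
proof -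
  have "frontier (polydisk :: (complex ^ 'n) set) \<noteq> {}"
    using polydisk_face_in_frontier[OF zero_in_polydisk norm_one] by blast
  moreover have "d \<le> dist v p" if "p \<in> frontier polydisk" for p
  proof -
    have "p \<notin> polydisk" using that by (simp add: frontier_def interior_open[OF open_polydisk])
    then obtain i where "norm (p $ i) \<ge> 1" by (auto simp: polydisk_def not_less)
    then have "d \<le> norm (p $ i) - norm (v $ i)" using d[of i] by simp
    also have "\<dots> \<le> norm ((p - v) $ i)" by (simp add: norm_triangle_ineq2)
    also have "\<dots> \<le> dist v p" using dist_vec_nth_le[of v i p] by (simp add: dist_norm norm_minus_commute)
    finally show ?thesis .
  qed
  ultimately show ?thesis unfolding infdist_def by (auto intro: cINF_greatest)
qed

text \<open>Moving by pseudohyperbolic distance at most 1/2 increases the distance to the circle by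
  at most a bounded factor, because |1 - t cnj z| \<ge> 1/2.\<close>

lemma one_minus_norm_mobius_le:
  assumes z: "norm z < 1" and t: "norm t \<le> 1 / 2"
  shows "1 - norm (mobius z t) \<le> 8 * (1 - norm z)"
proof -
  have t1: "norm t < 1" using t by simp
  have m: "norm (mobius z t) < 1" by (rule norm_mobius_less_one[OF z t1])
  have pos: "1 - (norm z)\<^sup>2 > 0" "1 - (norm t)\<^sup>2 > 0" using norm_less_one_sq_pos z t1 by auto
  have "norm (t * cnj z) \<le> 1 / 2 * 1" unfolding norm_mult using t z by (intro mult_mono) auto
  then have "norm (1 - t * cnj z) \<ge> 1 / 2" using norm_triangle_ineq2[of 1 "t * cnj z"] by simp
  then have "(norm (1 - t * cnj z))\<^sup>2 \<ge> (1 / 2)\<^sup>2" by (intro power_mono) auto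
  then have n: "(norm (1 - t * cnj z))\<^sup>2 \<ge> 1 / 4" by (simp add: power2_eq_square)
  have "(norm (mobius z t))\<^sup>2 \<le> norm (mobius z t)" using m by (simp add: power2_eq_square mult_left_le)
  then have "1 - norm (mobius z t) \<le> 1 - (norm (mobius z t))\<^sup>2" by simp
  also have "\<dots> = (1 - (norm z)\<^sup>2) * (1 - (norm t)\<^sup>2) / (norm (1 - t * cnj z))\<^sup>2"
    by (rule one_minus_norm_mobius_sq[OF z t1])
  also have "\<dots> \<le> ((1 - (norm z)\<^sup>2) * 1) / (1 / 4)"
    using pos n by (intro frac_le mult_left_mono mult_nonneg_nonneg) auto
  also have "\<dots> = 4 * ((1 - norm z) * (1 + norm z))" by (simp add: power2_eq_square algebra_simps)
  also have "\<dots> \<le> 4 * ((1 - norm z) * 2)" using z by (intro mult_left_mono) auto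
  finally show ?thesis by simp
qed

text \<open>The diagonal values near z are small as soon as one coordinate of z is close to the
  circle, since the points \<open>mobius_vec z t\<close> with t at most 1/2 have the same coordinate
  close to it. The layer \<delta> / 8 accounts for the factor in
  \<open>one_minus_norm_mobius_le\<close>.\<close>

lemma offdiagonal_boundary:
  fixes A :: "'n::finite bergman_op"
  assumes A: "clinear_op A" and r: "0 < r" "r < 1" and \<eta>: "\<eta> > 0"
    and lim: "((\<lambda>z. bergman_inner (A (normalized_kernel z)) (normalized_kernel z)) \<longlongrightarrow> 0) to_boundary"
  shows "\<exists>d>0. \<forall>z\<in>polydisk. (\<exists>i. 1 - norm (z $ i) < d) \<longrightarrow> (\<forall>u\<in>polydisk. \<forall>w\<in>polydisk.
    (\<forall>i. norm (mobius (z $ i) (u $ i)) \<le> r \<and> norm (mobius (z $ i) (w $ i)) \<le> r) \<longrightarrow>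
    norm (bergman_inner (A (normalized_kernel u)) (normalized_kernel w)) \<le> \<eta>)"
proof -
  obtain \<epsilon> where \<epsilon>: "\<epsilon> > 0" and off: "\<forall>z\<in>polydisk. (\<forall>t. (\<forall>i. norm (t i) \<le> 1 / 2) \<longrightarrow>
      norm (bergman_inner (A (normalized_kernel (mobius_vec z t))) (normalized_kernel (mobius_vec z t))) \<le> \<epsilon>) \<longrightarrow>
    (\<forall>s t. (\<forall>i. norm (s i) \<le> r \<and> norm (t i) \<le> r) \<longrightarrow>
      norm (bergman_inner (A (normalized_kernel (mobius_vec z s))) (normalized_kernel (mobius_vec z t))) \<le> \<eta>)"
    using offdiagonal_small[OF A r \<eta>] by blast
  have "\<forall>\<^sub>F z in to_boundary. dist (bergman_inner (A (normalized_kernel z)) (normalized_kernel z)) 0 < \<epsilon>"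
    using lim \<epsilon> by (rule tendstoD)
  then obtain \<delta> where \<delta>: "\<delta> > 0" and near: "\<And>v. v \<in> polydisk \<Longrightarrow> infdist v (frontier polydisk) < \<delta> \<Longrightarrow>
      norm (bergman_inner (A (normalized_kernel v)) (normalized_kernel v)) < \<epsilon>"
    unfolding eventually_to_boundary by auto
  have "norm (bergman_inner (A (normalized_kernel u)) (normalized_kernel w)) \<le> \<eta>"
    if z: "z \<in> polydisk" "1 - norm (z $ i) < \<delta> / 8" and uw: "u \<in> polydisk" "w \<in> polydisk"
      and m: "\<And>i. norm (mobius (z $ i) (u $ i)) \<le> r" "\<And>i. norm (mobius (z $ i) (w $ i)) \<le> r" for z i u w
  proof -
    have z1: "norm (z $ i) < 1" for i using z(1) by (simp add: polydisk_def)
    have diag: "norm (bergman_inner (A (normalized_kernel (mobius_vec z t))) (normalized_kernel (mobius_vec z t))) \<le> \<epsilon>"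
      if t: "\<And>i. norm (t i) \<le> 1 / 2" for t
    proof -
      have "norm (t i) < 1" for i using t[of i] by simp
      then have v: "mobius_vec z t \<in> polydisk" by (rule mobius_vec_polydisk[OF z(1)])
      have "infdist (mobius_vec z t) (frontier polydisk) \<le> 1 - norm (mobius_vec z t $ i)"
        by (rule infdist_frontier_polydisk_le[OF v])
      also have "\<dots> \<le> 8 * (1 - norm (z $ i))" unfolding mobius_vec_def vec_lambda_beta
        by (rule one_minus_norm_mobius_le[OF z1 t])
      also have "\<dots> < \<delta>" using z(2) by simp
      finally show ?thesis using near[OF v] by (simp add: less_imp_le)
    qed
    have eq: "mobius_vec z (\<lambda>i. mobius (z $ i) (u $ i)) = u" "mobius_vec z (\<lambda>i. mobius (z $ i) (w $ i)) = w"
      using z1 uw by (simp_all add: mobius_vec_def vec_eq_iff polydisk_def)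
    have "norm (bergman_inner (A (normalized_kernel (mobius_vec z (\<lambda>i. mobius (z $ i) (u $ i)))))
        (normalized_kernel (mobius_vec z (\<lambda>i. mobius (z $ i) (w $ i))))) \<le> \<eta>"
      by (rule off[rule_format, OF z(1) diag]) (use m in auto)
    then show ?thesis unfolding eq .
  qed
  then show ?thesis using \<delta> by (intro exI[of _ "\<delta> / 8"]) auto
qed

section \<open>Localized norms and the essential estimate\<close>

definition cut_norm :: "(complex ^ 'n::finite \<Rightarrow> real) \<Rightarrow> (complex ^ 'n) set \<Rightarrow> 'n bergman \<Rightarrow> real"
  where "cut_norm \<phi> S h = sqrt (\<integral>w. indicator S w * (norm (of_real (\<phi> w) * bergman_fun h w))\<^sup>2 \<partial>dv)"

lemma cut_norm_integrable:
  assumes "unit_symbol \<phi>" and [measurable]: "S \<in> sets borel"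
  shows "integrable dv (\<lambda>w. indicator S w * (norm (of_real (\<phi> w) * bergman_fun h w))\<^sup>2)"
  using integrable_real_mult_indicator[OF _ unit_symbol_square_integrable(1)[OF assms(1)], of S h]
  by (simp add: mult.commute)

lemma cut_norm_nonneg: "cut_norm \<phi> S h \<ge> 0"
  unfolding cut_norm_def by (intro real_sqrt_ge_zero integral_nonneg_AE AE_I2) simp

lemma cut_norm_sq:
  "(cut_norm \<phi> S h)\<^sup>2 = (\<integral>w. indicator S w * (norm (of_real (\<phi> w) * bergman_fun h w))\<^sup>2 \<partial>dv)"
  unfolding cut_norm_def by (intro real_sqrt_pow2 integral_nonneg_AE AE_I2) simp

lemma cut_norm_sum:
  assumes F: "finite F" and u: "\<And>j. j \<in> F \<Longrightarrow> unit_symbol (\<phi> j)" and S: "S \<in> sets borel"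
    and c: "\<And>w. (\<Sum>j\<in>F. (\<phi> j w)\<^sup>2) \<le> c"
  shows "(\<Sum>j\<in>F. (cut_norm (\<phi> j) S h)\<^sup>2) \<le> c * (cut_norm (\<lambda>_. 1) S h)\<^sup>2"
proof -
  have one: "unit_symbol (\<lambda>_. 1)" by (simp add: unit_symbol_def)
  have "(\<Sum>j\<in>F. (cut_norm (\<phi> j) S h)\<^sup>2) = (\<integral>w. (\<Sum>j\<in>F. indicator S w * (norm (of_real (\<phi> j w) * bergman_fun h w))\<^sup>2) \<partial>dv)"
    unfolding cut_norm_sq using cut_norm_integrable[OF u S] by (intro Bochner_Integration.integral_sum[symmetric])
  also have "\<dots> \<le> (\<integral>w. c * (indicator S w * (norm (of_real 1 * bergman_fun h w))\<^sup>2) \<partial>dv)"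
  proof (rule integral_mono)
    show "integrable dv (\<lambda>w. \<Sum>j\<in>F. indicator S w * (norm (of_real (\<phi> j w) * bergman_fun h w))\<^sup>2)"
      using cut_norm_integrable[OF u S] by (intro Bochner_Integration.integrable_sum)
    show "integrable dv (\<lambda>w. c * (indicator S w * (norm (of_real 1 * bergman_fun h w))\<^sup>2))"
      using cut_norm_integrable[OF one S] by (intro integrable_mult_right)
    fix w
    have "(\<Sum>j\<in>F. indicator S w * (norm (of_real (\<phi> j w) * bergman_fun h w))\<^sup>2) =
        (\<Sum>j\<in>F. (\<phi> j w)\<^sup>2) * (indicator S w * (norm (bergman_fun h w))\<^sup>2)"
      unfolding sum_distrib_right by (intro sum.cong) (simp_all add: norm_mult power_mult_distrib mult_ac)
    also have "\<dots> \<le> c * (indicator S w * (norm (bergman_fun h w))\<^sup>2)" using c by (intro mult_right_mono) auto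
    finally show "(\<Sum>j\<in>F. indicator S w * (norm (of_real (\<phi> j w) * bergman_fun h w))\<^sup>2) \<le>
        c * (indicator S w * (norm (of_real 1 * bergman_fun h w))\<^sup>2)" by simp
  qed
  also have "\<dots> = c * (cut_norm (\<lambda>_. 1) S h)\<^sup>2" unfolding cut_norm_sq by simp
  finally show ?thesis .
qed

lemma cut_norm_one: "cut_norm (\<lambda>_. 1) UNIV h = norm h"
  by (simp add: cut_norm_def norm_bergman_sq[symmetric])

text \<open>Cauchy-Schwarz in which f is replaced on the support of \<phi> by a comparison function
  k. Choosing for k a kernel of norm 1 turns pointwise bounds for f into norm bounds; choosing k = f
  gives the plain estimate.\<close>

lemma toeplitz_form_le_cut_norm:
  assumes \<phi>: "unit_symbol \<phi>" and C: "C \<ge> 0"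
    and le: "\<And>w. w \<in> polydisk \<Longrightarrow> \<phi> w \<noteq> 0 \<Longrightarrow> norm (bergman_fun f w) \<le> C * norm (bergman_fun k w)"
  shows "norm (toeplitz_form \<phi> h f) \<le> C * cut_norm \<phi> UNIV h * norm k"
proof -
  have [measurable]: "\<phi> \<in> borel_measurable borel" using \<phi> by (simp add: unit_symbol_def)
  let ?u = "\<lambda>w. norm (of_real (\<phi> w) * bergman_fun h w)" and ?k = "\<lambda>w. norm (bergman_fun k w)"
  have cs: "integrable dv (\<lambda>w. ?u w * ?k w)"
    "\<bar>\<integral>w. ?u w * ?k w \<partial>dv\<bar> \<le> sqrt (\<integral>w. (?u w)\<^sup>2 \<partial>dv) * sqrt (\<integral>w. (?k w)\<^sup>2 \<partial>dv)"
    using integral_cauchy_schwarz[of ?u dv ?k] unit_symbol_square_integrable(1)[OF \<phi>, of h] bergman_fun_square_integrable[of k]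
    by simp_all
  have "norm (toeplitz_form \<phi> h f) \<le> (\<integral>w. norm (of_real (\<phi> w) * bergman_fun h w * cnj (bergman_fun f w)) \<partial>dv)"
    unfolding toeplitz_form_def by (rule integral_norm_bound)
  also have "\<dots> \<le> (\<integral>w. C * (?u w * ?k w) \<partial>dv)"
  proof (rule integral_mono)
    show "integrable dv (\<lambda>w. norm (of_real (\<phi> w) * bergman_fun h w * cnj (bergman_fun f w)))"
      using toeplitz_form_integrable[OF \<phi>] by (rule integrable_norm)
    show "integrable dv (\<lambda>w. C * (?u w * ?k w))" using cs(1) by (rule integrable_mult_right)
    fix w
    show "norm (of_real (\<phi> w) * bergman_fun h w * cnj (bergman_fun f w)) \<le> C * (?u w * ?k w)"
    proof (cases "w \<in> polydisk \<and> \<phi> w \<noteq> 0")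
      case True
      then have "?u w * norm (bergman_fun f w) \<le> ?u w * (C * ?k w)" using le by (intro mult_left_mono) auto
      then show ?thesis by (simp add: norm_mult mult_ac)
    next
      case False
      then show ?thesis using C bergman_fun_outside[of w h] by auto
    qed
  qed
  also have "\<dots> = C * (\<integral>w. ?u w * ?k w \<partial>dv)" by simp
  also have "\<dots> \<le> C * (sqrt (\<integral>w. (?u w)\<^sup>2 \<partial>dv) * sqrt (\<integral>w. (?k w)\<^sup>2 \<partial>dv))" using cs(2) C by (intro mult_left_mono) auto
  also have "\<dots> = C * cut_norm \<phi> UNIV h * norm k" by (simp add: cut_norm_def norm_bergman_sq[symmetric])
  finally show ?thesis .
qed

lemma norm_toeplitz_le_cut_norm:
  assumes "unit_symbol \<phi>"
  shows "norm (toeplitz \<phi> h) \<le> cut_norm \<phi> UNIV h"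
proof (rule norm_bergman_le_inner[OF _ cut_norm_nonneg])
  fix g
  have "norm (toeplitz_form \<phi> h g) \<le> 1 * cut_norm \<phi> UNIV h * norm g"
    by (rule toeplitz_form_le_cut_norm[OF assms]) auto
  then show "norm (bergman_inner g (toeplitz \<phi> h)) \<le> cut_norm \<phi> UNIV h * norm g"
    using bergman_inner_commute[of g "toeplitz \<phi> h"] by (simp add: toeplitz_inner[OF assms])
qed

text \<open>On the support of \<phi> the norm \<open>1 / poly_delta w\<close> of the kernel at w is
  at most Q |k_z(w)|. The integral kernel of A between points of the support is therefore dominated
  by \<eta> Q^2 |k_z(u)| |k_z(w)|, a product of functions of norm 1 up to the constant; two
  applications of Cauchy-Schwarz give the bound.\<close>

lemma localized_form_small:
  fixes A :: "'n::finite bergman_op"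
  assumes A: "clinear_op A" and \<phi>: "unit_symbol \<phi>" and z: "z \<in> polydisk" and r: "0 < r" "r < 1" and \<eta>: "\<eta> \<ge> 0"
    and near: "\<And>w i. w \<in> polydisk \<Longrightarrow> \<phi> w \<noteq> 0 \<Longrightarrow> norm (mobius (z $ i) (w $ i)) \<le> r"
    and small: "\<And>u w. u \<in> polydisk \<Longrightarrow> \<phi> u \<noteq> 0 \<Longrightarrow> w \<in> polydisk \<Longrightarrow> \<phi> w \<noteq> 0 \<Longrightarrow>
      norm (bergman_inner (A (normalized_kernel u)) (normalized_kernel w)) \<le> \<eta>"
  shows "norm (bergman_inner (A (toeplitz \<phi> h)) (toeplitz \<phi> g)) \<le>
    \<eta> * (1 / (1 - r\<^sup>2)) ^ (2 * CARD('n)) * (cut_norm \<phi> UNIV h * cut_norm \<phi> UNIV g)"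
proof -
  define Q where "Q = (1 / (1 - r\<^sup>2)) ^ CARD('n)"
  have r2: "1 - r\<^sup>2 > 0" using r by (simp add: abs_square_less_1)
  then have Q: "Q > 0" by (simp add: Q_def)
  let ?k = "normalized_kernel z"
  have k: "1 / poly_delta w \<le> Q * norm (bergman_fun ?k w)" if w: "w \<in> polydisk" "\<phi> w \<noteq> 0" for w
  proof -
    have "(1 - r\<^sup>2) ^ CARD('n) = (\<Prod>i\<in>(UNIV :: 'n set). 1 - r\<^sup>2)" by simp
    also have "\<dots> \<le> (\<Prod>i\<in>UNIV. 1 / cosh2 (w $ i) (z $ i))"
    proof (rule prod_mono)
      fix i :: 'n
      have wz: "norm (w $ i) < 1" "norm (z $ i) < 1" using w(1) z by (auto simp: polydisk_def)
      have "(norm (mobius (w $ i) (z $ i)))\<^sup>2 \<le> r\<^sup>2"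
        using near[OF w, of i] norm_mobius_commute[of "z $ i" "w $ i"] by (intro power_mono) auto
      then show "0 \<le> 1 - r\<^sup>2 \<and> 1 - r\<^sup>2 \<le> 1 / cosh2 (w $ i) (z $ i)"
        unfolding inverse_cosh2[OF wz] using r2 by simp
    qed
    also have "\<dots> = poly_delta w * norm (bergman_fun ?k w)"
      unfolding norm_inner_normalized_kernels[OF w(1) z, symmetric] bergman_inner_kernel[OF w(1)]
      using poly_delta_pos[OF w(1)] by (simp add: norm_mult)
    finally have "(1 - r\<^sup>2) ^ CARD('n) \<le> poly_delta w * norm (bergman_fun ?k w)" .
    then show ?thesis using r2 poly_delta_pos[OF w(1)] by (simp add: Q_def power_one_over field_simps)
  qed
  \<comment> \<open>t is the adjoint of A applied to \<open>toeplitz \<phi> g\<close>. Its value at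
    w is a Toeplitz form of g and the image under A of the kernel at w.\<close>
  obtain t where t: "\<And>f. bergman_inner (A f) (toeplitz \<phi> g) = bergman_inner f t"
    using adjoint_vector[OF A] by blast
  have "norm (bergman_fun t w) \<le> \<eta> * Q * cut_norm \<phi> UNIV g * Q * norm (bergman_fun ?k w)" if w: "w \<in> polydisk" "\<phi> w \<noteq> 0" for w
  proof -
    have AK: "A (bergman_kernel w) = bergman_scale (of_real (1 / poly_delta w)) (A (normalized_kernel w))"
      using A by (simp add: bergman_kernel_def clinear_op_def)
    have "bergman_fun t w = cnj (bergman_inner (A (bergman_kernel w)) (toeplitz \<phi> g))"
      unfolding t bergman_inner_commute[of "bergman_kernel w"] complex_cnj_cnj
      by (rule bergman_inner_bergman_kernel[OF w(1), symmetric])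
    also have "\<dots> = toeplitz_form \<phi> g (A (bergman_kernel w))"
      by (simp add: bergman_inner_commute[of "A (bergman_kernel w)"] toeplitz_inner[OF \<phi>])
    finally have "norm (bergman_fun t w) = norm (toeplitz_form \<phi> g (A (bergman_kernel w)))" by simp
    also have "\<dots> \<le> (\<eta> / poly_delta w * Q) * cut_norm \<phi> UNIV g * norm ?k"
    proof (rule toeplitz_form_le_cut_norm[OF \<phi>])
      show "0 \<le> \<eta> / poly_delta w * Q" using \<eta> Q poly_delta_pos[OF w(1)] by simp
      fix u assume u: "u \<in> polydisk" "\<phi> u \<noteq> 0"
      have "poly_delta u * norm (bergman_fun (A (normalized_kernel w)) u) \<le> \<eta>"
        using small[OF w u] poly_delta_pos[OF u(1)] by (simp add: bergman_inner_kernel[OF u(1)] norm_mult)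
      then have "norm (bergman_fun (A (normalized_kernel w)) u) \<le> \<eta> * (1 / poly_delta u)"
        using poly_delta_pos[OF u(1)] by (simp add: field_simps)
      also have "\<dots> \<le> \<eta> * (Q * norm (bergman_fun ?k u))" by (rule mult_left_mono[OF k[OF u] \<eta>])
      finally have "1 / poly_delta w * norm (bergman_fun (A (normalized_kernel w)) u) \<le> 1 / poly_delta w * (\<eta> * (Q * norm (bergman_fun ?k u)))"
        using poly_delta_pos[OF w(1)] by (intro mult_left_mono) auto
      then show "norm (bergman_fun (A (bergman_kernel w)) u) \<le> \<eta> / poly_delta w * Q * norm (bergman_fun ?k u)"
        using poly_delta_pos[OF w(1)] by (simp add: AK bergman_fun_scale norm_mult norm_divide mult.assoc)
    qed
    also have "\<dots> = (\<eta> * Q * cut_norm \<phi> UNIV g) * (1 / poly_delta w)" by (simp add: norm_normalized_kernel[OF z])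
    also have "\<dots> \<le> (\<eta> * Q * cut_norm \<phi> UNIV g) * (Q * norm (bergman_fun ?k w))"
      using \<eta> Q by (intro mult_left_mono k w mult_nonneg_nonneg cut_norm_nonneg) auto
    finally show ?thesis by (simp add: mult.assoc)
  qed
  then have "norm (toeplitz_form \<phi> h t) \<le> (\<eta> * Q * cut_norm \<phi> UNIV g * Q) * cut_norm \<phi> UNIV h * norm ?k"
    using \<eta> Q by (intro toeplitz_form_le_cut_norm[OF \<phi>] mult_nonneg_nonneg cut_norm_nonneg) auto
  moreover have "(1 / (1 - r\<^sup>2)) ^ (2 * CARD('n)) = Q * Q" unfolding Q_def mult_2 power_add ..
  ultimately show ?thesis
    by (simp add: t toeplitz_inner[OF \<phi>] norm_normalized_kernel[OF z] mult_ac)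
qed

definition inner_part :: "real \<Rightarrow> (complex ^ 'n::finite) set"
  where "inner_part \<kappa> = {w. \<forall>i. \<kappa> \<le> 1 - norm (w $ i)}"

lemma inner_part_borel [measurable]: "inner_part \<kappa> \<in> sets borel"
proof -
  have "closed {w :: complex ^ 'a. \<forall>i. \<kappa> \<le> 1 - norm (w $ i)}"
    by (intro closed_Collect_all closed_Collect_le continuous_intros)
  then show ?thesis unfolding inner_part_def by (rule borel_closed)
qed

lemma inner_part_polydisk: "\<kappa> > 0 \<Longrightarrow> w \<in> inner_part \<kappa> \<Longrightarrow> w \<in> polydisk"
  unfolding inner_part_def polydisk_def mem_Collect_eq by (metis diff_gt_0_iff_gt less_le_trans)

text \<open>By \<open>one_minus_norm_mobius_sq\<close>, 1 - r^2 is at most (1 - |w|^2) / d^2, since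
  1 - |z|^2 \<le> 1 and the denominator is at least d^2.\<close>

lemma one_minus_norm_ge_of_near:
  assumes z: "norm z < 1" and w: "norm w < 1" and r: "0 < r" "r < 1" "norm (mobius z w) \<le> r"
    and d: "0 < d" "d \<le> 1 - norm z"
  shows "(1 - r\<^sup>2) * d\<^sup>2 / 2 \<le> 1 - norm w"
proof -
  have "norm (w * cnj z) \<le> 1 * norm z" unfolding norm_mult using w by (simp add: mult_left_le_one_le)
  then have "d \<le> norm (1 - w * cnj z)" using norm_triangle_ineq2[of 1 "w * cnj z"] d by simp
  then have n: "d\<^sup>2 \<le> (norm (1 - w * cnj z))\<^sup>2" using d by (intro power_mono) auto
  have pos: "0 \<le> 1 - (norm z)\<^sup>2" "1 - (norm z)\<^sup>2 \<le> 1" "0 \<le> 1 - (norm w)\<^sup>2" using norm_less_one_sq_pos[OF z] norm_less_one_sq_pos[OF w] by auto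
  have "(norm (mobius z w))\<^sup>2 \<le> r\<^sup>2" using r by (intro power_mono) auto
  then have "1 - r\<^sup>2 \<le> (1 - (norm z)\<^sup>2) * (1 - (norm w)\<^sup>2) / (norm (1 - w * cnj z))\<^sup>2"
    using one_minus_norm_mobius_sq[OF z w] by simp
  also have "\<dots> \<le> (1 * (1 - (norm w)\<^sup>2)) / d\<^sup>2"
    using pos n d by (intro frac_le mult_right_mono) auto
  finally have "(1 - r\<^sup>2) * d\<^sup>2 \<le> (1 - norm w) * (1 + norm w)"
    using d by (simp add: field_simps power2_eq_square)
  also have "\<dots> \<le> (1 - norm w) * 2" using w by (intro mult_left_mono) auto
  finally show ?thesis by simp
qed

text \<open>Cells meeting the boundary layer contribute \<epsilon> / 2 by
  \<open>localized_form_small\<close>; the others lie in a compact set and are estimated by the norm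
  of A and the part of h on that set. Cauchy-Schwarz over the cells reduces everything to the sum of
  squares of the partition, so the factor c appears in every term and cancels.\<close>

lemma essential_estimate:
  fixes A :: "'n::finite bergman_op"
  assumes A: "A \<in> slowly_commuting" and \<epsilon>: "\<epsilon> > 0"
    and lim: "((\<lambda>z. bergman_inner (A (normalized_kernel z)) (normalized_kernel z)) \<longlongrightarrow> 0) to_boundary"
  shows "\<exists>\<kappa>>0. \<forall>h. norm (A h) \<le> \<epsilon> * norm h + norm A * cut_norm (\<lambda>_. 1) (inner_part \<kappa>) h"
proof -
  have cl: "clinear_op A" using A by (simp add: slowly_commuting_def)
  define c where "c = 1 / ((4 :: real) ^ CARD('n))\<^sup>2"
  have c: "c > 0" by (simp add: c_def)
  \<comment> \<open>The tolerance carries the factor c because the form recovered from the partition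
    is c times the pairing with A h.\<close>
  obtain \<rho> where \<rho>: "1 / 2 \<le> \<rho>" "\<rho> < 1" and quad: "\<And>\<psi> h g. slow_symbol \<rho> \<psi> \<Longrightarrow>
    norm ((\<integral>w. of_real ((\<psi> w)\<^sup>2) * (bergman_fun (A h) w * cnj (bergman_fun g w)) \<partial>dv) -
      bergman_inner (A (toeplitz \<psi> h)) (toeplitz \<psi> g)) \<le> (c * (\<epsilon> / 2)) * norm h * norm g"
    using slowly_commuting_quadratic[OF A, of "c * (\<epsilon> / 2)"] c \<epsilon> by auto
  obtain \<phi> :: "('n \<Rightarrow> int \<times> int) \<Rightarrow> complex ^ 'n \<Rightarrow> real" and J :: "nat \<Rightarrow> ('n \<Rightarrow> int \<times> int) set" and r
    where J: "\<forall>m. finite (J m)" and r: "0 < r" "r < 1"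
    and slow: "\<forall>F e. finite F \<longrightarrow> (\<forall>j. \<bar>e j\<bar> \<le> 1) \<longrightarrow> slow_symbol \<rho> (\<lambda>z. \<Sum>j\<in>F. e j * \<phi> j z)"
    and sum_le: "\<forall>z m. (\<Sum>j\<in>J m. (\<phi> j z)\<^sup>2) \<le> c" and sum_eq: "\<forall>z. \<exists>m0. \<forall>m\<ge>m0. (\<Sum>j\<in>J m. (\<phi> j z)\<^sup>2) = c"
    and diam: "\<forall>j. \<forall>z\<in>polydisk. \<forall>w\<in>polydisk. \<phi> j z \<noteq> 0 \<longrightarrow> \<phi> j w \<noteq> 0 \<longrightarrow> (\<forall>i. norm (mobius (z $ i) (w $ i)) \<le> r)"
    using slow_partition[of \<rho>, where 'n = 'n] \<rho> unfolding c_def[symmetric] by auto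
  have u: "unit_symbol (\<phi> j)" for j
    using slow_symbol_unit[OF slow[rule_format, of "{j}" "\<lambda>_. 1"]] by simp
  define q where "q = (1 / (1 - r\<^sup>2)) ^ (2 * CARD('n))"
  have r2: "1 - r\<^sup>2 > 0" using r by (simp add: abs_square_less_1)
  then have q: "q > 0" by (simp add: q_def)
  define \<eta> where "\<eta> = \<epsilon> / (2 * q)"
  have \<eta>: "\<eta> > 0" "\<eta> * q = \<epsilon> / 2" using \<epsilon> q by (simp_all add: \<eta>_def)
  obtain d where d: "d > 0" and far: "\<forall>z\<in>polydisk. (\<exists>i. 1 - norm (z $ i) < d) \<longrightarrow> (\<forall>u\<in>polydisk. \<forall>w\<in>polydisk.
    (\<forall>i. norm (mobius (z $ i) (u $ i)) \<le> r \<and> norm (mobius (z $ i) (w $ i)) \<le> r) \<longrightarrow>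
    norm (bergman_inner (A (normalized_kernel u)) (normalized_kernel w)) \<le> \<eta>)"
    using offdiagonal_boundary[OF cl r \<eta>(1) lim] by blast
  define \<kappa> where "\<kappa> = (1 - r\<^sup>2) * d\<^sup>2 / 2"
  have \<kappa>: "\<kappa> > 0" using r2 d by (simp add: \<kappa>_def)
  let ?K = "inner_part \<kappa> :: (complex ^ 'n) set"
  let ?N = "\<lambda>j. cut_norm (\<phi> j) UNIV" and ?M = "\<lambda>j. cut_norm (\<phi> j) ?K"
  have cell: "norm (bergman_inner (A (toeplitz (\<phi> j) h)) (toeplitz (\<phi> j) g)) \<le>
      \<epsilon> / 2 * (?N j h * ?N j g) + norm A * (?M j h * ?N j g)" for j h g
  proof (cases "\<exists>z\<in>polydisk. \<phi> j z \<noteq> 0 \<and> (\<exists>i. 1 - norm (z $ i) < d)")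
    case True
    then obtain z where z: "z \<in> polydisk" "\<phi> j z \<noteq> 0" "\<exists>i. 1 - norm (z $ i) < d" by blast
    have "norm (bergman_inner (A (toeplitz (\<phi> j) h)) (toeplitz (\<phi> j) g)) \<le> \<eta> * q * (?N j h * ?N j g)"
      unfolding q_def
    proof (rule localized_form_small[OF cl u z(1) r less_imp_le[OF \<eta>(1)]])
      show "norm (mobius (z $ i) (w $ i)) \<le> r" if "w \<in> polydisk" "\<phi> j w \<noteq> 0" for w i
        using diam z that by blast
      then show "norm (bergman_inner (A (normalized_kernel u)) (normalized_kernel w)) \<le> \<eta>"
        if "u \<in> polydisk" "\<phi> j u \<noteq> 0" "w \<in> polydisk" "\<phi> j w \<noteq> 0" for u w
        using far z that by blast
    qed
    moreover have "0 \<le> norm A * (?M j h * ?N j g)" by (intro mult_nonneg_nonneg norm_ge_zero cut_norm_nonneg)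
    ultimately show ?thesis unfolding \<eta>(2) by linarith
  next
    case False
    have "w \<in> ?K" if "w \<in> polydisk" "\<phi> j w \<noteq> 0" for w
      unfolding inner_part_def mem_Collect_eq \<kappa>_def
    proof
      fix i
      have w1: "norm (w $ i) < 1" using that(1) by (simp add: polydisk_def)
      have "norm (mobius (w $ i) (w $ i)) \<le> r" using diam that by blast
      moreover have "d \<le> 1 - norm (w $ i)" using False that by (meson not_less)
      ultimately show "(1 - r\<^sup>2) * d\<^sup>2 / 2 \<le> 1 - norm (w $ i)" using one_minus_norm_ge_of_near[OF w1 w1 r] d by blast
    qed
    \<comment> \<open>A cell away from the layer vanishes outside the inner part, so restricting its
      cut norm to that set changes nothing.\<close>
    then have eq0: "indicator ?K w * (norm (of_real (\<phi> j w) * bergman_fun h w))\<^sup>2 = indicator UNIV w * (norm (of_real (\<phi> j w) * bergman_fun h w))\<^sup>2" for w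
      using bergman_fun_outside[of w h] by (cases "w \<in> polydisk \<and> \<phi> j w \<noteq> 0") (auto simp: indicator_def)
    have eq: "?M j h = ?N j h" unfolding cut_norm_def eq0 ..
    have "norm (bergman_inner (A (toeplitz (\<phi> j) h)) (toeplitz (\<phi> j) g)) \<le> norm (A (toeplitz (\<phi> j) h)) * norm (toeplitz (\<phi> j) g)"
      by (rule norm_bergman_inner_le)
    also have "\<dots> \<le> (norm A * norm (toeplitz (\<phi> j) h)) * norm (toeplitz (\<phi> j) g)"
      by (intro mult_right_mono norm_blinfun) simp
    also have "\<dots> \<le> (norm A * ?N j h) * ?N j g"
      by (intro mult_mono mult_left_mono norm_toeplitz_le_cut_norm u mult_nonneg_nonneg cut_norm_nonneg) auto
    also have "\<dots> = norm A * (?M j h * ?N j g)" by (simp add: eq)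
    also have "\<dots> \<le> \<epsilon> / 2 * (?N j h * ?N j g) + norm A * (?M j h * ?N j g)"
      using \<epsilon> by (simp add: cut_norm_nonneg)
    finally show ?thesis .
  qed
  have "norm (A h) \<le> \<epsilon> * norm h + norm A * cut_norm (\<lambda>_. 1) ?K h" for h
  proof (rule norm_bergman_le_inner)
    fix g
    let ?k = "cut_norm (\<lambda>_. 1) ?K h"
    let ?u = "\<lambda>w. bergman_fun (A h) w * cnj (bergman_fun g w)"
    have sq: "(\<Sum>j\<in>J m. (cut_norm (\<phi> j) S f)\<^sup>2) \<le> (sqrt c * cut_norm (\<lambda>_. 1) S f)\<^sup>2" if "S \<in> sets borel" for S f m
      using cut_norm_sum[of "J m" \<phi> S c f] J u that sum_le c by (simp add: power_mult_distrib)
    have cc: "sqrt c * (sqrt c * X) = c * X" for X using c by (simp flip: mult.assoc)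
    have cs: "(\<Sum>j\<in>J m. cut_norm (\<phi> j) S h * ?N j g) \<le> c * (cut_norm (\<lambda>_. 1) S h * norm g)" if "S \<in> sets borel" for S m
      using sum_norm_mult_le[of "\<lambda>j. of_real (cut_norm (\<phi> j) S h)" "J m" "sqrt c * cut_norm (\<lambda>_. 1) S h"
          "\<lambda>j. of_real (?N j g)" "sqrt c * cut_norm (\<lambda>_. 1) UNIV g"] sq[OF that] sq[of UNIV] c
      by (simp add: cut_norm_nonneg cut_norm_one mult_ac cc)
    have fin: "norm (\<integral>w. of_real (\<Sum>j\<in>J m. (\<phi> j w)\<^sup>2) * ?u w \<partial>dv) \<le> c * ((\<epsilon> * norm h + norm A * ?k) * norm g)" for m
    proof -
      let ?s = "\<Sum>j\<in>J m. bergman_inner (A (toeplitz (\<phi> j) h)) (toeplitz (\<phi> j) g)"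
      have "norm ((\<integral>w. of_real (\<Sum>j\<in>J m. (\<phi> j w)\<^sup>2) * ?u w \<partial>dv) - ?s) \<le> (c * (\<epsilon> / 2)) * norm h * norm g"
        by (rule partition_quadratic[where \<rho> = \<rho>]) (use J slow quad in auto)
      then have 1: "norm (\<integral>w. of_real (\<Sum>j\<in>J m. (\<phi> j w)\<^sup>2) * ?u w \<partial>dv) \<le> (c * (\<epsilon> / 2)) * norm h * norm g + norm ?s"
        using norm_triangle_ineq2[of "\<integral>w. of_real (\<Sum>j\<in>J m. (\<phi> j w)\<^sup>2) * ?u w \<partial>dv" ?s] by linarith
      have "norm ?s \<le> (\<Sum>j\<in>J m. \<epsilon> / 2 * (?N j h * ?N j g) + norm A * (?M j h * ?N j g))"
        by (rule sum_norm_le) (rule cell)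
      also have "\<dots> = \<epsilon> / 2 * (\<Sum>j\<in>J m. ?N j h * ?N j g) + norm A * (\<Sum>j\<in>J m. ?M j h * ?N j g)"
        by (simp add: sum.distrib sum_distrib_left)
      also have "\<dots> \<le> \<epsilon> / 2 * (c * (cut_norm (\<lambda>_. 1) UNIV h * norm g)) + norm A * (c * (?k * norm g))"
        using \<epsilon> by (intro add_mono mult_left_mono cs) auto
      finally have 2: "norm ?s \<le> \<epsilon> / 2 * (c * (norm h * norm g)) + norm A * (c * (?k * norm g))"
        by (simp add: cut_norm_one)
      show ?thesis using order_trans[OF 1 add_left_mono[OF 2]] by (simp add: algebra_simps)
    qed
    have [measurable]: "\<phi> j \<in> borel_measurable borel" for j using u[of j] by (simp add: unit_symbol_def)
    have int: "integrable dv ?u"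
      by (rule square_integrable_inner(1)) (auto intro: bergman_fun_square_integrable)
    \<comment> \<open>At each point the sums of squares are eventually equal to c and never exceed
      it, so dominated convergence removes the windows from the estimate \<open>fin\<close>, which
      is uniform in m.\<close>
    have "(\<lambda>m. \<integral>w. of_real (\<Sum>j\<in>J m. (\<phi> j w)\<^sup>2) * ?u w \<partial>dv) \<longlonglongrightarrow> (\<integral>w. of_real c * ?u w \<partial>dv)"
    proof (rule integral_dominated_convergence[where w = "\<lambda>w. c * norm (?u w)"])
      show "integrable dv (\<lambda>w. c * norm (?u w))" using int by (intro integrable_mult_right integrable_norm)
      show "AE w in dv. (\<lambda>m. of_real (\<Sum>j\<in>J m. (\<phi> j w)\<^sup>2) * ?u w) \<longlonglongrightarrow> of_real c * ?u w"
      proof (rule AE_I2)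
        fix w
        obtain m0 where "\<forall>m\<ge>m0. (\<Sum>j\<in>J m. (\<phi> j w)\<^sup>2) = c" using sum_eq by blast
        then have "\<forall>\<^sub>F m in sequentially. of_real (\<Sum>j\<in>J m. (\<phi> j w)\<^sup>2) * ?u w = of_real c * ?u w"
          by (intro eventually_sequentiallyI[of m0]) simp
        then show "(\<lambda>m. of_real (\<Sum>j\<in>J m. (\<phi> j w)\<^sup>2) * ?u w) \<longlonglongrightarrow> of_real c * ?u w"
          by (rule tendsto_eventually)
      qed
      show "AE w in dv. norm (of_real (\<Sum>j\<in>J m. (\<phi> j w)\<^sup>2) * ?u w) \<le> c * norm (?u w)" for m
      proof (rule AE_I2)
        fix w
        have "norm (of_real (\<Sum>j\<in>J m. (\<phi> j w)\<^sup>2) :: complex) = (\<Sum>j\<in>J m. (\<phi> j w)\<^sup>2)"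
          unfolding norm_of_real by (simp add: sum_nonneg)
        then show "norm (of_real (\<Sum>j\<in>J m. (\<phi> j w)\<^sup>2) * ?u w) \<le> c * norm (?u w)"
          unfolding norm_mult[of "of_real (\<Sum>j\<in>J m. (\<phi> j w)\<^sup>2)"] using sum_le by (intro mult_right_mono) auto
      qed
    qed measurable
    from LIMSEQ_le_const2[OF tendsto_norm[OF this]] fin
    have "norm (\<integral>w. of_real c * ?u w \<partial>dv) \<le> c * ((\<epsilon> * norm h + norm A * ?k) * norm g)" by blast
    moreover have "norm (\<integral>w. of_real c * ?u w \<partial>dv) = c * norm (bergman_inner g (A h))"
      using c bergman_inner_commute[of g "A h"] by (simp add: norm_mult bergman_inner_def[of "A h" g])
    ultimately show "norm (bergman_inner g (A h)) \<le> (\<epsilon> * norm h + norm A * ?k) * norm g"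
      using c by simp
  qed (use \<epsilon> in \<open>simp add: cut_norm_nonneg\<close>)
  then show ?thesis using \<kappa> by blast
qed

text \<open>On the inner part \<open>poly_delta\<close> is at least
  \<open>\<kappa> ^ CARD('n)\<close>, so point evaluations are uniformly bounded there and dominated
  convergence applies.\<close>

lemma cut_norm_inner_part_tendsto:
  fixes f :: "nat \<Rightarrow> 'n::finite bergman"
  assumes \<kappa>: "\<kappa> > 0" and bound: "\<And>m. norm (f m) \<le> B"
    and lim: "\<And>w. w \<in> polydisk \<Longrightarrow> (\<lambda>m. bergman_fun (f m) w) \<longlonglongrightarrow> 0"
  shows "(\<lambda>m. cut_norm (\<lambda>_. 1) (inner_part \<kappa>) (f m)) \<longlonglongrightarrow> 0"
proof -
  let ?K = "inner_part \<kappa> :: (complex ^ 'n) set"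
  have le: "indicator ?K w * (norm (of_real 1 * bergman_fun (f m) w))\<^sup>2 \<le> (B / \<kappa> ^ CARD('n))\<^sup>2" for m w
  proof (cases "w \<in> ?K")
    case True
    have w: "w \<in> polydisk" by (rule inner_part_polydisk[OF \<kappa> True])
    have "\<kappa> ^ CARD('n) = (\<Prod>i\<in>(UNIV :: 'n set). \<kappa>)" by simp
    also have "\<dots> \<le> poly_delta w" unfolding poly_delta_def
    proof (rule prod_mono)
      fix i
      have "(norm (w $ i))\<^sup>2 \<le> norm (w $ i)" using w by (simp add: polydisk_def power2_eq_square mult_left_le less_imp_le)
      moreover have "\<kappa> \<le> 1 - norm (w $ i)" using True by (simp add: inner_part_def)
      ultimately show "0 \<le> \<kappa> \<and> \<kappa> \<le> 1 - (norm (w $ i))\<^sup>2" using \<kappa> by linarith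
    qed
    finally have "\<kappa> ^ CARD('n) * norm (bergman_fun (f m) w) \<le> poly_delta w * norm (bergman_fun (f m) w)"
      by (intro mult_right_mono) auto
    also have "\<dots> \<le> B" using norm_bergman_fun_le[OF w] bound by (rule order_trans)
    finally have "norm (bergman_fun (f m) w) \<le> B / \<kappa> ^ CARD('n)" using \<kappa> by (simp add: field_simps)
    then show ?thesis using True by (simp add: power_mono)
  qed simp
  have "(\<lambda>m. \<integral>w. indicator ?K w * (norm (of_real 1 * bergman_fun (f m) w))\<^sup>2 \<partial>dv) \<longlonglongrightarrow> (\<integral>w. 0 \<partial>(dv :: (complex ^ 'n) measure))"
  proof (rule integral_dominated_convergence[where w = "\<lambda>_. (B / \<kappa> ^ CARD('n))\<^sup>2"])
    show "integrable dv (\<lambda>_ :: complex ^ 'n. (B / \<kappa> ^ CARD('n))\<^sup>2)"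
      by (rule finite_measure.integrable_const[OF finite_measure_dv])
    show "AE w in dv. (\<lambda>m. indicator ?K w * (norm (of_real 1 * bergman_fun (f m) w))\<^sup>2) \<longlonglongrightarrow> 0"
    proof (rule AE_I2)
      fix w
      show "(\<lambda>m. indicator ?K w * (norm (of_real 1 * bergman_fun (f m) w))\<^sup>2) \<longlonglongrightarrow> 0"
      proof (cases "w \<in> ?K")
        case True
        then have "(\<lambda>m. bergman_fun (f m) w) \<longlonglongrightarrow> 0" using lim inner_part_polydisk[OF \<kappa>] by blast
        then have "(\<lambda>m. (norm (bergman_fun (f m) w))\<^sup>2) \<longlonglongrightarrow> (norm (0 :: complex))\<^sup>2" by (intro tendsto_intros)
        then show ?thesis using True by simp
      qed simp
    qed
    show "AE w in dv. norm (indicator ?K w * (norm (of_real 1 * bergman_fun (f m) w))\<^sup>2) \<le> (B / \<kappa> ^ CARD('n))\<^sup>2" for m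
      using le[of _ m] by (intro AE_I2) simp
  qed measurable
  from tendsto_real_sqrt[OF this] show ?thesis by (simp add: cut_norm_def)
qed

text \<open>Normal families give a pointwise limit g of a subsequence in the unit ball; the
  differences have norm at most 2 and tend to 0 in mean square on inner parts, so the essential
  estimate forces norm convergence of the images. As g lies in the ball, the image of the ball is
  itself compact.\<close>

lemma compact_op_of_berezin:
  fixes A :: "'n::finite bergman_op"
  assumes A: "A \<in> slowly_commuting"
    and lim: "((\<lambda>z. bergman_inner (A (normalized_kernel z)) (normalized_kernel z)) \<longlongrightarrow> 0) to_boundary"
  shows "compact_op A"
proof -
  have "seq_compact (A ` cball 0 1)"
    unfolding seq_compact_def
  proof (intro allI impI)
    fix x :: "nat \<Rightarrow> 'n bergman" assume "\<forall>n. x n \<in> A ` cball 0 1"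
    then have x: "x n \<in> A ` cball 0 1" for n by blast
    have "\<exists>f. norm f \<le> 1 \<and> x n = A f" for n using x[of n] by auto
    then obtain f where f: "\<And>n. norm (f n) \<le> 1" "\<And>n. x n = A (f n)" by metis
    obtain s :: "nat \<Rightarrow> nat" and g where s: "strict_mono s" and g: "norm g \<le> 1"
      and conv: "\<forall>z\<in>polydisk. (\<lambda>n. bergman_fun (f (s n)) z) \<longlonglongrightarrow> bergman_fun g z"
      using bergman_montel[of f, OF f(1)] by blast
    have b: "norm (f (s m) - g) \<le> 2" for m using norm_triangle_ineq4[of "f (s m)" g] f(1)[of "s m"] g by linarith
    have pt: "(\<lambda>m. bergman_fun (f (s m) - g) w) \<longlonglongrightarrow> 0" if "w \<in> polydisk" for w
      using tendsto_diff[OF conv[rule_format, OF that] tendsto_const[of "bergman_fun g w"]] by (simp add: bergman_fun_diff)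
    have "(\<lambda>m. A (f (s m) - g)) \<longlonglongrightarrow> 0"
    proof (rule tendstoI)
      fix e :: real assume e: "e > 0"
      \<comment> \<open>With e / 4 the first term of the estimate is at most e / 2 on differences of
        norm at most 2.\<close>
      obtain \<kappa> where \<kappa>: "\<kappa> > 0" and est: "\<And>h. norm (A h) \<le> e / 4 * norm h + norm A * cut_norm (\<lambda>_. 1) (inner_part \<kappa>) h"
        using essential_estimate[OF A _ lim, of "e / 4"] e by auto
      have "(\<lambda>m. norm A * cut_norm (\<lambda>_. 1) (inner_part \<kappa>) (f (s m) - g)) \<longlonglongrightarrow> norm A * 0"
        by (intro tendsto_mult_left cut_norm_inner_part_tendsto[OF \<kappa> b pt])
      then have "\<forall>\<^sub>F m in sequentially. norm A * cut_norm (\<lambda>_. 1) (inner_part \<kappa>) (f (s m) - g) < e / 2"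
        using e by (intro order_tendstoD(2)[where a = "e / 2"]) auto
      then show "\<forall>\<^sub>F m in sequentially. dist (A (f (s m) - g)) 0 < e"
      proof (rule eventually_mono)
        fix m assume m: "norm A * cut_norm (\<lambda>_. 1) (inner_part \<kappa>) (f (s m) - g) < e / 2"
        have "e / 4 * norm (f (s m) - g) \<le> e / 4 * 2" using b e by (intro mult_left_mono) auto
        then show "dist (A (f (s m) - g)) 0 < e" using est[of "f (s m) - g"] m by simp
      qed
    qed
    then have "(\<lambda>m. A (f (s m)) - A g) \<longlonglongrightarrow> 0" by (simp add: blinfun.diff_right)
    then have "(x \<circ> s) \<longlonglongrightarrow> A g" by (simp add: LIM_zero_iff o_def f(2))
    moreover have "A g \<in> A ` cball 0 1" using g by simp
    ultimately show "\<exists>l\<in>A ` cball 0 1. \<exists>r. strict_mono r \<and> (x \<circ> r) \<longlonglongrightarrow> l" using s by blast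
  qed
  then have "compact (A ` cball 0 1)" by (simp add: compact_eq_seq_compact_metric)
  then show ?thesis by (simp add: compact_op_def compact_imp_closed)
qed

text \<open>One coordinate near the circle suffices: its factor has numerator at most 2 \<delta>,
  the other numerators are at most 1, and all denominators are at least \<kappa>^2.\<close>

lemma normalized_kernel_le_inner_part:
  fixes z w :: "complex ^ 'n::finite"
  assumes z: "z \<in> polydisk" and \<kappa>: "0 < \<kappa>" and w: "w \<in> inner_part \<kappa>" and i: "1 - norm (z $ i) < \<delta>"
  shows "norm (bergman_fun (normalized_kernel z) w) \<le> 2 * \<delta> * (1 / \<kappa>\<^sup>2) ^ CARD('n)"
proof -
  have w1: "w \<in> polydisk" by (rule inner_part_polydisk[OF \<kappa> w])
  define b where "b j = (if j = i then 2 * \<delta> else 1)" for j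
  have "norm (bergman_fun (normalized_kernel z) w) = (\<Prod>j\<in>UNIV. (1 - (norm (z $ j))\<^sup>2) / (norm (1 - w $ j * cnj (z $ j)))\<^sup>2)"
  proof -
    have "norm (complex_of_real (1 - (norm (z $ j))\<^sup>2)) = 1 - (norm (z $ j))\<^sup>2" for j
      unfolding norm_of_real using z norm_less_one_sq_pos[of "z $ j"] by (simp add: polydisk_def)
    then show ?thesis
      unfolding bergman_fun_normalized_kernel[OF z] normalized_kernel_fun_def using w1
      by (simp add: prod_norm[symmetric] norm_divide norm_power del: of_real_diff)
  qed
  also have "\<dots> \<le> (\<Prod>j\<in>UNIV. b j * (1 / \<kappa>\<^sup>2))"
  proof (rule prod_mono)
    fix j
    have z1: "norm (z $ j) < 1" using z by (simp add: polydisk_def)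
    have pos: "1 - (norm (z $ j))\<^sup>2 > 0" by (rule norm_less_one_sq_pos[OF z1])
    have "norm (w $ j * cnj (z $ j)) \<le> norm (w $ j) * 1" unfolding norm_mult using z1 by (intro mult_left_mono) auto
    moreover have "\<kappa> \<le> 1 - norm (w $ j)" using w by (simp add: inner_part_def)
    ultimately have "\<kappa> \<le> norm (1 - w $ j * cnj (z $ j))" using norm_triangle_ineq2[of 1 "w $ j * cnj (z $ j)"] by simp
    then have k: "\<kappa>\<^sup>2 \<le> (norm (1 - w $ j * cnj (z $ j)))\<^sup>2" using \<kappa> by (intro power_mono) auto
    have "1 - (norm (z $ j))\<^sup>2 \<le> b j"
    proof (cases "j = i")
      case True
      have "1 - (norm (z $ j))\<^sup>2 = (1 - norm (z $ j)) * (1 + norm (z $ j))" by (simp add: power2_eq_square algebra_simps)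
      also have "\<dots> \<le> \<delta> * 2" using i True z1 by (intro mult_mono) auto
      finally show ?thesis using True by (simp add: b_def)
    qed (simp add: b_def)
    then have "(1 - (norm (z $ j))\<^sup>2) / (norm (1 - w $ j * cnj (z $ j)))\<^sup>2 \<le> b j / \<kappa>\<^sup>2"
      using pos \<kappa> k by (intro frac_le) auto
    then show "0 \<le> (1 - (norm (z $ j))\<^sup>2) / (norm (1 - w $ j * cnj (z $ j)))\<^sup>2 \<and>
        (1 - (norm (z $ j))\<^sup>2) / (norm (1 - w $ j * cnj (z $ j)))\<^sup>2 \<le> b j * (1 / \<kappa>\<^sup>2)" using pos by simp
  qed
  also have "\<dots> = (\<Prod>j\<in>UNIV. b j) * (1 / \<kappa>\<^sup>2) ^ CARD('n)" unfolding prod.distrib prod_constant ..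
  also have "(\<Prod>j\<in>UNIV. b j) = 2 * \<delta>" unfolding b_def by (simp add: prod.delta)
  finally show ?thesis .
qed

text \<open>f is split by an inner part: outside, its mean square is small by dominated convergence
  and the kernel has norm 1; inside, the kernel is uniformly small once z is near the
  boundary.\<close>

lemma normalized_kernel_weakly_null:
  fixes f :: "'n::finite bergman"
  shows "((\<lambda>z. bergman_inner f (normalized_kernel z)) \<longlongrightarrow> 0) to_boundary"
proof (rule tendstoI)
  fix \<epsilon> :: real assume \<epsilon>: "\<epsilon> > 0"
  let ?K = "\<lambda>m :: nat. inner_part (1 / (real m + 1)) :: (complex ^ 'n) set"
  have u: "unit_symbol (indicator S)" if "S \<in> sets borel" for S :: "(complex ^ 'n) set"
    using that by (auto simp: unit_symbol_def indicator_def)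
  have "(\<lambda>m. \<integral>w. indicator UNIV w * (norm (of_real (indicator (- ?K m) w) * bergman_fun f w))\<^sup>2 \<partial>dv) \<longlonglongrightarrow> (\<integral>w. 0 \<partial>(dv :: (complex ^ 'n) measure))"
  proof (rule integral_dominated_convergence[where w = "\<lambda>w. (norm (bergman_fun f w))\<^sup>2"])
    show "AE w in dv. (\<lambda>m. indicator UNIV w * (norm (of_real (indicator (- ?K m) w) * bergman_fun f w))\<^sup>2) \<longlonglongrightarrow> 0"
    proof (rule AE_I2)
      fix w :: "complex ^ 'n"
      show "(\<lambda>m. indicator UNIV w * (norm (of_real (indicator (- ?K m) w) * bergman_fun f w))\<^sup>2) \<longlonglongrightarrow> 0"
      proof (cases "w \<in> polydisk")
        case True
        have "\<forall>\<^sub>F m :: nat in sequentially. \<forall>i\<in>UNIV. 1 / (real m + 1) < 1 - norm (w $ i)"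
        proof (intro eventually_ball_finite ballI finite)
          fix i
          have "(\<lambda>m. 1 / (real m + 1)) \<longlonglongrightarrow> 0" by real_asymp
          moreover have "0 < 1 - norm (w $ i)" using True by (simp add: polydisk_def)
          ultimately show "\<forall>\<^sub>F m :: nat in sequentially. 1 / (real m + 1) < 1 - norm (w $ i)" by (rule order_tendstoD(2))
        qed
        then have "\<forall>\<^sub>F m in sequentially. indicator UNIV w * (norm (of_real (indicator (- ?K m) w) * bergman_fun f w))\<^sup>2 = 0"
          by (rule eventually_mono) (auto simp: inner_part_def less_imp_le)
        then show ?thesis by (rule tendsto_eventually)
      qed (simp add: bergman_fun_outside)
    qed
    show "AE w in dv. norm (indicator UNIV w * (norm (of_real (indicator (- ?K m) w) * bergman_fun f w))\<^sup>2) \<le> (norm (bergman_fun f w))\<^sup>2" for m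
      by (intro AE_I2) (simp add: indicator_def)
  qed (use bergman_fun_square_integrable in \<open>simp_all, measurable\<close>)
  from tendsto_real_sqrt[OF this] have "(\<lambda>m. cut_norm (indicator (- ?K m)) UNIV f) \<longlonglongrightarrow> 0" by (simp add: cut_norm_def)
  then have "\<forall>\<^sub>F m in sequentially. cut_norm (indicator (- ?K m)) UNIV f < \<epsilon> / 2"
    using \<epsilon> by (intro order_tendstoD(2)) auto
  then obtain m where m: "cut_norm (indicator (- ?K m)) UNIV f < \<epsilon> / 2" by (auto simp: eventually_sequentially)
  define \<kappa> where "\<kappa> = 1 / (real m + 1)"
  have \<kappa>: "\<kappa> > 0" by (simp add: \<kappa>_def)
  \<comment> \<open>C collects the factor of \<delta> in the bound on the inner part together with
    the norm of f; adding 1 keeps it positive.\<close>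
  define C where "C = 2 * (1 / \<kappa>\<^sup>2) ^ CARD('n) * (norm f + 1)"
  have C: "C > 0" using \<kappa> norm_ge_zero[of f] by (simp add: C_def add_nonneg_pos)
  define \<delta> where "\<delta> = \<epsilon> / (2 * C)"
  have \<delta>: "\<delta> > 0" "\<delta> * C = \<epsilon> / 2" using \<epsilon> C by (simp_all add: \<delta>_def)
  have "norm (bergman_inner f (normalized_kernel z)) < \<epsilon>" if z: "z \<in> polydisk" "infdist z (frontier polydisk) < \<delta>" for z
  proof -
    obtain i where i: "1 - norm (z $ i) < \<delta>"
      using infdist_frontier_polydisk_ge[OF z(1), of \<delta>] z(2) by (meson not_le)
    let ?S = "inner_part \<kappa> :: (complex ^ 'n) set"
    let ?k = "normalized_kernel z"
    have uS: "unit_symbol (indicator ?S)" "unit_symbol (indicator (- ?S))" by (intro u; simp)+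
    have "bergman_inner f ?k = (\<integral>w. of_real (indicator ?S w) * bergman_fun f w * cnj (bergman_fun ?k w) +
        of_real (indicator (- ?S) w) * bergman_fun f w * cnj (bergman_fun ?k w) \<partial>dv)"
      unfolding bergman_inner_def by (rule Bochner_Integration.integral_cong) (auto simp: indicator_def)
    also have "\<dots> = toeplitz_form (indicator ?S) f ?k + toeplitz_form (indicator (- ?S)) f ?k"
      unfolding toeplitz_form_def by (rule Bochner_Integration.integral_add; rule toeplitz_form_integrable; rule uS)
    finally have eq: "bergman_inner f ?k = toeplitz_form (indicator ?S) f ?k + toeplitz_form (indicator (- ?S)) f ?k" .
    have "norm (toeplitz_form (indicator (- ?S)) f ?k) \<le> 1 * cut_norm (indicator (- ?S)) UNIV f * norm ?k"
      by (rule toeplitz_form_le_cut_norm[OF uS(2)]) auto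
    then have 1: "norm (toeplitz_form (indicator (- ?S)) f ?k) < \<epsilon> / 2"
      using m by (simp add: norm_normalized_kernel[OF z(1)] \<kappa>_def)
    define D where "D = 2 * \<delta> * (1 / \<kappa>\<^sup>2) ^ CARD('n)"
    have D: "D \<ge> 0" using \<delta> \<kappa> by (simp add: D_def)
    \<comment> \<open>The comparison function is the kernel at 0, which is the constant 1 on the
      polydisk, so the uniform bound for the kernel at z enters directly.\<close>
    have "norm (toeplitz_form (indicator ?S) f ?k) \<le> D * cut_norm (indicator ?S) UNIV f * norm (normalized_kernel 0 :: 'n bergman)"
    proof (rule toeplitz_form_le_cut_norm[OF uS(1) D])
      fix w :: "complex ^ 'n" assume w: "w \<in> polydisk" "indicator ?S w \<noteq> (0 :: real)"
      then have "w \<in> ?S" by (simp add: indicator_def split: if_splits)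
      moreover have "bergman_fun (normalized_kernel 0) w = 1"
        using w(1) by (simp add: bergman_fun_normalized_kernel[OF zero_in_polydisk] normalized_kernel_fun_def)
      ultimately show "norm (bergman_fun ?k w) \<le> D * norm (bergman_fun (normalized_kernel 0) w)"
        using normalized_kernel_le_inner_part[OF z(1) \<kappa> _ i, of w] by (simp add: D_def)
    qed
    also have "\<dots> = D * cut_norm (indicator ?S) UNIV f" by (simp add: norm_normalized_kernel[OF zero_in_polydisk])
    also have "\<dots> \<le> D * norm f"
    proof (rule mult_left_mono[OF _ D])
      show "cut_norm (indicator ?S) UNIV f \<le> norm f"
        using real_sqrt_le_mono[OF unit_symbol_square_integrable(2)[OF uS(1), of f]] by (simp add: cut_norm_def)
    qed
    also have "\<dots> \<le> \<delta> * C" using D by (simp add: D_def C_def algebra_simps)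
    finally have "norm (toeplitz_form (indicator ?S) f ?k) \<le> \<epsilon> / 2" by (simp add: \<delta>)
    then show ?thesis unfolding eq using norm_triangle_ineq[of "toeplitz_form (indicator ?S) f ?k" "toeplitz_form (indicator (- ?S)) f ?k"] 1
      by linarith
  qed
  then show "\<forall>\<^sub>F z in to_boundary. dist (bergman_inner f (normalized_kernel z)) 0 < \<epsilon>"
    unfolding eventually_to_boundary using \<delta> by auto
qed

text \<open>A finite net of the image of the unit ball reduces the claim to the weak convergence of
  the kernels against finitely many vectors.\<close>

lemma berezin_of_compact_op:
  fixes A :: "'n::finite bergman_op"
  assumes "compact_op A"
  shows "((\<lambda>z. bergman_inner (A (normalized_kernel z)) (normalized_kernel z)) \<longlongrightarrow> 0) to_boundary"
proof (rule tendstoI)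
  fix \<epsilon> :: real assume \<epsilon>: "\<epsilon> > 0"
  obtain F where F: "finite F" "A ` cball 0 1 \<subseteq> (\<Union>f\<in>F. ball f (\<epsilon> / 2))"
  proof -
    have "\<epsilon> / 2 > 0" using \<epsilon> by simp
    with assms have "\<exists>F. finite F \<and> closure (A ` cball 0 1) \<subseteq> (\<Union>f\<in>F. ball f (\<epsilon> / 2))"
      unfolding compact_op_def compact_eq_totally_bounded by (elim conjE allE impE)
    then obtain F where "finite F" "closure (A ` cball 0 1) \<subseteq> (\<Union>f\<in>F. ball f (\<epsilon> / 2))"
      by (elim exE conjE)
    then show ?thesis by (rule that[OF _ order_trans[OF closure_subset]])
  qed
  have "\<forall>\<^sub>F z in to_boundary. \<forall>f\<in>F. dist (bergman_inner f (normalized_kernel z)) 0 < \<epsilon> / 2"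
    using F(1) \<epsilon> by (intro eventually_ball_finite ballI tendstoD[OF normalized_kernel_weakly_null]) auto
  moreover have "\<forall>\<^sub>F z in to_boundary. z \<in> polydisk"
    unfolding eventually_to_boundary by (intro exI[of _ 1]) simp
  ultimately show "\<forall>\<^sub>F z in to_boundary. dist (bergman_inner (A (normalized_kernel z)) (normalized_kernel z)) 0 < \<epsilon>"
  proof eventually_elim
    fix z :: "complex ^ 'n"
    assume small: "\<forall>f\<in>F. dist (bergman_inner f (normalized_kernel z)) 0 < \<epsilon> / 2" and z: "z \<in> polydisk"
    let ?k = "normalized_kernel z"
    have k: "norm ?k = 1" by (rule norm_normalized_kernel[OF z])
    then have "A ?k \<in> A ` cball 0 1" by simp
    then obtain f where f: "f \<in> F" "dist f (A ?k) < \<epsilon> / 2" using F(2) by auto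
    have "bergman_inner (A ?k) ?k = bergman_inner (A ?k - f) ?k + bergman_inner f ?k" by (simp add: bergman_inner_diff_left)
    then have "norm (bergman_inner (A ?k) ?k) \<le> norm (bergman_inner (A ?k - f) ?k) + norm (bergman_inner f ?k)"
      by (simp add: norm_triangle_ineq)
    also have "norm (bergman_inner (A ?k - f) ?k) \<le> norm (A ?k - f)" using norm_bergman_inner_le[of "A ?k - f" ?k] k by simp
    finally show "dist (bergman_inner (A ?k) ?k) 0 < \<epsilon>" using f(2) small[rule_format, OF f(1)] by (simp add: dist_norm norm_minus_commute)
  qed
qed

theorem theoremA:
  fixes A :: "'n::finite bergman_op"
  assumes "A \<in> cstar_generated localized_ops"
  shows "((\<lambda>z. bergman_inner (A (normalized_kernel z)) (normalized_kernel z)) \<longlongrightarrow> 0) to_boundary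
    \<longleftrightarrow> compact_op A"
  using compact_op_of_berezin[OF subsetD[OF cstar_generated_slowly_commuting assms]] berezin_of_compact_op by blast

end
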